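(* Let $(X_t)_{t\le T}$ and $(Z_t)_{t\le T}$ be governed by $$X_t=X_0+\int_0^ta(s)X_s\,ds+W_t,\qquad Z_t=\int_0^tH(t,s)X_s\,ds+N_t,$$ in the setting described in the context, where $H$ satisfies the following conditions: (i) $H$ is continuous on $[0,T]^2$; (ii) $H(t,s)=\sum_{i=1}^\infty p_i(t)q_i(s)$ with $p_i\in C^1([0,T])$, $q_i\in C([0,T])$, and convergence in $L_1([0,T]^2)$; (iii) setting, for $n\ge 1$, $H_n(t,s)=\sum_{i=1}^np_i(t)q_i(s)$ and $L_n(t,s)=\frac{d}{dt}H_n(t,s)=\sum_{i=1}^np_i'(t)q_i(s)$, the functions $L_n$ converge in $L_1([0,T]^2)$ to a continuous function $L(t,s)$. For $0\le t\le r$ (with $r\le T$) define $$V_{r,t}=\begin{bmatrix}X_t\\ \int_0^tL(r,s)X_s\,ds\end{bmatrix},\quad B_r(s)=\begin{bmatrix}a(s)\\ L(r,s)\end{bmatrix}[I_m\ \ 0],\quad \Sigma=\begin{bmatrix}I_m\\0\end{bmatrix},\quad P_0=\begin{bmatrix}\mathrm{Cov}(X_0)&0\\0&0\end{bmatrix}.$$ Then the conditional mean $\hat V_{r,t}=\mathbb{E}[V_{r,t}|\mathcal{F}^Z_t]$ satisfies $$\hat V_{r,t}=\hat V_{r,0}+\int_0^t\begin{bmatrix}a(s)\\ L(r,s)\end{bmatrix}\hat X_s\,ds+\int_0^t\mathcal{P}_{r,s}\,[H(s,s)\ \ I]^T\,d\nu_s,$$ where $\hat X_s=\mathbb{E}[X_s|\mathcal{F}^Z_s]$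 and $\nu_t=Z_t-\int_0^t[H(s,s)\ \ I]\,\hat V_{r,s}\,ds$, and the conditional covariance $$\mathcal{P}_{r,t}=\mathbb{E}\big((V_{r,t}-\hat V_{r,t})(V_{t,t}-\hat V_{t,t})^T\,|\,\mathcal{F}^Z_t\big)$$ satisfies the Riccati type equation $$\mathcal{P}_{r,t}-P_0=\int_0^t\Big(\mathcal{P}_{r,s}^TB_t(s)^T+B_r(s)\mathcal{P}_{r,s}+\Sigma\Sigma^T-\mathcal{P}_{r,s}[H(s,s)\ \ I]^T[H(s,s)\ \ I]\mathcal{P}_{t,s}^T\Big)ds .$$
   Context: $(X_0,W,N)$ is a Gaussian family whose three terms are mutually independent; $X$ is $\mathbb{R}^m$-valued, $W$ and $N$ are standard Brownian motions in $\mathbb{R}^m$. The function $a:[0,T]\to\mathbb{R}^{m\times m}$ is continuous and $H:[0,T]^2\to\mathbb{R}$ is real-valued; scalars such as $L(r,s)$ and $H(s,s)$ appearing as matrix blocks stand for $L(r,s)I_m$ and $H(s,s)I_m$, and $I=I_m$. $\mathcal{F}^Z_t=\sigma(Z_s;\,s\le t)$ is the observation filtration.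
   Formalization: Two misprints that make the claim false are corrected: the innovation uses V̂_{s,s} instead of V̂_{r,s}, and the linear Riccati terms are P_{r,s}B_t(s)^T + B_r(s)P_{t,s}^T instead of P_{r,s}^T B_t(s)^T + B_r(s)P_{r,s}. *)

theory Defs
  imports "HOL-Probability.Probability"
begin

section \<open>Block matrices\<close>

text \<open>Stacking acts on rows and is polymorphic in the row type, so it also stacks vectors
  (\<open>'b = real\<close>). Blocks are indexed by the sum type, so an \<open>m\<close>-vector over an \<open>m\<close>-vector
  lives in \<open>real ^ ('m + 'm)\<close>. A scalar block \<open>c I\<close> is \<open>mat c\<close>.\<close>

definition vstack :: "'b ^ 'm \<Rightarrow> 'b ^ 'n \<Rightarrow> 'b ^ ('m::finite + 'n::finite)" where
  "vstack A B = (\<chi> i. case i of Inl j \<Rightarrow> A $ j | Inr j \<Rightarrow> B $ j)"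

definition hstack :: "'b ^ 'm ^ 'k \<Rightarrow> 'b ^ 'n ^ 'k \<Rightarrow> 'b ^ ('m::finite + 'n::finite) ^ 'k" where
  "hstack A B = (\<chi> i. vstack (A $ i) (B $ i))"

definition outer_prod :: "real ^ 'm \<Rightarrow> real ^ 'n \<Rightarrow> real ^ 'n ^ 'm" where
  "outer_prod x y = (\<chi> i j. x $ i * y $ j)"

section \<open>Probabilistic notions\<close>

definition generated_algebra ::
    "'w measure \<Rightarrow> 'i set \<Rightarrow> ('i \<Rightarrow> 'w \<Rightarrow> 'b::topological_space) \<Rightarrow> 'w measure" where
  "generated_algebra M I Y =
     sigma (space M) {Y s -` B \<inter> space M | s B. s \<in> I \<and> B \<in> sets borel}"

abbreviation natural_filtration ::
    "'w measure \<Rightarrow> (real \<Rightarrow> 'w \<Rightarrow> 'b::topological_space) \<Rightarrow> real \<Rightarrow> 'w measure" where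
  "natural_filtration M Y t \<equiv> generated_algebra M {0..t} Y"

definition vec_cond_exp ::
    "'w measure \<Rightarrow> 'w measure \<Rightarrow> ('w \<Rightarrow> real ^ 'n) \<Rightarrow> 'w \<Rightarrow> real ^ 'n" where
  "vec_cond_exp M F Y \<omega> = (\<chi> i. real_cond_exp M F (\<lambda>\<omega>. Y \<omega> $ i) \<omega>)"

definition mat_cond_exp ::
    "'w measure \<Rightarrow> 'w measure \<Rightarrow> ('w \<Rightarrow> real ^ 'n ^ 'k) \<Rightarrow> 'w \<Rightarrow> real ^ 'n ^ 'k" where
  "mat_cond_exp M F Y \<omega> = (\<chi> i j. real_cond_exp M F (\<lambda>\<omega>. Y \<omega> $ i $ j) \<omega>)"

definition covariance_matrix :: "'w measure \<Rightarrow> ('w \<Rightarrow> real ^ 'n) \<Rightarrow> real ^ 'n ^ 'n" where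
  "covariance_matrix M Y = (\<chi> i j. LINT \<omega>|M.
     (Y \<omega> $ i - (LINT \<omega>'|M. Y \<omega>' $ i)) * (Y \<omega> $ j - (LINT \<omega>'|M. Y \<omega>' $ j)))"

text \<open>Constants count as Gaussian random variables.\<close>

definition gaussian_rv :: "'w measure \<Rightarrow> ('w \<Rightarrow> real) \<Rightarrow> bool" where
  "gaussian_rv M Y \<longleftrightarrow> Y \<in> borel_measurable M \<and>
     (\<exists>\<mu>. (AE \<omega> in M. Y \<omega> = \<mu>) \<or>
          (\<exists>\<sigma>>0. distributed M lborel Y (\<lambda>x. ennreal (normal_density \<mu> \<sigma> x))))"

definition gaussian_family :: "'w measure \<Rightarrow> ('w \<Rightarrow> 'b::euclidean_space) set \<Rightarrow> bool" where
  "gaussian_family M \<Y> \<longleftrightarrow>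
     (\<forall>J c. finite J \<and> J \<subseteq> \<Y> \<longrightarrow> gaussian_rv M (\<lambda>\<omega>. \<Sum>Y\<in>J. c Y \<bullet> Y \<omega>))"

definition standard_brownian_motion ::
    "'w measure \<Rightarrow> real \<Rightarrow> (real \<Rightarrow> 'w \<Rightarrow> real ^ 'm) \<Rightarrow> bool" where
  "standard_brownian_motion M T B \<longleftrightarrow>
     (\<forall>t\<in>{0..T}. B t \<in> borel_measurable M) \<and>
     (AE \<omega> in M. B 0 \<omega> = 0) \<and>
     (AE \<omega> in M. continuous_on {0..T} (\<lambda>t. B t \<omega>)) \<and>
     (\<forall>s t. 0 \<le> s \<and> s < t \<and> t \<le> T \<longrightarrow>
        distributed M lborel (\<lambda>\<omega>. B t \<omega> - B s \<omega>)
          (\<lambda>x. ennreal (\<Prod>i\<in>UNIV. normal_density 0 (sqrt (t - s)) (x $ i))) \<and>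
        prob_space.indep_set M
          (sets (generated_algebra M {()} (\<lambda>_ \<omega>. B t \<omega> - B s \<omega>)))
          (sets (natural_filtration M B s)))"

section \<open>Time integrals and the Ito integral\<close>

text \<open>The library's conditional expectations are arbitrary versions, chosen separately for each
  time, so their paths need not be measurable. As usual, integrals of such processes are taken
  along a jointly measurable modification; two such modifications agree almost everywhere for the
  product of Lebesgue measure and \<open>M\<close>, so the integrals below are unique up to a null set.\<close>

definition measurable_modification ::
    "'w measure \<Rightarrow> real \<Rightarrow> (real \<Rightarrow> 'w \<Rightarrow> 'b::topological_space) \<Rightarrow> (real \<Rightarrow> 'w \<Rightarrow> 'b) \<Rightarrow> bool"
  where
  "measurable_modification M t Y Y' \<longleftrightarrow>
     (\<lambda>(s, \<omega>). Y' s \<omega>) \<in> borel_measurable (borel \<Otimes>\<^sub>M M) \<and>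
     (\<forall>s\<in>{0..t}. AE \<omega> in M. Y' s \<omega> = Y s \<omega>)"

text \<open>\<open>J\<close> is (a version of) the pathwise Lebesgue integral of \<open>Y\<close> over \<open>[0,t]\<close>.\<close>

definition has_time_integral ::
    "'w measure \<Rightarrow> (real \<Rightarrow> 'w \<Rightarrow> 'b::euclidean_space) \<Rightarrow> real \<Rightarrow> ('w \<Rightarrow> 'b) \<Rightarrow> bool" where
  "has_time_integral M Y t J \<longleftrightarrow> J \<in> borel_measurable M \<and>
     (\<exists>Y'. measurable_modification M t Y Y' \<and>
        (AE \<omega> in M. set_integrable lborel {0..t} (\<lambda>s. Y' s \<omega>) \<and>
                    J \<omega> = (LINT s:{0..t}|lborel. Y' s \<omega>)))"

text \<open>What the Ito isometry needs from the integrator \<open>\<nu>\<close>: it is a square-integrable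
  \<open>F\<close>-martingale on \<open>[0,t]\<close> whose bracket is that of a standard Brownian motion. The case
  \<open>u = s\<close> of the martingale property says that \<open>\<nu>\<close> is adapted up to null sets.\<close>

definition brownian_integrator ::
    "'w measure \<Rightarrow> (real \<Rightarrow> 'w measure) \<Rightarrow> real \<Rightarrow> (real \<Rightarrow> 'w \<Rightarrow> real ^ 'm) \<Rightarrow> bool" where
  "brownian_integrator M F t \<nu> \<longleftrightarrow>
     (\<forall>s\<in>{0..t}. \<nu> s \<in> borel_measurable M \<and> integrable M (\<lambda>\<omega>. (norm (\<nu> s \<omega>))\<^sup>2)) \<and>
     (\<forall>s u. 0 \<le> s \<and> s \<le> u \<and> u \<le> t \<longrightarrow>
        (AE \<omega> in M. vec_cond_exp M (F s) (\<nu> u) \<omega> = \<nu> s \<omega>) \<and>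
        (AE \<omega> in M. mat_cond_exp M (F s)
           (\<lambda>\<omega>. outer_prod (\<nu> u \<omega> - \<nu> s \<omega>) (\<nu> u \<omega> - \<nu> s \<omega>)) \<omega> = mat (u - s)))"

text \<open>A simple process on \<open>[0,t]\<close> has value \<open>\<xi> k\<close> on \<open>]\<tau> k, \<tau> (Suc k)]\<close>, for \<open>k < n\<close>.\<close>

definition simple_process ::
    "'w measure \<Rightarrow> (real \<Rightarrow> 'w measure) \<Rightarrow> real \<Rightarrow> nat \<Rightarrow> (nat \<Rightarrow> real) \<Rightarrow>
     (nat \<Rightarrow> 'w \<Rightarrow> 'b::real_normed_vector) \<Rightarrow> bool" where
  "simple_process M F t n \<tau> \<xi> \<longleftrightarrow>
     \<tau> 0 = 0 \<and> \<tau> n = t \<and>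
     (\<forall>k<n. \<tau> k \<le> \<tau> (Suc k) \<and> \<xi> k \<in> borel_measurable (F (\<tau> k)) \<and>
        (\<exists>C. \<forall>\<omega>\<in>space M. norm (\<xi> k \<omega>) \<le> C))"

definition simple_value ::
    "nat \<Rightarrow> (nat \<Rightarrow> real) \<Rightarrow> (nat \<Rightarrow> 'w \<Rightarrow> 'b::real_normed_vector) \<Rightarrow> real \<Rightarrow> 'w \<Rightarrow> 'b" where
  "simple_value n \<tau> \<xi> s \<omega> = (\<Sum>k<n. indicat_real {\<tau> k<..\<tau> (Suc k)} s *\<^sub>R \<xi> k \<omega>)"

definition simple_ito ::
    "nat \<Rightarrow> (nat \<Rightarrow> real) \<Rightarrow> (nat \<Rightarrow> 'w \<Rightarrow> real ^ 'm ^ 'k) \<Rightarrow> (real \<Rightarrow> 'w \<Rightarrow> real ^ 'm) \<Rightarrow>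
     'w \<Rightarrow> real ^ 'k" where
  "simple_ito n \<tau> \<xi> \<nu> \<omega> = (\<Sum>k<n. \<xi> k \<omega> *v (\<nu> (\<tau> (Suc k)) \<omega> - \<nu> (\<tau> k) \<omega>))"

text \<open>\<open>J\<close> is (a version of) the Ito integral of \<open>G\<close> over \<open>[0,t]\<close> with respect to \<open>\<nu>\<close>: the
  mean-square limit of the integrals of simple processes approximating \<open>G\<close> in mean square.\<close>

definition has_ito_integral ::
    "'w measure \<Rightarrow> (real \<Rightarrow> 'w measure) \<Rightarrow> (real \<Rightarrow> 'w \<Rightarrow> real ^ 'm) \<Rightarrow>
     (real \<Rightarrow> 'w \<Rightarrow> real ^ 'm ^ 'k) \<Rightarrow> real \<Rightarrow> ('w \<Rightarrow> real ^ 'k) \<Rightarrow> bool" where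
  "has_ito_integral M F \<nu> G t J \<longleftrightarrow>
     brownian_integrator M F t \<nu> \<and> J \<in> borel_measurable M \<and>
     (\<exists>G' n \<tau> \<xi>. measurable_modification M t G G' \<and>
        (\<forall>j. simple_process M F t (n j) (\<tau> j) (\<xi> j)) \<and>
        (\<lambda>j::nat. \<integral>\<^sup>+ s\<in>{0..t}. (\<integral>\<^sup>+ \<omega>. ennreal
           ((norm (G' s \<omega> - simple_value (n j) (\<tau> j) (\<xi> j) s \<omega>))\<^sup>2) \<partial>M) \<partial>lborel)
           \<longlonglongrightarrow> 0 \<and>
        (\<lambda>j. \<integral>\<^sup>+ \<omega>. ennreal
           ((norm (J \<omega> - simple_ito (n j) (\<tau> j) (\<xi> j) \<nu> \<omega>))\<^sup>2) \<partial>M)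
           \<longlonglongrightarrow> 0)"

section \<open>The augmented filtering problem\<close>

definition aug_state ::
    "(real \<Rightarrow> real \<Rightarrow> real) \<Rightarrow> (real \<Rightarrow> 'w \<Rightarrow> real ^ 'm) \<Rightarrow> real \<Rightarrow> real \<Rightarrow> 'w \<Rightarrow>
     real ^ ('m::finite + 'm)" where
  "aug_state L X r t \<omega> = vstack (X t \<omega>) (LINT s:{0..t}|lborel. L r s *\<^sub>R X s \<omega>)"

definition state_estimate ::
    "'w measure \<Rightarrow> (real \<Rightarrow> 'w \<Rightarrow> real ^ 'm) \<Rightarrow> (real \<Rightarrow> 'w \<Rightarrow> real ^ 'm) \<Rightarrow> real \<Rightarrow> 'w \<Rightarrow>
     real ^ 'm" where
  "state_estimate M Z X t = vec_cond_exp M (natural_filtration M Z t) (X t)"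

definition aug_estimate ::
    "'w measure \<Rightarrow> (real \<Rightarrow> 'w \<Rightarrow> real ^ 'm) \<Rightarrow> (real \<Rightarrow> real \<Rightarrow> real) \<Rightarrow>
     (real \<Rightarrow> 'w \<Rightarrow> real ^ 'm) \<Rightarrow> real \<Rightarrow> real \<Rightarrow> 'w \<Rightarrow> real ^ ('m::finite + 'm)" where
  "aug_estimate M Z L X r t = vec_cond_exp M (natural_filtration M Z t) (aug_state L X r t)"

definition aug_cond_cov ::
    "'w measure \<Rightarrow> (real \<Rightarrow> 'w \<Rightarrow> real ^ 'm) \<Rightarrow> (real \<Rightarrow> real \<Rightarrow> real) \<Rightarrow>
     (real \<Rightarrow> 'w \<Rightarrow> real ^ 'm) \<Rightarrow> real \<Rightarrow> real \<Rightarrow> 'w \<Rightarrow>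
     real ^ ('m + 'm) ^ ('m::finite + 'm)" where
  "aug_cond_cov M Z L X r t = mat_cond_exp M (natural_filtration M Z t)
     (\<lambda>\<omega>. outer_prod (aug_state L X r t \<omega> - aug_estimate M Z L X r t \<omega>)
                     (aug_state L X t t \<omega> - aug_estimate M Z L X t t \<omega>))"

text \<open>In the notation of the theorem: \<open>[a(s); L(r,s)]\<close>, \<open>B\<^sub>r(s)\<close>, \<open>[H(s,s) I]\<close>, \<open>\<Sigma>\<close>, \<open>P\<^sub>0\<close>.\<close>

definition drift_col ::
    "(real \<Rightarrow> real ^ 'm ^ 'm) \<Rightarrow> (real \<Rightarrow> real \<Rightarrow> real) \<Rightarrow> real \<Rightarrow> real \<Rightarrow>
     real ^ 'm ^ ('m::finite + 'm)" where
  "drift_col a L r s = vstack (a s) (mat (L r s))"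

definition drift_mat ::
    "(real \<Rightarrow> real ^ 'm ^ 'm) \<Rightarrow> (real \<Rightarrow> real \<Rightarrow> real) \<Rightarrow> real \<Rightarrow> real \<Rightarrow>
     real ^ ('m + 'm) ^ ('m::finite + 'm)" where
  "drift_mat a L r s = drift_col a L r s ** hstack (mat 1) 0"

definition obs_mat :: "(real \<Rightarrow> real \<Rightarrow> real) \<Rightarrow> real \<Rightarrow> real ^ ('m::finite + 'm) ^ 'm" where
  "obs_mat H s = hstack (mat (H s s)) (mat 1)"

definition noise_mat :: "real ^ 'm ^ ('m::finite + 'm)" where
  "noise_mat = vstack (mat 1) 0"

definition initial_cov ::
    "'w measure \<Rightarrow> ('w \<Rightarrow> real ^ 'm) \<Rightarrow> real ^ ('m + 'm) ^ ('m::finite + 'm)" where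
  "initial_cov M Y = vstack (hstack (covariance_matrix M Y) 0) (hstack 0 0)"

end

theory Submission
  imports Defs
begin

text \<open>Everything happens in the Hilbert space of square-integrable random variables. All variables of
  the model lie in the closed linear span of a Gaussian family, so the conditional expectation
  \<open>\<pi>\<^sub>t\<close> given the observation is the orthogonal projection onto the span of the observation and
  conditional covariances are constants; no stochastic calculus is needed. Since
  \<open>H(t,s) = H(s,s) + \<integral>\<^sub>s\<^sup>t L(u,s) du\<close>, the observation is \<open>Z\<^sub>t = \<integral>\<^sub>0\<^sup>t h\<^sub>s ds + N\<^sub>t\<close> with
  \<open>h\<^sub>s = [H(s,s) I] V\<close>, \<open>V\<close> the augmented state with both indices \<open>s\<close>. For a signal
  \<open>v\<^sub>t = v\<^sub>0 + \<integral>\<^sub>0\<^sup>t b\<^sub>s ds + w\<^sub>t\<close> the remainder \<open>\<pi>\<^sub>t v\<^sub>t - \<pi>\<^sub>0 v\<^sub>0 - \<integral>\<^sub>0\<^sup>t \<pi>\<^sub>s b\<^sub>s ds\<close> is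
  orthogonal to the past, and its inner product with \<open>\<nu>\<^sub>u\<close> is \<open>\<integral>\<^sub>0\<^sup>u E[v\<^sub>s (h\<^sub>s - \<pi>\<^sub>s h\<^sub>s)] ds\<close>.
  The difference \<open>D\<close> between this remainder and a Riemann sum of the Ito integral of this gain lies in
  the span of the observation; there the independent noise bounds the norm of \<open>D\<close> by its inner
  products with the observation, and Gronwall's inequality makes \<open>D\<close> small. The Riccati equation
  is the difference of the product rules for \<open>E[v v']\<close> and \<open>E[\<pi>v \<pi>v']\<close>.\<close>

section \<open>Mean-square geometry\<close>

context prob_space
begin

text \<open>Three obstacles shape the proof. Conditional expectations are arbitrary versions, chosen
  for each time separately, so a filtered process has no paths to integrate along. Time integrals
  are therefore handled weakly: \<open>wint\<close> fixes an integral by its inner products with all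
  square-integrable variables, and measurable modifications serve only to produce such integrals.
  Next, it is not known beforehand that the innovations carry all the information of the
  observation, so no representation theorem turns the remainder into a stochastic integral.
  \<open>observed_norm_bound\<close> takes its place: it estimates in the span of the observation
  itself, at the price of a feedback term through the filtered signal, which Gronwall absorbs.
  Finally, \<open>H\<close> is only an L_1 limit of separable kernels and is not assumed
  differentiable; \<open>kernel_derivative\<close> recovers the integral identity that is needed.
  Gaussianity enters through \<open>gaussian_chf\<close>, which covers constants and survives
  mean-square limits. The initial state need not be centred, which is why the constant 1 is adjoined
  to the spans.\<close>

definition L2 :: "('a \<Rightarrow> real) set" where
  "L2 = {f. f \<in> borel_measurable M \<and> integrable M (\<lambda>w. (f w)\<^sup>2)}"

definition ip :: "('a \<Rightarrow> real) \<Rightarrow> ('a \<Rightarrow> real) \<Rightarrow> real" where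
  "ip f g = (LINT w|M. f w * g w)"

definition nrm :: "('a \<Rightarrow> real) \<Rightarrow> real" where
  "nrm f = sqrt (ip f f)"

lemma L2_measurable [measurable_dest]: "f \<in> L2 \<Longrightarrow> f \<in> borel_measurable M"
  by (simp add: L2_def)

lemma L2_integrable_mult:
  assumes "f \<in> L2" "g \<in> L2"
  shows "integrable M (\<lambda>w. f w * g w)"
proof (rule Bochner_Integration.integrable_bound[of _ "\<lambda>w. (f w)\<^sup>2 + (g w)\<^sup>2"])
  show "integrable M (\<lambda>w. (f w)\<^sup>2 + (g w)\<^sup>2)"
    using assms by (auto simp: L2_def)
  show "(\<lambda>w. f w * g w) \<in> borel_measurable M"
    using assms by (auto simp: L2_def)
  have "\<bar>x * y\<bar> \<le> x\<^sup>2 + y\<^sup>2" for x y :: real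
  proof -
    have "0 \<le> (\<bar>x\<bar> - \<bar>y\<bar>)\<^sup>2" by simp
    then have "2 * (\<bar>x\<bar> * \<bar>y\<bar>) \<le> x\<^sup>2 + y\<^sup>2" by (simp add: power2_diff)
    moreover have "0 \<le> \<bar>x\<bar> * \<bar>y\<bar>" by simp
    ultimately show ?thesis unfolding abs_mult by linarith
  qed
  then show "AE w in M. norm (f w * g w) \<le> norm ((f w)\<^sup>2 + (g w)\<^sup>2)"
    by simp
qed

lemma L2_const [simp, intro]: "(\<lambda>w. c) \<in> L2"
  by (simp add: L2_def)

lemma L2_scale [simp, intro]: "f \<in> L2 \<Longrightarrow> (\<lambda>w. c * f w) \<in> L2"
  by (auto simp: L2_def power_mult_distrib)

lemma L2_add [simp, intro]:
  assumes "f \<in> L2" "g \<in> L2" shows "(\<lambda>w. f w + g w) \<in> L2"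
proof -
  have "(\<lambda>w. (f w + g w)\<^sup>2) = (\<lambda>w. (f w)\<^sup>2 + (g w)\<^sup>2 + 2 * (f w * g w))"
    by (simp add: power2_sum mult.assoc)
  then show ?thesis
    using assms L2_integrable_mult[OF assms] by (auto simp: L2_def)
qed

lemma L2_minus [simp, intro]: "f \<in> L2 \<Longrightarrow> (\<lambda>w. - f w) \<in> L2"
  using L2_scale[of f "-1"] by simp

lemma L2_diff [simp, intro]: "f \<in> L2 \<Longrightarrow> g \<in> L2 \<Longrightarrow> (\<lambda>w. f w - g w) \<in> L2"
  using L2_add[OF _ L2_minus, of f g] by simp

lemma L2_sum [simp, intro]: "(\<And>i. i \<in> A \<Longrightarrow> f i \<in> L2) \<Longrightarrow> (\<lambda>w. \<Sum>i\<in>A. f i w) \<in> L2"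
  by (induction A rule: infinite_finite_induct) auto

lemma L2_integrable: "f \<in> L2 \<Longrightarrow> integrable M f"
  using L2_integrable_mult[of f "\<lambda>_. 1"] by simp

lemma L2_AE_cong:
  assumes "f \<in> L2" "AE w in M. g w = f w" "g \<in> borel_measurable M"
  shows "g \<in> L2"
proof -
  have "integrable M (\<lambda>w. (g w)\<^sup>2)"
    using assms by (subst integrable_cong_AE[of _ _ "\<lambda>w. (f w)\<^sup>2"]) (auto simp: L2_def)
  then show ?thesis using assms by (simp add: L2_def)
qed

lemma ip_commute: "ip f g = ip g f"
  by (simp add: ip_def mult.commute)

lemma ip_add_left: "f \<in> L2 \<Longrightarrow> g \<in> L2 \<Longrightarrow> h \<in> L2 \<Longrightarrow> ip (\<lambda>w. f w + g w) h = ip f h + ip g h"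
  unfolding ip_def by (subst Bochner_Integration.integral_add[symmetric]) (auto simp: distrib_right L2_integrable_mult)

lemma ip_diff_left: "f \<in> L2 \<Longrightarrow> g \<in> L2 \<Longrightarrow> h \<in> L2 \<Longrightarrow> ip (\<lambda>w. f w - g w) h = ip f h - ip g h"
  unfolding ip_def by (subst Bochner_Integration.integral_diff[symmetric]) (auto simp: left_diff_distrib L2_integrable_mult)

lemma ip_scale_left: "ip (\<lambda>w. c * f w) h = c * ip f h"
  by (simp add: ip_def mult.assoc)

lemma ip_minus_left: "ip (\<lambda>w. - f w) h = - ip f h"
  by (simp add: ip_def)

lemma ip_zero_left [simp]: "ip (\<lambda>w. 0) h = 0" "ip h (\<lambda>w. 0) = 0"
  by (simp_all add: ip_def)

lemma ip_sum_left:
  assumes "\<And>i. i \<in> A \<Longrightarrow> f i \<in> L2" "h \<in> L2"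
  shows "ip (\<lambda>w. \<Sum>i\<in>A. f i w) h = (\<Sum>i\<in>A. ip (f i) h)"
  using assms by (induction A rule: infinite_finite_induct) (auto simp: ip_add_left)

lemma ip_add_right: "f \<in> L2 \<Longrightarrow> g \<in> L2 \<Longrightarrow> h \<in> L2 \<Longrightarrow> ip h (\<lambda>w. f w + g w) = ip h f + ip h g"
  using ip_add_left[of f g h] by (simp only: ip_commute[of h])

lemma ip_diff_right: "f \<in> L2 \<Longrightarrow> g \<in> L2 \<Longrightarrow> h \<in> L2 \<Longrightarrow> ip h (\<lambda>w. f w - g w) = ip h f - ip h g"
  using ip_diff_left[of f g h] by (simp only: ip_commute[of h])

lemma ip_scale_right: "ip h (\<lambda>w. c * f w) = c * ip h f"
  using ip_scale_left[of c f h] by (simp only: ip_commute[of h])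

lemma ip_minus_right: "ip h (\<lambda>w. - f w) = - ip h f"
  using ip_minus_left[of f h] by (simp only: ip_commute[of h])

lemma ip_sum_right:
  assumes "\<And>i. i \<in> A \<Longrightarrow> f i \<in> L2" "h \<in> L2"
  shows "ip h (\<lambda>w. \<Sum>i\<in>A. f i w) = (\<Sum>i\<in>A. ip h (f i))"
  using ip_sum_left[OF assms] by (simp only: ip_commute[of h])

lemmas ip_bilinear = ip_add_left ip_diff_left ip_scale_left ip_minus_left
  ip_add_right ip_diff_right ip_scale_right ip_minus_right

lemma ip_cong_AE:
  assumes "AE w in M. f w = f' w" "AE w in M. g w = g' w"
    "f \<in> borel_measurable M" "g \<in> borel_measurable M" "f' \<in> borel_measurable M" "g' \<in> borel_measurable M"
  shows "ip f g = ip f' g'"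
  unfolding ip_def by (rule integral_cong_AE) (use assms in auto)

lemma ip_const: "ip f (\<lambda>_. c) = c * expectation f" "ip (\<lambda>_. c) f = c * expectation f"
  by (simp_all add: ip_def)

lemma ip_self_nonneg [simp]: "0 \<le> ip f f"
  unfolding ip_def by (rule integral_nonneg_AE) auto

lemma nrm_nonneg [simp]: "0 \<le> nrm f"
  by (simp add: nrm_def)

lemma nrm_square: "(nrm f)\<^sup>2 = ip f f"
  by (simp add: nrm_def)

lemma nn_integral_square:
  assumes "f \<in> L2"
  shows "(\<integral>\<^sup>+w. ennreal ((f w)\<^sup>2) \<partial>M) = ennreal ((nrm f)\<^sup>2)"
proof -
  have "(\<integral>\<^sup>+w. ennreal ((f w)\<^sup>2) \<partial>M) = ennreal (LINT w|M. (f w)\<^sup>2)"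
    using assms by (intro nn_integral_eq_integral) (auto simp: L2_def)
  then show ?thesis unfolding nrm_square by (simp add: ip_def power2_eq_square)
qed

lemma ip_self_eq_0_iff:
  assumes "f \<in> L2" shows "ip f f = 0 \<longleftrightarrow> (AE w in M. f w = 0)"
proof -
  have "integrable M (\<lambda>w. f w * f w)" using assms by (simp add: L2_integrable_mult)
  then have "ip f f = 0 \<longleftrightarrow> (AE w in M. f w * f w = 0)"
    unfolding ip_def by (intro integral_nonneg_eq_0_iff_AE) auto
  then show ?thesis by simp
qed

lemma Cauchy_Schwarz_ip:
  assumes [simp]: "f \<in> L2" "g \<in> L2"
  shows "\<bar>ip f g\<bar> \<le> nrm f * nrm g"
proof (cases "ip g g = 0")
  case True
  then have "AE w in M. g w = 0" using ip_self_eq_0_iff assms by blast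
  then have "ip f g = 0" unfolding ip_def by (intro integral_eq_zero_AE) auto
  then show ?thesis by simp
next
  case False
  then have pos: "ip g g > 0" using ip_self_nonneg[of g] by linarith
  define c where "c = ip f g / ip g g"
  have "0 \<le> ip (\<lambda>w. f w - c * g w) (\<lambda>w. f w - c * g w)" by simp
  also have "\<dots> = ip f f - 2 * c * ip f g + c\<^sup>2 * ip g g"
    by (simp add: ip_bilinear ip_commute[of g f] power2_eq_square algebra_simps)
  also have "\<dots> = ip f f - (ip f g)\<^sup>2 / ip g g"
    using pos by (simp add: c_def power2_eq_square field_simps)
  finally have "(ip f g)\<^sup>2 \<le> ip f f * ip g g" using pos by (simp add: field_simps)
  then have "sqrt ((ip f g)\<^sup>2) \<le> sqrt (ip f f * ip g g)" by (rule real_sqrt_le_mono)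
  then show ?thesis by (simp add: nrm_def real_sqrt_mult)
qed

lemma nrm_triangle:
  assumes [simp]: "f \<in> L2" "g \<in> L2"
  shows "nrm (\<lambda>w. f w + g w) \<le> nrm f + nrm g"
proof (rule power2_le_imp_le)
  have "(nrm (\<lambda>w. f w + g w))\<^sup>2 = (nrm f)\<^sup>2 + (nrm g)\<^sup>2 + 2 * ip f g"
    by (simp add: nrm_square ip_bilinear ip_commute[of g f])
  also have "\<dots> \<le> (nrm f + nrm g)\<^sup>2"
    using Cauchy_Schwarz_ip[OF assms] by (simp add: power2_sum)
  finally show "(nrm (\<lambda>w. f w + g w))\<^sup>2 \<le> (nrm f + nrm g)\<^sup>2" .
qed (simp add: add_nonneg_nonneg)

lemma nrm_minus: "nrm (\<lambda>w. - f w) = nrm f"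
  by (simp add: nrm_def ip_minus_left ip_minus_right)

lemma nrm_commute: "nrm (\<lambda>w. f w - g w) = nrm (\<lambda>w. g w - f w)"
  using nrm_minus[of "\<lambda>w. f w - g w"] by simp

lemma nrm_triangle3:
  assumes "f \<in> L2" "g \<in> L2" "h \<in> L2"
  shows "nrm (\<lambda>w. f w - h w) \<le> nrm (\<lambda>w. f w - g w) + nrm (\<lambda>w. g w - h w)"
  using nrm_triangle[of "\<lambda>w. f w - g w" "\<lambda>w. g w - h w"] assms by simp

lemma nrm_zero [simp]: "nrm (\<lambda>w. 0) = 0"
  by (simp add: nrm_def)

lemma nrm_scale: "nrm (\<lambda>w. c * f w) = \<bar>c\<bar> * nrm f"
  by (simp add: nrm_def ip_scale_left ip_scale_right real_sqrt_mult flip: mult.assoc)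

lemma abs_expectation_le_nrm: "f \<in> L2 \<Longrightarrow> \<bar>expectation f\<bar> \<le> nrm f"
  using Cauchy_Schwarz_ip[of "\<lambda>_. 1" f] by (simp add: ip_const nrm_def prob_space)

lemma expectation_abs_le_nrm: "f \<in> L2 \<Longrightarrow> expectation (\<lambda>w. \<bar>f w\<bar>) \<le> nrm f"
proof -
  assume f: "f \<in> L2"
  have "(\<lambda>w. \<bar>f w\<bar>) \<in> L2" using f by (auto simp: L2_def)
  from abs_expectation_le_nrm[OF this] show ?thesis
    by (simp add: nrm_def ip_def)
qed

lemma ip_tendsto:
  assumes "\<And>n. f n \<in> L2" "\<And>n. g n \<in> L2" "f' \<in> L2" "g' \<in> L2"
    "(\<lambda>n. nrm (\<lambda>w. f n w - f' w)) \<longlonglongrightarrow> 0" "(\<lambda>n. nrm (\<lambda>w. g n w - g' w)) \<longlonglongrightarrow> 0"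
  shows "(\<lambda>n. ip (f n) (g n)) \<longlonglongrightarrow> ip f' g'"
proof -
  have bd: "\<bar>ip (f n) (g n) - ip f' g'\<bar> \<le>
      nrm (\<lambda>w. f n w - f' w) * nrm (\<lambda>w. g n w - g' w)
      + nrm (\<lambda>w. f n w - f' w) * nrm g' + nrm f' * nrm (\<lambda>w. g n w - g' w)" for n
  proof -
    have "ip (f n) (g n) - ip f' g' = ip (\<lambda>w. f n w - f' w) (\<lambda>w. g n w - g' w)
        + ip (\<lambda>w. f n w - f' w) g' + ip f' (\<lambda>w. g n w - g' w)"
      using assms(1-4) by (simp add: ip_bilinear)
    moreover have "\<bar>ip (\<lambda>w. f n w - f' w) (\<lambda>w. g n w - g' w)\<bar> \<le> nrm (\<lambda>w. f n w - f' w) * nrm (\<lambda>w. g n w - g' w)"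
      "\<bar>ip (\<lambda>w. f n w - f' w) g'\<bar> \<le> nrm (\<lambda>w. f n w - f' w) * nrm g'"
      "\<bar>ip f' (\<lambda>w. g n w - g' w)\<bar> \<le> nrm f' * nrm (\<lambda>w. g n w - g' w)"
      using assms(1-4) by (intro Cauchy_Schwarz_ip; simp)+
    ultimately show ?thesis by linarith
  qed
  have "(\<lambda>n. nrm (\<lambda>w. f n w - f' w) * nrm (\<lambda>w. g n w - g' w)
      + nrm (\<lambda>w. f n w - f' w) * nrm g' + nrm f' * nrm (\<lambda>w. g n w - g' w)) \<longlonglongrightarrow> 0 * 0 + 0 * nrm g' + nrm f' * 0"
    by (intro tendsto_intros assms)
  then have lim: "(\<lambda>n. nrm (\<lambda>w. f n w - f' w) * nrm (\<lambda>w. g n w - g' w)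
      + nrm (\<lambda>w. f n w - f' w) * nrm g' + nrm f' * nrm (\<lambda>w. g n w - g' w)) \<longlonglongrightarrow> 0"
    by simp
  have "(\<lambda>n. ip (f n) (g n) - ip f' g') \<longlonglongrightarrow> 0"
    by (rule Lim_null_comparison[OF always_eventually lim]) (use bd in \<open>simp add: real_norm_def\<close>)
  then show ?thesis by (rule LIM_zero_cancel)
qed

text \<open>A subsequence with summable increments converges almost everywhere, and Fatou's lemma
  turns the Cauchy property into mean-square convergence.\<close>

lemma L2_complete:
  assumes F: "subalgebra M F" and fF: "\<And>n. f n \<in> borel_measurable F" and f: "\<And>n. f n \<in> L2"
    and fast: "\<And>n m. n \<le> m \<Longrightarrow> nrm (\<lambda>w. f m w - f n w) \<le> (1/2)^n"
  obtains l where "l \<in> borel_measurable F" "l \<in> L2"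
    "(\<lambda>n. nrm (\<lambda>w. f n w - l w)) \<longlonglongrightarrow> 0" "AE w in M. (\<lambda>n. f n w) \<longlonglongrightarrow> l w"
proof -
  \<comment> \<open>Taking \<open>lim\<close> at every point makes the limit measurable for
    \<open>F\<close> itself, although convergence holds only almost everywhere; \<open>F\<close>
    need not contain the null sets of \<open>M\<close>.\<close>
  define l where "l w = lim (\<lambda>n. f n w)" for w
  have lF: "l \<in> borel_measurable F"
    unfolding l_def using fF by (rule borel_measurable_lim_metric)
  have F_M: "g \<in> borel_measurable M" if "g \<in> borel_measurable F" for g :: "'a \<Rightarrow> real"
    using measurable_from_subalg[OF F that] .
  note fM [measurable] = F_M[OF fF] and lM [measurable] = F_M[OF lF]
  have incr: "expectation (\<lambda>w. \<bar>f (Suc n) w - f n w\<bar>) \<le> (1/2)^n" for n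
    using expectation_abs_le_nrm[of "\<lambda>w. f (Suc n) w - f n w"] fast[of n "Suc n"] f by simp
  have "(\<integral>\<^sup>+w. (\<Sum>n. ennreal \<bar>f (Suc n) w - f n w\<bar>) \<partial>M) = (\<Sum>n. \<integral>\<^sup>+w. ennreal \<bar>f (Suc n) w - f n w\<bar> \<partial>M)"
    by (intro nn_integral_suminf) auto
  also have "\<dots> = (\<Sum>n. ennreal (expectation (\<lambda>w. \<bar>f (Suc n) w - f n w\<bar>)))"
    using f by (intro suminf_cong nn_integral_eq_integral integrable_abs L2_integrable L2_diff) auto
  also have "\<dots> \<le> (\<Sum>n. ennreal ((1/2)^n))"
    using incr by (intro suminf_le ennreal_leI summableI) auto
  also have "\<dots> < \<infinity>"
    by (subst suminf_ennreal2) (auto intro: summable_geometric)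
  finally have "AE w in M. (\<Sum>n. ennreal \<bar>f (Suc n) w - f n w\<bar>) \<noteq> \<infinity>"
    by (intro nn_integral_PInf_AE) auto
  then have conv: "AE w in M. (\<lambda>n. f n w) \<longlonglongrightarrow> l w"
  proof eventually_elim
    case (elim w)
    then have "summable (\<lambda>n. \<bar>f (Suc n) w - f n w\<bar>)"
      by (intro summable_suminf_not_top) auto
    then have "summable (\<lambda>n. f (Suc n) w - f n w)"
      by (rule summable_rabs_cancel)
    then obtain s where "(\<lambda>n. \<Sum>i<n. f (Suc i) w - f i w) \<longlonglongrightarrow> s"
      by (auto simp: summable_def sums_def)
    then have "(\<lambda>n. (f n w - f 0 w) + f 0 w) \<longlonglongrightarrow> s + f 0 w"
      unfolding sum_lessThan_telescope[of "\<lambda>i. f i w"] by (intro tendsto_add tendsto_const)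
    then have "convergent (\<lambda>n. f n w)" by (auto simp: convergent_def)
    then show ?case unfolding l_def by (simp add: convergent_LIMSEQ_iff)
  qed
  have sq: "(\<integral>\<^sup>+w. ennreal ((f n w - l w)\<^sup>2) \<partial>M) \<le> ennreal (((1/2)^n)\<^sup>2)" for n
  proof -
    have "AE w in M. ennreal ((f n w - l w)\<^sup>2) = liminf (\<lambda>m. ennreal ((f n w - f m w)\<^sup>2))"
      using conv
    proof eventually_elim
      case (elim w)
      have "(\<lambda>m. ennreal ((f n w - f m w)\<^sup>2)) \<longlonglongrightarrow> ennreal ((f n w - l w)\<^sup>2)"
        by (intro tendsto_ennrealI tendsto_intros elim)
      from lim_imp_Liminf[OF _ this] show ?case by simp
    qed
    then have "(\<integral>\<^sup>+w. ennreal ((f n w - l w)\<^sup>2) \<partial>M) = (\<integral>\<^sup>+w. liminf (\<lambda>m. ennreal ((f n w - f m w)\<^sup>2)) \<partial>M)"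
      by (rule nn_integral_cong_AE)
    also have "\<dots> \<le> liminf (\<lambda>m. \<integral>\<^sup>+w. ennreal ((f n w - f m w)\<^sup>2) \<partial>M)"
      by (intro nn_integral_liminf) auto
    also have "\<dots> \<le> liminf (\<lambda>m. ennreal (((1/2)^n)\<^sup>2))"
    proof (rule Liminf_mono, rule eventually_sequentiallyI[of n])
      fix m assume "n \<le> m"
      then have "(nrm (\<lambda>w. f n w - f m w))\<^sup>2 \<le> ((1/2)^n)\<^sup>2"
        using fast[of n m] nrm_commute[of "f n" "f m"] by (intro power_mono) auto
      moreover have "(\<integral>\<^sup>+w. ennreal ((f n w - f m w)\<^sup>2) \<partial>M) = ennreal ((nrm (\<lambda>w. f n w - f m w))\<^sup>2)"
        by (rule nn_integral_square) (simp add: f)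
      ultimately show "(\<integral>\<^sup>+w. ennreal ((f n w - f m w)\<^sup>2) \<partial>M) \<le> ennreal (((1/2)^n)\<^sup>2)"
        by (simp add: ennreal_leI)
    qed
    also have "\<dots> = ennreal (((1/2)^n)\<^sup>2)" by (simp add: Liminf_const)
    finally show ?thesis .
  qed
  have dL2: "(\<lambda>w. f n w - l w) \<in> L2" for n
  proof -
    have "integrable M (\<lambda>w. (f n w - l w)\<^sup>2)"
      by (rule integrableI_bounded)
        (use le_less_trans[OF sq[of n] ennreal_less_top] in simp_all)
    then show ?thesis by (simp add: L2_def)
  qed
  have lL2: "l \<in> L2"
    using L2_diff[OF f[of 0] dL2[of 0]] by simp
  have "nrm (\<lambda>w. f n w - l w) \<le> (1/2)^n" for n
  proof (rule power2_le_imp_le)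
    have "(\<integral>\<^sup>+w. ennreal ((f n w - l w)\<^sup>2) \<partial>M) = ennreal ((nrm (\<lambda>w. f n w - l w))\<^sup>2)"
      by (rule nn_integral_square[OF dL2])
    then show "(nrm (\<lambda>w. f n w - l w))\<^sup>2 \<le> ((1/2)^n)\<^sup>2"
      using sq[of n] by (simp add: ennreal_le_iff)
  qed simp
  then have "(\<lambda>n. nrm (\<lambda>w. f n w - l w)) \<longlonglongrightarrow> 0"
    by (intro Lim_null_comparison[OF always_eventually LIMSEQ_power_zero[of "1/2"]]) auto
  then show ?thesis using that lF lL2 conv by blast
qed

end

section \<open>Linear spans, their mean-square closures and orthogonal projection\<close>

inductive_set lin :: "('w \<Rightarrow> real) set \<Rightarrow> ('w \<Rightarrow> real) set" for S where
  zero: "(\<lambda>x. 0) \<in> lin S"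
| step: "f \<in> S \<Longrightarrow> g \<in> lin S \<Longrightarrow> (\<lambda>x. c * f x + g x) \<in> lin S"

lemma lin_base: "f \<in> S \<Longrightarrow> f \<in> lin S"
  using lin.step[OF _ lin.zero, of f S 1] by simp

lemma lin_add: "f \<in> lin S \<Longrightarrow> g \<in> lin S \<Longrightarrow> (\<lambda>x. f x + g x) \<in> lin S"
proof (induction rule: lin.induct)
  case (step f h c)
  then show ?case using lin.step[of f S "\<lambda>x. h x + g x" c] by (simp add: add.assoc)
qed simp

lemma lin_scale: "f \<in> lin S \<Longrightarrow> (\<lambda>x. b * f x) \<in> lin S"
proof (induction rule: lin.induct)
  case (step f h c)
  then show ?case using lin.step[of f S "\<lambda>x. b * h x" "b * c"] by (simp add: algebra_simps)
qed (simp add: lin.zero)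

lemma lin_mono:
  assumes "S \<subseteq> S'" shows "lin S \<subseteq> lin S'"
proof
  fix f assume "f \<in> lin S"
  then show "f \<in> lin S'" by induction (use assms in \<open>auto intro: lin.intros\<close>)
qed

lemma lin_measurable:
  assumes "S \<subseteq> borel_measurable F" "f \<in> lin S" shows "f \<in> borel_measurable F"
  using assms(2,1) by induction auto

context prob_space
begin

lemma lin_L2: "S \<subseteq> L2 \<Longrightarrow> f \<in> lin S \<Longrightarrow> f \<in> L2"
  by (rotate_tac 1, induction rule: lin.induct) auto

text \<open>Elements are functions, not classes. A square-integrable function that agrees almost
  everywhere with a member is itself a member, being at distance 0 from it.\<close>

definition cspan :: "('a \<Rightarrow> real) set \<Rightarrow> ('a \<Rightarrow> real) set" where
  "cspan S = {Y \<in> L2. \<forall>e>0. \<exists>V\<in>lin S. nrm (\<lambda>x. Y x - V x) < e}"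

lemma cspan_L2: "Y \<in> cspan S \<Longrightarrow> Y \<in> L2"
  by (simp add: cspan_def)

lemma lin_cspan: "S \<subseteq> L2 \<Longrightarrow> f \<in> lin S \<Longrightarrow> f \<in> cspan S"
  unfolding cspan_def using lin_L2 by (auto intro!: bexI[of _ f])

lemma cspan_base: "S \<subseteq> L2 \<Longrightarrow> f \<in> S \<Longrightarrow> f \<in> cspan S"
  by (rule lin_cspan[OF _ lin_base])

lemma cspan_mono: "S \<subseteq> S' \<Longrightarrow> cspan S \<subseteq> cspan S'"
  using lin_mono[of S S'] unfolding cspan_def by blast

lemma cspan_closed:
  assumes "S \<subseteq> L2" "Y \<in> L2" "\<And>e. e > 0 \<Longrightarrow> \<exists>V\<in>cspan S. nrm (\<lambda>x. Y x - V x) < e"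
  shows "Y \<in> cspan S"
  unfolding cspan_def
proof (intro CollectI conjI allI impI assms(2))
  fix e :: real assume "0 < e"
  then obtain V where V: "V \<in> cspan S" "nrm (\<lambda>x. Y x - V x) < e / 2"
    using assms(3)[of "e/2"] by auto
  obtain U where U: "U \<in> lin S" "nrm (\<lambda>x. V x - U x) < e / 2"
    using V(1) \<open>0 < e\<close> half_gt_zero unfolding cspan_def by blast
  show "\<exists>V\<in>lin S. nrm (\<lambda>x. Y x - V x) < e"
    using nrm_triangle3[OF assms(2) cspan_L2[OF V(1)] lin_L2[OF assms(1) U(1)]] U V
    by (intro bexI[of _ U]) auto
qed

lemma cspan_tendsto:
  assumes "S \<subseteq> L2" "Y \<in> L2" "\<And>n. V n \<in> cspan S" "(\<lambda>n. nrm (\<lambda>x. V n x - Y x)) \<longlonglongrightarrow> 0"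
  shows "Y \<in> cspan S"
proof (rule cspan_closed[OF assms(1,2)])
  fix e :: real assume "0 < e"
  then obtain n where "nrm (\<lambda>x. V n x - Y x) < e"
    using order_tendstoD(2)[OF assms(4)] by (auto simp: eventually_sequentially)
  then show "\<exists>V\<in>cspan S. nrm (\<lambda>x. Y x - V x) < e"
    using assms(3) nrm_commute by metis
qed

lemma cspan_add:
  assumes S: "S \<subseteq> L2" and f: "f \<in> cspan S" and g: "g \<in> cspan S"
  shows "(\<lambda>x. f x + g x) \<in> cspan S"
  unfolding cspan_def
proof (intro CollectI conjI allI impI)
  show "(\<lambda>x. f x + g x) \<in> L2" using f g cspan_L2 by auto
  fix e :: real assume "0 < e"
  then obtain V U where V: "V \<in> lin S" "nrm (\<lambda>x. f x - V x) < e / 2"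
    and U: "U \<in> lin S" "nrm (\<lambda>x. g x - U x) < e / 2"
    using f g half_gt_zero unfolding cspan_def by blast
  have "nrm (\<lambda>x. (f x - V x) + (g x - U x)) \<le> nrm (\<lambda>x. f x - V x) + nrm (\<lambda>x. g x - U x)"
    using f g U V lin_L2[OF S] cspan_L2 by (intro nrm_triangle) auto
  also have "(\<lambda>x. (f x - V x) + (g x - U x)) = (\<lambda>x. (f x + g x) - (V x + U x))"
    by (simp add: algebra_simps)
  finally show "\<exists>V\<in>lin S. nrm (\<lambda>x. f x + g x - V x) < e"
    using U V lin_add[OF V(1) U(1)] by (intro bexI[of _ "\<lambda>x. V x + U x"]) auto
qed

lemma cspan_scale:
  assumes S: "S \<subseteq> L2" and f: "f \<in> cspan S"
  shows "(\<lambda>x. c * f x) \<in> cspan S"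
  unfolding cspan_def
proof (intro CollectI conjI allI impI)
  show "(\<lambda>x. c * f x) \<in> L2" using f cspan_L2 by auto
  fix e :: real assume "0 < e"
  then have "e / (\<bar>c\<bar> + 1) > 0" by simp
  then obtain V where V: "V \<in> lin S" "nrm (\<lambda>x. f x - V x) < e / (\<bar>c\<bar> + 1)"
    using f unfolding cspan_def by blast
  have "nrm (\<lambda>x. c * (f x - V x)) = \<bar>c\<bar> * nrm (\<lambda>x. f x - V x)" by (rule nrm_scale)
  also have "\<dots> \<le> (\<bar>c\<bar> + 1) * nrm (\<lambda>x. f x - V x)" by (intro mult_right_mono) auto
  also have "\<dots> < e" using V(2) by (simp add: pos_less_divide_eq mult.commute)
  finally show "\<exists>V\<in>lin S. nrm (\<lambda>x. c * f x - V x) < e"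
    using lin_scale[OF V(1)] by (intro bexI[of _ "\<lambda>x. c * V x"]) (auto simp: right_diff_distrib)
qed

lemma cspan_minus: "S \<subseteq> L2 \<Longrightarrow> f \<in> cspan S \<Longrightarrow> (\<lambda>x. - f x) \<in> cspan S"
  using cspan_scale[of S f "-1"] by simp

lemma cspan_diff:
  "S \<subseteq> L2 \<Longrightarrow> f \<in> cspan S \<Longrightarrow> g \<in> cspan S \<Longrightarrow> (\<lambda>x. f x - g x) \<in> cspan S"
  using cspan_add[OF _ _ cspan_minus, of S f g] by simp

lemma cspan_zero: "S \<subseteq> L2 \<Longrightarrow> (\<lambda>x. 0) \<in> cspan S"
  by (rule lin_cspan[OF _ lin.zero])

lemma cspan_sum:
  "S \<subseteq> L2 \<Longrightarrow> (\<And>i. i \<in> A \<Longrightarrow> f i \<in> cspan S) \<Longrightarrow> (\<lambda>x. \<Sum>i\<in>A. f i x) \<in> cspan S"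
  by (induction A rule: infinite_finite_induct) (auto simp: cspan_zero cspan_add)

lemma cspan_idem:
  assumes S: "S \<subseteq> L2" and R: "R \<subseteq> cspan S" shows "cspan R \<subseteq> cspan S"
proof
  fix Y assume Y: "Y \<in> cspan R"
  have "V \<in> cspan S" if "V \<in> lin R" for V
    using that by induction (use R S in \<open>auto intro!: cspan_zero cspan_add cspan_scale\<close>)
  then have "\<exists>V\<in>cspan S. nrm (\<lambda>x. Y x - V x) < e" if "e > 0" for e
    using Y that unfolding cspan_def[of R] by blast
  then show "Y \<in> cspan S" by (rule cspan_closed[OF S cspan_L2[OF Y]])
qed

lemma cspan_orth:
  assumes S: "S \<subseteq> L2" and U: "U \<in> L2" and orth: "\<And>V. V \<in> S \<Longrightarrow> ip U V = 0" and Y: "Y \<in> cspan S"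
  shows "ip U Y = 0"
proof -
  have lin: "ip U V = 0" if "V \<in> lin S" for V
    using that
  proof induction
    case (step f g c)
    then show ?case using S U lin_L2[OF S] orth by (auto simp: ip_bilinear subset_iff)
  qed simp
  have "\<bar>ip U Y\<bar> \<le> e * nrm U" if e: "e > 0" for e
  proof -
    obtain V where V: "V \<in> lin S" "nrm (\<lambda>x. Y x - V x) < e"
      using Y e unfolding cspan_def by blast
    have "ip U Y = ip U (\<lambda>x. Y x - V x)"
      using lin[OF V(1)] U cspan_L2[OF Y] lin_L2[OF S V(1)] by (simp add: ip_bilinear)
    then have "\<bar>ip U Y\<bar> \<le> nrm U * nrm (\<lambda>x. Y x - V x)"
      using U cspan_L2[OF Y] lin_L2[OF S V(1)] by (simp add: Cauchy_Schwarz_ip)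
    also have "\<dots> \<le> e * nrm U"
      using V(2) by (subst mult.commute, intro mult_right_mono) auto
    finally show ?thesis .
  qed
  then have "\<bar>ip U Y\<bar> \<le> e" if "e > 0" for e
  proof -
    have "\<bar>ip U Y\<bar> \<le> (e / (nrm U + 1)) * nrm U"
      using that by (intro \<open>\<And>e. 0 < e \<Longrightarrow> \<bar>ip U Y\<bar> \<le> e * nrm U\<close>) (simp add: add_nonneg_pos)
    also have "\<dots> \<le> e"
    proof -
      have "e * nrm U \<le> e * (nrm U + 1)" using that by (intro mult_left_mono) auto
      then show ?thesis by (simp add: pos_divide_le_eq add_nonneg_pos)
    qed
    finally show ?thesis .
  qed
  then show ?thesis using field_le_epsilon[of "\<bar>ip U Y\<bar>" 0] by simp
qed

lemma parallelogram_ip: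
  assumes "f \<in> L2" "g \<in> L2"
  shows "ip (\<lambda>x. f x - g x) (\<lambda>x. f x - g x)
    = 2 * ip f f + 2 * ip g g - ip (\<lambda>x. f x + g x) (\<lambda>x. f x + g x)"
  using assms by (simp add: ip_bilinear)

lemma ip_diff_scale:
  assumes "f \<in> L2" "g \<in> L2"
  shows "ip (\<lambda>x. f x - b * g x) (\<lambda>x. f x - b * g x) = ip f f - 2 * b * ip f g + b\<^sup>2 * ip g g"
  using assms by (simp add: ip_bilinear ip_commute[of g f] power2_eq_square algebra_simps)

text \<open>A minimizing sequence for the distance is Cauchy by the parallelogram law, and its limit
  is orthogonal by the usual variation. The approximants are combinations of
  \<open>F\<close>-measurable functions, and \<open>L2_complete\<close> keeps the limit measurable
  for \<open>F\<close>, which the comparison with conditional expectations needs.\<close>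

lemma L2_projection:
  assumes S: "S \<subseteq> L2" and SF: "S \<subseteq> borel_measurable F" and F: "subalgebra M F" and Y [simp]: "Y \<in> L2"
  obtains P where "P \<in> cspan S" "P \<in> borel_measurable F" "\<And>V. V \<in> S \<Longrightarrow> ip (\<lambda>x. Y x - P x) V = 0"
proof -
  define q where "q V = ip (\<lambda>x. Y x - V x) (\<lambda>x. Y x - V x)" for V
  define d where "d = Inf (q ` lin S)"
  note linL2 [simp] = lin_L2[OF S]
  have ne: "q ` lin S \<noteq> {}" using lin.zero by blast
  have bdd: "bdd_below (q ` lin S)" by (intro bdd_belowI[of _ 0]) (auto simp: q_def)
  have d_le: "d \<le> q V" if "V \<in> lin S" for V
    unfolding d_def by (rule cInf_lower[OF imageI[OF that] bdd])
  \<comment> \<open>The excess is chosen backwards: the parallelogram law bounds the squared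
    distance of \<open>V m\<close> and \<open>V n\<close> by (1/4)^n for \<open>n \<le> m\<close>,
    which is the rate (1/2)^n that \<open>L2_complete\<close> asks for.\<close>
  have "\<exists>V\<in>lin S. q V < d + (1/4)^n / 4" for n :: nat
    using cInf_lessD[OF ne, of "d + (1/4)^n / 4"] by (auto simp: d_def)
  then obtain V where V: "\<And>n. V n \<in> lin S" "\<And>n. q (V n) < d + (1/4)^n / 4" by metis
  note V(1) [simp]
  have fast: "nrm (\<lambda>x. V m x - V n x) \<le> (1/2)^n" if "n \<le> m" for n m
  proof (rule power2_le_imp_le)
    let ?A = "\<lambda>x. (1/2) * (V m x + V n x)"
    have "?A \<in> lin S" by (intro lin_scale lin_add V)
    then have "d \<le> q ?A" by (rule d_le)
    moreover have "ip (\<lambda>x. V m x - V n x) (\<lambda>x. V m x - V n x) = 2 * q (V m) + 2 * q (V n) - 4 * q ?A"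
    proof -
      have "ip (\<lambda>x. (Y x - V n x) - (Y x - V m x)) (\<lambda>x. (Y x - V n x) - (Y x - V m x))
        = 2 * q (V n) + 2 * q (V m) - ip (\<lambda>x. (Y x - V n x) + (Y x - V m x)) (\<lambda>x. (Y x - V n x) + (Y x - V m x))"
        unfolding q_def by (rule parallelogram_ip) simp_all
      moreover have "(\<lambda>x. (Y x - V n x) + (Y x - V m x)) = (\<lambda>x. 2 * (Y x - (1/2) * (V m x + V n x)))"
        by (simp add: fun_eq_iff field_simps)
      ultimately show ?thesis unfolding q_def by (simp only: ip_scale_left ip_scale_right) simp
    qed
    moreover have "(1/4::real)^m \<le> (1/4)^n" using that by (intro power_decreasing) auto
    ultimately have "ip (\<lambda>x. V m x - V n x) (\<lambda>x. V m x - V n x) \<le> (1/4)^n"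
      using V(2)[of m] V(2)[of n] by linarith
    then show "(nrm (\<lambda>x. V m x - V n x))\<^sup>2 \<le> ((1/2)^n)\<^sup>2"
      unfolding nrm_square by (simp add: power2_eq_square power_mult_distrib[symmetric])
  qed simp
  have VF: "V n \<in> borel_measurable F" for n using lin_measurable[OF SF V(1)] .
  obtain P where P: "P \<in> borel_measurable F" "P \<in> L2" "(\<lambda>n. nrm (\<lambda>x. V n x - P x)) \<longlonglongrightarrow> 0"
    using L2_complete[OF F VF linL2[OF V(1)] fast] by metis
  have Pc: "P \<in> cspan S"
    by (rule cspan_tendsto[OF S P(2) lin_cspan[OF S V(1)] P(3)])
  note P(2) [simp]
  have lim: "(\<lambda>n. q (\<lambda>x. V n x + U x)) \<longlonglongrightarrow> q (\<lambda>x. P x + U x)" if [simp]: "U \<in> L2" for U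
  proof -
    have "(\<lambda>x. (Y x - (V n x + U x)) - (Y x - (P x + U x))) = (\<lambda>x. P x - V n x)" for n
      by (simp add: algebra_simps)
    then have "(\<lambda>n. nrm (\<lambda>x. (Y x - (V n x + U x)) - (Y x - (P x + U x)))) \<longlonglongrightarrow> 0"
      using P(3) by (simp add: nrm_commute[of P])
    then show ?thesis unfolding q_def by (intro ip_tendsto) simp_all
  qed
  have "(\<lambda>n. d + (1/4)^n / 4) \<longlonglongrightarrow> d + 0 / 4"
    by (intro tendsto_intros LIMSEQ_power_zero) auto
  moreover have "(\<lambda>n. q (V n)) \<longlonglongrightarrow> q P" using lim[of "\<lambda>_. 0"] by simp
  ultimately have qP: "q P \<le> d"
    using V(2) by (intro LIMSEQ_le[of "\<lambda>n. q (V n)" _ "\<lambda>n. d + (1/4)^n / 4"]) (auto intro: less_imp_le)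
  have "ip (\<lambda>x. Y x - P x) U = 0" if U: "U \<in> S" for U
  proof -
    have [simp]: "U \<in> L2" using S U by blast
    define c where "c = ip (\<lambda>x. Y x - P x) U"
    define k where "k = ip U U"
    have k: "k \<ge> 0" by (simp add: k_def)
    \<comment> \<open>With this \<open>b\<close> the move from \<open>P\<close> to
      \<open>P + b U\<close> changes \<open>q\<close> by -b^2 (k + 2), so minimality forces
      \<open>b = 0\<close>. The 1 in the denominator covers a null \<open>U\<close>.\<close>
    define b where "b = c / (k + 1)"
    have "d \<le> q (\<lambda>x. P x + b * U x)"
    proof (rule LIMSEQ_le_const[OF lim])
      show "\<exists>N. \<forall>n\<ge>N. d \<le> q (\<lambda>x. V n x + b * U x)"
        by (intro exI[of _ 0] allI impI d_le lin_add lin_scale lin_base U V)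
    qed simp
    also have "q (\<lambda>x. P x + b * U x) = q P - 2 * b * c + b\<^sup>2 * k"
    proof -
      have "(\<lambda>x. Y x - (P x + b * U x)) = (\<lambda>x. (Y x - P x) - b * U x)" by (simp add: algebra_simps)
      then have "q (\<lambda>x. P x + b * U x) = ip (\<lambda>x. (Y x - P x) - b * U x) (\<lambda>x. (Y x - P x) - b * U x)"
        unfolding q_def by simp
      also have "\<dots> = q P - 2 * b * c + b\<^sup>2 * k"
        unfolding q_def c_def k_def
        by (rule ip_diff_scale) simp_all
      finally show ?thesis .
    qed
    finally have "0 \<le> b\<^sup>2 * k - 2 * b * c" using qP by linarith
    also have "b\<^sup>2 * k - 2 * b * c = - (b\<^sup>2 * (k + 2))"
    proof -
      have "c = b * (k + 1)" using k by (simp add: b_def)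
      then show ?thesis by (simp add: power2_eq_square algebra_simps)
    qed
    finally have "b\<^sup>2 * (k + 2) \<le> 0" by simp
    then have "b = 0" using k by (auto simp: mult_le_0_iff)
    then show ?thesis using k by (simp add: b_def c_def)
  qed
  then show ?thesis using that Pc P(1) by blast
qed

text \<open>The residual of the projection of \<open>Y\<close> is orthogonal to \<open>S\<close>,
  hence by assumption to \<open>Y\<close>, hence to itself. This criterion puts a weakly defined
  variable into a span when nothing but its inner products is known.\<close>

lemma cspan_orthI:
  assumes S: "S \<subseteq> L2" and Y: "Y \<in> L2" and orth: "\<And>U. U \<in> L2 \<Longrightarrow> (\<And>V. V \<in> S \<Longrightarrow> ip U V = 0) \<Longrightarrow> ip Y U = 0"
  shows "Y \<in> cspan S"
proof -
  have "subalgebra M M" by (simp add: subalgebra_def)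
  moreover have "S \<subseteq> borel_measurable M" using S L2_measurable by blast
  ultimately obtain P where P: "P \<in> cspan S" "\<And>V. V \<in> S \<Longrightarrow> ip (\<lambda>z. Y z - P z) V = 0"
    using L2_projection[OF S _ _ Y] by metis
  let ?U = "\<lambda>z. Y z - P z"
  have UL: "?U \<in> L2" using Y cspan_L2[OF P(1)] by auto
  have "ip Y ?U = 0" by (rule orth[OF UL P(2)])
  moreover have "ip P ?U = 0" using cspan_orth[OF S UL P(2) P(1)] by (subst ip_commute)
  moreover have "ip ?U ?U = ip Y ?U - ip P ?U"
    by (rule ip_diff_left[OF Y cspan_L2[OF P(1)] UL])
  ultimately have "ip ?U ?U = 0" by simp
  then have "nrm ?U = 0" by (simp add: nrm_def)
  then have "\<exists>V\<in>cspan S. nrm (\<lambda>z. Y z - V z) < e" if "e > 0" for e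
    using P(1) that by (intro bexI[of _ P]) simp_all
  then show ?thesis by (rule cspan_closed[OF S Y])
qed

end

section \<open>Gaussian families and conditional expectations\<close>

text \<open>A generator, stable under intersection, of the sigma-algebra of \<open>S\<close>.
  Building it one preimage at a time matches \<open>trig_orth_indicator\<close>, which multiplies a
  weight by one indicator at a time.\<close>

inductive_set preimage_inters :: "'w set \<Rightarrow> ('w \<Rightarrow> real) set \<Rightarrow> 'w set set" for \<Omega> S where
  whole: "\<Omega> \<in> preimage_inters \<Omega> S"
| inter: "A \<in> preimage_inters \<Omega> S \<Longrightarrow> \<zeta> \<in> S \<Longrightarrow> B \<in> sets borel \<Longrightarrow> A \<inter> (\<zeta> -` B \<inter> \<Omega>) \<in> preimage_inters \<Omega> S"

lemma preimage_inters_Int: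
  "A \<in> preimage_inters \<Omega> S \<Longrightarrow> C \<in> preimage_inters \<Omega> S \<Longrightarrow> C \<inter> A \<in> preimage_inters \<Omega> S"
proof (induction rule: preimage_inters.induct)
  case whole
  have "C \<subseteq> \<Omega>" using whole by (induction rule: preimage_inters.induct) auto
  then show ?case using whole by (simp add: Int_absorb2)
next
  case (inter A \<zeta> B)
  then show ?case using preimage_inters.inter[of "C \<inter> A" \<Omega> S \<zeta> B] by (simp add: Int_assoc)
qed

context prob_space
begin

text \<open>In effect \<open>W\<close> has conditional expectation 0 given \<open>\<zeta>\<close>.
  The positive and negative parts of \<open>W\<close>, normalized to densities, push
  \<open>\<zeta>\<close> forward to two probability laws; the hypotheses say that their
  characteristic functions agree, so the laws agree by Levy's uniqueness theorem.\<close>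

lemma fourier_zero:
  fixes W \<zeta> :: "'a \<Rightarrow> real"
  assumes W: "integrable M W" and \<zeta> [measurable]: "\<zeta> \<in> borel_measurable M"
    and c: "\<And>u. expectation (\<lambda>x. W x * cos (u * \<zeta> x)) = 0"
    and s: "\<And>u. expectation (\<lambda>x. W x * sin (u * \<zeta> x)) = 0"
    and g [measurable]: "g \<in> borel_measurable borel" and Wg: "integrable M (\<lambda>x. W x * g (\<zeta> x))"
  shows "expectation (\<lambda>x. W x * g (\<zeta> x)) = 0"
proof -
  note [measurable] = borel_measurable_integrable[OF W]
  define p n where "p x = max 0 (W x)" and "n x = max 0 (- W x)" for x
  have [measurable]: "p \<in> borel_measurable M" "n \<in> borel_measurable M"
    unfolding p_def n_def by auto
  have pn0: "0 \<le> p x" "0 \<le> n x" and pnW: "p x - n x = W x" "p x \<le> \<bar>W x\<bar>" "n x \<le> \<bar>W x\<bar>" for x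
    by (auto simp: p_def n_def)
  have int_p: "integrable M p" and int_n: "integrable M n"
    unfolding p_def n_def using W by (auto intro!: integrable_max)
  define m where "m = expectation p"
  have "expectation W = expectation p - expectation n"
    using int_p int_n by (subst Bochner_Integration.integral_diff[symmetric]) (simp_all add: pnW)
  \<comment> \<open>At \<open>u = 0\<close> the cosine hypothesis says that \<open>W\<close> has
    mean 0, so both parts have the same mass \<open>m\<close>. If \<open>m = 0\<close> they cannot
    be normalized, but then \<open>W\<close> vanishes almost everywhere.\<close>
  then have mn: "expectation n = m" using c[of 0] by (simp add: m_def)
  have "m \<ge> 0" unfolding m_def using pn0 by simp
  show ?thesis
  proof (cases "m = 0")
    case True
    then have "AE x in M. p x = 0" "AE x in M. n x = 0"
      using integral_nonneg_eq_0_iff_AE[OF int_p] integral_nonneg_eq_0_iff_AE[OF int_n] pn0 mn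
      by (simp_all add: m_def)
    then have "AE x in M. W x = 0" by eventually_elim (metis pnW(1) diff_zero)
    then show ?thesis by (intro integral_eq_zero_AE) auto
  next
    case False
    then have m: "m > 0" using \<open>m \<ge> 0\<close> by simp
    define \<mu> where "\<mu> f = distr (density M (\<lambda>x. ennreal (f x / m))) borel \<zeta>" for f :: "'a \<Rightarrow> real"
    have dist: "real_distribution (\<mu> f)"
      if f: "integrable M f" "\<And>x. 0 \<le> f x" "expectation f = m" for f
    proof -
      note [measurable] = borel_measurable_integrable[OF f(1)]
      have "emeasure (density M (\<lambda>x. ennreal (f x / m))) (space M) = (\<integral>\<^sup>+x. ennreal (f x / m) \<partial>M)"
        by (subst emeasure_density) (auto intro!: nn_integral_cong)
      also have "\<dots> = ennreal (expectation (\<lambda>x. f x / m))"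
        using f m by (intro nn_integral_eq_integral) auto
      also have "\<dots> = 1" using f m by simp
      finally have "prob_space (density M (\<lambda>x. ennreal (f x / m)))"
        by (intro prob_spaceI) simp
      then show ?thesis
        unfolding \<mu>_def by (intro prob_space.real_distribution_distr) auto
    qed
    have integral_\<mu>: "integral\<^sup>L (\<mu> f) h = expectation (\<lambda>x. (f x / m) *\<^sub>R h (\<zeta> x))"
      if f: "integrable M f" "\<And>x. 0 \<le> f x" and h [measurable]: "h \<in> borel_measurable borel"
      for f and h :: "real \<Rightarrow> 'c :: {banach, second_countable_topology}"
    proof -
      note [measurable] = borel_measurable_integrable[OF f(1)]
      show ?thesis unfolding \<mu>_def using f m
        by (subst integral_distr, simp, simp, subst integral_density) auto
    qed
    have "char (\<mu> p) u = char (\<mu> n) u" for u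
    proof -
      have ib: "integrable M (\<lambda>x. (f x / m) *\<^sub>R iexp (u * \<zeta> x))" if f: "integrable M f" for f
      proof -
        note [measurable] = borel_measurable_integrable[OF f]
        have "integrable M (\<lambda>x. f x / m)" using f by simp
        then show ?thesis
          by (rule Bochner_Integration.integrable_bound) (auto simp: norm_exp_eq_Re)
      qed
      have "char (\<mu> p) u - char (\<mu> n) u
          = (CLINT x|M. (p x / m) *\<^sub>R iexp (u * \<zeta> x)) - (CLINT x|M. (n x / m) *\<^sub>R iexp (u * \<zeta> x))"
        unfolding char_def using int_p int_n pn0 by (subst (1 2) integral_\<mu>) auto
      also have "\<dots> = (CLINT x|M. (W x / m) *\<^sub>R iexp (u * \<zeta> x))"
        using ib[OF int_p] ib[OF int_n]
        by (subst Bochner_Integration.integral_diff[symmetric])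
          (simp_all add: scaleR_left_diff_distrib[symmetric] diff_divide_distrib[symmetric] pnW)
      also have "\<dots> = 0"
      proof (rule complex_eqI)
        have "Re (CLINT x|M. (W x / m) *\<^sub>R iexp (u * \<zeta> x)) = expectation (\<lambda>x. W x * cos (u * \<zeta> x)) / m"
          unfolding integral_Re[OF ib[OF W], symmetric] by (simp add: Re_exp)
        then show "Re (CLINT x|M. (W x / m) *\<^sub>R iexp (u * \<zeta> x)) = Re 0" by (simp add: c)
        have "Im (CLINT x|M. (W x / m) *\<^sub>R iexp (u * \<zeta> x)) = expectation (\<lambda>x. W x * sin (u * \<zeta> x)) / m"
          unfolding integral_Im[OF ib[OF W], symmetric] by (simp add: Im_exp)
        then show "Im (CLINT x|M. (W x / m) *\<^sub>R iexp (u * \<zeta> x)) = Im 0" by (simp add: s)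
      qed
      finally show ?thesis by simp
    qed
    then have "\<mu> p = \<mu> n"
      using dist[OF int_p] dist[OF int_n] pn0 mn by (intro Levy_uniqueness) (auto simp: m_def)
    then have eq: "expectation (\<lambda>x. p x / m * g (\<zeta> x)) = expectation (\<lambda>x. n x / m * g (\<zeta> x))"
      using integral_\<mu>[OF int_p pn0(1) g] integral_\<mu>[OF int_n pn0(2) g] by auto
    have "integrable M (\<lambda>x. p x * g (\<zeta> x))" "integrable M (\<lambda>x. n x * g (\<zeta> x))"
      using pnW pn0 by (auto intro!: Bochner_Integration.integrable_bound[OF Wg] AE_I2 mult_right_mono simp: abs_mult)
    then have "expectation (\<lambda>x. W x * g (\<zeta> x)) = expectation (\<lambda>x. p x * g (\<zeta> x)) - expectation (\<lambda>x. n x * g (\<zeta> x))"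
      by (subst Bochner_Integration.integral_diff[symmetric]) (simp_all add: pnW left_diff_distrib[symmetric])
    then show ?thesis using eq m by simp
  qed
qed

text \<open>Vanishing of the Fourier transform of the signed measure with density \<open>W\<close>
  under the joint map of finitely many members of \<open>S\<close>: an element of
  \<open>lin S\<close> is a frequency vector applied to them.\<close>

definition trig_orth :: "('a \<Rightarrow> real) set \<Rightarrow> ('a \<Rightarrow> real) \<Rightarrow> bool" where
  "trig_orth S W \<longleftrightarrow> integrable M W \<and> (\<forall>U\<in>lin S.
     expectation (\<lambda>x. W x * cos (U x)) = 0 \<and> expectation (\<lambda>x. W x * sin (U x)) = 0)"

lemma integrable_mult_bounded:
  fixes W :: "'a \<Rightarrow> real"
  assumes "integrable M W" "f \<in> borel_measurable M" "\<And>x. \<bar>f x\<bar> \<le> 1"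
  shows "integrable M (\<lambda>x. W x * f x)"
  using assms by (intro Bochner_Integration.integrable_bound[OF assms(1)])
    (auto simp: abs_mult intro!: mult_left_le)

text \<open>\<open>fourier_zero\<close> is applied to the weights \<open>W cos U\<close> and
  \<open>W sin U\<close>. Product-to-sum formulas turn its hypotheses into integrals of
  \<open>W\<close> against trigonometric functions of \<open>u \<zeta> + U\<close> and
  \<open>- u \<zeta> + U\<close>, which lie in \<open>lin S\<close> again.\<close>

lemma trig_orth_indicator:
  assumes S: "S \<subseteq> borel_measurable M" and W: "trig_orth S W" and \<zeta>: "\<zeta> \<in> S" and B: "B \<in> sets borel"
  shows "trig_orth S (\<lambda>x. W x * indicator B (\<zeta> x))"
proof -
  have \<zeta>m [measurable]: "\<zeta> \<in> borel_measurable M" using S \<zeta> by blast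
  have WI: "integrable M W" using W by (simp add: trig_orth_def)
  note [measurable] = B borel_measurable_integrable[OF WI]
  have key: "expectation (\<lambda>x. W x * cos (u * \<zeta> x + U x)) = 0"
    "expectation (\<lambda>x. W x * sin (u * \<zeta> x + U x)) = 0" if "U \<in> lin S" for u U
    using W lin.step[OF \<zeta> that] by (simp_all add: trig_orth_def)
  have "expectation (\<lambda>x. (W x * cos (U x)) * indicator B (\<zeta> x)) = 0 \<and>
      expectation (\<lambda>x. (W x * sin (U x)) * indicator B (\<zeta> x)) = 0" if U: "U \<in> lin S" for U
  proof
    have [measurable]: "U \<in> borel_measurable M" using lin_measurable[OF S U] .
    have ci: "integrable M (\<lambda>x. W x * cos (u * \<zeta> x + U x))" "integrable M (\<lambda>x. W x * sin (u * \<zeta> x + U x))" for u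
      by (intro integrable_mult_bounded WI; simp)+
    have ci0: "integrable M (\<lambda>x. W x * cos (U x))" "integrable M (\<lambda>x. W x * sin (U x))"
      using ci[of 0] by simp_all
    show "expectation (\<lambda>x. (W x * cos (U x)) * indicator B (\<zeta> x)) = 0"
    proof (rule fourier_zero[of "\<lambda>x. W x * cos (U x)" \<zeta> "indicator B"])
      fix u
      have "(\<lambda>x. (W x * cos (U x)) * cos (u * \<zeta> x))
          = (\<lambda>x. (W x * cos (u * \<zeta> x + U x) + W x * cos ((-u) * \<zeta> x + U x)) / 2)"
        by (simp add: cos_add cos_diff algebra_simps fun_eq_iff)
      then show "expectation (\<lambda>x. (W x * cos (U x)) * cos (u * \<zeta> x)) = 0"
        using key[OF U, of u] key[OF U, of "-u"] ci[of u] ci[of "-u"] by simp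
      have "(\<lambda>x. (W x * cos (U x)) * sin (u * \<zeta> x))
          = (\<lambda>x. (W x * sin (u * \<zeta> x + U x) - W x * sin ((-u) * \<zeta> x + U x)) / 2)"
        by (simp add: sin_add sin_diff algebra_simps fun_eq_iff)
      then show "expectation (\<lambda>x. (W x * cos (U x)) * sin (u * \<zeta> x)) = 0"
        using key[OF U, of u] key[OF U, of "-u"] ci[of u] ci[of "-u"] by simp
    qed (auto intro!: integrable_mult_bounded ci0 simp: indicator_def)
    show "expectation (\<lambda>x. (W x * sin (U x)) * indicator B (\<zeta> x)) = 0"
    proof (rule fourier_zero[of "\<lambda>x. W x * sin (U x)" \<zeta> "indicator B"])
      fix u
      have "(\<lambda>x. (W x * sin (U x)) * cos (u * \<zeta> x))
          = (\<lambda>x. (W x * sin (u * \<zeta> x + U x) + W x * sin ((-u) * \<zeta> x + U x)) / 2)"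
        by (simp add: sin_add sin_diff algebra_simps fun_eq_iff)
      then show "expectation (\<lambda>x. (W x * sin (U x)) * cos (u * \<zeta> x)) = 0"
        using key[OF U, of u] key[OF U, of "-u"] ci[of u] ci[of "-u"] by simp
      have "(\<lambda>x. (W x * sin (U x)) * sin (u * \<zeta> x))
          = (\<lambda>x. (W x * cos ((-u) * \<zeta> x + U x) - W x * cos (u * \<zeta> x + U x)) / 2)"
        by (simp add: cos_add cos_diff algebra_simps fun_eq_iff)
      then show "expectation (\<lambda>x. (W x * sin (U x)) * sin (u * \<zeta> x)) = 0"
        using key[OF U, of u] key[OF U, of "-u"] ci[of u] ci[of "-u"] by simp
    qed (auto intro!: integrable_mult_bounded ci0 simp: indicator_def)
  qed
  then show ?thesis
    unfolding trig_orth_def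
    by (auto intro!: integrable_mult_bounded WI simp: mult_ac indicator_def)
qed

text \<open>Intersections of preimages are reached by repeated use of
  \<open>trig_orth_indicator\<close>. The sets against which \<open>W\<close> integrates to 0 are
  closed under complements and disjoint unions, so Dynkin's argument extends this to the whole
  sigma-algebra.\<close>

lemma trig_orth_sigma:
  assumes S: "S \<subseteq> borel_measurable M" and W: "trig_orth S W"
    and A: "A \<in> sigma_sets (space M) {\<zeta> -` B \<inter> space M | \<zeta> B. \<zeta> \<in> S \<and> B \<in> sets borel}"
  shows "expectation (\<lambda>x. W x * indicator A x) = 0"
proof -
  let ?P = "preimage_inters (space M) S"
  have WI: "integrable M W" using W by (simp add: trig_orth_def)
  note [measurable] = borel_measurable_integrable[OF WI]
  have P_sub: "?P \<subseteq> sets M"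
  proof
    fix A assume "A \<in> ?P" then show "A \<in> sets M"
      by induction (use S in \<open>auto intro!: sets.Int measurable_sets\<close>)
  qed
  have P_orth: "trig_orth S (\<lambda>x. W x * indicator A x)" if "A \<in> ?P" for A
    using that
  proof induction
    case whole
    have "expectation (\<lambda>x. W x * indicator (space M) x * f x) = expectation (\<lambda>x. W x * f x)" for f
      by (intro Bochner_Integration.integral_cong) auto
    then show ?case using W WI by (auto simp: trig_orth_def intro!: integrable_mult_bounded simp: indicator_def)
  next
    case (inter A \<zeta> B)
    have "integrable M (\<lambda>x. W x * indicator (A \<inter> (\<zeta> -` B \<inter> space M)) x)"
      using inter S P_sub by (intro integrable_mult_bounded WI borel_measurable_indicator) (auto intro!: sets.Int measurable_sets simp: indicator_def)
    moreover have "expectation (\<lambda>x. W x * indicator (A \<inter> (\<zeta> -` B \<inter> space M)) x * f x)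
        = expectation (\<lambda>x. W x * indicator A x * indicator B (\<zeta> x) * f x)" for f
      by (intro Bochner_Integration.integral_cong) (auto simp: indicator_def)
    ultimately show ?case
      using trig_orth_indicator[OF S inter.IH inter.hyps(2,3)] by (simp add: trig_orth_def)
  qed
  have PP: "?P \<subseteq> Pow (space M)" using P_sub sets.space_closed by blast
  have "sigma_sets (space M) {\<zeta> -` B \<inter> space M | \<zeta> B. \<zeta> \<in> S \<and> B \<in> sets borel} \<subseteq> sigma_sets (space M) ?P"
  proof (intro sigma_sets_mono, safe)
    fix \<zeta> B assume "\<zeta> \<in> S" "B \<in> sets (borel :: real measure)"
    from preimage_inters.inter[OF preimage_inters.whole this, of "space M"]
    moreover have "space M \<inter> (\<zeta> -` B \<inter> space M) = \<zeta> -` B \<inter> space M" by blast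
    ultimately show "\<zeta> -` B \<inter> space M \<in> sigma_sets (space M) ?P" by (simp add: sigma_sets.Basic)
  qed
  then have AP: "A \<in> sigma_sets (space M) ?P" using A by blast
  have "Int_stable ?P" by (auto simp: Int_stable_def intro: preimage_inters_Int)
  from this PP AP show ?thesis
  proof (induction rule: sigma_sets_induct_disjoint)
    case (basic A)
    then show ?case using P_orth[OF basic] lin.zero[of S] by (auto simp: trig_orth_def dest!: bspec)
  next
    case (compl A)
    have "A \<in> sets M" using compl(1) P_sub sets.sigma_sets_subset by blast
    have "expectation (\<lambda>x. W x * indicator (space M - A) x) = expectation (\<lambda>x. W x - W x * indicator A x)"
      by (intro Bochner_Integration.integral_cong) (auto simp: indicator_def)
    also have "\<dots> = expectation W - expectation (\<lambda>x. W x * indicator A x)"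
      using WI \<open>A \<in> sets M\<close> by (intro Bochner_Integration.integral_diff integrable_mult_bounded) (auto simp: indicator_def)
    also have "expectation W = 0" using W lin.zero[of S] by (auto simp: trig_orth_def dest!: bspec)
    finally show ?case using compl by simp
  next
    case (union A)
    have [measurable]: "A i \<in> sets M" for i using union(2) P_sub sets.sigma_sets_subset[of ?P M] by blast
    have "(LINT x:(\<Union>i. A i)|M. W x) = (\<Sum>i. (LINT x:(A i)|M. W x))"
    proof (rule lebesgue_integral_countable_add)
      show "A i \<inter> A j = {}" if "i \<noteq> j" for i j
        using union(1) that by (auto simp: disjoint_family_on_def)
      show "set_integrable M (\<Union>i. A i) W"
        unfolding set_integrable_def by (rule integrable_mult_indicator[OF _ WI]) simp
    qed simp
    then show ?case using union(3) by (simp add: set_lebesgue_integral_def mult.commute)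
  qed simp
qed

text \<open>Real and imaginary part of the normal characteristic function at argument 1, with the
  mean and variance of \<open>Y\<close>. Argument 1 suffices because the property is used on linear
  spaces. Unlike a density, this form includes constants and passes to limits.\<close>

definition gaussian_chf :: "('a \<Rightarrow> real) \<Rightarrow> bool" where
  "gaussian_chf Y \<longleftrightarrow>
     expectation (\<lambda>w. cos (Y w)) = exp (- (ip Y Y - (expectation Y)\<^sup>2) / 2) * cos (expectation Y) \<and>
     expectation (\<lambda>w. sin (Y w)) = exp (- (ip Y Y - (expectation Y)\<^sup>2) / 2) * sin (expectation Y)"

lemma gaussian_rv_L2_chf:
  assumes "gaussian_rv M Y"
  shows "Y \<in> L2 \<and> gaussian_chf Y"
proof -
  have [measurable]: "Y \<in> borel_measurable M" using assms by (simp add: gaussian_rv_def)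
  from assms obtain \<mu> where "(AE w in M. Y w = \<mu>) \<or>
      (\<exists>\<sigma>>0. distributed M lborel Y (\<lambda>x. ennreal (normal_density \<mu> \<sigma> x)))"
    unfolding gaussian_rv_def by blast
  then show ?thesis
  proof
    assume AE: "AE w in M. Y w = \<mu>"
    have E: "expectation (\<lambda>w. f (Y w)) = f \<mu>" if [measurable]: "f \<in> borel_measurable borel" for f :: "real \<Rightarrow> real"
    proof -
      have "expectation (\<lambda>w. f (Y w)) = expectation (\<lambda>w. f \<mu>)"
        by (intro integral_cong_AE) (use AE in auto)
      then show ?thesis by (simp add: prob_space)
    qed
    have "Y \<in> L2" by (rule L2_AE_cong[OF L2_const[of \<mu>]]) (use AE in auto)
    moreover have "ip Y Y = \<mu>\<^sup>2" using E[of "\<lambda>x. x * x"] by (simp add: ip_def power2_eq_square)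
    moreover have "expectation Y = \<mu>" using E[of "\<lambda>x. x"] by simp
    moreover have "expectation (\<lambda>w. cos (Y w)) = cos \<mu>" "expectation (\<lambda>w. sin (Y w)) = sin \<mu>"
      by (rule E, simp)+
    ultimately show ?thesis by (simp add: gaussian_chf_def)
  next
    assume "\<exists>\<sigma>>0. distributed M lborel Y (\<lambda>x. ennreal (normal_density \<mu> \<sigma> x))"
    then obtain \<sigma> where \<sigma>: "\<sigma> > 0" and D: "distributed M lborel Y (normal_density \<mu> \<sigma>)" by auto
    have Emu: "expectation Y = \<mu>" using normal_distributed_expectation[OF \<sigma> D] .
    have Var: "variance Y = \<sigma>\<^sup>2" using normal_distributed_variance[OF \<sigma> D] .
    define Z where "Z w = (Y w - \<mu>) / \<sigma>" for w
    have Zm [measurable]: "Z \<in> borel_measurable M" unfolding Z_def by measurable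
    have DZ: "distributed M lborel Z std_normal_density"
      using normal_standard_normal_convert[OF \<sigma>, of Y \<mu>] D unfolding Z_def by simp
    have YZ: "Y w = \<mu> + \<sigma> * Z w" for w using \<sigma> by (simp add: Z_def)
    have "integrable lborel (\<lambda>x. std_normal_density x * x ^ 2)"
      using integrable_std_normal_moment[of 2] .
    then have "integrable M (\<lambda>w. (Z w)\<^sup>2)"
      by (subst distributed_integrable[OF DZ, symmetric]) auto
    then have ZL: "Z \<in> L2" by (simp add: L2_def)
    then have YL: "Y \<in> L2" unfolding YZ[abs_def] by auto
    have "variance Y = ip Y Y - \<mu>\<^sup>2"
    proof -
      have "variance Y = ip (\<lambda>w. Y w - \<mu>) (\<lambda>w. Y w - \<mu>)"
        unfolding Emu ip_def by (simp add: power2_eq_square)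
      also have "\<dots> = ip Y Y - \<mu>\<^sup>2"
        using YL L2_integrable[OF YL] by (simp add: ip_bilinear ip_const Emu prob_space power2_eq_square)
      finally show ?thesis .
    qed
    then have V: "ip Y Y - (expectation Y)\<^sup>2 = \<sigma>\<^sup>2" using Var Emu by simp
    have ib: "integrable lborel (\<lambda>x. std_normal_density x *\<^sub>R iexp (\<sigma> * x))"
      by (rule Bochner_Integration.integrable_bound[OF integrable_normal_density[of 1 0]])
        (auto simp: norm_exp_eq_Re)
    have chf: "(CLINT x|lborel. std_normal_density x *\<^sub>R iexp (\<sigma> * x)) = exp (- (\<sigma>\<^sup>2) / 2)"
      using char_std_normal_distribution unfolding char_def
      by (subst (asm) integral_density) (auto dest: fun_cong)
    have cosZ: "expectation (\<lambda>w. cos (\<sigma> * Z w)) = exp (- (\<sigma>\<^sup>2) / 2)"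
    proof -
      have "expectation (\<lambda>w. cos (\<sigma> * Z w)) = (LINT x|lborel. std_normal_density x * cos (\<sigma> * x))"
        by (rule distributed_integral[OF DZ, symmetric]) auto
      also have "\<dots> = Re (CLINT x|lborel. std_normal_density x *\<^sub>R iexp (\<sigma> * x))"
        unfolding integral_Re[OF ib, symmetric] by (simp add: Re_exp)
      finally show ?thesis unfolding chf by (simp add: Re_exp)
    qed
    have sinZ: "expectation (\<lambda>w. sin (\<sigma> * Z w)) = 0"
    proof -
      have "expectation (\<lambda>w. sin (\<sigma> * Z w)) = (LINT x|lborel. std_normal_density x * sin (\<sigma> * x))"
        by (rule distributed_integral[OF DZ, symmetric]) auto
      also have "\<dots> = Im (CLINT x|lborel. std_normal_density x *\<^sub>R iexp (\<sigma> * x))"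
        unfolding integral_Im[OF ib, symmetric] by (simp add: Im_exp)
      finally show ?thesis unfolding chf by (simp add: Im_exp)
    qed
    have cs: "integrable M (\<lambda>w. cos (\<sigma> * Z w))" "integrable M (\<lambda>w. sin (\<sigma> * Z w))"
      by (intro integrable_const_bound[of _ 1]; simp)+
    have "expectation (\<lambda>w. cos (Y w)) = exp (- (\<sigma>\<^sup>2) / 2) * cos \<mu>"
      "expectation (\<lambda>w. sin (Y w)) = exp (- (\<sigma>\<^sup>2) / 2) * sin \<mu>"
      unfolding YZ cos_add sin_add using cs cosZ sinZ by simp_all
    then have "gaussian_chf Y"
      unfolding gaussian_chf_def V unfolding Emu by simp
    with YL show ?thesis by blast
  qed
qed

text \<open>All terms of the identity are continuous in mean square: the left sides because sine and
  cosine are Lipschitz, the right sides because mean and second moment converge.\<close>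

lemma gaussian_chf_cspan:
  assumes G: "G \<subseteq> L2" and lin: "\<And>V. V \<in> lin G \<Longrightarrow> gaussian_chf V" and Y: "Y \<in> cspan G"
  shows "gaussian_chf Y"
proof -
  have YL [measurable, simp]: "Y \<in> L2" using cspan_L2[OF Y] .
  have "\<exists>V\<in>lin G. nrm (\<lambda>w. Y w - V w) < 1 / Suc n" for n
    using Y unfolding cspan_def by auto
  then obtain V where V: "\<And>n. V n \<in> lin G" "\<And>n. nrm (\<lambda>w. Y w - V n w) < 1 / Suc n" by metis
  have VL [measurable, simp]: "V n \<in> L2" for n using lin_L2[OF G V(1)] .
  have lim0: "(\<lambda>n. nrm (\<lambda>w. V n w - Y w)) \<longlonglongrightarrow> 0"
    using V(2) nrm_commute[of Y] by (intro Lim_null_comparison[OF always_eventually LIMSEQ_inverse_real_of_nat])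
      (auto simp: less_imp_le inverse_eq_divide)
  \<comment> \<open>The third condition on \<open>f\<close> is there for integrability alone. It
    also admits the identity, which gives the convergence of the means.\<close>
  have lip: "(\<lambda>n. expectation (\<lambda>w. f (V n w))) \<longlonglongrightarrow> expectation (\<lambda>w. f (Y w))"
    if f: "\<And>x y. \<bar>f x - f y\<bar> \<le> \<bar>x - y\<bar>" "f \<in> borel_measurable borel" "\<And>x. \<bar>f x\<bar> \<le> \<bar>x\<bar> + 1" for f :: "real \<Rightarrow> real"
  proof -
    note [measurable] = f(2)
    have i: "integrable M (\<lambda>w. f (U w))" if U: "U \<in> L2" for U
    proof (rule Bochner_Integration.integrable_bound)
      show "integrable M (\<lambda>w. \<bar>U w\<bar> + 1)" using L2_integrable[OF U] by auto
      show "(\<lambda>w. f (U w)) \<in> borel_measurable M" using L2_measurable[OF U] by measurable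
    qed (use f(3) in auto)
    have "\<bar>expectation (\<lambda>w. f (V n w)) - expectation (\<lambda>w. f (Y w))\<bar> \<le> nrm (\<lambda>w. V n w - Y w)" for n
    proof -
      have "\<bar>expectation (\<lambda>w. f (V n w)) - expectation (\<lambda>w. f (Y w))\<bar> = \<bar>expectation (\<lambda>w. f (V n w) - f (Y w))\<bar>"
        by (simp add: i)
      also have "\<dots> \<le> expectation (\<lambda>w. \<bar>f (V n w) - f (Y w)\<bar>)" by (rule integral_abs_bound)
      also have "\<dots> \<le> expectation (\<lambda>w. \<bar>V n w - Y w\<bar>)"
        by (intro integral_mono integrable_abs Bochner_Integration.integrable_diff i L2_integrable VL YL f(1))
      also have "\<dots> \<le> nrm (\<lambda>w. V n w - Y w)" by (rule expectation_abs_le_nrm) simp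
      finally show ?thesis .
    qed
    then have "(\<lambda>n. expectation (\<lambda>w. f (V n w)) - expectation (\<lambda>w. f (Y w))) \<longlonglongrightarrow> 0"
      by (intro Lim_null_comparison[OF always_eventually lim0]) auto
    then show ?thesis by (rule LIM_zero_cancel)
  qed
  have cosl: "\<bar>cos x - cos y\<bar> \<le> \<bar>x - y\<bar>" and sinl: "\<bar>sin x - sin y\<bar> \<le> \<bar>x - y\<bar>" for x y :: real
  proof -
    have s: "\<bar>sin z\<bar> \<le> \<bar>z\<bar>" for z :: real by (rule abs_sin_x_le_abs_x)
    have "\<bar>cos x - cos y\<bar> = 2 * \<bar>sin ((x + y) / 2)\<bar> * \<bar>sin ((y - x) / 2)\<bar>"
      by (simp add: cos_diff_cos abs_mult)
    also have "\<dots> \<le> 2 * 1 * \<bar>(y - x) / 2\<bar>" by (intro mult_mono s) auto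
    finally show "\<bar>cos x - cos y\<bar> \<le> \<bar>x - y\<bar>" by (simp add: abs_minus_commute)
    have "\<bar>sin x - sin y\<bar> = 2 * \<bar>sin ((x - y) / 2)\<bar> * \<bar>cos ((x + y) / 2)\<bar>"
      by (simp add: sin_diff_sin abs_mult)
    also have "\<dots> \<le> 2 * \<bar>(x - y) / 2\<bar> * 1" by (intro mult_mono s) auto
    finally show "\<bar>sin x - sin y\<bar> \<le> \<bar>x - y\<bar>" by simp
  qed
  have E: "(\<lambda>n. expectation (V n)) \<longlonglongrightarrow> expectation Y"
    using lip[of "\<lambda>x. x"] by simp
  have I: "(\<lambda>n. ip (V n) (V n)) \<longlonglongrightarrow> ip Y Y" by (intro ip_tendsto lim0) auto
  have C: "(\<lambda>n. expectation (\<lambda>w. cos (V n w))) \<longlonglongrightarrow> expectation (\<lambda>w. cos (Y w))"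
    by (rule lip[OF cosl]) (auto intro: order_trans[OF abs_cos_le_one])
  have S: "(\<lambda>n. expectation (\<lambda>w. sin (V n w))) \<longlonglongrightarrow> expectation (\<lambda>w. sin (Y w))"
    by (rule lip[OF sinl]) (auto intro: order_trans[OF abs_sin_le_one])
  have C': "(\<lambda>n. expectation (\<lambda>w. cos (V n w))) \<longlonglongrightarrow> exp (- (ip Y Y - (expectation Y)\<^sup>2) / 2) * cos (expectation Y)"
    using lin[OF V(1), unfolded gaussian_chf_def]
    by (simp only:) (intro tendsto_intros E I; simp)
  have S': "(\<lambda>n. expectation (\<lambda>w. sin (V n w))) \<longlonglongrightarrow> exp (- (ip Y Y - (expectation Y)\<^sup>2) / 2) * sin (expectation Y)"
    using lin[OF V(1), unfolded gaussian_chf_def]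
    by (simp only:) (intro tendsto_intros E I; simp)
  show ?thesis
    unfolding gaussian_chf_def using LIMSEQ_unique[OF C C'] LIMSEQ_unique[OF S S'] by simp
qed

text \<open>For a centred \<open>D\<close> orthogonal to \<open>S\<close> the variance of
  \<open>u D + U\<close> splits, so the joint characteristic function factorizes: uncorrelated
  Gaussian variables are independent. Hence every \<open>g(D)\<close> minus its mean is orthogonal
  to functions of \<open>S\<close>; the identity and the square are what conditional means and
  covariances need.\<close>

lemma gaussian_orth_imp_trig_orth:
  assumes G: "G \<subseteq> L2" and chf: "\<And>V. V \<in> cspan G \<Longrightarrow> gaussian_chf V"
    and S: "S \<subseteq> cspan G" and D: "D \<in> cspan G" and ED: "expectation D = 0"
    and orth: "\<And>V. V \<in> S \<Longrightarrow> ip D V = 0"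
  shows "trig_orth S D" "trig_orth S (\<lambda>w. D w * D w - ip D D)"
proof -
  have DL [simp, measurable]: "D \<in> L2" using cspan_L2[OF D] .
  have SL: "S \<subseteq> L2" using S cspan_L2 by blast
  have key: "expectation (\<lambda>w. cos (u * D w + U w)) = exp (- (u\<^sup>2 * ip D D) / 2) * expectation (\<lambda>w. cos (U w)) \<and>
      expectation (\<lambda>w. sin (u * D w + U w)) = exp (- (u\<^sup>2 * ip D D) / 2) * expectation (\<lambda>w. sin (U w))"
    if U: "U \<in> lin S" for u U
  proof -
    have UL [simp]: "U \<in> L2" using lin_L2[OF SL U] .
    have UG: "U \<in> cspan G" using lin_cspan[OF SL U] cspan_idem[OF G S] by blast
    have "gaussian_chf U" "gaussian_chf (\<lambda>w. u * D w + U w)"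
      using chf UG cspan_add[OF G cspan_scale[OF G D] UG] by auto
    moreover have "ip D U = 0" by (rule cspan_orth[OF SL DL orth lin_cspan[OF SL U]])
    then have "ip (\<lambda>w. u * D w + U w) (\<lambda>w. u * D w + U w) = u\<^sup>2 * ip D D + ip U U"
      by (simp add: ip_bilinear ip_commute[of U D] power2_eq_square)
    moreover have "expectation (\<lambda>w. u * D w + U w) = expectation U"
      using ED L2_integrable[OF DL] L2_integrable[OF UL] by simp
    ultimately show ?thesis
      unfolding gaussian_chf_def by (simp add: exp_add[symmetric] field_simps)
  qed
  have key0: "expectation (\<lambda>w. cos (u * D w)) = exp (- (u\<^sup>2 * ip D D) / 2)"
    "expectation (\<lambda>w. sin (u * D w)) = 0" for u
    using key[OF lin.zero, of u] by (simp_all add: prob_space)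
  \<comment> \<open>\<open>fourier_zero\<close> with the roles exchanged: the centred trigonometric
    function of \<open>U\<close> is the weight, and \<open>D\<close> is the variable tested against
    all Borel functions.\<close>
  have fac: "expectation (\<lambda>w. (f (U w) - expectation (\<lambda>w. f (U w))) * g (D w)) = 0"
    if U: "U \<in> lin S" and f: "f = cos \<or> f = sin" and g [measurable]: "g \<in> borel_measurable borel"
      and gi: "integrable M (\<lambda>w. g (D w))" for U f g
  proof -
    have UL [simp, measurable]: "U \<in> L2" using lin_L2[OF SL U] .
    have [measurable]: "U \<in> borel_measurable M" "D \<in> borel_measurable M" using UL DL L2_measurable by blast+
    have fm [measurable]: "f \<in> borel_measurable borel" using f by auto
    have f1: "\<bar>f x\<bar> \<le> 1" for x using f by auto
    have bi: "integrable M (\<lambda>w. h (X w))" if "h = cos \<or> h = sin" "X \<in> borel_measurable M" for h :: "real \<Rightarrow> real" and X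
      using that by (intro integrable_const_bound[of _ 1]) auto
    have bim: "integrable M (\<lambda>w. h (X w) * k (Z w))" if "h = cos \<or> h = sin" "X \<in> borel_measurable M" "k = cos \<or> k = sin" "Z \<in> borel_measurable M" for h k :: "real \<Rightarrow> real" and X Z
      using that by (intro integrable_mult_bounded bi) auto
    show ?thesis
    proof (rule fourier_zero[of "\<lambda>w. f (U w) - expectation (\<lambda>w. f (U w))" D g])
      show "integrable M (\<lambda>w. f (U w) - expectation (\<lambda>w. f (U w)))"
        using bi[OF f] by simp
      have "integrable M (\<lambda>w. g (D w) * f (U w))"
        by (intro integrable_mult_bounded gi f1) measurable
      then show "integrable M (\<lambda>w. (f (U w) - expectation (\<lambda>w. f (U w))) * g (D w))"
        using gi by (simp add: algebra_simps)
      fix u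
      have exps: "expectation (\<lambda>w. cos (U w) * cos (u * D w)) = exp (- (u\<^sup>2 * ip D D) / 2) * expectation (\<lambda>w. cos (U w))"
        "expectation (\<lambda>w. sin (U w) * cos (u * D w)) = exp (- (u\<^sup>2 * ip D D) / 2) * expectation (\<lambda>w. sin (U w))"
        "expectation (\<lambda>w. cos (U w) * sin (u * D w)) = 0"
        "expectation (\<lambda>w. sin (U w) * sin (u * D w)) = 0"
      proof -
        have i: "integrable M (\<lambda>w. cos (v * D w + U w))" "integrable M (\<lambda>w. sin (v * D w + U w))" for v
          by (intro bi; simp)+
        have "(\<lambda>w. cos (U w) * cos (u * D w)) = (\<lambda>w. (cos (u * D w + U w) + cos ((-u) * D w + U w)) / 2)"
          "(\<lambda>w. sin (U w) * cos (u * D w)) = (\<lambda>w. (sin (u * D w + U w) + sin ((-u) * D w + U w)) / 2)"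
          "(\<lambda>w. cos (U w) * sin (u * D w)) = (\<lambda>w. (sin (u * D w + U w) - sin ((-u) * D w + U w)) / 2)"
          "(\<lambda>w. sin (U w) * sin (u * D w)) = (\<lambda>w. (cos ((-u) * D w + U w) - cos (u * D w + U w)) / 2)"
          by (simp_all add: sin_add sin_diff cos_add cos_diff algebra_simps fun_eq_iff)
        note eq = this
        show "expectation (\<lambda>w. cos (U w) * cos (u * D w)) = exp (- (u\<^sup>2 * ip D D) / 2) * expectation (\<lambda>w. cos (U w))"
          unfolding eq using i[of u] i[of "-u"] key[OF U, of u] key[OF U, of "-u"] by simp
        show "expectation (\<lambda>w. sin (U w) * cos (u * D w)) = exp (- (u\<^sup>2 * ip D D) / 2) * expectation (\<lambda>w. sin (U w))"
          unfolding eq using i[of u] i[of "-u"] key[OF U, of u] key[OF U, of "-u"] by simp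
        show "expectation (\<lambda>w. cos (U w) * sin (u * D w)) = 0"
          unfolding eq using i[of u] i[of "-u"] key[OF U, of u] key[OF U, of "-u"] by simp
        show "expectation (\<lambda>w. sin (U w) * sin (u * D w)) = 0"
          unfolding eq using i[of u] i[of "-u"] key[OF U, of u] key[OF U, of "-u"] by simp
      qed
      show "expectation (\<lambda>w. (f (U w) - expectation (\<lambda>w. f (U w))) * cos (u * D w)) = 0"
        using f exps key0[of u] bim[of f U cos "\<lambda>w. u * D w"] bi[of cos "\<lambda>w. u * D w"]
        by (auto simp: left_diff_distrib)
      show "expectation (\<lambda>w. (f (U w) - expectation (\<lambda>w. f (U w))) * sin (u * D w)) = 0"
        using f exps key0[of u] bim[of f U sin "\<lambda>w. u * D w"] bi[of sin "\<lambda>w. u * D w"]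
        by (auto simp: left_diff_distrib)
    qed (use L2_measurable[OF DL] g in auto)
  qed
  have orth_fun: "trig_orth S (\<lambda>w. g (D w) - c)"
    if g [measurable]: "g \<in> borel_measurable borel" and gi: "integrable M (\<lambda>w. g (D w))"
      and c: "expectation (\<lambda>w. g (D w)) = c" for g c
    unfolding trig_orth_def
  proof (intro conjI ballI)
    show "integrable M (\<lambda>w. g (D w) - c)" using gi by simp
    fix U assume U: "U \<in> lin S"
    have [measurable]: "U \<in> borel_measurable M" using lin_L2[OF SL U] L2_measurable by blast
    have main: "expectation (\<lambda>w. (g (D w) - c) * f (U w)) = 0" if f: "f = cos \<or> f = sin" for f :: "real \<Rightarrow> real"
    proof -
      have [measurable]: "f \<in> borel_measurable borel" using f by auto
      have f1: "\<bar>f x\<bar> \<le> 1" for x using f by auto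
      have fi: "integrable M (\<lambda>w. f (U w))"
        using f1 by (intro integrable_const_bound[of _ 1]) auto
      have gfi: "integrable M (\<lambda>w. g (D w) * f (U w))"
        by (intro integrable_mult_bounded gi f1) measurable
      have "expectation (\<lambda>w. g (D w) * f (U w)) - expectation (\<lambda>w. f (U w)) * expectation (\<lambda>w. g (D w)) = 0"
        using fac[OF U f g gi] gi gfi by (simp add: algebra_simps)
      then show ?thesis using c fi gfi by (simp add: left_diff_distrib)
    qed
    show "expectation (\<lambda>w. (g (D w) - c) * cos (U w)) = 0" "expectation (\<lambda>w. (g (D w) - c) * sin (U w)) = 0"
      using main by blast+
  qed
  show "trig_orth S D"
    using orth_fun[of "\<lambda>x. x" 0] ED L2_integrable[OF DL] by simp
  show "trig_orth S (\<lambda>w. D w * D w - ip D D)"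
    using orth_fun[of "\<lambda>x. x * x" "ip D D"] L2_integrable_mult[OF DL DL] by (simp add: ip_def)
qed

definition generated_by :: "'a measure \<Rightarrow> ('a \<Rightarrow> real) set \<Rightarrow> bool" where
  "generated_by F S \<longleftrightarrow> space F = space M \<and>
     sets F = sigma_sets (space M) {\<zeta> -` B \<inter> space M | \<zeta> B. \<zeta> \<in> S \<and> B \<in> sets borel}"

lemma generated_by_measurable:
  assumes "generated_by F S" shows "S \<subseteq> borel_measurable F"
proof
  fix \<zeta> assume "\<zeta> \<in> S"
  then show "\<zeta> \<in> borel_measurable F"
    using assms unfolding generated_by_def by (intro measurableI) (auto intro!: sigma_sets.Basic)
qed

lemma generated_by_subalgebra:
  assumes "generated_by F S" "S \<subseteq> borel_measurable M" shows "subalgebra M F"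
proof -
  have "sets F \<subseteq> sets M"
    using assms unfolding generated_by_def by (auto intro!: sets.sigma_sets_subset)
  then show ?thesis using assms by (simp add: subalgebra_def generated_by_def)
qed

lemma trig_orth_cond_exp:
  assumes F: "generated_by F S" and S: "S \<subseteq> borel_measurable M" and W: "trig_orth S W"
  shows "AE w in M. real_cond_exp M F W w = 0"
proof -
  interpret finite_measure_subalgebra M F
    by unfold_locales (rule generated_by_subalgebra[OF F S])
  show ?thesis
  proof (rule real_cond_exp_charact)
    fix A assume "A \<in> sets F"
    then have "expectation (\<lambda>w. W w * indicator A w) = 0"
      using F by (intro trig_orth_sigma[OF S W]) (simp add: generated_by_def)
    then show "(LINT x:A|M. W x) = (LINT x:A|M. 0)"
      by (simp add: set_lebesgue_integral_def mult.commute)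
  qed (use W in \<open>auto simp: trig_orth_def\<close>)
qed

lemma gaussian_cond_exp_orth:
  assumes G: "G \<subseteq> L2" and chf: "\<And>V. V \<in> cspan G \<Longrightarrow> gaussian_chf V"
    and F: "generated_by F S" and S: "S \<subseteq> cspan G"
    and D: "D \<in> cspan G" and ED: "expectation D = 0" and D_orth: "\<And>V. V \<in> S \<Longrightarrow> ip D V = 0"
  shows "AE w in M. real_cond_exp M F D w = 0"
    and "AE w in M. real_cond_exp M F (\<lambda>w. D w * D w) w = ip D D"
proof -
  have SM: "S \<subseteq> borel_measurable M" using S cspan_L2 L2_measurable by blast
  interpret finite_measure_subalgebra M F
    by unfold_locales (rule generated_by_subalgebra[OF F SM])
  note orth = gaussian_orth_imp_trig_orth[OF G chf S D ED D_orth]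
  show "AE w in M. real_cond_exp M F D w = 0" by (rule trig_orth_cond_exp[OF F SM orth(1)])
  have i: "integrable M (\<lambda>w. D w * D w)" using cspan_L2[OF D] L2_integrable_mult by blast
  have "AE w in M. real_cond_exp M F (\<lambda>w. D w * D w - ip D D) w = 0"
    by (rule trig_orth_cond_exp[OF F SM orth(2)])
  moreover have "AE w in M. real_cond_exp M F (\<lambda>w. D w * D w - ip D D) w
      = real_cond_exp M F (\<lambda>w. D w * D w) w - real_cond_exp M F (\<lambda>w. ip D D) w"
    by (rule real_cond_exp_diff[OF i]) simp
  moreover have "AE w in M. real_cond_exp M F (\<lambda>w. ip D D) w = ip D D"
    by (rule real_cond_exp_F_meas) auto
  ultimately show "AE w in M. real_cond_exp M F (\<lambda>w. D w * D w) w = ip D D"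
    by eventually_elim simp
qed

text \<open>Polarization of the result for squares, applied to \<open>D + E\<close> and
  \<open>D - E\<close>, which are again centred and orthogonal to \<open>S\<close>.\<close>

lemma gaussian_cond_exp_prod:
  assumes G: "G \<subseteq> L2" and chf: "\<And>V. V \<in> cspan G \<Longrightarrow> gaussian_chf V"
    and F: "generated_by F S" and S: "S \<subseteq> cspan G"
    and D: "D \<in> cspan G" and ED: "expectation D = 0" and D_orth: "\<And>V. V \<in> S \<Longrightarrow> ip D V = 0"
    and E: "E \<in> cspan G" and EE: "expectation E = 0" and E_orth: "\<And>V. V \<in> S \<Longrightarrow> ip E V = 0"
  shows "AE w in M. real_cond_exp M F (\<lambda>w. D w * E w) w = ip D E"
proof -
  have SM: "S \<subseteq> borel_measurable M" using S cspan_L2 L2_measurable by blast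
  interpret finite_measure_subalgebra M F
    by unfold_locales (rule generated_by_subalgebra[OF F SM])
  note DL [simp] = cspan_L2[OF D] and EL [simp] = cspan_L2[OF E]
  have SL: "V \<in> L2" if "V \<in> S" for V using S cspan_L2 that by blast
  define P Q where "P w = D w + E w" and "Q w = D w - E w" for w
  have PG: "P \<in> cspan G" and QG: "Q \<in> cspan G"
    unfolding P_def[abs_def] Q_def[abs_def] using D E G by (auto intro: cspan_add cspan_diff)
  have P: "AE w in M. real_cond_exp M F (\<lambda>w. P w * P w) w = ip P P"
    using L2_integrable[OF DL] L2_integrable[OF EL] ED EE D_orth E_orth SL
    by (intro gaussian_cond_exp_orth(2)[OF G chf F S PG]) (auto simp: P_def[abs_def] ip_bilinear)
  have Q: "AE w in M. real_cond_exp M F (\<lambda>w. Q w * Q w) w = ip Q Q"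
    using L2_integrable[OF DL] L2_integrable[OF EL] ED EE D_orth E_orth SL
    by (intro gaussian_cond_exp_orth(2)[OF G chf F S QG]) (auto simp: Q_def[abs_def] ip_bilinear)
  note PL = cspan_L2[OF PG] and QL = cspan_L2[OF QG]
  have DE: "(\<lambda>w. D w * E w) = (\<lambda>w. (1/4) * (P w * P w - Q w * Q w))"
    by (simp add: P_def Q_def fun_eq_iff algebra_simps)
  have ipDE: "ip D E = (1/4) * (ip P P - ip Q Q)"
    unfolding P_def[abs_def] Q_def[abs_def] by (simp add: ip_bilinear ip_commute[of E D])
  have "AE w in M. real_cond_exp M F (\<lambda>w. (1/4) * (P w * P w - Q w * Q w)) w
      = (1/4) * real_cond_exp M F (\<lambda>w. P w * P w - Q w * Q w) w"
    by (rule real_cond_exp_cmult) (intro Bochner_Integration.integrable_diff L2_integrable_mult PL QL)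
  moreover have "AE w in M. real_cond_exp M F (\<lambda>w. P w * P w - Q w * Q w) w
      = real_cond_exp M F (\<lambda>w. P w * P w) w - real_cond_exp M F (\<lambda>w. Q w * Q w) w"
    by (rule real_cond_exp_diff) (intro L2_integrable_mult PL QL)+
  ultimately show ?thesis using P Q unfolding DE ipDE by eventually_elim simp
qed

text \<open>The residual of the projection is centred because the constant belongs to the span, and
  orthogonal to \<open>S\<close>. Its conditional expectation therefore vanishes, while the
  projection, being \<open>F\<close>-measurable, is its own. So \<open>real_cond_exp\<close> and the
  projection agree almost everywhere.\<close>

lemma gaussian_cond_exp_projection:
  assumes G: "G \<subseteq> L2" and chf: "\<And>V. V \<in> cspan G \<Longrightarrow> gaussian_chf V" and one: "(\<lambda>w. 1) \<in> cspan G"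
    and F: "generated_by F S" and S: "S \<subseteq> cspan G" and Y: "Y \<in> cspan G"
  shows "real_cond_exp M F Y \<in> cspan (insert (\<lambda>w. 1) S)"
    and "V \<in> cspan (insert (\<lambda>w. 1) S) \<Longrightarrow> ip (\<lambda>w. Y w - real_cond_exp M F Y w) V = 0"
proof -
  let ?S = "insert (\<lambda>w. 1) S"
  have SL: "?S \<subseteq> L2" using S cspan_L2 by blast
  have SM: "S \<subseteq> borel_measurable M" using SL L2_measurable by blast
  have sub: "subalgebra M F" by (rule generated_by_subalgebra[OF F SM])
  interpret finite_measure_subalgebra M F by unfold_locales (rule sub)
  note YL [simp] = cspan_L2[OF Y]
  obtain P where P: "P \<in> cspan ?S" "P \<in> borel_measurable F" "\<And>V. V \<in> ?S \<Longrightarrow> ip (\<lambda>w. Y w - P w) V = 0"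
    using L2_projection[OF SL _ sub YL] generated_by_measurable[OF F] by (metis borel_measurable_const insert_subset)
  note PL [simp] = cspan_L2[OF P(1)]
  have PG: "P \<in> cspan G" using cspan_idem[OF G, of ?S] one S P(1) by blast
  have D0: "AE w in M. real_cond_exp M F (\<lambda>w. Y w - P w) w = 0"
  proof (rule gaussian_cond_exp_orth(1)[OF G chf F S cspan_diff[OF G Y PG]])
    show "expectation (\<lambda>w. Y w - P w) = 0"
      using P(3)[of "\<lambda>_. 1"] by (simp add: ip_const)
  qed (use P(3) in auto)
  moreover have "AE w in M. real_cond_exp M F (\<lambda>w. Y w - P w) w = real_cond_exp M F Y w - real_cond_exp M F P w"
    by (rule real_cond_exp_diff) (auto intro: L2_integrable)
  moreover have "AE w in M. real_cond_exp M F P w = P w"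
    by (rule real_cond_exp_F_meas) (auto intro: L2_integrable P)
  ultimately have eq: "AE w in M. real_cond_exp M F Y w = P w" by eventually_elim simp
  have [measurable]: "real_cond_exp M F Y \<in> borel_measurable M"
    by (rule measurable_from_subalg[OF sub]) simp
  have CL: "real_cond_exp M F Y \<in> L2" by (rule L2_AE_cong[OF PL eq]) simp
  show "real_cond_exp M F Y \<in> cspan ?S"
  proof (rule cspan_closed[OF SL CL])
    fix e :: real assume "0 < e"
    have "nrm (\<lambda>w. real_cond_exp M F Y w - P w) = 0"
      using ip_self_eq_0_iff[OF L2_diff[OF CL PL]] eq by (simp add: nrm_def)
    then show "\<exists>V\<in>cspan ?S. nrm (\<lambda>w. real_cond_exp M F Y w - V w) < e"
      using P(1) \<open>0 < e\<close> by (intro bexI[of _ P]) auto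
  qed
  assume V: "V \<in> cspan ?S"
  have "ip (\<lambda>w. Y w - real_cond_exp M F Y w) V = ip (\<lambda>w. Y w - P w) V"
    by (rule ip_cong_AE) (use eq L2_measurable[OF YL] L2_measurable[OF PL] L2_measurable[OF cspan_L2[OF V]] in auto)
  also have "\<dots> = 0" by (rule cspan_orth[OF SL _ P(3) V]) auto
  finally show "ip (\<lambda>w. Y w - real_cond_exp M F Y w) V = 0" .
qed

end

section \<open>Mean-square continuity and weak integrals\<close>

lemma gronwall:
  fixes u :: "real \<Rightarrow> real"
  assumes cont: "continuous_on {0..T} u" and K: "0 \<le> K"
    and le: "\<And>t. t \<in> {0..T} \<Longrightarrow> u t \<le> c + K * integral {0..t} u" and t: "t \<in> {0..T}"
  shows "u t \<le> c * exp (K * t)"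
proof -
  \<comment> \<open>The right side of the integral inequality times the integrating factor; the
    inequality makes its derivative nonpositive.\<close>
  define F where "F t = (c + K * integral {0..t} u) * exp (- K * t)" for t
  have dF: "(F has_real_derivative K * (u s - (c + K * integral {0..s} u)) * exp (- K * s)) (at s within {0..T})"
    if s: "s \<in> {0..T}" for s
  proof -
    have "((\<lambda>t. integral {0..t} u) has_real_derivative u s) (at s within {0..T})"
      using integral_has_real_derivative[OF cont s] .
    then show ?thesis
      unfolding F_def by (auto intro!: derivative_eq_intros simp: algebra_simps)
  qed
  have "F t \<le> F 0"
  proof -
    have deriv: "(F has_derivative (*) (K * (u s - (c + K * integral {0..s} u)) * exp (- K * s))) (at s within {0..t})"
      if "0 \<le> s" "s \<le> t" for s
      using has_derivative_subset[OF dF[of s, unfolded has_field_derivative_def], of "{0..t}"] that t by auto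
    show ?thesis
    proof (cases "0 < t")
      case True
      from mvt_simple[OF True deriv] obtain s where s: "s \<in> {0<..<t}"
        and eq: "F t - F 0 = K * (u s - (c + K * integral {0..s} u)) * exp (- K * s) * (t - 0)" by blast
      have "K * (u s - (c + K * integral {0..s} u)) * exp (- K * s) * (t - 0) \<le> 0"
        using le[of s] K s t by (intro mult_nonpos_nonneg mult_nonneg_nonpos) auto
      then show ?thesis using eq by linarith
    next
      case False
      then show ?thesis using t by auto
    qed
  qed
  then have "(c + K * integral {0..t} u) * exp (- K * t) \<le> c" by (simp add: F_def)
  then have "c + K * integral {0..t} u \<le> c * exp (K * t)"
    by (simp add: exp_minus field_simps)
  then show ?thesis using le[OF t] by linarith
qed


lemma continuous_on_Pair_right: "continuous_on A (Pair s)"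
  using continuous_on_Pair[OF continuous_on_const[of A s] continuous_on_id[of A]] by simp

text \<open>Fubini for \<open>k\<close> cut off outside the compact triangle. Integrability of the
  inner integrals belongs to the conclusion, since it comes out of Fubini without a separate
  continuity argument.\<close>

lemma triangle_integral:
  fixes k :: "real \<Rightarrow> real \<Rightarrow> real"
  assumes cont: "continuous_on {(s, u). 0 \<le> u \<and> u \<le> s \<and> s \<le> t} (\<lambda>(s, u). k s u)"
  shows "(\<lambda>s. integral {0..s} (k s)) integrable_on {0..t}" (is ?i1)
    and "(\<lambda>u. integral {u..t} (\<lambda>s. k s u)) integrable_on {0..t}" (is ?i2)
    and "integral {0..t} (\<lambda>s. integral {0..s} (k s)) = integral {0..t} (\<lambda>u. integral {u..t} (\<lambda>s. k s u))" (is ?eq)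
proof -
  let ?A = "{(s, u). 0 \<le> u \<and> u \<le> s \<and> s \<le> t}"
  define f where "f s u = indicator ?A (s, u) * k s u" for s u
  have "closed ?A"
    by (simp add: case_prod_unfold) (intro closed_Collect_conj closed_Collect_le continuous_intros)
  moreover have "?A \<subseteq> cbox (0, 0) (t, t)" by (auto simp: cbox_Pair_eq)
  ultimately have "compact ?A"
    using bounded_subset[OF bounded_cbox] by (auto simp: compact_eq_bounded_closed)
  from borel_integrable_compact[OF this cont]
  have int: "integrable (lborel \<Otimes>\<^sub>M lborel) (case_prod f)"
    by (simp add: lborel_prod f_def case_prod_unfold)
  have c1: "continuous_on {0..s} (k s)" if "s \<le> t" for s
  proof -
    have "continuous_on {0..s} (\<lambda>u. case Pair s u of (s, u) \<Rightarrow> k s u)"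
      by (rule continuous_on_compose2[OF cont continuous_on_Pair_right]) (use that in auto)
    then show ?thesis by simp
  qed
  have c2: "continuous_on {u..t} (\<lambda>s. k s u)" if "0 \<le> u" for u
  proof -
    have "continuous_on {u..t} (\<lambda>s. case (s, u) of (s, u) \<Rightarrow> k s u)"
      by (rule continuous_on_compose2[OF cont]) (use that in \<open>auto intro!: continuous_intros\<close>)
    then show ?thesis by simp
  qed
  have i1: "(LINT u|lborel. f s u) = (if s \<in> {0..t} then integral {0..s} (k s) else 0)" for s
  proof (cases "s \<in> {0..t}")
    case True
    have "(LINT u|lborel. f s u) = (LINT u:{0..s}|lborel. k s u)"
      unfolding set_lebesgue_integral_def f_def using True
      by (intro Bochner_Integration.integral_cong) (auto simp: indicator_def)
    also have "\<dots> = integral {0..s} (k s)"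
      using c1[of s] True by (intro set_borel_integral_eq_integral borel_integrable_atLeastAtMost')
        auto
    finally show ?thesis using True by simp
  next
    case False
    then have "f s u = 0" for u by (auto simp: f_def indicator_def)
    then show ?thesis unfolding if_not_P[OF False] by simp
  qed
  have i2: "(LINT s|lborel. f s u) = (if u \<in> {0..t} then integral {u..t} (\<lambda>s. k s u) else 0)" for u
  proof (cases "u \<in> {0..t}")
    case True
    have "(LINT s|lborel. f s u) = (LINT s:{u..t}|lborel. k s u)"
      unfolding set_lebesgue_integral_def f_def using True
      by (intro Bochner_Integration.integral_cong) (auto simp: indicator_def)
    also have "\<dots> = integral {u..t} (\<lambda>s. k s u)"
      using c2[of u] True by (intro set_borel_integral_eq_integral borel_integrable_atLeastAtMost')
        auto
    finally show ?thesis using True by simp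
  next
    case False
    then have "f s u = 0" for s by (auto simp: f_def indicator_def)
    then show ?thesis unfolding if_not_P[OF False] by simp
  qed
  have I1: "integrable lborel (\<lambda>s. if s \<in> {0..t} then integral {0..s} (k s) else 0)"
    using lborel_pair.integrable_fst[OF int] unfolding i1 .
  have I2: "integrable lborel (\<lambda>u. if u \<in> {0..t} then integral {u..t} (\<lambda>s. k s u) else 0)"
    using lborel_pair.integrable_snd[OF int] unfolding i2 .
  show ?i1 using integrable_on_lborel[OF I1] integrable_restrict_UNIV by fast
  show ?i2 using integrable_on_lborel[OF I2] integrable_restrict_UNIV by fast
  have "integral UNIV (\<lambda>s. if s \<in> {0..t} then integral {0..s} (k s) else 0)
      = integral UNIV (\<lambda>u. if u \<in> {0..t} then integral {u..t} (\<lambda>s. k s u) else 0)"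
    using lborel_pair.Fubini_integral[OF int] unfolding i1 i2 integral_lborel[OF I1] integral_lborel[OF I2] by simp
  then show ?eq by (simp only: integral_restrict_UNIV)
qed

text \<open>The square is cut along its diagonal and the upper half is transposed. In
  \<open>product_rule\<close> this separates the past of one drift paired with the present of the
  other from its mirror image.\<close>

lemma double_integral_split:
  fixes k :: "real \<Rightarrow> real \<Rightarrow> real"
  assumes cont: "continuous_on ({0..t} \<times> {0..t}) (\<lambda>(s, u). k s u)"
  shows "integral {0..t} (\<lambda>s. integral {0..t} (k s)) = integral {0..t} (\<lambda>s. integral {0..s} (k s) + integral {0..s} (\<lambda>u. k u s))"
    and "(\<lambda>s. integral {0..s} (k s)) integrable_on {0..t}" "(\<lambda>s. integral {0..s} (\<lambda>u. k u s)) integrable_on {0..t}"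
proof -
  let ?A = "{(s, u). 0 \<le> u \<and> u \<le> s \<and> s \<le> t}"
  have c1: "continuous_on ?A (\<lambda>(s, u). k s u)"
    by (rule continuous_on_subset[OF cont]) auto
  have c2: "continuous_on ?A (\<lambda>(s, u). k u s)"
  proof -
    have "continuous_on ?A (\<lambda>x. case prod.swap x of (s, u) \<Rightarrow> k s u)"
      by (rule continuous_on_compose2[OF cont]) (auto intro!: continuous_on_swap)
    then show ?thesis by (simp add: case_prod_unfold)
  qed
  note T1 = triangle_integral[OF c1] and T2 = triangle_integral[OF c2]
  have "integral {0..t} (\<lambda>s. integral {0..t} (k s)) = integral {0..t} (\<lambda>s. integral {0..s} (k s) + integral {s..t} (k s))"
  proof (rule integral_cong)
    fix s assume s: "s \<in> {0..t}"
    have "continuous_on {0..t} (\<lambda>u. case Pair s u of (s, u) \<Rightarrow> k s u)"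
      by (rule continuous_on_compose2[OF cont continuous_on_Pair_right]) (use s in auto)
    then have "continuous_on {0..t} (k s)" by simp
    then show "integral {0..t} (k s) = integral {0..s} (k s) + integral {s..t} (k s)"
      using s by (intro Henstock_Kurzweil_Integration.integral_combine[symmetric] integrable_continuous_interval) auto
  qed
  also have "\<dots> = integral {0..t} (\<lambda>s. integral {0..s} (k s)) + integral {0..t} (\<lambda>s. integral {s..t} (k s))"
    by (intro Henstock_Kurzweil_Integration.integral_add T1(1) T2(2))
  also have "\<dots> = integral {0..t} (\<lambda>s. integral {0..s} (k s) + integral {0..s} (\<lambda>u. k u s))"
    unfolding T2(3)[symmetric] by (intro Henstock_Kurzweil_Integration.integral_add[symmetric] T1(1) T2(1))
  finally show "integral {0..t} (\<lambda>s. integral {0..t} (k s)) = integral {0..t} (\<lambda>s. integral {0..s} (k s) + integral {0..s} (\<lambda>u. k u s))" .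
  show "(\<lambda>s. integral {0..s} (k s)) integrable_on {0..t}" "(\<lambda>s. integral {0..s} (\<lambda>u. k u s)) integrable_on {0..t}"
    using T1(1) T2(1) .
qed

context prob_space
begin

section \<open>Mean-square continuous families of random variables\<close>

definition L2cont :: "real set \<Rightarrow> (real \<Rightarrow> 'a \<Rightarrow> real) \<Rightarrow> bool" where
  "L2cont S y \<longleftrightarrow> (\<forall>s\<in>S. y s \<in> L2) \<and>
     (\<forall>s\<in>S. \<forall>e>0. \<exists>d>0. \<forall>u\<in>S. \<bar>u - s\<bar> < d \<longrightarrow> nrm (\<lambda>w. y u w - y s w) < e)"

lemma L2cont_L2: "L2cont S y \<Longrightarrow> s \<in> S \<Longrightarrow> y s \<in> L2"
  by (simp add: L2cont_def)

lemma L2cont_subset: "L2cont S y \<Longrightarrow> R \<subseteq> S \<Longrightarrow> L2cont R y"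
  unfolding L2cont_def by (meson subsetD)

lemma L2cont_tendsto:
  assumes y: "L2cont S y" and x: "\<And>n. x n \<in> S" "s \<in> S" "x \<longlonglongrightarrow> s"
  shows "(\<lambda>n. nrm (\<lambda>w. y (x n) w - y s w)) \<longlonglongrightarrow> 0"
proof (rule LIMSEQ_I)
  fix e :: real assume "0 < e"
  then obtain d where d: "d > 0" "\<And>u. u \<in> S \<Longrightarrow> \<bar>u - s\<bar> < d \<Longrightarrow> nrm (\<lambda>w. y u w - y s w) < e"
    using y x(2) unfolding L2cont_def by blast
  obtain N where "\<And>n. n \<ge> N \<Longrightarrow> \<bar>x n - s\<bar> < d"
    using LIMSEQ_D[OF x(3) d(1)] by auto
  then show "\<exists>N. \<forall>n\<ge>N. norm (nrm (\<lambda>w. y (x n) w - y s w) - 0) < e"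
    using d(2)[OF x(1)] by auto
qed

lemma ip_continuous_on:
  assumes y: "L2cont S y" and z: "L2cont R z"
  shows "continuous_on (S \<times> R) (\<lambda>(s, u). ip (y s) (z u))"
  unfolding continuous_on_sequentially
proof (intro allI ballI impI, elim conjE)
  fix x a assume a: "a \<in> S \<times> R" and x: "\<forall>n. x n \<in> S \<times> R" "x \<longlonglongrightarrow> a"
  have "(\<lambda>n. ip (y (fst (x n))) (z (snd (x n)))) \<longlonglongrightarrow> ip (y (fst a)) (z (snd a))"
  proof (rule ip_tendsto)
    show "(\<lambda>n. nrm (\<lambda>w. y (fst (x n)) w - y (fst a) w)) \<longlonglongrightarrow> 0"
      using a x by (intro L2cont_tendsto[OF y]) (auto simp: mem_Times_iff intro: tendsto_fst)
    show "(\<lambda>n. nrm (\<lambda>w. z (snd (x n)) w - z (snd a) w)) \<longlonglongrightarrow> 0"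
      using a x by (intro L2cont_tendsto[OF z]) (auto simp: mem_Times_iff intro: tendsto_snd)
  qed (use a x L2cont_L2[OF y] L2cont_L2[OF z] in \<open>auto simp: mem_Times_iff\<close>)
  then show "((\<lambda>(s, u). ip (y s) (z u)) \<circ> x) \<longlonglongrightarrow> (\<lambda>(s, u). ip (y s) (z u)) a"
    by (simp add: o_def case_prod_unfold)
qed

lemma L2cont_const: "U \<in> L2 \<Longrightarrow> L2cont S (\<lambda>_. U)"
  by (auto simp: L2cont_def intro: exI[of _ 1])

lemma ip_continuous_on_diag:
  assumes y: "L2cont S y" and z: "L2cont S z"
  shows "continuous_on S (\<lambda>s. ip (y s) (z s))"
proof -
  have "continuous_on S (\<lambda>s. case (s, s) of (s, u) \<Rightarrow> ip (y s) (z u))"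
    by (rule continuous_on_compose2[OF ip_continuous_on[OF y z]]) (auto intro!: continuous_intros)
  then show ?thesis by simp
qed

lemma ip_continuous_on1: "L2cont S y \<Longrightarrow> U \<in> L2 \<Longrightarrow> continuous_on S (\<lambda>s. ip (y s) U)"
  by (rule ip_continuous_on_diag[OF _ L2cont_const])

lemma ip_continuous_on2: "L2cont S y \<Longrightarrow> U \<in> L2 \<Longrightarrow> continuous_on S (\<lambda>s. ip U (y s))"
  by (rule ip_continuous_on_diag[OF L2cont_const])

lemma L2contI_sq:
  assumes "\<And>s. s \<in> S \<Longrightarrow> y s \<in> L2"
    and "\<And>s u. s \<in> S \<Longrightarrow> u \<in> S \<Longrightarrow> nrm (\<lambda>w. y u w - y s w) \<le> g s u"
    and "\<And>s. s \<in> S \<Longrightarrow> continuous_on S (g s)" "\<And>s. s \<in> S \<Longrightarrow> g s s = 0"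
  shows "L2cont S y"
  unfolding L2cont_def
proof (intro conjI ballI allI impI assms(1))
  fix s and e :: real assume s: "s \<in> S" and "0 < e"
  then obtain d where "d > 0" "\<And>u. u \<in> S \<Longrightarrow> dist u s < d \<Longrightarrow> dist (g s u) (g s s) < e"
    using assms(3)[OF s] unfolding continuous_on_iff by metis
  then have "nrm (\<lambda>w. y u w - y s w) < e" if "u \<in> S" "\<bar>u - s\<bar> < d" for u
  proof -
    have "\<bar>g s u\<bar> < e"
      using \<open>\<And>u. u \<in> S \<Longrightarrow> dist u s < d \<Longrightarrow> dist (g s u) (g s s) < e\<close>[of u] that assms(4)[OF s]
      by (simp add: dist_real_def)
    then show ?thesis using assms(2)[OF s that(1)] by linarith
  qed
  then show "\<exists>d>0. \<forall>u\<in>S. \<bar>u - s\<bar> < d \<longrightarrow> nrm (\<lambda>w. y u w - y s w) < e"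
    using \<open>d > 0\<close> by blast
qed

lemma L2contI_ip:
  assumes y: "\<And>s. s \<in> S \<Longrightarrow> y s \<in> L2"
    and c: "\<And>s. s \<in> S \<Longrightarrow> continuous_on S (\<lambda>u. ip (\<lambda>w. y u w - y s w) (\<lambda>w. y u w - y s w))"
  shows "L2cont S y"
proof (rule L2contI_sq[OF y])
  show "nrm (\<lambda>w. y u w - y s w) \<le> sqrt (ip (\<lambda>w. y u w - y s w) (\<lambda>w. y u w - y s w))" for s u
    by (simp add: nrm_def)
  show "continuous_on S (\<lambda>u. sqrt (ip (\<lambda>w. y u w - y s w) (\<lambda>w. y u w - y s w)))" if "s \<in> S" for s
    using c[OF that] by (intro continuous_intros)
qed auto

lemma L2cont_add:
  assumes y: "L2cont S y" and z: "L2cont S z" shows "L2cont S (\<lambda>s w. y s w + z s w)"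
  unfolding L2cont_def
proof (intro conjI ballI allI impI)
  note yL = L2cont_L2[OF y] and zL = L2cont_L2[OF z]
  show "(\<lambda>w. y s w + z s w) \<in> L2" if "s \<in> S" for s using yL zL that by auto
  fix s e :: real assume s: "s \<in> S" and "0 < e"
  then have e2: "e / 2 > 0" by simp
  obtain d1 where d1: "d1 > 0" "\<And>u. u \<in> S \<Longrightarrow> \<bar>u - s\<bar> < d1 \<Longrightarrow> nrm (\<lambda>w. y u w - y s w) < e / 2"
    using y s e2 unfolding L2cont_def by metis
  obtain d2 where d2: "d2 > 0" "\<And>u. u \<in> S \<Longrightarrow> \<bar>u - s\<bar> < d2 \<Longrightarrow> nrm (\<lambda>w. z u w - z s w) < e / 2"
    using z s e2 unfolding L2cont_def by metis
  have "nrm (\<lambda>w. y u w + z u w - (y s w + z s w)) < e" if u: "u \<in> S" "\<bar>u - s\<bar> < min d1 d2" for u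
  proof -
    have "(\<lambda>w. y u w + z u w - (y s w + z s w)) = (\<lambda>w. (y u w - y s w) + (z u w - z s w))"
      by (simp add: algebra_simps)
    then have "nrm (\<lambda>w. y u w + z u w - (y s w + z s w)) \<le> nrm (\<lambda>w. y u w - y s w) + nrm (\<lambda>w. z u w - z s w)"
      using nrm_triangle[of "\<lambda>w. y u w - y s w" "\<lambda>w. z u w - z s w"] yL zL s u by simp
    then show ?thesis using d1(2)[OF u(1)] d2(2)[OF u(1)] u(2) by simp
  qed
  then show "\<exists>d>0. \<forall>u\<in>S. \<bar>u - s\<bar> < d \<longrightarrow> nrm (\<lambda>w. y u w + z u w - (y s w + z s w)) < e"
    using d1(1) d2(1) by (intro exI[of _ "min d1 d2"]) auto
qed

lemma L2cont_scale:
  assumes y: "L2cont S y" and c: "continuous_on S c" shows "L2cont S (\<lambda>s w. c s * y s w)"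
proof (rule L2contI_ip)
  note yL = L2cont_L2[OF y]
  show "(\<lambda>w. c s * y s w) \<in> L2" if "s \<in> S" for s using yL that by auto
  fix s assume s: "s \<in> S"
  have "continuous_on S (\<lambda>u. c u * c u * ip (y u) (y u) - 2 * c u * c s * ip (y u) (y s) + c s * c s * ip (y s) (y s))"
    by (intro continuous_intros ip_continuous_on_diag ip_continuous_on1 y yL s c)
  then show "continuous_on S (\<lambda>u. ip (\<lambda>w. c u * y u w - c s * y s w) (\<lambda>w. c u * y u w - c s * y s w))"
  proof (rule continuous_on_eq)
    fix u assume u: "u \<in> S"
    show "c u * c u * ip (y u) (y u) - 2 * c u * c s * ip (y u) (y s) + c s * c s * ip (y s) (y s)
      = ip (\<lambda>w. c u * y u w - c s * y s w) (\<lambda>w. c u * y u w - c s * y s w)"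
      using yL[OF s] yL[OF u] by (simp add: ip_bilinear ip_commute[of "y s" "y u"] algebra_simps)
  qed
qed

lemma L2cont_minus: "L2cont S y \<Longrightarrow> L2cont S (\<lambda>s w. - y s w)"
  using L2cont_scale[of S y "\<lambda>_. -1"] by simp

lemma L2cont_diff: "L2cont S y \<Longrightarrow> L2cont S z \<Longrightarrow> L2cont S (\<lambda>s w. y s w - z s w)"
  using L2cont_add[OF _ L2cont_minus, of S y z] by simp

lemma L2cont_sum:
  assumes "\<And>i. i \<in> A \<Longrightarrow> L2cont S (y i)" shows "L2cont S (\<lambda>s w. \<Sum>i\<in>A. y i s w)"
  using assms by (induction A rule: infinite_finite_induct) (auto intro: L2cont_add L2cont_const)

lemma L2cont_bounded:
  assumes y: "L2cont {a..b} y"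
  obtains C where "C \<ge> 0" "\<And>s. s \<in> {a..b} \<Longrightarrow> nrm (y s) \<le> C"
proof -
  have "continuous_on {a..b} (\<lambda>s. nrm (y s))"
    unfolding nrm_def by (intro continuous_on_real_sqrt ip_continuous_on_diag y)
  from compact_continuous_image[OF this compact_Icc]
  have "bounded ((\<lambda>s. nrm (y s)) ` {a..b})" by (rule compact_imp_bounded)
  then obtain C where C: "\<forall>s\<in>{a..b}. \<bar>nrm (y s)\<bar> \<le> C"
    unfolding bounded_iff by auto
  show ?thesis
  proof (rule that[of "max C 0"])
    fix s assume "s \<in> {a..b}"
    with C have "\<bar>nrm (y s)\<bar> \<le> C" by blast
    then show "nrm (y s) \<le> max C 0" by linarith
  qed simp
qed

text \<open>The distance of \<open>y s\<close> and \<open>y u\<close> is a continuous function of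
  \<open>(s, u)\<close> on a compact square, hence uniformly continuous, and it vanishes on the
  diagonal: \<open>(s, u)\<close> is compared with \<open>(u, u)\<close>.\<close>

lemma L2cont_uniform:
  assumes y: "L2cont {a..b} y" and e: "e > 0"
  shows "\<exists>d>0. \<forall>s\<in>{a..b}. \<forall>u\<in>{a..b}. \<bar>s - u\<bar> < d \<longrightarrow> nrm (\<lambda>w. y s w - y u w) < e"
proof -
  note yL = L2cont_L2[OF y]
  let ?S = "{a..b} \<times> {a..b}"
  let ?f = "\<lambda>(s, u). nrm (\<lambda>w. y s w - y u w)"
  have "continuous_on ?S (\<lambda>x. sqrt (ip (y (fst x)) (y (fst x)) - 2 * ip (y (fst x)) (y (snd x)) + ip (y (snd x)) (y (snd x))))"
  proof (intro continuous_intros)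
    show "continuous_on ?S (\<lambda>x. ip (y (fst x)) (y (fst x)))"
      by (rule continuous_on_compose2[OF ip_continuous_on_diag[OF y y]]) (auto intro!: continuous_intros)
    show "continuous_on ?S (\<lambda>x. ip (y (snd x)) (y (snd x)))"
      by (rule continuous_on_compose2[OF ip_continuous_on_diag[OF y y]]) (auto intro!: continuous_intros)
    show "continuous_on ?S (\<lambda>x. ip (y (fst x)) (y (snd x)))"
      using ip_continuous_on[OF y y] by (simp add: case_prod_unfold)
  qed
  then have "continuous_on ?S ?f"
  proof (rule continuous_on_eq)
    fix x assume "x \<in> ?S"
    then obtain s u where "x = (s, u)" "s \<in> {a..b}" "u \<in> {a..b}" by auto
    then show "sqrt (ip (y (fst x)) (y (fst x)) - 2 * ip (y (fst x)) (y (snd x)) + ip (y (snd x)) (y (snd x))) = ?f x"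
      using yL by (simp add: nrm_def ip_bilinear ip_commute[of "y u" "y s"])
  qed
  then have "uniformly_continuous_on ?S ?f"
    by (intro compact_uniformly_continuous compact_Times) auto
  from this[unfolded uniformly_continuous_on_def, rule_format, OF e]
  obtain d where d: "d > 0" "\<forall>x\<in>?S. \<forall>x'\<in>?S. dist x' x < d \<longrightarrow> dist (?f x') (?f x) < e" by blast
  show ?thesis
  proof (intro exI[of _ d] conjI ballI impI d(1))
    fix s u assume "s \<in> {a..b}" "u \<in> {a..b}" "\<bar>s - u\<bar> < d"
    then show "nrm (\<lambda>w. y s w - y u w) < e"
      using d(2)[rule_format, of "(u, u)" "(s, u)"] by (simp add: dist_Pair_Pair dist_real_def)
  qed
qed

text \<open>The Pettis integral over \<open>[0, t]\<close>. It determines \<open>Y\<close> up to a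
  null set and mentions no paths, so it makes sense for families of conditional
  expectations.\<close>

definition wint :: "(real \<Rightarrow> 'a \<Rightarrow> real) \<Rightarrow> real \<Rightarrow> ('a \<Rightarrow> real) \<Rightarrow> bool" where
  "wint y t Y \<longleftrightarrow> Y \<in> L2 \<and> (\<forall>U\<in>L2. ip Y U = integral {0..t} (\<lambda>s. ip (y s) U))"

lemma wint_L2: "wint y t Y \<Longrightarrow> Y \<in> L2"
  by (simp add: wint_def)

lemma wint_ip: "wint y t Y \<Longrightarrow> U \<in> L2 \<Longrightarrow> ip Y U = integral {0..t} (\<lambda>s. ip (y s) U)"
  by (simp add: wint_def)

lemma wint_ip2: "wint y t Y \<Longrightarrow> U \<in> L2 \<Longrightarrow> ip U Y = integral {0..t} (\<lambda>s. ip U (y s))"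
  using wint_ip[of y t Y U] by (simp add: ip_commute[of U])

lemma wint_incr_ip:
  assumes y: "L2cont {0..T} y" and s: "0 \<le> s" "s \<le> t" "t \<le> T" and Y: "wint y s Ys" "wint y t Yt" and U: "U \<in> L2"
  shows "ip (\<lambda>w. Yt w - Ys w) U = integral {s..t} (\<lambda>r. ip (y r) U)"
proof -
  have "(\<lambda>r. ip (y r) U) integrable_on {0..t}"
    using s by (intro integrable_continuous_interval ip_continuous_on1 U L2cont_subset[OF y]) auto
  then have "integral {0..s} (\<lambda>r. ip (y r) U) + integral {s..t} (\<lambda>r. ip (y r) U) = integral {0..t} (\<lambda>r. ip (y r) U)"
    using s by (intro Henstock_Kurzweil_Integration.integral_combine) auto
  then show ?thesis using Y U by (simp add: ip_diff_left wint_L2 wint_ip)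
qed

text \<open>The increment is tested against itself; Cauchy-Schwarz under the integral sign then
  leaves one factor of its norm to cancel.\<close>

lemma wint_incr_nrm:
  assumes y: "L2cont {0..T} y" and s: "0 \<le> s" "s \<le> t" "t \<le> T" and Y: "wint y s Ys" "wint y t Yt"
    and C: "\<And>r. r \<in> {0..T} \<Longrightarrow> nrm (y r) \<le> C"
  shows "nrm (\<lambda>w. Yt w - Ys w) \<le> C * (t - s)"
proof -
  let ?D = "\<lambda>w. Yt w - Ys w"
  have DL: "?D \<in> L2" using Y wint_L2 by auto
  have "(nrm ?D)\<^sup>2 = integral {s..t} (\<lambda>r. ip (y r) ?D)"
    unfolding nrm_square by (rule wint_incr_ip[OF y s Y DL])
  also have "\<dots> \<le> integral {s..t} (\<lambda>r. C * nrm ?D)"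
  proof (rule integral_le)
    show "(\<lambda>r. ip (y r) ?D) integrable_on {s..t}"
      using s by (intro integrable_continuous_interval ip_continuous_on1 DL L2cont_subset[OF y]) auto
    show "ip (y r) ?D \<le> C * nrm ?D" if "r \<in> {s..t}" for r
    proof -
      have "r \<in> {0..T}" using that s by auto
      then have "\<bar>ip (y r) ?D\<bar> \<le> nrm (y r) * nrm ?D" "nrm (y r) * nrm ?D \<le> C * nrm ?D"
        using C L2cont_L2[OF y] DL by (auto intro!: Cauchy_Schwarz_ip mult_right_mono)
      then show ?thesis by linarith
    qed
  qed auto
  also have "\<dots> = C * (t - s) * nrm ?D" using s by simp
  finally have "nrm ?D * nrm ?D \<le> (C * (t - s)) * nrm ?D" by (simp add: power2_eq_square)
  moreover have "0 \<le> C * (t - s)" using order_trans[OF nrm_nonneg C[of s]] s by (intro mult_nonneg_nonneg) auto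
  ultimately show ?thesis
    by (cases "nrm ?D = 0") (auto simp: mult_le_cancel_right less_le)
qed

lemma wint_L2cont:
  assumes y: "L2cont {0..T} y" and Y: "\<And>t. t \<in> {0..T} \<Longrightarrow> wint y t (Y t)"
  shows "L2cont {0..T} Y"
proof -
  obtain C where C: "C \<ge> 0" "\<And>s. s \<in> {0..T} \<Longrightarrow> nrm (y s) \<le> C" using L2cont_bounded[OF y] by metis
  show ?thesis
  proof (rule L2contI_sq)
    show "Y s \<in> L2" if "s \<in> {0..T}" for s using wint_L2[OF Y[OF that]] .
    show "nrm (\<lambda>w. Y u w - Y s w) \<le> C * \<bar>u - s\<bar>" if "s \<in> {0..T}" "u \<in> {0..T}" for s u
    proof (cases "s \<le> u")
      case True
      then show ?thesis using wint_incr_nrm[OF y _ True _ Y Y C(2)] that by simp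
    next
      case False
      then show ?thesis using wint_incr_nrm[OF y _ _ _ Y Y C(2), of u s] that nrm_commute[of "Y u"] by simp
    qed
  qed (auto intro!: continuous_intros)
qed

text \<open>A variable orthogonal to \<open>S\<close> is orthogonal to every \<open>y s\<close>,
  hence to the integral; \<open>cspan_orthI\<close> concludes without approximating the integral by
  sums.\<close>

lemma wint_cspan:
  assumes S: "S \<subseteq> L2" and y: "\<And>s. s \<in> {0..t} \<Longrightarrow> y s \<in> cspan S" and Y: "wint y t Y"
  shows "Y \<in> cspan S"
proof (rule cspan_orthI[OF S wint_L2[OF Y]])
  fix U assume U: "U \<in> L2" and o: "\<And>V. V \<in> S \<Longrightarrow> ip U V = 0"
  have "ip Y U = integral {0..t} (\<lambda>s. ip (y s) U)" by (rule wint_ip[OF Y U])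
  also have "\<dots> = integral {0..t} (\<lambda>s. 0)"
    by (rule integral_cong) (subst ip_commute, rule cspan_orth[OF S U o y])
  finally show "ip Y U = 0" by simp
qed

end

section \<open>Weak integrals realized as integrals along paths\<close>

lemma set_integral_square_le:
  fixes f :: "real \<Rightarrow> real"
  assumes ab: "a \<le> b" and f: "set_integrable lborel {a..b} f" and f2: "set_integrable lborel {a..b} (\<lambda>s. (f s)\<^sup>2)"
  shows "(LINT s:{a..b}|lborel. f s)\<^sup>2 \<le> (b - a) * (LINT s:{a..b}|lborel. (f s)\<^sup>2)"
proof (cases "a = b")
  case True
  have "AE s in lborel. indicat_real {b..b} s *\<^sub>R f s = 0"
    using AE_lborel_singleton[of b] by eventually_elim simp
  then have "(LINT s:{b..b}|lborel. f s) = 0"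
    unfolding set_lebesgue_integral_def by (rule integral_eq_zero_AE)
  then show ?thesis using True by simp
next
  case False
  then have t: "b - a > 0" using ab by simp
  define t where "t = b - a"
  have t: "t > 0" using t by (simp add: t_def)
  define I where "I = (LINT s:{a..b}|lborel. f s)"
  define J where "J = (LINT s:{a..b}|lborel. (f s)\<^sup>2)"
  \<comment> \<open>The mean value of \<open>f\<close>. The integral of the square of
    \<open>f - c\<close> is nonnegative, and that is the claim.\<close>
  define c where "c = I / t"
  have one: "set_integrable lborel {a..b} (\<lambda>s. 1::real)"
    by (intro borel_integrable_atLeastAtMost') auto
  have "0 \<le> (LINT s:{a..b}|lborel. (f s - c)\<^sup>2)"
    unfolding set_lebesgue_integral_def by (intro integral_nonneg_AE) auto
  also have "\<dots> = (LINT s:{a..b}|lborel. (f s)\<^sup>2 - ((2 * c) * f s - c\<^sup>2 * 1))"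
    by (intro set_lebesgue_integral_cong) (auto simp: power2_diff)
  also have "\<dots> = J - ((2 * c) * I - c\<^sup>2 * (LINT s:{a..b}|lborel. 1))"
  proof -
    have m: "set_integrable lborel {a..b} (\<lambda>s. (2 * c) * f s)" "set_integrable lborel {a..b} (\<lambda>s. c\<^sup>2 * 1)"
      using f one by (simp_all only: set_integrable_mult_right)
    show ?thesis
      unfolding I_def J_def set_integral_diff(2)[OF f2 set_integral_diff(1)[OF m]] set_integral_diff(2)[OF m]
      by (simp only: set_integral_mult_right)
  qed
  also have "(LINT s:{a..b}|lborel. (1::real)) = t"
    using t by (simp add: set_lebesgue_integral_def t_def)
  also have "J - ((2 * c) * I - c\<^sup>2 * t) = J - I\<^sup>2 / t"
    using t by (simp add: c_def power2_eq_square)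
  finally have "I\<^sup>2 \<le> t * J" using t by (simp add: field_simps)
  then show ?thesis by (simp add: I_def J_def t_def)
qed

context prob_space
begin

text \<open>The bridge from paths to inner products: for any jointly measurable modification, Fubini
  moves the expectation inside the time integral. Nothing but agreement at each single time relates
  \<open>y'\<close> to \<open>y\<close>.\<close>

lemma path_integral:
  fixes y :: "real \<Rightarrow> 'a \<Rightarrow> real"
  assumes T: "0 \<le> T" and y: "L2cont {0..T} y"
    and meas: "(\<lambda>(s, w). y' s w) \<in> borel_measurable (borel \<Otimes>\<^sub>M M)"
    and mod: "\<And>s. s \<in> {0..T} \<Longrightarrow> AE w in M. y' s w = y s w"
  shows "AE w in M. set_integrable lborel {0..T} (\<lambda>s. y' s w)" (is ?AE)
    and "t \<in> {0..T} \<Longrightarrow> wint y t (\<lambda>w. LINT s:{0..t}|lborel. y' s w)"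
proof -
  interpret P: pair_sigma_finite lborel M ..
  note [measurable] = meas
  have sets_eq [measurable_cong]: "sets (lborel \<Otimes>\<^sub>M M) = sets (borel \<Otimes>\<^sub>M M)"
    by (intro sets_pair_measure_cong) auto
  define g where "g s w = indicator {0..T} s * y' s w" for s w
  have gm [measurable]: "case_prod g \<in> borel_measurable (lborel \<Otimes>\<^sub>M M)"
    unfolding g_def[abs_def] by measurable
  note yL = L2cont_L2[OF y]
  have ym [measurable]: "y' s \<in> borel_measurable M" for s
    using meas by measurable
  have y'L: "y' s \<in> L2" if "s \<in> {0..T}" for s
    by (rule L2_AE_cong[OF yL[OF that] mod[OF that]]) simp
  have ip_y': "ip (y' s) U = ip (y s) U" if "s \<in> {0..T}" "U \<in> L2" for s U
    using mod[OF that(1)] yL[OF that(1)] that(2) by (intro ip_cong_AE) (auto intro: L2_measurable)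
  have ip_y'2: "ip (y' s) (y' s) = ip (y s) (y s)" if "s \<in> {0..T}" for s
    using mod[OF that(1)] yL[OF that(1)] by (intro ip_cong_AE) (auto intro: L2_measurable)
  \<comment> \<open>Square integrability on the product space: the second moment at time
    \<open>s\<close> is \<open>ip (y s) (y s)\<close>, continuous on a compact interval.\<close>
  have g2: "integrable (lborel \<Otimes>\<^sub>M M) (case_prod (\<lambda>s w. (g s w)\<^sup>2))"
  proof (rule P.Fubini_integrable)
    have "set_integrable lborel {0..T} (\<lambda>s. ip (y s) (y s))"
      by (intro borel_integrable_atLeastAtMost' ip_continuous_on_diag y)
    then have "integrable lborel (\<lambda>s. indicator {0..T} s * ip (y s) (y s))"
      by (simp add: set_integrable_def)
    moreover have "(LINT w|M. norm ((g s w)\<^sup>2)) = indicator {0..T} s * ip (y s) (y s)" for s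
      using ip_y'2[of s] by (auto simp: g_def indicator_def ip_def power2_eq_square)
    ultimately show "integrable lborel (\<lambda>s. LINT w|M. norm (case (s, w) of (s, w) \<Rightarrow> (g s w)\<^sup>2))"
      by simp
    show "AE s in lborel. integrable M (\<lambda>w. case (s, w) of (s, w) \<Rightarrow> (g s w)\<^sup>2)"
      using y'L by (intro AE_I2) (auto simp: g_def indicator_def L2_def)
  qed measurable
  have gU: "integrable (lborel \<Otimes>\<^sub>M M) (case_prod (\<lambda>s w. g s w * U w))" if U: "U \<in> L2" for U
  proof (rule Bochner_Integration.integrable_bound)
    have [measurable]: "U \<in> borel_measurable M" using U L2_measurable by blast
    have "integrable (lborel \<Otimes>\<^sub>M M) (case_prod (\<lambda>s w. indicator {0..T} s * (U w)\<^sup>2))"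
    proof (rule P.Fubini_integrable)
      show "integrable lborel (\<lambda>s. LINT w|M. norm (case (s, w) of (s, w) \<Rightarrow> indicator {0..T} s * (U w)\<^sup>2))"
        by (simp add: abs_mult integrable_indicator_iff emeasure_lborel_Icc_eq)
      show "AE s in lborel. integrable M (\<lambda>w. case (s, w) of (s, w) \<Rightarrow> indicator {0..T} s * (U w)\<^sup>2)"
        using U by (intro AE_I2) (auto simp: L2_def)
    qed measurable
    then show "integrable (lborel \<Otimes>\<^sub>M M) (\<lambda>x. (case_prod (\<lambda>s w. (g s w)\<^sup>2) x) + (case_prod (\<lambda>s w. indicator {0..T} s * (U w)\<^sup>2) x))"
      using g2 by (rule Bochner_Integration.integrable_add[rotated])
    show "case_prod (\<lambda>s w. g s w * U w) \<in> borel_measurable (lborel \<Otimes>\<^sub>M M)" by measurable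
    have "\<bar>x * z\<bar> \<le> x\<^sup>2 + z\<^sup>2" for x z :: real
    proof -
      have "0 \<le> (\<bar>x\<bar> - \<bar>z\<bar>)\<^sup>2" by simp
      then have "2 * (\<bar>x\<bar> * \<bar>z\<bar>) \<le> x\<^sup>2 + z\<^sup>2" by (simp add: power2_diff)
      moreover have "0 \<le> \<bar>x\<bar> * \<bar>z\<bar>" by simp
      ultimately show ?thesis unfolding abs_mult by linarith
    qed
    then show "AE x in lborel \<Otimes>\<^sub>M M. norm (case_prod (\<lambda>s w. g s w * U w) x)
        \<le> norm ((case_prod (\<lambda>s w. (g s w)\<^sup>2) x) + (case_prod (\<lambda>s w. indicator {0..T} s * (U w)\<^sup>2) x))"
      by (intro AE_I2) (auto simp: g_def indicator_def split: prod.splits)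
  qed
  have g1: "AE w in M. integrable lborel (\<lambda>s. g s w)"
    using P.AE_integrable_snd[OF gU[OF L2_const[of 1]]] by simp
  then show ?AE
    by (simp add: set_integrable_def g_def)
  assume t: "t \<in> {0..T}"
  let ?Y = "\<lambda>w. LINT s:{0..t}|lborel. y' s w"
  have Ym [measurable]: "?Y \<in> borel_measurable M"
    unfolding set_lebesgue_integral_def by measurable
  have YL: "?Y \<in> L2"
  proof -
    \<comment> \<open>Cauchy-Schwarz in time bounds the square of the path integral by
      \<open>t\<close> times the integral of the squares, whose expectation is finite by
      \<open>g2\<close>.\<close>
    have dom: "integrable M (\<lambda>w. t * (LINT s|lborel. (g s w)\<^sup>2))"
      using P.integrable_snd[OF g2] by simp
    have le: "AE w in M. norm ((?Y w)\<^sup>2) \<le> norm (t * (LINT s|lborel. (g s w)\<^sup>2))"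
      using g1 P.AE_integrable_snd[OF g2]
    proof eventually_elim
      case (elim w)
      have i1: "set_integrable lborel {0..T} (\<lambda>s. y' s w)" "set_integrable lborel {0..T} (\<lambda>s. (y' s w)\<^sup>2)"
      proof -
        have "(g s w)\<^sup>2 = indicator {0..T} s * (y' s w)\<^sup>2" for s by (simp add: g_def indicator_def)
        then show "set_integrable lborel {0..T} (\<lambda>s. y' s w)" "set_integrable lborel {0..T} (\<lambda>s. (y' s w)\<^sup>2)"
          using elim by (simp_all add: set_integrable_def g_def)
      qed
      have i2: "set_integrable lborel {0..t} (\<lambda>s. y' s w)" "set_integrable lborel {0..t} (\<lambda>s. (y' s w)\<^sup>2)"
        using t by (auto intro: set_integrable_subset[OF i1(1)] set_integrable_subset[OF i1(2)])
      have "(?Y w)\<^sup>2 \<le> t * (LINT s:{0..t}|lborel. (y' s w)\<^sup>2)"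
        using set_integral_square_le[of 0 t "\<lambda>s. y' s w"] t i2 by simp
      also have "(LINT s:{0..t}|lborel. (y' s w)\<^sup>2) \<le> (LINT s|lborel. (g s w)\<^sup>2)"
        unfolding set_lebesgue_integral_def using i2(2) elim(2) t
        by (intro integral_mono) (auto simp: set_integrable_def g_def indicator_def)
      finally have "(?Y w)\<^sup>2 \<le> t * (LINT s|lborel. (g s w)\<^sup>2)" using t by (simp add: mult_left_mono)
      then show ?case by simp
    qed
    have "integrable M (\<lambda>w. (?Y w)\<^sup>2)"
      by (rule Bochner_Integration.integrable_bound[OF dom _ le]) measurable
    then show ?thesis by (simp add: L2_def)
  qed
  show "wint y t ?Y"
    unfolding wint_def
  proof (intro conjI ballI YL)
    fix U assume U: "U \<in> L2"
    have [measurable]: "U \<in> borel_measurable M" using U L2_measurable by blast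
    let ?k = "\<lambda>s w. indicator {0..t} s * (g s w * U w)"
    have int: "integrable (lborel \<Otimes>\<^sub>M M) (case_prod ?k)"
    proof (rule Bochner_Integration.integrable_bound[OF gU[OF U]])
      show "AE x in lborel \<Otimes>\<^sub>M M. norm (case_prod ?k x) \<le> norm (case_prod (\<lambda>s w. g s w * U w) x)"
        by (intro AE_I2) (auto simp: indicator_def)
    qed measurable
    have "ip ?Y U = (LINT w|M. LINT s|lborel. ?k s w)"
      unfolding ip_def set_lebesgue_integral_def
    proof (intro Bochner_Integration.integral_cong refl)
      fix w
      have "(LINT s|lborel. ?k s w) = (LINT s|lborel. (indicator {0..t} s * y' s w) * U w)"
        using t by (intro Bochner_Integration.integral_cong) (auto simp: g_def indicator_def)
      then show "(LINT s|lborel. indicat_real {0..t} s *\<^sub>R y' s w) * U w = (LINT s|lborel. ?k s w)" by simp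
    qed
    also have "\<dots> = (LINT s|lborel. LINT w|M. ?k s w)" by (rule P.Fubini_integral[OF int])
    also have "\<dots> = (LINT s:{0..t}|lborel. ip (y s) U)"
      unfolding set_lebesgue_integral_def
    proof (intro Bochner_Integration.integral_cong refl)
      fix s
      show "(LINT w|M. ?k s w) = indicat_real {0..t} s *\<^sub>R ip (y s) U"
        using t ip_y'[OF _ U, of s] by (auto simp: indicator_def g_def ip_def)
    qed
    also have "\<dots> = integral {0..t} (\<lambda>s. ip (y s) U)"
      using t by (intro set_borel_integral_eq_integral borel_integrable_atLeastAtMost'
        continuous_on_subset[OF ip_continuous_on1[OF y U]]) auto
    finally show "ip ?Y U = integral {0..t} (\<lambda>s. ip (y s) U)" .
  qed
qed

text \<open>Uniform mean-square continuity makes the values on fine grids converge at every time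
  almost surely; only countably many random variables enter each grid, hence joint measurability.\<close>

lemma measurable_modification_exists:
  assumes y: "L2cont {0..T} y"
  obtains y' where "(\<lambda>(s, w). y' s w) \<in> borel_measurable (borel \<Otimes>\<^sub>M M)"
    "\<And>s. s \<in> {0..T} \<Longrightarrow> AE w in M. y' s w = y s w"
proof -
  note yL = L2cont_L2[OF y]
  \<comment> \<open>The grids below run over all integers, while nothing is known about
    \<open>y\<close> outside \<open>[0, T]\<close>.\<close>
  define y0 where "y0 s = (if s \<in> {0..T} then y s else (\<lambda>_. 0))" for s
  have [measurable]: "y0 s \<in> borel_measurable M" for s
    using L2_measurable[OF yL[of s]] by (simp add: y0_def)
  \<comment> \<open>With this tolerance two grid approximations \<open>k \<le> m\<close> differ by
    at most (1/2)^k, the rate that \<open>L2_complete\<close> asks for.\<close>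
  have "\<exists>d>0. \<forall>s\<in>{0..T}. \<forall>u\<in>{0..T}. \<bar>s - u\<bar> < d \<longrightarrow> nrm (\<lambda>w. y s w - y u w) < (1/2)^k / 2" for k :: nat
    by (rule L2cont_uniform[OF y]) simp
  then obtain d where d: "\<And>k. d k > 0"
    "\<And>k s u. s \<in> {0..T} \<Longrightarrow> u \<in> {0..T} \<Longrightarrow> \<bar>s - u\<bar> < d k \<Longrightarrow> nrm (\<lambda>w. y s w - y u w) < (1/2)^k / 2"
    by metis
  \<comment> \<open>The grid point below \<open>s\<close> for the mesh \<open>d k / 2\<close>.
    Rounding down keeps it in \<open>[0, T]\<close>, and half of \<open>d k\<close> makes the
    distance strictly smaller than \<open>d k\<close>.\<close>
  define gr where "gr k s = (d k / 2) * of_int \<lfloor>s / (d k / 2)\<rfloor>" for k s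
  have gr: "gr k s \<in> {0..T}" "\<bar>gr k s - s\<bar> < d k" if "s \<in> {0..T}" for k s
  proof -
    define c where "c = d k / 2"
    have c: "c > 0" using d(1)[of k] by (simp add: c_def)
    have "of_int \<lfloor>s / c\<rfloor> \<le> s / c" "s / c < of_int \<lfloor>s / c\<rfloor> + 1" by linarith+
    then have "c * of_int \<lfloor>s / c\<rfloor> \<le> s" "s < c * (of_int \<lfloor>s / c\<rfloor> + 1)"
      using c by (simp_all only: pos_le_divide_eq pos_divide_less_eq mult.commute[of _ c])
    moreover have "0 \<le> c * of_int \<lfloor>s / c\<rfloor>" using c that by simp
    moreover have "gr k s = c * of_int \<lfloor>s / c\<rfloor>" "d k = 2 * c" by (simp_all add: gr_def c_def)
    ultimately show "gr k s \<in> {0..T}" "\<bar>gr k s - s\<bar> < d k"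
      using that c by (auto simp: distrib_left abs_if)
  qed
  define Y where "Y k s = y0 (gr k s)" for k s
  have Ym: "(\<lambda>(s, w). Y k s w) \<in> borel_measurable (borel \<Otimes>\<^sub>M M)" for k
  proof -
    have "(\<lambda>x. y0 ((d k / 2) * of_int \<lfloor>fst x / (d k / 2)\<rfloor>) (snd x)) \<in> borel_measurable (borel \<Otimes>\<^sub>M M)"
      by (rule measurable_compose_countable[where f="\<lambda>i x. y0 ((d k / 2) * of_int i) (snd x)"
          and g="\<lambda>x. \<lfloor>fst x / (d k / 2)\<rfloor>"]) measurable
    then show ?thesis by (simp add: Y_def gr_def case_prod_unfold)
  qed
  define y' where "y' s w = lim (\<lambda>k. Y k s w)" for s w
  have "(\<lambda>x. lim (\<lambda>k. (\<lambda>(s, w). Y k s w) x)) \<in> borel_measurable (borel \<Otimes>\<^sub>M M)"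
    by (rule borel_measurable_lim_metric[OF Ym])
  then have m: "(\<lambda>(s, w). y' s w) \<in> borel_measurable (borel \<Otimes>\<^sub>M M)"
    by (simp add: y'_def case_prod_unfold)
  have "AE w in M. y' s w = y s w" if s: "s \<in> {0..T}" for s
  proof -
    have YL: "Y k s \<in> L2" for k using gr(1)[OF s] yL by (simp add: Y_def y0_def)
    have near: "nrm (\<lambda>w. Y k s w - y s w) < (1/2)^k / 2" for k
      using d(2)[OF gr(1)[OF s] s gr(2)[OF s]] gr(1)[OF s] by (simp add: Y_def y0_def)
    have fast: "nrm (\<lambda>w. Y m s w - Y k s w) \<le> (1/2)^k" if "k \<le> m" for k m
    proof -
      have "nrm (\<lambda>w. Y m s w - Y k s w) \<le> nrm (\<lambda>w. Y m s w - y s w) + nrm (\<lambda>w. Y k s w - y s w)"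
        using nrm_triangle3[OF YL yL[OF s] YL, of m k] nrm_commute[of "y s" "Y k s"] by simp
      moreover have "(1/2)^m \<le> (1/2::real)^k" using that by (intro power_decreasing) auto
      ultimately show ?thesis using near[of m] near[of k] by linarith
    qed
    have "subalgebra M M" by (simp add: subalgebra_def)
    then obtain l where "l \<in> borel_measurable M" and l: "l \<in> L2" "(\<lambda>k. nrm (\<lambda>w. Y k s w - l w)) \<longlonglongrightarrow> 0"
      "AE w in M. (\<lambda>k. Y k s w) \<longlonglongrightarrow> l w"
      by (rule L2_complete[OF _ L2_measurable[OF YL] YL fast])
    have "nrm (\<lambda>w. l w - y s w) \<le> 0"
    proof (rule LIMSEQ_le_const[where X="\<lambda>k. nrm (\<lambda>w. Y k s w - l w) + (1/2)^k / 2"])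
      have "(\<lambda>k. nrm (\<lambda>w. Y k s w - l w) + (1/2)^k / 2) \<longlonglongrightarrow> 0 + 0 / 2"
        by (intro tendsto_add tendsto_divide l(2) LIMSEQ_power_zero tendsto_const) auto
      then show "(\<lambda>k. nrm (\<lambda>w. Y k s w - l w) + (1/2)^k / 2) \<longlonglongrightarrow> 0" by simp
      show "\<exists>N. \<forall>k\<ge>N. nrm (\<lambda>w. l w - y s w) \<le> nrm (\<lambda>w. Y k s w - l w) + (1/2)^k / 2"
      proof (intro exI[of _ 0] allI impI)
        fix k
        show "nrm (\<lambda>w. l w - y s w) \<le> nrm (\<lambda>w. Y k s w - l w) + (1/2)^k / 2"
          using nrm_triangle3[OF l(1) YL yL[OF s], of k] nrm_commute[of l "Y k s"] near[of k] by simp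
      qed
    qed
    then have "nrm (\<lambda>w. l w - y s w) = 0" by (intro order_antisym) simp_all
    then have "AE w in M. l w - y s w = 0"
      using ip_self_eq_0_iff[OF L2_diff[OF l(1) yL[OF s]]] by (simp add: nrm_def)
    then show ?thesis using l(3)
      by eventually_elim (simp add: y'_def limI)
  qed
  then show ?thesis using that m by blast
qed

end

section \<open>The filtering problem\<close>

lemma indicator_integral:
  fixes f :: "real \<Rightarrow> real"
  assumes f: "f integrable_on {0..u}" and t: "t \<in> {0..u}"
  shows "(\<lambda>s. indicator {0..t} s * f s) integrable_on {0..u}"
    and "integral {0..u} (\<lambda>s. indicator {0..t} s * f s) = integral {0..t} f"
proof -
  have eq: "(\<lambda>s. indicator {0..t} s * f s) = (\<lambda>s. if s \<in> {0..t} then f s else 0)"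
    by (auto simp: indicator_def)
  have int: "{0..t} \<inter> {0..u} = {0..t}" "{0..u} \<inter> {0..t} = {0..t}" using t by auto
  have "f integrable_on {0..t}" by (rule integrable_on_subinterval[OF f]) (use t in auto)
  then show "(\<lambda>s. indicator {0..t} s * f s) integrable_on {0..u}"
    unfolding eq by (subst integrable_restrict_Int) (simp only: int)
  show "integral {0..u} (\<lambda>s. indicator {0..t} s * f s) = integral {0..t} f"
    unfolding eq by (subst integral_restrict_Int) (simp only: int)
qed

context prob_space
begin

text \<open>Integration by parts for expectations of products, with \<open>m1\<close> and
  \<open>m2\<close> in the role of martingale parts: \<open>o1\<close> and \<open>o2\<close> say
  that their later increments do not see the drifts at earlier times, and \<open>c\<close> is the
  density of their bracket. It serves three times: for the innovations, for the signals and for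
  their filters.\<close>

lemma product_rule:
  assumes b: "L2cont {0..T} b1" "L2cont {0..T} b2"
    and U: "\<And>t. t \<in> {0..T} \<Longrightarrow> U1 t \<in> L2" "\<And>t. t \<in> {0..T} \<Longrightarrow> U2 t \<in> L2"
    and m: "\<And>t. t \<in> {0..T} \<Longrightarrow> m1 t \<in> L2" "\<And>t. t \<in> {0..T} \<Longrightarrow> m2 t \<in> L2"
    and d1: "\<And>t Y. t \<in> {0..T} \<Longrightarrow> Y \<in> L2 \<Longrightarrow> ip (U1 t) Y = ip (U1 0) Y + integral {0..t} (\<lambda>s. ip (b1 s) Y) + ip (m1 t) Y"
    and d2: "\<And>t Y. t \<in> {0..T} \<Longrightarrow> Y \<in> L2 \<Longrightarrow> ip (U2 t) Y = ip (U2 0) Y + integral {0..t} (\<lambda>s. ip (b2 s) Y) + ip (m2 t) Y"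
    and o1: "\<And>s t. 0 \<le> s \<Longrightarrow> s \<le> t \<Longrightarrow> t \<le> T \<Longrightarrow> ip (m1 t) (b2 s) = ip (m1 s) (b2 s)"
    and o2: "\<And>s t. 0 \<le> s \<Longrightarrow> s \<le> t \<Longrightarrow> t \<le> T \<Longrightarrow> ip (m2 t) (b1 s) = ip (m2 s) (b1 s)"
    and z: "\<And>t. t \<in> {0..T} \<Longrightarrow> ip (m1 t) (U2 0) = 0" "\<And>t. t \<in> {0..T} \<Longrightarrow> ip (m2 t) (U1 0) = 0"
    and c: "ip (m1 t) (m2 t) = integral {0..t} c" "c integrable_on {0..t}"
    and t: "t \<in> {0..T}"
  shows "((\<lambda>s. ip (U1 s) (b2 s) + ip (b1 s) (U2 s) + c s) has_integral ip (U1 t) (U2 t) - ip (U1 0) (U2 0)) {0..t}"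
proof -
  have t0: "0 \<in> {0..T}" using t by auto
  note UL = U[OF t] U[OF t0] and mL = m[OF t]
  have sub: "{0..t} \<subseteq> {0..T}" using t by auto
  note bt = L2cont_subset[OF b(1) sub] L2cont_subset[OF b(2) sub]
  have bL: "b1 s \<in> L2" "b2 s \<in> L2" if "s \<in> {0..t}" for s using L2cont_L2[OF bt(1)] L2cont_L2[OF bt(2)] that by auto
  define k where "k s u = ip (b1 s) (b2 u)" for s u
  have k: "continuous_on ({0..t} \<times> {0..t}) (\<lambda>(s, u). k s u)"
    unfolding k_def by (rule ip_continuous_on[OF bt])
  note dbl = double_integral_split[OF k]
  \<comment> \<open>These keep \<open>m1 t\<close> and \<open>m2 t\<close> at the final time, as the
    expansion produces them. At the end \<open>o1\<close> and \<open>o2\<close> replace the final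
    time by \<open>s\<close>, which turns the integrand into products of values at
    \<open>s\<close>.\<close>
  define A B where "A s = ip (U1 0) (b2 s) + ip (m1 t) (b2 s)" and "B s = ip (b1 s) (U2 0) + ip (b1 s) (m2 t)" for s
  have AB: "A integrable_on {0..t}" "B integrable_on {0..t}"
    unfolding A_def[abs_def] B_def[abs_def]
    by (intro integrable_continuous_interval continuous_intros ip_continuous_on1 ip_continuous_on2 bt UL mL)+
  have i: "(\<lambda>s. integral {0..t} (k s)) integrable_on {0..t}"
    using integral_continuous_on_param[of "{0..t}" 0 t k] k
    by (intro integrable_continuous_interval) (simp add: cbox_interval)
  have "ip (U1 t) (U2 t) = ip (U1 0) (U2 t) + integral {0..t} (\<lambda>s. ip (b1 s) (U2 t)) + ip (m1 t) (U2 t)"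
    by (rule d1[OF t UL(2)])
  also have "integral {0..t} (\<lambda>s. ip (b1 s) (U2 t)) = integral {0..t} (\<lambda>s. B s + integral {0..t} (k s))"
  proof (rule integral_cong)
    fix s assume s: "s \<in> {0..t}"
    show "ip (b1 s) (U2 t) = B s + integral {0..t} (k s)"
      using d2[OF t bL(1)[OF s]] by (simp add: B_def k_def[abs_def] ip_commute[of "b1 s"])
  qed
  also have "\<dots> = integral {0..t} B + integral {0..t} (\<lambda>s. integral {0..t} (k s))"
    by (rule Henstock_Kurzweil_Integration.integral_add[OF AB(2) i])
  also have "ip (U1 0) (U2 t) = ip (U1 0) (U2 0) + integral {0..t} (\<lambda>s. ip (U1 0) (b2 s))"
    using d2[OF t UL(3)] z(2)[OF t] by (simp add: ip_commute[of "U1 0"])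
  also have "ip (m1 t) (U2 t) = integral {0..t} (\<lambda>s. ip (m1 t) (b2 s)) + integral {0..t} c"
    using d2[OF t mL(1)] z(1)[OF t] c by (simp add: ip_commute[of "m1 t"])
  finally have "ip (U1 t) (U2 t) - ip (U1 0) (U2 0) = (integral {0..t} (\<lambda>s. ip (U1 0) (b2 s)) + integral {0..t} (\<lambda>s. ip (m1 t) (b2 s)))
      + integral {0..t} B + integral {0..t} (\<lambda>s. integral {0..t} (k s)) + integral {0..t} c" by simp
  also have "integral {0..t} (\<lambda>s. ip (U1 0) (b2 s)) + integral {0..t} (\<lambda>s. ip (m1 t) (b2 s)) = integral {0..t} A"
    unfolding A_def[abs_def]
    by (intro Henstock_Kurzweil_Integration.integral_add[symmetric] integrable_continuous_interval ip_continuous_on2 bt UL mL)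
  finally have eq: "ip (U1 t) (U2 t) - ip (U1 0) (U2 0) = integral {0..t} A + integral {0..t} B
      + integral {0..t} (\<lambda>s. integral {0..s} (k s) + integral {0..s} (\<lambda>u. k u s)) + integral {0..t} c"
    unfolding dbl(1) .
  have "((\<lambda>s. A s + B s + (integral {0..s} (k s) + integral {0..s} (\<lambda>u. k u s)) + c s) has_integral ip (U1 t) (U2 t) - ip (U1 0) (U2 0)) {0..t}"
    unfolding eq by (intro has_integral_add integrable_integral integrable_add AB dbl(2,3) c(2))
  then show ?thesis
  proof (rule has_integral_eq[rotated])
    fix s assume s: "s \<in> {0..t}"
    then have s': "s \<in> {0..T}" "0 \<le> s" "s \<le> t" "t \<le> T" using t by auto
    have "ip (U1 s) (b2 s) = ip (U1 0) (b2 s) + integral {0..s} (\<lambda>u. k u s) + ip (m1 t) (b2 s)"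
      using d1[OF s'(1) bL(2)[OF s]] o1[OF s'(2-4)] by (simp add: k_def)
    moreover have "ip (b1 s) (U2 s) = ip (b1 s) (U2 0) + integral {0..s} (k s) + ip (b1 s) (m2 t)"
      using d2[OF s'(1) bL(1)[OF s]] o2[OF s'(2-4)] by (simp add: k_def[abs_def] ip_commute[of "b1 s"])
    ultimately show "A s + B s + (integral {0..s} (k s) + integral {0..s} (\<lambda>u. k u s)) + c s
        = ip (U1 s) (b2 s) + ip (b1 s) (U2 s) + c s"
      by (simp add: A_def B_def)
  qed
qed

end

text \<open>The filtering problem reduced to spans and inner products. \<open>GX\<close> spans the
  signal side, the observed drift \<open>h\<close> lies in its closed span, and the noise is
  orthogonal to it with the covariance of a Brownian motion. The signal has no dynamics at this
  stage.\<close>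

locale filtering = prob_space M for M :: "'w measure" +
  fixes T :: real and GX :: "('w \<Rightarrow> real) set"
    and h N Z :: "real \<Rightarrow> 'i::finite \<Rightarrow> 'w \<Rightarrow> real" and F :: "real \<Rightarrow> 'w measure"
  assumes T: "0 \<le> T"
    and GX_L2: "GX \<subseteq> L2" and one_GX: "(\<lambda>x. 1) \<in> GX"
    and h_GX: "\<And>s i. s \<in> {0..T} \<Longrightarrow> h s i \<in> cspan GX"
    and h_cont: "\<And>i. L2cont {0..T} (\<lambda>s. h s i)"
    and N_L2: "\<And>s i. s \<in> {0..T} \<Longrightarrow> N s i \<in> L2"
    and N_orth: "\<And>s i V. s \<in> {0..T} \<Longrightarrow> V \<in> GX \<Longrightarrow> ip (N s i) V = 0"
    and N_cov: "\<And>s t i j. s \<in> {0..T} \<Longrightarrow> t \<in> {0..T} \<Longrightarrow> ip (N s i) (N t j) = (if i = j then min s t else 0)"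
    and Z_meas: "\<And>t i. t \<in> {0..T} \<Longrightarrow> Z t i \<in> borel_measurable M"
    and Z_eq: "\<And>t i. t \<in> {0..T} \<Longrightarrow> \<exists>Y. wint (\<lambda>s. h s i) t Y \<and> (AE x in M. Z t i x = Y x + N t i x)"
    and chf_lin: "\<And>V. V \<in> lin (GX \<union> {N s i | s i. s \<in> {0..T}}) \<Longrightarrow> gaussian_chf V"
    and F_gen: "\<And>t. t \<in> {0..T} \<Longrightarrow> generated_by (F t) {Z s i | s i. s \<in> {0..t}}"
begin

definition "GG = GX \<union> {N s i | s i. s \<in> {0..T}}"

definition "SZ t = insert (\<lambda>x. 1) {Z s i | s i. s \<in> {0..t}}"

definition "cZ t = cspan (SZ t)"

abbreviation "hat t Y \<equiv> real_cond_exp M (F t) Y"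

lemma GG_L2: "GG \<subseteq> L2"
  using GX_L2 N_L2 by (auto simp: GG_def)

lemma GX_GG: "cspan GX \<subseteq> cspan GG"
  by (intro cspan_mono) (auto simp: GG_def)

lemma N_GG: "s \<in> {0..T} \<Longrightarrow> N s i \<in> cspan GG"
  by (intro cspan_base[OF GG_L2]) (auto simp: GG_def)

lemma one_cspan: "(\<lambda>x. 1) \<in> cspan GX" "(\<lambda>x. 1) \<in> cspan GG"
  using cspan_base[OF GX_L2 one_GX] GX_GG by auto

lemma N_orth_cspan: "s \<in> {0..T} \<Longrightarrow> V \<in> cspan GX \<Longrightarrow> ip (N s i) V = 0"
  by (rule cspan_orth[OF GX_L2 N_L2 N_orth])

lemma N_orth_cspan': "s \<in> {0..T} \<Longrightarrow> V \<in> cspan GX \<Longrightarrow> ip V (N s i) = 0"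
  by (subst ip_commute) (rule N_orth_cspan)

lemma chf: "V \<in> cspan GG \<Longrightarrow> gaussian_chf V"
  by (rule gaussian_chf_cspan[OF GG_L2]) (auto simp: GG_def intro: chf_lin)

lemma Z_decomp:
  assumes t: "t \<in> {0..T}"
  shows "Z t i \<in> cspan GG" "Z t i \<in> L2"
    and "U \<in> L2 \<Longrightarrow> ip (Z t i) U = integral {0..t} (\<lambda>s. ip (h s i) U) + ip (N t i) U"
proof -
  obtain Y where Y: "wint (\<lambda>s. h s i) t Y" "AE x in M. Z t i x = Y x + N t i x"
    using Z_eq[OF t] by blast
  have YG: "Y \<in> cspan GX"
    by (rule wint_cspan[OF GX_L2 _ Y(1)]) (use t h_GX in auto)
  note [measurable] = Z_meas[OF t] L2_measurable[OF cspan_L2[OF YG]] L2_measurable[OF N_L2[OF t]]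
  have YN: "(\<lambda>x. Y x + N t i x) \<in> cspan GG"
    using YG GX_GG N_GG[OF t] by (intro cspan_add[OF GG_L2]) auto
  show ZL: "Z t i \<in> L2" by (rule L2_AE_cong[OF cspan_L2[OF YN] Y(2)]) measurable
  have "nrm (\<lambda>x. Z t i x - (Y x + N t i x)) = 0"
    using ip_self_eq_0_iff[OF L2_diff[OF ZL cspan_L2[OF YN]]] Y(2) by (simp add: nrm_def)
  then show "Z t i \<in> cspan GG"
    using YN by (intro cspan_closed[OF GG_L2 ZL] bexI[of _ "\<lambda>x. Y x + N t i x"]) simp_all
  assume U: "U \<in> L2"
  have "ip (Z t i) U = ip (\<lambda>x. Y x + N t i x) U"
    using Y(2) L2_measurable[OF U] by (intro ip_cong_AE) auto
  also have "\<dots> = ip Y U + ip (N t i) U"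
    by (rule ip_add_left[OF cspan_L2[OF YG] N_L2[OF t] U])
  finally show "ip (Z t i) U = integral {0..t} (\<lambda>s. ip (h s i) U) + ip (N t i) U"
    using wint_ip[OF Y(1) U] by simp
qed

lemma SZ_GG: "t \<le> T \<Longrightarrow> SZ t \<subseteq> cspan GG"
  using Z_decomp(1) one_cspan by (auto simp: SZ_def)

lemma SZ_L2: "t \<le> T \<Longrightarrow> SZ t \<subseteq> L2"
  using SZ_GG cspan_L2 by blast

lemma cZ_GG: "t \<le> T \<Longrightarrow> cZ t \<subseteq> cspan GG"
  unfolding cZ_def by (rule cspan_idem[OF GG_L2 SZ_GG])

lemma cZ_L2: "V \<in> cZ t \<Longrightarrow> V \<in> L2"
  unfolding cZ_def by (rule cspan_L2)

lemma cZ_mono: "s \<le> t \<Longrightarrow> cZ s \<subseteq> cZ t"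
  unfolding cZ_def by (intro cspan_mono) (auto simp: SZ_def)

lemma Z_cZ: "t \<le> T \<Longrightarrow> s \<in> {0..t} \<Longrightarrow> Z s i \<in> cZ t"
  unfolding cZ_def by (intro cspan_base SZ_L2) (auto simp: SZ_def)

lemma one_cZ: "t \<le> T \<Longrightarrow> (\<lambda>x. 1) \<in> cZ t"
  unfolding cZ_def by (intro cspan_base SZ_L2) (auto simp: SZ_def)

lemma cZ_orthI:
  assumes "t \<le> T" "U \<in> L2" "ip U (\<lambda>x. 1) = 0" "\<And>s i. s \<in> {0..t} \<Longrightarrow> ip U (Z s i) = 0" "V \<in> cZ t"
  shows "ip U V = 0"
  using assms(3,4) by (intro cspan_orth[OF SZ_L2[OF assms(1)] assms(2) _ assms(5)[unfolded cZ_def]]) (auto simp: SZ_def)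

lemma hat_cZ:
  assumes t: "t \<in> {0..T}" and Y: "Y \<in> cspan GG"
  shows "hat t Y \<in> cZ t" and "V \<in> cZ t \<Longrightarrow> ip (hat t Y) V = ip Y V"
proof -
  have S: "{Z s i | s i. s \<in> {0..t}} \<subseteq> cspan GG" using SZ_GG[of t] t by (auto simp: SZ_def)
  note proj = gaussian_cond_exp_projection[OF GG_L2 chf one_cspan(2) F_gen[OF t] S Y, folded SZ_def, folded cZ_def]
  show hat: "hat t Y \<in> cZ t" by (rule proj(1)) simp
  assume V: "V \<in> cZ t"
  have "ip (\<lambda>x. Y x - hat t Y x) V = 0" by (rule proj(2)[OF _ V]) simp
  then show "ip (hat t Y) V = ip Y V"
    using ip_diff_left[OF cspan_L2[OF Y] cZ_L2[OF hat] cZ_L2[OF V]] by simp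
qed

lemma hat_L2: "t \<in> {0..T} \<Longrightarrow> Y \<in> cspan GG \<Longrightarrow> hat t Y \<in> L2"
  using hat_cZ(1) cZ_L2 by blast

lemma hat_orth: "t \<in> {0..T} \<Longrightarrow> Y \<in> cspan GG \<Longrightarrow> V \<in> cZ t \<Longrightarrow> ip (\<lambda>x. Y x - hat t Y x) V = 0"
  using hat_cZ(2) hat_L2 cZ_L2 by (subst ip_diff_left) (auto intro: cspan_L2)

text \<open>A projection is a contraction. The difference is treated directly because
  \<open>hat\<close> yields a chosen version for each argument and is linear only up to null sets:
  the difference of the two filters is tested against itself.\<close>

lemma hat_nrm_diff:
  assumes t: "t \<in> {0..T}" and Y: "Y \<in> cspan GG" "Y' \<in> cspan GG"
  shows "nrm (\<lambda>x. hat t Y x - hat t Y' x) \<le> nrm (\<lambda>x. Y x - Y' x)"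
proof -
  let ?E = "\<lambda>x. hat t Y x - hat t Y' x"
  have "t \<le> T" using t by simp
  have E: "?E \<in> cZ t"
    using hat_cZ(1)[OF t] Y unfolding cZ_def by (intro cspan_diff[OF SZ_L2[OF \<open>t \<le> T\<close>]])
  note L = cspan_L2[OF Y(1)] cspan_L2[OF Y(2)] hat_L2[OF t Y(1)] hat_L2[OF t Y(2)] cZ_L2[OF E]
  have "nrm ?E * nrm ?E = ip ?E ?E" by (simp add: nrm_square[symmetric] power2_eq_square)
  also have "\<dots> = ip (\<lambda>x. Y x - Y' x) ?E"
    using hat_cZ(2)[OF t Y(1) E] hat_cZ(2)[OF t Y(2) E] L by (simp only: ip_diff_left)
  also have "\<dots> \<le> nrm (\<lambda>x. Y x - Y' x) * nrm ?E"
    using Cauchy_Schwarz_ip[OF L2_diff[OF L(1,2)] L(5)] by linarith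
  finally show ?thesis
    by (cases "nrm ?E = 0") (auto simp: mult_le_cancel_right less_le)
qed

lemma hat_nrm:
  assumes t: "t \<in> {0..T}" and Y: "Y \<in> cspan GG" shows "nrm (hat t Y) \<le> nrm Y"
proof -
  note L = cspan_L2[OF Y] hat_L2[OF t Y]
  have "nrm (hat t Y) * nrm (hat t Y) = ip Y (hat t Y)"
    using hat_cZ(2)[OF t Y hat_cZ(1)[OF t Y]] by (simp add: nrm_square[symmetric] power2_eq_square)
  also have "\<dots> \<le> nrm Y * nrm (hat t Y)"
    using Cauchy_Schwarz_ip[OF L] by linarith
  finally show ?thesis
    by (cases "nrm (hat t Y) = 0") (auto simp: mult_le_cancel_right less_le)
qed

text \<open>The pairing of \<open>N t\<close> with \<open>Z s\<close> reduces to the noise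
  covariance \<open>min t s\<close>, which stays equal to \<open>s\<close> for all times after
  \<open>s\<close>; so later noise increments are orthogonal to the observed past.\<close>

lemma N_incr_orth:
  assumes t: "0 \<le> t" "t \<le> v" "v \<le> T" and V: "V \<in> cZ t"
  shows "ip (N v i) V = ip (N t i) V"
proof -
  have tv: "t \<in> {0..T}" "v \<in> {0..T}" "t \<le> T" using t by auto
  note NL = N_L2[OF tv(1)] N_L2[OF tv(2)]
  have "ip (\<lambda>x. N v i x - N t i x) V = 0"
  proof (rule cZ_orthI[OF tv(3) _ _ _ V])
    show "(\<lambda>x. N v i x - N t i x) \<in> L2" using NL by auto
    show "ip (\<lambda>x. N v i x - N t i x) (\<lambda>x. 1) = 0"
      using NL N_orth_cspan[OF tv(1) one_cspan(1)] N_orth_cspan[OF tv(2) one_cspan(1)] by (simp add: ip_diff_left)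
    fix s j assume s: "s \<in> {0..t}"
    then have s': "s \<in> {0..T}" "min t s = s" "min v s = s" using t by auto
    have "ip (N r i) (Z s j) = ip (N r i) (N s j)" if r: "r \<in> {0..T}" for r
    proof -
      have "integral {0..s} (\<lambda>u. ip (h u j) (N r i)) = integral {0..s} (\<lambda>u. 0)"
        using s' by (intro integral_cong N_orth_cspan'[OF r] h_GX) auto
      then show ?thesis
        using Z_decomp(3)[OF s'(1) N_L2[OF r]] by (simp add: ip_commute[of "N r i"])
    qed
    then show "ip (\<lambda>x. N v i x - N t i x) (Z s j) = 0"
      using NL Z_decomp(2)[OF s'(1)] tv s' by (simp add: ip_diff_left N_cov)
  qed
  then show ?thesis using NL cZ_L2[OF V] by (simp add: ip_diff_left)
qed

text \<open>The noise makes a linear functional of the observation at least as large in mean square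
  as its integrand; so pairings with the observation control the norm in the observed span.\<close>

lemma observed_norm_bound:
  assumes u: "u \<in> {0..T}" and D: "D \<in> cZ u" and D1: "ip D (\<lambda>x. 1) = 0"
    and DZ: "\<And>v i. v \<in> {0..u} \<Longrightarrow> ip D (Z v i) = integral {0..v} (\<phi> i)"
    and \<phi>: "\<And>i. \<phi> i integrable_on {0..u}" "\<And>i. (\<lambda>s. (\<phi> i s)\<^sup>2) integrable_on {0..u}"
  shows "ip D D \<le> (\<Sum>i\<in>UNIV. integral {0..u} (\<lambda>s. (\<phi> i s)\<^sup>2))"
proof -
  let ?\<Phi> = "\<Sum>i\<in>UNIV. integral {0..u} (\<lambda>s. (\<phi> i s)\<^sup>2)"
  have DL: "D \<in> L2" using cZ_L2[OF D] .
  have uT: "u \<le> T" using u by simp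
  \<comment> \<open>Each combination \<open>V\<close> of observations is a signal part
    \<open>A\<close> plus a noise part \<open>B\<close>, and \<open>B\<close> behaves like a Wiener
    integral of the step function \<open>f\<close>: its pairings with the noise are integrals of
    \<open>f\<close>, its squared norm is the integral of f^2. Everything about \<open>f\<close> is
    recorded through integrals, so that the induction can add one observation at a time.\<close>
  have dec: "\<exists>A B f. A \<in> cspan GX \<and> B \<in> L2 \<and> (\<forall>U\<in>L2. ip V U = ip A U + ip B U) \<and> (\<forall>Y\<in>cspan GX. ip B Y = 0) \<and>
      (\<forall>i. f i integrable_on {0..u} \<and> (\<lambda>s. (f i s)\<^sup>2) integrable_on {0..u} \<and> (\<lambda>s. f i s * \<phi> i s) integrable_on {0..u}) \<and>
      (\<forall>i. \<forall>v\<in>{0..u}. ip B (N v i) = integral {0..v} (f i)) \<and>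
      ip B B = (\<Sum>i\<in>UNIV. integral {0..u} (\<lambda>s. (f i s)\<^sup>2)) \<and>
      ip D V = (\<Sum>i\<in>UNIV. integral {0..u} (\<lambda>s. f i s * \<phi> i s))"
    if "V \<in> lin (SZ u)" for V
    using that
  proof induction
    case zero
    show ?case
      by (rule exI[of _ "\<lambda>_. 0"], rule exI[of _ "\<lambda>_. 0"], rule exI[of _ "\<lambda>_ _. 0"]) (simp add: cspan_zero[OF GX_L2] Henstock_Kurzweil_Integration.integrable_0)
  next
    case (step g V c)
    then obtain A B f where AB: "A \<in> cspan GX" "B \<in> L2" "\<And>U. U \<in> L2 \<Longrightarrow> ip V U = ip A U + ip B U"
      "\<And>Y. Y \<in> cspan GX \<Longrightarrow> ip B Y = 0"
      and fi: "\<And>i. f i integrable_on {0..u}" "\<And>i. (\<lambda>s. (f i s)\<^sup>2) integrable_on {0..u}" "\<And>i. (\<lambda>s. f i s * \<phi> i s) integrable_on {0..u}"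
      and BN: "\<And>i v. v \<in> {0..u} \<Longrightarrow> ip B (N v i) = integral {0..v} (f i)"
      and BB: "ip B B = (\<Sum>i\<in>UNIV. integral {0..u} (\<lambda>s. (f i s)\<^sup>2))"
      and DV: "ip D V = (\<Sum>i\<in>UNIV. integral {0..u} (\<lambda>s. f i s * \<phi> i s))"
      by blast
    have VL: "V \<in> L2" using lin_L2[OF SZ_L2[OF uT] step.hyps(2)] .
    have AL: "A \<in> L2" using cspan_L2[OF AB(1)] .
    show ?case
    proof (cases "g = (\<lambda>x. 1)")
      case True
      have A': "(\<lambda>x. c * 1 + A x) \<in> cspan GX"
        by (intro cspan_add[OF GX_L2] cspan_scale[OF GX_L2] one_cspan AB)
      have e1: "\<forall>U\<in>L2. ip (\<lambda>x. c * g x + V x) U = ip (\<lambda>x. c * 1 + A x) U + ip B U"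
        unfolding True using VL AL AB(3) by (simp add: ip_add_left)
      have e2: "ip D (\<lambda>x. c * g x + V x) = ip D V"
      proof -
        have "ip D (\<lambda>x. c * g x + V x) = c * ip D (\<lambda>x. 1) + ip D V"
          unfolding True using DL VL by (subst ip_add_right) (auto simp only: L2_scale L2_const ip_scale_right)
        then show ?thesis using D1 by simp
      qed
      show ?thesis
        using A' e1 e2 AB(2,4) fi BN BB DV by (intro exI[of _ "\<lambda>x. c * 1 + A x"] exI[of _ B] exI[of _ f]) auto
    next
      case False
      then obtain t j where t: "t \<in> {0..u}" and g: "g = Z t j" using step.hyps(1) by (auto simp: SZ_def)
      then have tT: "t \<in> {0..T}" using uT by auto
      note NL = N_L2[OF tT] and ZL = Z_decomp(2)[OF tT]
      obtain Y where Y: "wint (\<lambda>s. h s j) t Y" using Z_eq[OF tT] by blast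
      have YG: "Y \<in> cspan GX"
        by (rule wint_cspan[OF GX_L2 _ Y]) (use tT h_GX in auto)
      note YL = cspan_L2[OF YG]
      define ci where "ci i = (if i = j then c else 0)" for i
      \<comment> \<open>Adding \<open>c\<close> times coordinate \<open>j\<close> of the observation
        at time \<open>t\<close> adds the integrand \<open>c\<close> on \<open>[0, t]\<close> in
        that coordinate.\<close>
      define f' where "f' i s = f i s + ci i * indicator {0..t} s" for i s
      have ind: "(indicator {0..t} :: real \<Rightarrow> real) integrable_on {0..u}" "integral {0..u} (indicator {0..t}) = t"
        using indicator_integral[of "\<lambda>_. 1" u t] t by auto
      have A': "(\<lambda>x. c * Y x + A x) \<in> cspan GX"
        by (intro cspan_add[OF GX_L2] cspan_scale[OF GX_L2] YG AB)
      have B': "(\<lambda>x. c * N t j x + B x) \<in> L2" using AB NL by auto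
      have e1: "ip (\<lambda>x. c * g x + V x) U = ip (\<lambda>x. c * Y x + A x) U + ip (\<lambda>x. c * N t j x + B x) U"
        if U: "U \<in> L2" for U
        unfolding g using U VL AL AB(2,3) NL YL ZL Z_decomp(3)[OF tT U, of j] wint_ip[OF Y U]
        by (simp add: ip_add_left ip_scale_left algebra_simps)
      have e2: "ip (\<lambda>x. c * N t j x + B x) Q = 0" if Q: "Q \<in> cspan GX" for Q
        using AB(2) AB(4)[OF Q] NL N_orth_cspan[OF tT Q] cspan_L2[OF Q] by (simp add: ip_add_left ip_scale_left)
      have fi1: "(\<lambda>s. ci i * indicator {0..t} s) integrable_on {0..u}" for i
        using integrable_on_mult_right[OF ind(1)] by simp
      have fi2: "(\<lambda>s. (2 * ci i) * (indicator {0..t} s * f i s)) integrable_on {0..u}" for i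
        by (rule integrable_on_mult_right[OF indicator_integral(1)[OF fi(1) t]])
      have fi3: "(\<lambda>s. (ci i)\<^sup>2 * indicator {0..t} s) integrable_on {0..u}" for i
        using integrable_on_mult_right[OF ind(1)] by simp
      have fi4: "(\<lambda>s. ci i * (indicator {0..t} s * \<phi> i s)) integrable_on {0..u}" for i
        by (rule integrable_on_mult_right[OF indicator_integral(1)[OF \<phi>(1) t]])
      have f'2: "(\<lambda>s. (f' i s)\<^sup>2) = (\<lambda>s. (f i s)\<^sup>2 + ((2 * ci i) * (indicator {0..t} s * f i s) + (ci i)\<^sup>2 * indicator {0..t} s))" for i
        by (auto simp: f'_def fun_eq_iff power2_sum indicator_def power2_eq_square algebra_simps)
      have f'\<phi>: "(\<lambda>s. f' i s * \<phi> i s) = (\<lambda>s. f i s * \<phi> i s + ci i * (indicator {0..t} s * \<phi> i s))" for i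
        by (auto simp: f'_def fun_eq_iff algebra_simps)
      have int': "f' i integrable_on {0..u}" "(\<lambda>s. (f' i s)\<^sup>2) integrable_on {0..u}" "(\<lambda>s. f' i s * \<phi> i s) integrable_on {0..u}" for i
      proof -
        show "f' i integrable_on {0..u}"
          using Henstock_Kurzweil_Integration.integrable_add[OF fi(1) fi1] by (simp add: f'_def[abs_def])
        show "(\<lambda>s. (f' i s)\<^sup>2) integrable_on {0..u}" unfolding f'2
          by (intro Henstock_Kurzweil_Integration.integrable_add fi fi2 fi3)
        show "(\<lambda>s. f' i s * \<phi> i s) integrable_on {0..u}" unfolding f'\<phi>
          by (intro Henstock_Kurzweil_Integration.integrable_add fi fi4)
      qed
      have e3: "ip (\<lambda>x. c * N t j x + B x) (N v i) = integral {0..v} (f' i)" if v: "v \<in> {0..u}" for v i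
      proof -
        have vT: "v \<in> {0..T}" using v uT by auto
        have "integral {0..v} (\<lambda>s. ci i * indicator {0..t} s) = ci i * min t v"
        proof -
          have "integral {0..v} (indicator {0..t} :: real \<Rightarrow> real) = min t v"
          proof (cases "t \<le> v")
            case True
            then show ?thesis using indicator_integral(2)[of "\<lambda>_. 1" v t] t by auto
          next
            case False
            then have "integral {0..v} (indicator {0..t} :: real \<Rightarrow> real) = integral {0..v} (\<lambda>_. 1)"
              by (intro integral_cong) (auto simp: indicator_def)
            then show ?thesis using False v by simp
          qed
          then show ?thesis by simp
        qed
        moreover have "integral {0..v} (f' i) = integral {0..v} (f i) + integral {0..v} (\<lambda>s. ci i * indicator {0..t} s)"
          unfolding f'_def[abs_def] using v
          by (intro Henstock_Kurzweil_Integration.integral_add integrable_on_subinterval[OF fi(1)] integrable_on_subinterval[OF fi1]) auto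
        ultimately show ?thesis
          using AB(2) NL N_L2[OF vT] BN[OF v, of i] N_cov[OF tT vT, of j i]
          by (cases "i = j") (auto simp: ip_add_left ip_scale_left ci_def)
      qed
      have e4: "ip (\<lambda>x. c * N t j x + B x) (\<lambda>x. c * N t j x + B x) = (\<Sum>i\<in>UNIV. integral {0..u} (\<lambda>s. (f' i s)\<^sup>2))"
      proof -
        have "integral {0..u} (\<lambda>s. (f' i s)\<^sup>2) = integral {0..u} (\<lambda>s. (f i s)\<^sup>2) + ((2 * ci i) * integral {0..t} (f i) + (ci i)\<^sup>2 * t)" for i
          unfolding f'2
          by (subst Henstock_Kurzweil_Integration.integral_add[OF fi(2) Henstock_Kurzweil_Integration.integrable_add[OF fi2 fi3]],
              subst Henstock_Kurzweil_Integration.integral_add[OF fi2 fi3])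
            (simp add: ind(2) indicator_integral(2)[OF fi(1) t])
        then have "(\<Sum>i\<in>UNIV. integral {0..u} (\<lambda>s. (f' i s)\<^sup>2)) = ip B B + (\<Sum>i\<in>UNIV. (2 * ci i) * integral {0..t} (f i) + (ci i)\<^sup>2 * t)"
          by (simp add: sum.distrib BB)
        also have "(\<Sum>i\<in>UNIV. (2 * ci i) * integral {0..t} (f i) + (ci i)\<^sup>2 * t) = (\<Sum>i\<in>UNIV. if i = j then 2 * c * integral {0..t} (f j) + c\<^sup>2 * t else 0)"
          by (intro sum.cong) (auto simp: ci_def)
        also have "\<dots> = 2 * c * ip B (N t j) + c\<^sup>2 * t" using BN[OF t, of j] by simp
        finally show ?thesis
          using AB(2) NL N_cov[OF tT tT, of j j] ip_commute[of "N t j" B]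
          by (simp add: ip_add_left ip_add_right ip_scale_left ip_scale_right power2_eq_square algebra_simps)
      qed
      have e5: "ip D (\<lambda>x. c * g x + V x) = (\<Sum>i\<in>UNIV. integral {0..u} (\<lambda>s. f' i s * \<phi> i s))"
      proof -
        have "integral {0..u} (\<lambda>s. f' i s * \<phi> i s) = integral {0..u} (\<lambda>s. f i s * \<phi> i s) + ci i * integral {0..t} (\<phi> i)" for i
          unfolding f'\<phi> by (subst Henstock_Kurzweil_Integration.integral_add[OF fi(3) fi4])
            (simp add: indicator_integral(2)[OF \<phi>(1) t])
        then have "(\<Sum>i\<in>UNIV. integral {0..u} (\<lambda>s. f' i s * \<phi> i s)) = ip D V + (\<Sum>i\<in>UNIV. ci i * integral {0..t} (\<phi> i))"
          by (simp add: sum.distrib DV)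
        also have "(\<Sum>i\<in>UNIV. ci i * integral {0..t} (\<phi> i)) = (\<Sum>i\<in>UNIV. if i = j then c * integral {0..t} (\<phi> j) else 0)"
          by (intro sum.cong) (auto simp: ci_def)
        finally show ?thesis unfolding g using DL VL ZL DZ[OF t, of j]
          by (simp add: ip_add_right ip_scale_right)
      qed
      show ?thesis
        using A' B' e1 e2 int' e3 e4 e5
        by (intro exI[of _ "\<lambda>x. c * Y x + A x"] exI[of _ "\<lambda>x. c * N t j x + B x"] exI[of _ f'] conjI ballI allI)
    qed
  qed
  \<comment> \<open>The two parts of \<open>V\<close> are orthogonal, so
    \<open>ip B B \<le> ip V V\<close>; the rest is 2 f \<phi> \<le> f^2 + \<phi>^2. Letting
    \<open>V\<close> tend to \<open>D\<close> yields \<open>ip D D\<close> on both sides with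
    factors 1 and 1/2, which is the claim.\<close>
  have bound: "ip D V \<le> (ip V V + ?\<Phi>) / 2" if V: "V \<in> lin (SZ u)" for V
  proof -
    obtain A B f where AB: "A \<in> cspan GX" "B \<in> L2" "\<And>U. U \<in> L2 \<Longrightarrow> ip V U = ip A U + ip B U"
      "\<And>Y. Y \<in> cspan GX \<Longrightarrow> ip B Y = 0"
      and fi: "\<And>i. (\<lambda>s. (f i s)\<^sup>2) integrable_on {0..u}" "\<And>i. (\<lambda>s. f i s * \<phi> i s) integrable_on {0..u}"
      and BB: "ip B B = (\<Sum>i\<in>UNIV. integral {0..u} (\<lambda>s. (f i s)\<^sup>2))"
      and DV: "ip D V = (\<Sum>i\<in>UNIV. integral {0..u} (\<lambda>s. f i s * \<phi> i s))"
      using dec[OF V] by blast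
    have VL: "V \<in> L2" using lin_L2[OF SZ_L2[OF uT] V] .
    have VV: "ip B B \<le> ip V V"
      using AB(3)[OF VL] AB(3)[OF cspan_L2[OF AB(1)]] AB(3)[OF AB(2)] AB(4)[OF AB(1)]
        ip_commute[of A V] ip_commute[of B V] ip_commute[of A B] ip_self_nonneg[of A] by linarith
    have "integral {0..u} (\<lambda>s. f i s * \<phi> i s) \<le> (integral {0..u} (\<lambda>s. (f i s)\<^sup>2) + integral {0..u} (\<lambda>s. (\<phi> i s)\<^sup>2)) / 2" for i
    proof -
      have "integral {0..u} (\<lambda>s. f i s * \<phi> i s) \<le> integral {0..u} (\<lambda>s. (1/2) * ((f i s)\<^sup>2 + (\<phi> i s)\<^sup>2))"
      proof (rule integral_le[OF fi(2)])
        show "(\<lambda>s. (1/2) * ((f i s)\<^sup>2 + (\<phi> i s)\<^sup>2)) integrable_on {0..u}"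
          by (intro integrable_on_mult_right Henstock_Kurzweil_Integration.integrable_add fi(1) \<phi>(2))
        show "f i s * \<phi> i s \<le> (1/2) * ((f i s)\<^sup>2 + (\<phi> i s)\<^sup>2)" for s
          using zero_le_power2[of "f i s - \<phi> i s"] by (simp add: power2_diff)
      qed
      also have "\<dots> = (1/2) * (integral {0..u} (\<lambda>s. (f i s)\<^sup>2) + integral {0..u} (\<lambda>s. (\<phi> i s)\<^sup>2))"
        by (simp only: integral_mult_right Henstock_Kurzweil_Integration.integral_add[OF fi(1) \<phi>(2)])
      finally show ?thesis by simp
    qed
    then have "ip D V \<le> (\<Sum>i\<in>UNIV. (integral {0..u} (\<lambda>s. (f i s)\<^sup>2) + integral {0..u} (\<lambda>s. (\<phi> i s)\<^sup>2)) / 2)"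
      unfolding DV by (intro sum_mono)
    also have "\<dots> = (ip B B + ?\<Phi>) / 2"
      by (simp add: sum_divide_distrib[symmetric] sum.distrib BB)
    also have "\<dots> \<le> (ip V V + ?\<Phi>) / 2"
      by (intro divide_right_mono add_right_mono VV) simp
    finally show ?thesis .
  qed
  have "\<exists>V\<in>lin (SZ u). nrm (\<lambda>x. D x - V x) < 1 / Suc n" for n
    using D unfolding cZ_def cspan_def by auto
  then obtain V where V: "\<And>n. V n \<in> lin (SZ u)" "\<And>n. nrm (\<lambda>x. D x - V n x) < 1 / Suc n" by metis
  have VL: "V n \<in> L2" for n using lin_L2[OF SZ_L2[OF uT] V(1)] .
  have lim0: "(\<lambda>n. nrm (\<lambda>x. V n x - D x)) \<longlonglongrightarrow> 0"
    using V(2) nrm_commute[of D] by (intro Lim_null_comparison[OF always_eventually LIMSEQ_inverse_real_of_nat])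
      (auto simp: less_imp_le inverse_eq_divide)
  have l1: "(\<lambda>n. ip D (V n)) \<longlonglongrightarrow> ip D D"
    by (rule ip_tendsto) (use DL VL lim0 in simp_all)
  have l2: "(\<lambda>n. (ip (V n) (V n) + ?\<Phi>) / 2) \<longlonglongrightarrow> (ip D D + ?\<Phi>) / 2"
    by (intro tendsto_intros ip_tendsto) (use DL VL lim0 in simp_all)
  have "ip D D \<le> (ip D D + ?\<Phi>) / 2"
    by (rule LIMSEQ_le[OF l1 l2]) (use bound[OF V(1)] in blast)
  then show ?thesis by simp
qed

end

section \<open>Step functions on half-open cells\<close>

lemma indicator_greaterThanAtMost_integral:
  fixes f :: "real \<Rightarrow> real"
  assumes f: "f integrable_on {0..u}" and ab: "0 \<le> a" "a \<le> b" "b \<le> u"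
  shows "(\<lambda>s. indicator {a<..b} s * f s) integrable_on {0..u}"
    and "integral {0..u} (\<lambda>s. indicator {a<..b} s * f s) = integral {0..b} f - integral {0..a} f"
proof -
  have ab': "a \<in> {0..u}" "b \<in> {0..u}" using ab by auto
  note A = indicator_integral[OF f ab'(1)] and B = indicator_integral[OF f ab'(2)]
  have "((\<lambda>s. indicator {0..b} s * f s - indicator {0..a} s * f s) has_integral integral {0..b} f - integral {0..a} f) {0..u}"
    using A B by (intro has_integral_diff) (metis integrable_integral)+
  then have "((\<lambda>s. indicator {a<..b} s * f s) has_integral integral {0..b} f - integral {0..a} f) {0..u}"
    by (rule has_integral_eq[rotated]) (use ab in \<open>auto simp: indicator_def\<close>)
  then show "(\<lambda>s. indicator {a<..b} s * f s) integrable_on {0..u}"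
    "integral {0..u} (\<lambda>s. indicator {a<..b} s * f s) = integral {0..b} f - integral {0..a} f"
    by (auto simp: integrable_on_def integral_unique)
qed

lemma integral_indicator_min:
  fixes a b v :: real
  assumes "0 \<le> a" "a \<le> b" "0 \<le> v"
  shows "(indicat_real {a<..b} has_integral min b v - min a v) {0..v}"
proof -
  have i: "(\<lambda>s. 1::real) integrable_on {0..v}" by (rule integrable_continuous_interval) simp
  have "0 \<le> min a v" "min a v \<le> min b v" "min b v \<le> v" using assms by auto
  note I = indicator_greaterThanAtMost_integral[OF i this]
  have "((\<lambda>s. indicator {min a v<..min b v} s * (1::real)) has_integral min b v - min a v) {0..v}"
    using integrable_integral[OF I(1)] unfolding I(2) using assms by simp
  then show ?thesis
    by (rule has_integral_eq[rotated]) (auto simp: indicator_def)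
qed

lemma bounded_borel_integrable_on:
  fixes f :: "real \<Rightarrow> real"
  assumes m: "(\<lambda>s. indicator {0..u} s * f s) \<in> borel_measurable borel"
    and b: "\<And>s. s \<in> {0..u} \<Longrightarrow> \<bar>f s\<bar> \<le> C"
  shows "f integrable_on {0..u}"
proof -
  have "set_integrable lborel {0..u} (\<lambda>s. C)"
    by (rule borel_integrable_atLeastAtMost') (rule continuous_on_const)
  then have "set_integrable lborel {0..u} f"
    unfolding set_integrable_def
  proof (rule Bochner_Integration.integrable_bound)
    show "AE s in lborel. norm (indicator {0..u} s *\<^sub>R f s) \<le> norm (indicator {0..u} s *\<^sub>R C)"
      using b by (intro AE_I2) (auto simp: indicator_def, fastforce)
  qed (use m in simp)
  then show ?thesis by (rule set_borel_integral_eq_integral(1))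
qed

text \<open>The left-open cells cover \<open>]0, t]\<close> without overlap. Time 0 lies in none of
  them, which is why the approximation results below exclude it.\<close>

lemma uniform_partition_step:
  fixes g :: "nat \<Rightarrow> 'b::real_vector"
  assumes t: "0 < t" and n: "0 < n" and s: "s \<in> {0<..t}"
  obtains k where "k < n" "t * real k / real n < s" "s \<le> t * real (Suc k) / real n"
    "(\<Sum>j<n. indicat_real {t * real j / real n<..t * real (Suc j) / real n} s *\<^sub>R g j) = g k"
proof -
  define x where "x = s * real n / t"
  have x: "0 < x" "x \<le> real n" using t n s by (auto simp: x_def field_simps)
  \<comment> \<open>Cells are open on the left, so the index is the ceiling minus one, not the
    floor.\<close>
  define k where "k = nat (\<lceil>x\<rceil> - 1)"
  have k1: "real k < x" "x \<le> real k + 1" and k: "int k = \<lceil>x\<rceil> - 1" using x unfolding k_def by linarith+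
  have cell: "s \<in> {t * real j / real n<..t * real (Suc j) / real n} \<longleftrightarrow> j = k" for j
  proof -
    have "s \<in> {t * real j / real n<..t * real (Suc j) / real n} \<longleftrightarrow> real j < x \<and> x \<le> real j + 1"
      using t n by (auto simp: x_def field_simps)
    also have "\<dots> \<longleftrightarrow> j = k" using k1 by auto
    finally show ?thesis .
  qed
  have kn: "k < n" using k1 x by linarith
  have "(\<Sum>j<n. indicat_real {t * real j / real n<..t * real (Suc j) / real n} s *\<^sub>R g j) = (\<Sum>j<n. if j = k then g k else 0)"
  proof (intro sum.cong refl)
    fix j
    have "indicat_real {t * real j / real n<..t * real (Suc j) / real n} s = (if j = k then 1 else 0)"
      unfolding indicator_def cell by simp
    then show "indicat_real {t * real j / real n<..t * real (Suc j) / real n} s *\<^sub>R g j = (if j = k then g k else 0)"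
      by (simp only:) simp
  qed
  also have "\<dots> = g k" using kn by simp
  finally show ?thesis using that[OF kn] cell[of k] unfolding greaterThanAtMost_iff by blast
qed

context prob_space
begin

lemma ip_null: "X \<in> L2 \<Longrightarrow> Y \<in> L2 \<Longrightarrow> ip X X = 0 \<Longrightarrow> ip X Y = 0"
  using Cauchy_Schwarz_ip[of X Y] by (simp add: nrm_def)

lemma Cauchy_Schwarz_ip_sq: "X \<in> L2 \<Longrightarrow> Y \<in> L2 \<Longrightarrow> (ip X Y)\<^sup>2 \<le> ip X X * ip Y Y"
proof -
  assume "X \<in> L2" "Y \<in> L2"
  then have "\<bar>ip X Y\<bar>\<^sup>2 \<le> (nrm X * nrm Y)\<^sup>2" by (intro power_mono Cauchy_Schwarz_ip) auto
  then show ?thesis by (simp add: power_mult_distrib nrm_square)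
qed

end

context filtering
begin

lemma h_bound: obtains C where "C \<ge> 0" "\<And>s i. s \<in> {0..T} \<Longrightarrow> nrm (h s i) \<le> C"
proof -
  have "\<exists>C\<ge>0. \<forall>s\<in>{0..T}. nrm (h s i) \<le> C" for i
    using L2cont_bounded[OF h_cont[of i]] by metis
  then obtain C where C: "\<And>i. C i \<ge> 0" "\<And>i s. s \<in> {0..T} \<Longrightarrow> nrm (h s i) \<le> C i" by metis
  show ?thesis
  proof (rule that[of "sum C UNIV"])
    show "nrm (h s i) \<le> sum C UNIV" if "s \<in> {0..T}" for s i
      using C(2)[OF that, of i] member_le_sum[of i UNIV C] C(1) by fastforce
  qed (simp add: sum_nonneg C(1))
qed

lemma h_L2: "s \<in> {0..T} \<Longrightarrow> h s i \<in> L2"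
  using h_GX cspan_L2 by blast

lemma ip_Z_signal:
  assumes "t \<in> {0..T}" "Y \<in> cspan GX"
  shows "ip Y (Z t i) = integral {0..t} (\<lambda>s. ip Y (h s i))"
  using Z_decomp(3)[OF assms(1) cspan_L2[OF assms(2)]] N_orth_cspan[OF assms]
  by (simp add: ip_commute[of Y])

lemma ip_Z:
  assumes "t \<in> {0..T}" "U \<in> L2"
  shows "ip U (Z t i) = integral {0..t} (\<lambda>s. ip U (h s i)) + ip U (N t i)"
  using Z_decomp(3)[OF assms] by (simp add: ip_commute[of U])

text \<open>The increment of the filter of a fixed \<open>Y\<close> is orthogonal to the observation
  up to \<open>t\<close>; afterwards its pairings are integrals of
  \<open>ip (Y - hat t Y) (h s i)\<close>. So \<open>observed_norm_bound\<close> applies with an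
  integrand supported on \<open>]t, u]\<close>. The factor 2 is the crude bound of the error
  \<open>Y - hat t Y\<close> by twice the norm of \<open>Y\<close>.\<close>

lemma hat_incr:
  assumes C: "\<And>s i. s \<in> {0..T} \<Longrightarrow> nrm (h s i) \<le> C"
    and t: "0 \<le> t" "t \<le> u" "u \<le> T" and Y: "Y \<in> cspan GX"
  shows "nrm (\<lambda>w. hat u Y w - hat t Y w) \<le> 2 * nrm Y * C * sqrt CARD('i) * sqrt (u - t)"
proof -
  have tT: "t \<in> {0..T}" "u \<in> {0..T}" "t \<in> {0..u}" using t by auto
  have C0: "0 \<le> C" using order_trans[OF nrm_nonneg C[OF tT(1)]] .
  have YG: "Y \<in> cspan GG" using Y GX_GG by blast
  note hatc = hat_cZ[OF tT(1) YG] hat_cZ[OF tT(2) YG]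
  note L = cspan_L2[OF Y] hat_L2[OF tT(1) YG] hat_L2[OF tT(2) YG]
  let ?D = "\<lambda>w. hat u Y w - hat t Y w" and ?E = "\<lambda>w. Y w - hat t Y w"
  have DL: "?D \<in> L2" and EL: "?E \<in> L2" using L by auto
  have htu: "hat t Y \<in> cZ u" using hatc(1) cZ_mono[OF t(2)] by blast
  have D: "?D \<in> cZ u"
    using hatc(3) htu unfolding cZ_def by (intro cspan_diff SZ_L2 t)
  define g where "g i s = ip ?E (h s i)" for i s
  have gc: "continuous_on {0..u} (g i)" for i
    unfolding g_def by (rule ip_continuous_on2[OF L2cont_subset[OF h_cont] EL]) (use t in auto)
  have gi: "g i integrable_on {0..u}" "(\<lambda>s. (g i s)\<^sup>2) integrable_on {0..u}" for i
    by (intro integrable_continuous_interval gc continuous_intros)+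
  define \<phi> where "\<phi> i s = g i s - indicator {0..t} s * g i s" for i s
  have \<phi>2: "(\<phi> i s)\<^sup>2 = (g i s)\<^sup>2 - indicator {0..t} s * (g i s)\<^sup>2" for i s
    by (simp add: \<phi>_def indicator_def)
  note I1 = indicator_integral[OF gi(1) tT(3)] and I2 = indicator_integral[OF gi(2) tT(3)]
  have "ip ?D ?D \<le> (\<Sum>i\<in>UNIV. integral {0..u} (\<lambda>s. (\<phi> i s)\<^sup>2))"
  proof (rule observed_norm_bound[OF tT(2) D])
    show "ip ?D (\<lambda>w. 1) = 0"
      using hatc(2)[OF one_cZ] hatc(4)[OF one_cZ] L tT by (simp add: ip_diff_left)
    show "\<phi> i integrable_on {0..u}" for i
      unfolding \<phi>_def[abs_def] by (intro Henstock_Kurzweil_Integration.integrable_diff gi I1)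
    show "(\<lambda>s. (\<phi> i s)\<^sup>2) integrable_on {0..u}" for i
      unfolding \<phi>2 by (intro Henstock_Kurzweil_Integration.integrable_diff gi I2)
    fix v i assume v: "v \<in> {0..u}"
    then have vT: "v \<in> {0..T}" using t by auto
    have ZL: "Z v i \<in> L2" using Z_decomp(2)[OF vT] .
    have Du: "ip ?D (Z v i) = ip Y (Z v i) - ip (hat t Y) (Z v i)"
      using L ZL hatc(4)[OF Z_cZ[OF t(3) v]] by (simp add: ip_diff_left)
    show "ip ?D (Z v i) = integral {0..v} (\<phi> i)"
    proof (cases "v \<le> t")
      case True
      have "ip ?D (Z v i) = 0"
        unfolding Du using hatc(2)[OF Z_cZ, of v i] True v t by simp
      moreover have "integral {0..v} (\<phi> i) = integral {0..v} (\<lambda>_. 0)"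
        by (intro integral_cong) (use True in \<open>auto simp: \<phi>_def\<close>)
      ultimately show ?thesis by simp
    next
      case False
      have tv: "t \<in> {0..v}" using False t by auto
      have hE: "integral {0..r} (g i) = integral {0..r} (\<lambda>s. ip Y (h s i)) - integral {0..r} (\<lambda>s. ip (hat t Y) (h s i))"
        if r: "r \<in> {0..T}" for r
      proof -
        have c: "L2cont {0..r} (\<lambda>s. h s i)" by (rule L2cont_subset[OF h_cont]) (use r in auto)
        have "integral {0..r} (g i) = integral {0..r} (\<lambda>s. ip Y (h s i) - ip (hat t Y) (h s i))"
          unfolding g_def by (intro integral_cong ip_diff_left L h_L2) (use r in auto)
        also have "\<dots> = integral {0..r} (\<lambda>s. ip Y (h s i)) - integral {0..r} (\<lambda>s. ip (hat t Y) (h s i))"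
          by (intro Henstock_Kurzweil_Integration.integral_diff integrable_continuous_interval ip_continuous_on2[OF c] L)
        finally show ?thesis .
      qed
      have "ip ?D (Z v i) = integral {0..v} (g i) - ip (hat t Y) (N v i)"
        unfolding Du ip_Z_signal[OF vT Y] ip_Z[OF vT L(2)] hE[OF vT] by simp
      moreover have "ip (hat t Y) (N v i) = ip (hat t Y) (N t i)"
        using N_incr_orth[of t v "hat t Y" i] hatc(1) t False vT by (simp add: ip_commute[of "hat t Y"])
      moreover have "ip (hat t Y) (N t i) = integral {0..t} (g i)"
        using hatc(2)[OF Z_cZ, of t i] ip_Z_signal[OF tT(1) Y, of i] ip_Z[OF tT(1) L(2), of i] hE[OF tT(1)] t by simp
      moreover have "integral {0..v} (\<phi> i) = integral {0..v} (g i) - integral {0..t} (g i)"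
      proof -
        have gv: "g i integrable_on {0..v}" by (rule integrable_on_subinterval[OF gi(1)]) (use v in auto)
        note I = indicator_integral[OF gv tv]
        show ?thesis unfolding \<phi>_def[abs_def]
          by (subst Henstock_Kurzweil_Integration.integral_diff[OF gv I(1)]) (simp add: I(2))
      qed
      ultimately show ?thesis by simp
    qed
  qed
  also have "\<dots> \<le> (\<Sum>i\<in>(UNIV::'i set). (2 * nrm Y * C)\<^sup>2 * (u - t))"
  proof (rule sum_mono)
    fix i
    have g_le: "(g i s)\<^sup>2 \<le> (2 * nrm Y * C)\<^sup>2" if s: "s \<in> {0..u}" for s
    proof -
      have sT: "s \<in> {0..T}" using s t by auto
      have "nrm ?E \<le> nrm Y + nrm (hat t Y)"
        using nrm_triangle[OF L(1) L2_minus[OF L(2)]] nrm_minus[of "hat t Y"] by simp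
      also have "\<dots> \<le> 2 * nrm Y" using hat_nrm[OF tT(1) YG] by simp
      finally have "nrm ?E * nrm (h s i) \<le> 2 * nrm Y * C" using C[OF sT, of i] by (intro mult_mono) auto
      then have "\<bar>g i s\<bar> \<le> 2 * nrm Y * C"
        using Cauchy_Schwarz_ip[OF EL h_L2[OF sT], of i] by (simp add: g_def)
      then show ?thesis by (rule power2_le_iff_abs_le[THEN iffD2, rotated]) (simp add: C0)
    qed
    have gi': "(\<lambda>s. (g i s)\<^sup>2) integrable_on {t..u}"
      by (rule integrable_on_subinterval[OF gi(2)]) (use t in auto)
    have "integral {0..u} (\<lambda>s. (\<phi> i s)\<^sup>2) = integral {0..u} (\<lambda>s. (g i s)\<^sup>2) - integral {0..t} (\<lambda>s. (g i s)\<^sup>2)"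
      unfolding \<phi>2 by (subst Henstock_Kurzweil_Integration.integral_diff[OF gi(2) I2(1)]) (simp add: I2(2))
    also have "\<dots> = integral {t..u} (\<lambda>s. (g i s)\<^sup>2)"
      using Henstock_Kurzweil_Integration.integral_combine[OF t(1,2) gi(2)[of i]] by simp
    also have "\<dots> \<le> integral {t..u} (\<lambda>s. (2 * nrm Y * C)\<^sup>2)"
      by (intro integral_le gi') (use g_le t in auto)
    also have "\<dots> = (2 * nrm Y * C)\<^sup>2 * (u - t)" using t by simp
    finally show "integral {0..u} (\<lambda>s. (\<phi> i s)\<^sup>2) \<le> (2 * nrm Y * C)\<^sup>2 * (u - t)" .
  qed
  also have "\<dots> = (2 * nrm Y * C)\<^sup>2 * CARD('i) * (u - t)" by simp
  finally have "sqrt (ip ?D ?D) \<le> sqrt ((2 * nrm Y * C)\<^sup>2 * CARD('i) * (u - t))" by (rule real_sqrt_le_mono)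
  then show ?thesis using C0 by (simp add: nrm_def[of ?D] real_sqrt_mult abs_mult)
qed

text \<open>Changing the variable at a fixed time is controlled by contraction, changing the time
  for a fixed variable by \<open>hat_incr\<close>. The modulus may depend on the base point
  \<open>s\<close>, so only the norm of \<open>y s\<close> enters.\<close>

lemma hat_L2cont:
  assumes y: "L2cont {0..T} y" and yG: "\<And>s. s \<in> {0..T} \<Longrightarrow> y s \<in> cspan GX"
  shows "L2cont {0..T} (\<lambda>s. hat s (y s))"
proof -
  obtain C where C: "C \<ge> 0" "\<And>s i. s \<in> {0..T} \<Longrightarrow> nrm (h s i) \<le> C" using h_bound by metis
  define K where "K = 2 * C * sqrt CARD('i)"
  have yGG: "y s \<in> cspan GG" if "s \<in> {0..T}" for s using yG[OF that] GX_GG by blast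
  have incr: "nrm (\<lambda>w. hat u Y w - hat t Y w) \<le> nrm Y * K * sqrt \<bar>u - t\<bar>"
    if "t \<in> {0..T}" "u \<in> {0..T}" "Y \<in> cspan GX" for t u Y
  proof (cases "t \<le> u")
    case True
    then show ?thesis using hat_incr[OF C(2) _ True _ that(3)] that by (simp add: K_def mult_ac)
  next
    case False
    then show ?thesis using hat_incr[OF C(2), of u t Y] that nrm_commute[of "hat u Y" "hat t Y"] by (simp add: K_def mult_ac)
  qed
  show ?thesis
  proof (rule L2contI_sq[where g="\<lambda>s u. nrm (\<lambda>w. y u w - y s w) + nrm (y s) * K * sqrt \<bar>u - s\<bar>"])
    show "hat s (y s) \<in> L2" if "s \<in> {0..T}" for s by (rule hat_L2[OF that yGG[OF that]])
    show "nrm (\<lambda>w. y s w - y s w) + nrm (y s) * K * sqrt \<bar>s - s\<bar> = 0" for s by simp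
    fix s assume s: "s \<in> {0..T}"
    note yL = cspan_L2[OF yG]
    have "continuous_on {0..T} (\<lambda>u. sqrt (ip (y u) (y u) - 2 * ip (y u) (y s) + ip (y s) (y s)))"
      by (intro continuous_intros ip_continuous_on_diag ip_continuous_on1 y yL s)
    then have "continuous_on {0..T} (\<lambda>u. nrm (\<lambda>w. y u w - y s w))"
    proof (rule continuous_on_eq)
      fix u assume u: "u \<in> {0..T}"
      show "sqrt (ip (y u) (y u) - 2 * ip (y u) (y s) + ip (y s) (y s)) = nrm (\<lambda>w. y u w - y s w)"
        using yL[OF s] yL[OF u] by (simp add: nrm_def ip_diff_left ip_diff_right ip_commute[of "y s" "y u"])
    qed
    then show "continuous_on {0..T} (\<lambda>u. nrm (\<lambda>w. y u w - y s w) + nrm (y s) * K * sqrt \<bar>u - s\<bar>)"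
      by (intro continuous_intros)
    fix u assume u: "u \<in> {0..T}"
    have "nrm (\<lambda>w. hat u (y u) w - hat s (y s) w)
        \<le> nrm (\<lambda>w. hat u (y u) w - hat u (y s) w) + nrm (\<lambda>w. hat u (y s) w - hat s (y s) w)"
      by (intro nrm_triangle3 hat_L2 u s yGG)
    also have "\<dots> \<le> nrm (\<lambda>w. y u w - y s w) + nrm (y s) * K * sqrt \<bar>u - s\<bar>"
      by (intro add_mono hat_nrm_diff incr u s yGG yG)
    finally show "nrm (\<lambda>w. hat u (y u) w - hat s (y s) w) \<le> nrm (\<lambda>w. y u w - y s w) + nrm (y s) * K * sqrt \<bar>u - s\<bar>" .
  qed
qed

end

section \<open>Innovations\<close>

text \<open>\<open>I\<close> is a parameter because the integral of the filtered \<open>h\<close> is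
  determined only up to a null set at each time. The theorem supplies a pathwise version; the
  arguments here use its inner products alone.\<close>

locale innovation = filtering M T GX h N Z F
  for M :: "'w measure" and T :: real and GX :: "('w \<Rightarrow> real) set"
    and h N Z :: "real \<Rightarrow> 'i::finite \<Rightarrow> 'w \<Rightarrow> real" and F :: "real \<Rightarrow> 'w measure" +
  fixes I :: "real \<Rightarrow> 'i \<Rightarrow> 'w \<Rightarrow> real"
  assumes I: "\<And>t i. t \<in> {0..T} \<Longrightarrow> wint (\<lambda>s. real_cond_exp M (F s) (h s i)) t (I t i)"
begin

definition hh :: "real \<Rightarrow> 'i \<Rightarrow> 'w \<Rightarrow> real" where "hh s i = hat s (h s i)"
definition ht :: "real \<Rightarrow> 'i \<Rightarrow> 'w \<Rightarrow> real" where "ht s i x = h s i x - hh s i x"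
definition nu :: "real \<Rightarrow> 'i \<Rightarrow> 'w \<Rightarrow> real" where "nu t i x = Z t i x - I t i x"

lemma h_GG: "s \<in> {0..T} \<Longrightarrow> h s i \<in> cspan GG"
  using h_GX GX_GG by blast

lemma hh_cZ: "s \<in> {0..T} \<Longrightarrow> hh s i \<in> cZ s"
  unfolding hh_def by (rule hat_cZ(1)[OF _ h_GG])

lemma hh_L2: "s \<in> {0..T} \<Longrightarrow> hh s i \<in> L2"
  by (rule cZ_L2[OF hh_cZ])

lemma hh_cont: "L2cont {0..T} (\<lambda>s. hh s i)"
  unfolding hh_def by (rule hat_L2cont[OF h_cont h_GX])

lemma ht_L2: "s \<in> {0..T} \<Longrightarrow> ht s i \<in> L2"
  unfolding ht_def[abs_def] by (rule L2_diff[OF h_L2 hh_L2])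

lemma ht_cont: "L2cont {0..T} (\<lambda>s. ht s i)"
  unfolding ht_def[abs_def] by (rule L2cont_diff[OF h_cont hh_cont])

lemma ht_orth: "s \<in> {0..T} \<Longrightarrow> V \<in> cZ s \<Longrightarrow> ip (ht s i) V = 0"
  using hat_orth[OF _ h_GG] by (simp add: ht_def[abs_def] hh_def)

lemma ht_cont_sub: "t \<in> {0..T} \<Longrightarrow> L2cont {0..t} (\<lambda>s. ht s i)" "t \<in> {0..T} \<Longrightarrow> L2cont {0..t} (\<lambda>s. hh s i)"
  by (rule L2cont_subset[OF ht_cont], simp, rule L2cont_subset[OF hh_cont], simp)

lemma I_cZ: assumes t: "t \<in> {0..T}" shows "I t i \<in> cZ t"
  unfolding cZ_def
proof (rule wint_cspan[OF SZ_L2 _ I[OF t]])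
  fix s assume s: "s \<in> {0..t}"
  then have "hh s i \<in> cZ s" "s \<le> t" using t by (auto intro: hh_cZ)
  then have "hh s i \<in> cZ t" using cZ_mono by blast
  then show "hat s (h s i) \<in> cspan (SZ t)" by (simp add: hh_def cZ_def)
qed (use t in simp)

lemma nu_cZ: "t \<in> {0..T} \<Longrightarrow> nu t i \<in> cZ t"
  using Z_cZ[of t t i] I_cZ[of t i] cspan_diff[OF SZ_L2, of t "Z t i" "I t i"]
  by (simp add: nu_def[abs_def] cZ_def)

lemma nu_L2: "t \<in> {0..T} \<Longrightarrow> nu t i \<in> L2"
  by (rule cZ_L2[OF nu_cZ])

lemma nu_ip:
  assumes t: "t \<in> {0..T}" and U: "U \<in> L2"
  shows "ip (nu t i) U = integral {0..t} (\<lambda>s. ip (ht s i) U) + ip (N t i) U"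
proof -
  have c: "L2cont {0..t} (\<lambda>s. h s i)" by (rule L2cont_subset[OF h_cont]) (use t in auto)
  have "integral {0..t} (\<lambda>s. ip (ht s i) U) = integral {0..t} (\<lambda>s. ip (h s i) U - ip (hh s i) U)"
    unfolding ht_def[abs_def] by (intro integral_cong ip_diff_left h_L2 hh_L2 U) (use t in auto)
  also have "\<dots> = integral {0..t} (\<lambda>s. ip (h s i) U) - integral {0..t} (\<lambda>s. ip (hh s i) U)"
    by (intro Henstock_Kurzweil_Integration.integral_diff integrable_continuous_interval
        ip_continuous_on1[OF c] ip_continuous_on1[OF ht_cont_sub(2)[OF t]] U)
  finally show ?thesis
    unfolding nu_def[abs_def]
    using ip_diff_left[OF Z_decomp(2)[OF t] wint_L2[OF I[OF t]] U] Z_decomp(3)[OF t U] wint_ip[OF I[OF t] U]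
    by (simp add: hh_def)
qed

text \<open>By \<open>nu_ip\<close> an innovation increment consists of filtering errors and of a
  noise increment, both taken after \<open>s\<close> and both orthogonal to the observation up to
  \<open>s\<close>.\<close>

lemma nu_incr_orth:
  assumes s: "0 \<le> s" "s \<le> t" "t \<le> T" and V: "V \<in> cZ s"
  shows "ip (nu t i) V = ip (nu s i) V"
proof -
  have sT: "s \<in> {0..T}" "t \<in> {0..T}" using s by auto
  have VL: "V \<in> L2" using cZ_L2[OF V] .
  have i: "(\<lambda>r. ip (ht r i) V) integrable_on {0..t}"
    by (intro integrable_continuous_interval ip_continuous_on1[OF ht_cont_sub(1)[OF sT(2)]] VL)
  have "integral {s..t} (\<lambda>r. ip (ht r i) V) = integral {s..t} (\<lambda>r. 0)"
  proof (rule integral_cong)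
    fix r assume r: "r \<in> {s..t}"
    then have "r \<in> {0..T}" "V \<in> cZ r" using s V cZ_mono[of s r] by auto
    then show "ip (ht r i) V = 0" by (rule ht_orth)
  qed
  then have "integral {0..t} (\<lambda>r. ip (ht r i) V) = integral {0..s} (\<lambda>r. ip (ht r i) V)"
    using Henstock_Kurzweil_Integration.integral_combine[OF s(1,2) i] by simp
  then show ?thesis
    using N_incr_orth[OF s V] by (simp add: nu_ip[OF sT(1) VL] nu_ip[OF sT(2) VL])
qed

lemma nu_zero: "U \<in> L2 \<Longrightarrow> ip (nu 0 i) U = 0"
proof -
  assume U: "U \<in> L2"
  have z: "0 \<in> {0..T}" using T by simp
  have "ip (N 0 i) (N 0 i) = 0" using N_cov[OF z z] by simp
  then show ?thesis using ip_null[OF N_L2[OF z] U] nu_ip[OF z U, of i] by simp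
qed

lemma nu_mean: "t \<in> {0..T} \<Longrightarrow> ip (nu t i) (\<lambda>x. 1) = 0"
  using nu_incr_orth[of 0 t "\<lambda>x. 1" i] nu_zero[OF L2_const, of i 1] one_cZ[OF T] by simp

text \<open>At equal times this is \<open>product_rule\<close> with drift \<open>ht\<close> and
  martingale part \<open>N\<close>. The drift terms vanish because \<open>ht s\<close> is orthogonal
  to \<open>nu s\<close>, so the bracket of the noise is all that is left. Distinct times reduce to
  the earlier one.\<close>

lemma nu_cov:
  assumes s: "s \<in> {0..T}" and t: "t \<in> {0..T}"
  shows "ip (nu s i) (nu t j) = (if i = j then min s t else 0)"
proof -
  have diag: "ip (nu t i) (nu t j) = (if i = j then t else 0)" if t: "t \<in> {0..T}" for t i j
  proof -
    have "((\<lambda>s. ip (nu s i) (ht s j) + ip (ht s i) (nu s j) + (if i = j then 1 else 0)) has_integral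
        ip (nu t i) (nu t j) - ip (nu 0 i) (nu 0 j)) {0..t}"
    proof (rule product_rule[OF ht_cont ht_cont nu_L2 nu_L2 N_L2 N_L2 _ _ _ _ _ _ _ _ t])
      show "ip (nu t i) Y = ip (nu 0 i) Y + integral {0..t} (\<lambda>s. ip (ht s i) Y) + ip (N t i) Y"
        if "t \<in> {0..T}" "Y \<in> L2" for t Y i
        using nu_ip[OF that] nu_zero[OF that(2)] by simp
      then show "ip (nu t j) Y = ip (nu 0 j) Y + integral {0..t} (\<lambda>s. ip (ht s j) Y) + ip (N t j) Y"
        if "t \<in> {0..T}" "Y \<in> L2" for t Y using that by blast
      have o: "ip (N t i) (ht s j) = ip (N s i) (ht s j)" if st: "0 \<le> s" "s \<le> t" "t \<le> T" for s t i j
      proof -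
        have sT: "s \<in> {0..T}" "t \<in> {0..T}" using st by auto
        show ?thesis
          unfolding ht_def[abs_def]
          using N_incr_orth[OF st hh_cZ[OF sT(1)], of i j] N_orth_cspan[OF sT(1) h_GX[OF sT(1)]]
            N_orth_cspan[OF sT(2) h_GX[OF sT(1)]] h_L2[OF sT(1)] hh_L2[OF sT(1)] N_L2[OF sT(1)] N_L2[OF sT(2)]
          by (simp add: ip_diff_right)
      qed
      show "ip (N t i) (ht s j) = ip (N s i) (ht s j)" "ip (N t j) (ht s i) = ip (N s j) (ht s i)"
        if "0 \<le> s" "s \<le> t" "t \<le> T" for s t using o[OF that] by blast+
      have z: "0 \<in> {0..T}" using T by simp
      show "ip (N t i) (nu 0 j) = 0" "ip (N t j) (nu 0 i) = 0" if "t \<in> {0..T}" for t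
        using nu_zero[OF N_L2[OF that]] ip_commute[of "N t i" "nu 0 j"] ip_commute[of "N t j" "nu 0 i"] by simp_all
      have "integral {0..t} (\<lambda>_. (if i = j then 1 else 0)::real) = (if i = j then t else 0)" using t by auto
      then show "ip (N t i) (N t j) = integral {0..t} (\<lambda>_. if i = j then 1 else 0)"
        using N_cov[OF t t, of i j] by simp
      show "(\<lambda>_. (if i = j then 1 else 0)::real) integrable_on {0..t}"
        by (rule integrable_continuous_interval) simp
    qed
    moreover have "((\<lambda>s. ip (nu s i) (ht s j) + ip (ht s i) (nu s j) + (if i = j then 1 else 0)) has_integral
        (if i = j then t else 0)) {0..t}"
    proof (rule has_integral_eq)
      show "((\<lambda>_. (if i = j then 1 else 0)::real) has_integral (if i = j then t else 0)) {0..t}"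
        using has_integral_const_real[of "if i = j then 1 else 0::real" 0 t] t by (auto split: if_splits)
      fix s assume "s \<in> {0..t}"
      then have s: "s \<in> {0..T}" using t by auto
      show "(if i = j then 1 else 0) = ip (nu s i) (ht s j) + ip (ht s i) (nu s j) + (if i = j then 1 else 0)"
        using ht_orth[OF s nu_cZ[OF s]] by (simp add: ip_commute[of "nu s i"])
    qed
    ultimately have "ip (nu t i) (nu t j) - ip (nu 0 i) (nu 0 j) = (if i = j then t else 0)"
      by (rule has_integral_unique)
    moreover have "0 \<in> {0..T}" using T by simp
    then have "ip (nu 0 i) (nu 0 j) = 0" by (intro nu_zero nu_L2)
    ultimately show ?thesis by simp
  qed
  show ?thesis
  proof (cases "s \<le> t")
    case True
    then have "ip (nu t j) (nu s i) = ip (nu s j) (nu s i)"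
      using s t by (intro nu_incr_orth nu_cZ) auto
    then show ?thesis using diag[OF s, of j i] True ip_commute[of "nu s i" "nu t j"] by auto
  next
    case False
    then have "ip (nu s i) (nu t j) = ip (nu t i) (nu t j)"
      using s t by (intro nu_incr_orth nu_cZ) auto
    then show ?thesis using diag[OF t, of i j] False by auto
  qed
qed

text \<open>The evolution \<open>v = v 0 + \<integral> b + w\<close> in weak form. Of the noise
  \<open>w\<close> only this is asked: its later increments are orthogonal to earlier values of
  \<open>h\<close>, and it is centred. By \<open>sig_w_orth\<close> this makes the increments
  orthogonal to the observed past.\<close>

definition signal :: "(real \<Rightarrow> 'w \<Rightarrow> real) \<Rightarrow> (real \<Rightarrow> 'w \<Rightarrow> real) \<Rightarrow> (real \<Rightarrow> 'w \<Rightarrow> real) \<Rightarrow> bool" where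
  "signal v b w \<longleftrightarrow>
     (\<forall>t\<in>{0..T}. v t \<in> cspan GX \<and> b t \<in> cspan GX \<and> w t \<in> cspan GX) \<and>
     L2cont {0..T} v \<and> L2cont {0..T} b \<and>
     (\<forall>t\<in>{0..T}. \<forall>U\<in>L2. ip (v t) U = ip (v 0) U + integral {0..t} (\<lambda>s. ip (b s) U) + ip (w t) U) \<and>
     (\<forall>s t i. 0 \<le> s \<and> s \<le> t \<and> t \<le> T \<longrightarrow> ip (w t) (h s i) = ip (w s) (h s i)) \<and>
     (\<forall>t\<in>{0..T}. ip (w t) (\<lambda>x. 1) = 0)"

context
  fixes v b w assumes sig: "signal v b w"
begin

lemma sig_GX: "t \<in> {0..T} \<Longrightarrow> v t \<in> cspan GX" "t \<in> {0..T} \<Longrightarrow> b t \<in> cspan GX" "t \<in> {0..T} \<Longrightarrow> w t \<in> cspan GX"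
  using sig unfolding signal_def by blast+

lemma sig_GG: "t \<in> {0..T} \<Longrightarrow> v t \<in> cspan GG" "t \<in> {0..T} \<Longrightarrow> b t \<in> cspan GG" "t \<in> {0..T} \<Longrightarrow> w t \<in> cspan GG"
  by (rule subsetD[OF GX_GG sig_GX(1)] subsetD[OF GX_GG sig_GX(2)] subsetD[OF GX_GG sig_GX(3)]; assumption)+

lemma sig_L2: "t \<in> {0..T} \<Longrightarrow> v t \<in> L2" "t \<in> {0..T} \<Longrightarrow> b t \<in> L2" "t \<in> {0..T} \<Longrightarrow> w t \<in> L2"
  by (rule cspan_L2[OF sig_GX(1)] cspan_L2[OF sig_GX(2)] cspan_L2[OF sig_GX(3)]; assumption)+

lemma sig_cont: "L2cont {0..T} v" "L2cont {0..T} b"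
  using sig unfolding signal_def by blast+

lemma sig_b_sub: "t \<in> {0..T} \<Longrightarrow> L2cont {0..t} b"
  by (rule L2cont_subset[OF sig_cont(2)]) auto

lemma sig_ip: "t \<in> {0..T} \<Longrightarrow> U \<in> L2 \<Longrightarrow> ip (v t) U = ip (v 0) U + integral {0..t} (\<lambda>s. ip (b s) U) + ip (w t) U"
  using sig unfolding signal_def by blast+

lemma sig_w_h:
  assumes "0 \<le> r" "r \<le> s" "s \<le> t" "t \<le> T"
  shows "ip (w t) (h r i) = ip (w s) (h r i)"
proof -
  have "0 \<le> s \<and> s \<le> t \<and> t \<le> T \<Longrightarrow> ip (w t) (h s i) = ip (w s) (h s i)" for s t i
    using sig unfolding signal_def by blast
  from this[of r t i] this[of r s i] show ?thesis using assms by simp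
qed

lemma sig_w_orth:
  assumes s: "0 \<le> s" "s \<le> t" "t \<le> T" and V: "V \<in> cZ s"
  shows "ip (w t) V = ip (w s) V"
proof -
  have sT: "s \<in> {0..T}" "t \<in> {0..T}" using s by auto
  note wL = sig_L2(3)[OF sT(1)] sig_L2(3)[OF sT(2)]
  have "ip (\<lambda>x. w t x - w s x) V = 0"
  proof (rule cZ_orthI[OF _ _ _ _ V])
    show "ip (\<lambda>x. w t x - w s x) (\<lambda>x. 1) = 0"
      using sig sT wL by (simp add: ip_diff_left signal_def)
    fix r i assume r: "r \<in> {0..s}"
    then have rT: "r \<in> {0..T}" using s by auto
    have "integral {0..r} (\<lambda>u. ip (w t) (h u i)) = integral {0..r} (\<lambda>u. ip (w s) (h u i))"
      by (intro integral_cong sig_w_h) (use r s in auto)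
    then have "ip (w t) (Z r i) = ip (w s) (Z r i)"
      using ip_Z_signal[OF rT sig_GX(3)[OF sT(1)]] ip_Z_signal[OF rT sig_GX(3)[OF sT(2)]] by simp
    then show "ip (\<lambda>x. w t x - w s x) (Z r i) = 0"
      using wL Z_decomp(2)[OF rT] by (simp add: ip_diff_left)
  qed (use wL s in auto)
  then show ?thesis using wL cZ_L2[OF V] by (simp add: ip_diff_left)
qed

lemma sig_hat_cZ: "t \<in> {0..T} \<Longrightarrow> hat t (v t) \<in> cZ t" "t \<in> {0..T} \<Longrightarrow> hat t (b t) \<in> cZ t"
  by (rule hat_cZ(1)[OF _ sig_GG(1)] hat_cZ(1)[OF _ sig_GG(2)]; assumption)+

lemma sig_hat_L2: "t \<in> {0..T} \<Longrightarrow> hat t (v t) \<in> L2" "t \<in> {0..T} \<Longrightarrow> hat t (b t) \<in> L2"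
  by (rule cZ_L2[OF sig_hat_cZ(1)] cZ_L2[OF sig_hat_cZ(2)]; assumption)+

lemma sig_hatb_cont: "L2cont {0..T} (\<lambda>s. hat s (b s))"
  by (rule hat_L2cont[OF sig_cont(2) sig_GX(2)])

lemma sig_hatb_sub: "t \<in> {0..T} \<Longrightarrow> L2cont {0..t} (\<lambda>s. hat s (b s))"
  by (rule L2cont_subset[OF sig_hatb_cont]) auto

text \<open>One entry of the Kalman gain: by \<open>gain_err\<close> it is the covariance of two
  filtering errors, and \<open>gain_PP\<close> identifies it with an entry of
  \<open>P [H I]^T\<close>.\<close>

definition gain :: "'i \<Rightarrow> real \<Rightarrow> real" where "gain i s = ip (v s) (ht s i)"

lemma gain_cont: "continuous_on {0..T} (gain i)"
  unfolding gain_def[abs_def] by (rule ip_continuous_on_diag[OF sig_cont(1) ht_cont])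

end

section \<open>Sums of deterministic step integrands against the innovations\<close>

definition step_sum :: "nat \<Rightarrow> (nat \<Rightarrow> real) \<Rightarrow> (nat \<Rightarrow> 'i \<Rightarrow> real) \<Rightarrow> 'w \<Rightarrow> real" where
  "step_sum n \<tau> g x = (\<Sum>k<n. \<Sum>i\<in>UNIV. g k i * (nu (\<tau> (Suc k)) i x - nu (\<tau> k) i x))"

definition step_fun :: "nat \<Rightarrow> (nat \<Rightarrow> real) \<Rightarrow> (nat \<Rightarrow> 'i \<Rightarrow> real) \<Rightarrow> 'i \<Rightarrow> real \<Rightarrow> real" where
  "step_fun n \<tau> g i s = (\<Sum>k<n. g k i * indicator {\<tau> k<..\<tau> (Suc k)} s)"

context
  fixes n :: nat and \<tau> :: "nat \<Rightarrow> real" and t :: real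
  assumes \<tau>: "\<And>k. k < n \<Longrightarrow> 0 \<le> \<tau> k" "\<And>k. k < n \<Longrightarrow> \<tau> k \<le> \<tau> (Suc k)" "\<And>k. k < n \<Longrightarrow> \<tau> (Suc k) \<le> t"
    and t: "t \<in> {0..T}"
begin

lemma \<tau>_mem: "k < n \<Longrightarrow> \<tau> k \<in> {0..t}" "k < n \<Longrightarrow> \<tau> (Suc k) \<in> {0..t}"
  "k < n \<Longrightarrow> \<tau> k \<in> {0..T}" "k < n \<Longrightarrow> \<tau> (Suc k) \<in> {0..T}"
  using \<tau>[of k] t by auto

lemma nu_\<tau>_L2: "k < n \<Longrightarrow> nu (\<tau> k) i \<in> L2" "k < n \<Longrightarrow> nu (\<tau> (Suc k)) i \<in> L2"
  by (rule nu_L2[OF \<tau>_mem(3)] nu_L2[OF \<tau>_mem(4)]; assumption)+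

lemma step_sum_cZ: "step_sum n \<tau> g \<in> cZ t"
proof -
  have S: "SZ t \<subseteq> L2" using t by (intro SZ_L2) simp
  have "nu s i \<in> cspan (SZ t)" if "s \<in> {0..t}" for s i
    using nu_cZ[of s i] cZ_mono[of s t] that t unfolding cZ_def by auto
  then show ?thesis
    unfolding step_sum_def[abs_def] cZ_def using \<tau>_mem
    by (intro cspan_sum[OF S] cspan_scale[OF S] cspan_diff[OF S]) auto
qed

lemma step_sum_ip:
  assumes V: "V \<in> L2"
  shows "ip (step_sum n \<tau> g) V = (\<Sum>k<n. \<Sum>i\<in>UNIV. g k i * (ip (nu (\<tau> (Suc k)) i) V - ip (nu (\<tau> k) i) V))"
proof -
  have "ip (step_sum n \<tau> g) V = (\<Sum>k<n. ip (\<lambda>x. \<Sum>i\<in>UNIV. g k i * (nu (\<tau> (Suc k)) i x - nu (\<tau> k) i x)) V)"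
    unfolding step_sum_def[abs_def] using nu_\<tau>_L2 V by (intro ip_sum_left L2_sum L2_scale L2_diff) auto
  also have "\<dots> = (\<Sum>k<n. \<Sum>i\<in>UNIV. g k i * (ip (nu (\<tau> (Suc k)) i) V - ip (nu (\<tau> k) i) V))"
  proof (intro sum.cong refl)
    fix k assume "k \<in> {..<n}"
    then have k: "k < n" by simp
    have "ip (\<lambda>x. \<Sum>i\<in>UNIV. g k i * (nu (\<tau> (Suc k)) i x - nu (\<tau> k) i x)) V
        = (\<Sum>i\<in>UNIV. ip (\<lambda>x. g k i * (nu (\<tau> (Suc k)) i x - nu (\<tau> k) i x)) V)"
      using nu_\<tau>_L2[OF k] V by (intro ip_sum_left L2_scale L2_diff) auto
    also have "\<dots> = (\<Sum>i\<in>UNIV. g k i * (ip (nu (\<tau> (Suc k)) i) V - ip (nu (\<tau> k) i) V))"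
      using nu_\<tau>_L2[OF k] V by (intro sum.cong refl) (simp add: ip_scale_left ip_diff_left)
    finally show "ip (\<lambda>x. \<Sum>i\<in>UNIV. g k i * (nu (\<tau> (Suc k)) i x - nu (\<tau> k) i x)) V
        = (\<Sum>i\<in>UNIV. g k i * (ip (nu (\<tau> (Suc k)) i) V - ip (nu (\<tau> k) i) V))" .
  qed
  finally show ?thesis .
qed

lemma step_sum_one: "ip (step_sum n \<tau> g) (\<lambda>x. 1) = 0"
  unfolding step_sum_ip[OF L2_const] using nu_mean \<tau>_mem by (intro sum.neutral ballI) auto

lemma step_fun_integral:
  assumes v: "v \<in> {0..t}"
  shows "(step_fun n \<tau> g i has_integral (\<Sum>k<n. g k i * (min (\<tau> (Suc k)) v - min (\<tau> k) v))) {0..v}"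
  unfolding step_fun_def[abs_def]
  by (intro has_integral_sum has_integral_mult_right integral_indicator_min) (use \<tau> v in auto)

lemma step_sum_nu:
  assumes v: "v \<in> {0..t}"
  shows "ip (step_sum n \<tau> g) (nu v i) = integral {0..v} (step_fun n \<tau> g i)"
proof -
  have vT: "v \<in> {0..T}" using v t by auto
  have "ip (step_sum n \<tau> g) (nu v i) = (\<Sum>k<n. \<Sum>j\<in>UNIV. if j = i then g k i * (min (\<tau> (Suc k)) v - min (\<tau> k) v) else 0)"
    unfolding step_sum_ip[OF nu_L2[OF vT]]
    by (intro sum.cong refl) (use nu_cov[OF \<tau>_mem(3) vT] nu_cov[OF \<tau>_mem(4) vT] in auto)
  then show ?thesis using integral_unique[OF step_fun_integral[OF v]] by simp
qed

lemma step_fun_prod_integral: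
  assumes f: "f integrable_on {0..t}"
  shows "((\<lambda>s. step_fun n \<tau> g i s * f s) has_integral
    (\<Sum>k<n. g k i * (integral {0..\<tau> (Suc k)} f - integral {0..\<tau> k} f))) {0..t}"
proof -
  have "((\<lambda>s. \<Sum>k<n. g k i * (indicator {\<tau> k<..\<tau> (Suc k)} s * f s)) has_integral
    (\<Sum>k<n. g k i * (integral {0..\<tau> (Suc k)} f - integral {0..\<tau> k} f))) {0..t}"
  proof (intro has_integral_sum has_integral_mult_right)
    fix k assume "k \<in> {..<n}"
    then have k: "0 \<le> \<tau> k" "\<tau> k \<le> \<tau> (Suc k)" "\<tau> (Suc k) \<le> t" using \<tau> by auto
    show "((\<lambda>s. indicator {\<tau> k<..\<tau> (Suc k)} s * f s) has_integral integral {0..\<tau> (Suc k)} f - integral {0..\<tau> k} f) {0..t}"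
      using integrable_integral[OF indicator_greaterThanAtMost_integral(1)[OF f k]]
      unfolding indicator_greaterThanAtMost_integral(2)[OF f k] .
  qed simp
  then show ?thesis by (simp only: step_fun_def sum_distrib_right mult.assoc)
qed

end

lemma step_fun_borel: "step_fun n \<tau> g i \<in> borel_measurable borel"
  unfolding step_fun_def[abs_def] by measurable

section \<open>The remainder of the filter and its pairings with the innovations\<close>

context
  fixes v b w :: "real \<Rightarrow> 'w \<Rightarrow> real" and J :: "real \<Rightarrow> 'w \<Rightarrow> real"
  assumes sig: "signal v b w"
    and J: "\<And>t. t \<in> {0..T} \<Longrightarrow> wint (\<lambda>s. real_cond_exp M (F s) (b s)) t (J t)"
begin

definition mart :: "real \<Rightarrow> 'w \<Rightarrow> real" where
  "mart t x = hat t (v t) x - hat 0 (v 0) x - J t x"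

lemma zero_T: "0 \<in> {0..T}" using T by simp

lemma mart_ip:
  assumes t: "t \<in> {0..T}" and U: "U \<in> L2"
  shows "ip (mart t) U = ip (hat t (v t)) U - ip (hat 0 (v 0)) U - integral {0..t} (\<lambda>s. ip (hat s (b s)) U)"
  unfolding mart_def[abs_def]
  using sig_hat_L2(1)[OF sig t] sig_hat_L2(1)[OF sig zero_T] wint_L2[OF J[OF t]] U wint_ip[OF J[OF t] U]
  by (simp add: ip_diff_left)

lemma J_cZ: assumes t: "t \<in> {0..T}" shows "J t \<in> cZ t"
  unfolding cZ_def
proof (rule wint_cspan[OF SZ_L2 _ J[OF t]])
  fix s assume s: "s \<in> {0..t}"
  then have "hat s (b s) \<in> cZ s" "s \<le> t" using t by (auto intro: sig_hat_cZ(2)[OF sig])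
  then show "hat s (b s) \<in> cspan (SZ t)" using cZ_mono unfolding cZ_def by blast
qed (use t in simp)

lemma mart_cZ:
  assumes t: "t \<in> {0..T}" shows "mart t \<in> cZ t"
proof -
  have S: "SZ t \<subseteq> L2" using t by (intro SZ_L2) simp
  have "hat 0 (v 0) \<in> cZ t" using sig_hat_cZ(1)[OF sig zero_T] cZ_mono[of 0 t] t by auto
  then show ?thesis
    unfolding mart_def[abs_def] using sig_hat_cZ(1)[OF sig t] J_cZ[OF t] unfolding cZ_def
    by (intro cspan_diff[OF S])
qed

lemma mart_L2: "t \<in> {0..T} \<Longrightarrow> mart t \<in> L2"
  by (rule cZ_L2[OF mart_cZ])

lemma mart_orth:
  assumes s: "0 \<le> s" "s \<le> t" "t \<le> T" and V: "V \<in> cZ s"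
  shows "ip (mart t) V = ip (mart s) V"
proof -
  have sT: "s \<in> {0..T}" "t \<in> {0..T}" using s by auto
  have VL: "V \<in> L2" using cZ_L2[OF V] .
  have Vr: "V \<in> cZ r" if "s \<le> r" for r using V cZ_mono[OF that] by blast
  have i: "(\<lambda>r. ip (b r) V) integrable_on {0..t}" "(\<lambda>r. ip (hat r (b r)) V) integrable_on {0..t}"
    by (intro integrable_continuous_interval ip_continuous_on1[OF sig_b_sub[OF sig sT(2)]]
        ip_continuous_on1[OF sig_hatb_sub[OF sig sT(2)]] VL)+
  have "integral {s..t} (\<lambda>r. ip (hat r (b r)) V) = integral {s..t} (\<lambda>r. ip (b r) V)"
    by (intro integral_cong hat_cZ(2) sig_GG(2)[OF sig] Vr) (use s in auto)
  then have "integral {0..t} (\<lambda>r. ip (hat r (b r)) V) - integral {0..s} (\<lambda>r. ip (hat r (b r)) V)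
      = integral {0..t} (\<lambda>r. ip (b r) V) - integral {0..s} (\<lambda>r. ip (b r) V)"
    using Henstock_Kurzweil_Integration.integral_combine[OF s(1,2) i(1)]
      Henstock_Kurzweil_Integration.integral_combine[OF s(1,2) i(2)] by linarith
  moreover have "ip (hat t (v t)) V = ip (v t) V" "ip (hat s (v s)) V = ip (v s) V"
    using s by (auto intro!: hat_cZ(2) sig_GG(1)[OF sig] Vr)
  ultimately show ?thesis
    using mart_ip[OF sT(1) VL] mart_ip[OF sT(2) VL] sig_ip[OF sig sT(1) VL] sig_ip[OF sig sT(2) VL]
      sig_w_orth[OF sig s V] by linarith
qed

lemma mart_zero: "U \<in> L2 \<Longrightarrow> ip (mart 0) U = 0"
  using mart_ip[OF zero_T] by simp

lemma mart_mean: "t \<in> {0..T} \<Longrightarrow> ip (mart t) (\<lambda>x. 1) = 0"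
  using mart_orth[of 0 t "\<lambda>x. 1"] mart_zero[OF L2_const, of 1] one_cZ[OF T] by simp

text \<open>Without projections the pairing of \<open>v u\<close> with \<open>nu u\<close> is an
  integral of pairings with the errors \<open>ht s\<close>. Carrying the signal from
  \<open>s\<close> to \<open>u\<close> splits off the gain at \<open>s\<close> and leaves a double
  integral of the drift over a triangle; it is exactly what the drift term of the remainder
  subtracts, in the other order of integration.\<close>

lemma mart_nu:
  assumes u: "0 \<le> u" "u \<le> t" "t \<le> T"
  shows "ip (mart t) (nu u i) = integral {0..u} (gain v i)"
proof -
  have uT: "u \<in> {0..T}" using u by auto
  note nuL = nu_L2[OF uT]
  have htL: "ht s j \<in> L2" if "s \<in> {0..u}" for s j using ht_L2 that uT by auto
  have w_ht: "ip (w u) (ht s i) = ip (w s) (ht s i)" if s: "s \<in> {0..u}" for s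
  proof -
    have s': "s \<in> {0..T}" "0 \<le> s" "s \<le> u" "u \<le> T" using s uT by auto
    show ?thesis unfolding ht_def[abs_def]
      using sig_w_orth[OF sig s'(2-4) hh_cZ[OF s'(1)], of i] sig_w_h[OF sig s'(2) order_refl s'(3,4), of i]
        sig_L2(3)[OF sig s'(1)] sig_L2(3)[OF sig uT] h_L2[OF s'(1)] hh_L2[OF s'(1)]
      by (simp add: ip_diff_right)
  qed
  define k where "k s r = ip (b s) (ht r i)" for s r
  have kc: "continuous_on ({0..u} \<times> {0..u}) (\<lambda>(s, r). k s r)"
    unfolding k_def by (rule ip_continuous_on[OF sig_b_sub[OF sig uT] ht_cont_sub(1)[OF uT]])
  have k_tri: "continuous_on {(s, r). 0 \<le> r \<and> r \<le> s \<and> s \<le> u} (\<lambda>(s, r). k s r)"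
    by (rule continuous_on_subset[OF kc]) auto
  note tri = triangle_integral[OF k_tri]
  \<comment> \<open>Between \<open>s\<close> and \<open>u\<close> the signal changes by its drift
    and by noise; the noise increment is orthogonal to \<open>ht s i\<close> by
    \<open>w_ht\<close>.\<close>
  have v_ht: "ip (ht s i) (v u) = gain v i s + integral {s..u} (\<lambda>r. k r s)" if s: "s \<in> {0..u}" for s
  proof -
    have s': "s \<in> {0..T}" "0 \<le> s" "s \<le> u" using s uT by auto
    have i: "(\<lambda>r. ip (b r) (ht s i)) integrable_on {0..u}"
      by (intro integrable_continuous_interval ip_continuous_on1[OF sig_b_sub[OF sig uT]] htL s)
    show ?thesis
      using sig_ip[OF sig uT htL[OF s], of i] sig_ip[OF sig s'(1) htL[OF s], of i] w_ht[OF s]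
        Henstock_Kurzweil_Integration.integral_combine[OF s'(2,3) i]
      by (simp add: ip_commute[of "ht s i" "v u"] gain_def[OF sig] k_def)
  qed
  have gi: "gain v i integrable_on {0..u}"
    by (intro integrable_continuous_interval continuous_on_subset[OF gain_cont[OF sig]]) (use uT in auto)
  have "ip (mart t) (nu u i) = ip (mart u) (nu u i)" by (rule mart_orth[OF u nu_cZ[OF uT]])
  also have "\<dots> = ip (hat u (v u)) (nu u i) - ip (hat 0 (v 0)) (nu u i) - integral {0..u} (\<lambda>s. ip (hat s (b s)) (nu u i))"
    by (rule mart_ip[OF uT nuL])
  also have "ip (hat 0 (v 0)) (nu u i) = 0"
    using nu_incr_orth[of 0 u "hat 0 (v 0)" i] u sig_hat_cZ(1)[OF sig zero_T] nu_zero[OF sig_hat_L2(1)[OF sig zero_T]]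
    by (simp add: ip_commute[of "hat 0 (v 0)"])
  also have "ip (hat u (v u)) (nu u i) = integral {0..u} (\<lambda>s. gain v i s + integral {s..u} (\<lambda>r. k r s))"
  proof -
    have "ip (hat u (v u)) (nu u i) = ip (v u) (nu u i)"
      by (rule hat_cZ(2)[OF uT sig_GG(1)[OF sig uT] nu_cZ[OF uT]])
    also have "\<dots> = integral {0..u} (\<lambda>s. ip (ht s i) (v u))"
      using nu_ip[OF uT sig_L2(1)[OF sig uT], of i] N_orth_cspan[OF uT sig_GX(1)[OF sig uT]]
      by (simp add: ip_commute[of "v u" "nu u i"])
    also have "\<dots> = integral {0..u} (\<lambda>s. gain v i s + integral {s..u} (\<lambda>r. k r s))"
      by (rule integral_cong[OF v_ht])
    finally show ?thesis .
  qed
  also have "integral {0..u} (\<lambda>s. ip (hat s (b s)) (nu u i)) = integral {0..u} (\<lambda>s. integral {0..s} (k s))"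
  proof (rule integral_cong)
    fix s assume s: "s \<in> {0..u}"
    then have s': "s \<in> {0..T}" "0 \<le> s" "s \<le> u" "u \<le> T" using uT by auto
    have "ip (hat s (b s)) (nu u i) = ip (nu s i) (hat s (b s))"
      using nu_incr_orth[OF s'(2-4) sig_hat_cZ(2)[OF sig s'(1)]] by (simp add: ip_commute[of "hat s (b s)"])
    also have "\<dots> = ip (nu s i) (b s)"
      using hat_cZ(2)[OF s'(1) sig_GG(2)[OF sig s'(1)] nu_cZ[OF s'(1)], of i] by (simp add: ip_commute[of "nu s i"])
    also have "\<dots> = integral {0..s} (k s)"
      using nu_ip[OF s'(1) sig_L2(2)[OF sig s'(1)], of i] N_orth_cspan[OF s'(1) sig_GX(2)[OF sig s'(1)]]
      by (simp add: k_def[abs_def] ip_commute[of "b s"])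
    finally show "ip (hat s (b s)) (nu u i) = integral {0..s} (k s)" .
  qed
  also have "integral {0..u} (\<lambda>s. gain v i s + integral {s..u} (\<lambda>r. k r s)) = integral {0..u} (gain v i) + integral {0..u} (\<lambda>s. integral {s..u} (\<lambda>r. k r s))"
    by (rule Henstock_Kurzweil_Integration.integral_add[OF gi tri(2)])
  finally show ?thesis using tri(3) by simp
qed

end

end

text \<open>There are finitely many components, so the minimum of their moduli of continuity
  provides one mesh for all. Values are taken at the left end of each cell, as an adapted integrand
  requires.\<close>

lemma uniform_step_approx:
  fixes G :: "'j::finite \<Rightarrow> real \<Rightarrow> real"
  assumes G: "\<And>i. continuous_on {0..T} (G i)" and t: "0 \<le> t" "t \<le> T" and e: "0 < e"
  obtains n\<^sub>0 where "\<And>n s i. n \<ge> n\<^sub>0 \<Longrightarrow> 0 < n \<Longrightarrow> s \<in> {0<..t} \<Longrightarrow>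
    \<bar>G i s - (\<Sum>k<n. G i (t * real k / real n) * indicator {t * real k / real n<..t * real (Suc k) / real n} s)\<bar> \<le> e"
proof -
  have "\<exists>d>0. \<forall>s\<in>{0..T}. \<forall>u\<in>{0..T}. dist u s < d \<longrightarrow> dist (G i u) (G i s) < e" for i
    using compact_uniformly_continuous[OF G[of i] compact_Icc] e unfolding uniformly_continuous_on_def by blast
  then obtain d where d: "\<And>i. d i > 0" "\<And>i s u. s \<in> {0..T} \<Longrightarrow> u \<in> {0..T} \<Longrightarrow> dist u s < d i \<Longrightarrow> dist (G i u) (G i s) < e"
    by metis
  define m where "m = Min (range d)"
  have m: "m > 0" "\<And>i. m \<le> d i" unfolding m_def using d(1) by auto
  obtain n0 where n0: "t / m < real n0" using reals_Archimedean2 by blast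
  show ?thesis
  proof (rule that[of n0])
    fix n s i assume n: "n0 \<le> n" "0 < n" and s: "s \<in> {0<..t}"
    have t0: "0 < t" using s by auto
    have "t / m < real n" using n0 n by linarith
    then have tn: "t / real n < m" using m(1) n by (simp add: field_simps)
    obtain k where k: "k < n" "t * real k / real n < s" "s \<le> t * real (Suc k) / real n"
      "(\<Sum>j<n. indicat_real {t * real j / real n<..t * real (Suc j) / real n} s *\<^sub>R G i (t * real j / real n)) = G i (t * real k / real n)"
      by (rule uniform_partition_step[OF t0 n(2) s, of "\<lambda>k. G i (t * real k / real n)"])
    have "t * real (Suc k) / real n = t * real k / real n + t / real n"
      by (simp add: add_divide_distrib[symmetric] algebra_simps)
    then have "dist s (t * real k / real n) < d i"
      using k tn m(2)[of i] by (simp add: dist_real_def)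
    moreover have "t * real k / real n \<in> {0..T}" "s \<in> {0..T}" using k(2) t0 s t by auto
    ultimately have "dist (G i s) (G i (t * real k / real n)) < e" by (intro d(2))
    then show "\<bar>G i s - (\<Sum>k<n. G i (t * real k / real n) * indicator {t * real k / real n<..t * real (Suc k) / real n} s)\<bar> \<le> e"
      using k(4) by (simp add: dist_real_def mult.commute)
  qed
qed

context innovation
begin

context
  fixes v b w :: "real \<Rightarrow> 'w \<Rightarrow> real" and J :: "real \<Rightarrow> 'w \<Rightarrow> real"
  assumes sig: "signal v b w"
    and J: "\<And>t. t \<in> {0..T} \<Longrightarrow> wint (\<lambda>s. real_cond_exp M (F s) (b s)) t (J t)"
begin

text \<open>The projections of the difference \<open>D\<close> onto the past satisfy an integral inequality:
  pairing \<open>D\<close> with the observation gives the error of the integrand plus the pairing of \<open>D\<close> with the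
  filtered signal.\<close>

lemma mart_step_approx:
  obtains K where "K \<ge> 0"
    "\<And>t n \<tau> g e. t \<in> {0..T} \<Longrightarrow> (\<And>k. k < n \<Longrightarrow> 0 \<le> \<tau> k) \<Longrightarrow> (\<And>k. k < n \<Longrightarrow> \<tau> k \<le> \<tau> (Suc k)) \<Longrightarrow>
      (\<And>k. k < n \<Longrightarrow> \<tau> (Suc k) \<le> t) \<Longrightarrow> 0 \<le> e \<Longrightarrow>
      (\<And>i s. s \<in> {0<..t} \<Longrightarrow> \<bar>gain v i s - step_fun n \<tau> g i s\<bar> \<le> e) \<Longrightarrow>
      (nrm (\<lambda>x. mart v J t x - step_sum n \<tau> g x))\<^sup>2 \<le> K * e\<^sup>2"
proof -
  obtain C where C: "C \<ge> 0" "\<And>s i. s \<in> {0..T} \<Longrightarrow> nrm (h s i) \<le> C" using h_bound by metis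
  define m where "m = real CARD('i)"
  have m0: "0 \<le> m" by (simp add: m_def)
  \<comment> \<open>Read backwards from the estimates: \<open>\<alpha>\<close> satisfies
    \<open>\<alpha> u \<le> A m T e^2 + A \<integral> \<alpha>\<close>, so Gronwall bounds it by
    \<open>B e^2\<close>, and the final bound (2 m + 2 B) T e^2 is \<open>K e^2\<close>. None of the
    constants depends on the partition.\<close>
  define A where "A = 2 * m * C\<^sup>2"
  define B where "B = A * m * T * exp (A * T)"
  define K where "K = 2 * m * T + 2 * T * B"
  have A0: "0 \<le> A" "0 \<le> B" "0 \<le> K"
    using m0 T by (auto simp: A_def B_def K_def)
  show ?thesis
  proof (rule that[OF A0(3)])
    fix t n \<tau> g and e :: real
    assume t: "t \<in> {0..T}" and \<tau>: "\<And>k. k < n \<Longrightarrow> 0 \<le> \<tau> k" "\<And>k. k < n \<Longrightarrow> \<tau> k \<le> \<tau> (Suc k)" "\<And>k. k < n \<Longrightarrow> \<tau> (Suc k) \<le> t"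
      and e: "0 \<le> e" and app: "\<And>i s. s \<in> {0<..t} \<Longrightarrow> \<bar>gain v i s - step_fun n \<tau> g i s\<bar> \<le> e"
    let ?D = "\<lambda>x. mart v J t x - step_sum n \<tau> g x"
    note MT = mart_cZ[OF sig J t] mart_L2[OF sig J t]
    have ST: "step_sum n \<tau> g \<in> cZ t" "step_sum n \<tau> g \<in> L2"
      by (rule step_sum_cZ[where n=n and \<tau>=\<tau>, OF \<tau> t] cZ_L2[OF step_sum_cZ[where n=n and \<tau>=\<tau>, OF \<tau> t]]; assumption)+
    have tT: "t \<le> T" using t by simp
    have D: "?D \<in> cZ t" using MT(1) ST(1) unfolding cZ_def by (intro cspan_diff[OF SZ_L2[OF tT]])
    have DL: "?D \<in> L2" and DG: "?D \<in> cspan GG" using D cZ_L2 cZ_GG[OF tT] by auto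
    have D1: "ip ?D (\<lambda>x. 1) = 0"
      using MT(2) ST(2) mart_mean[OF sig J t] step_sum_one[where n=n and \<tau>=\<tau>, OF \<tau> t] by (simp add: ip_diff_left)
    define p where "p i s = ip ?D (hh s i)" for i s
    have pc: "continuous_on {0..T} (p i)" for i
      unfolding p_def by (rule ip_continuous_on2[OF hh_cont DL])
    \<comment> \<open>The approximation is assumed on \<open>]0, t]\<close> only. Redefining the
      error of the integrand at the single point 0 makes it bounded by \<open>e\<close> throughout
      without changing any integral.\<close>
    define f where "f i s = (if s = 0 then 0 else gain v i s - step_fun n \<tau> g i s)" for i s
    have fe: "\<bar>f i s\<bar> \<le> e" if "s \<in> {0..t}" for i s
      using app[of s i] that e by (auto simp: f_def)
    have fm: "(\<lambda>s. indicator {0..t} s * f i s) \<in> borel_measurable borel" for i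
    proof -
      have "continuous_on {0..t} (gain v i)"
        by (rule continuous_on_subset[OF gain_cont[OF sig]]) (use t in auto)
      then have [measurable]: "(\<lambda>s. indicator {0..t} s *\<^sub>R gain v i s) \<in> borel_measurable borel"
        by (rule borel_measurable_continuous_on_indicator[OF _ , rotated]) simp
      have [measurable]: "step_fun n \<tau> g i \<in> borel_measurable borel" by (rule step_fun_borel)
      have "(\<lambda>s. indicator {0..t} s * f i s) = (\<lambda>s. if s = 0 then 0 else indicator {0..t} s *\<^sub>R gain v i s - indicator {0..t} s * step_fun n \<tau> g i s)"
        by (auto simp: f_def right_diff_distrib)
      then show ?thesis by simp
    qed
    have sub: "{0..u} \<subseteq> {0..T}" if "u \<in> {0..t}" for u using that t by auto
    have fu: "(\<lambda>s. indicator {0..u} s * f i s) \<in> borel_measurable borel" if u: "u \<in> {0..t}" for u i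
    proof -
      have "(\<lambda>s. indicator {0..u} s * f i s) = (\<lambda>s. indicator {0..u} s * (indicator {0..t} s * f i s))"
        using u by (auto simp: indicator_def)
      then show ?thesis using fm[of i] by simp
    qed
    have ppc: "continuous_on {0..u} (p i)" if "u \<in> {0..t}" for u i
      by (rule continuous_on_subset[OF pc sub[OF that]])
    have fi: "f i integrable_on {0..u}" if u: "u \<in> {0..t}" for u i
      by (rule bounded_borel_integrable_on[OF fu[OF u], where C=e]) (use fe u in auto)
    define \<phi> where "\<phi> i s = f i s + p i s" for i s
    have \<phi>i: "\<phi> i integrable_on {0..u}" if u: "u \<in> {0..t}" for u i
      unfolding \<phi>_def[abs_def] by (intro Henstock_Kurzweil_Integration.integrable_add fi[OF u] integrable_continuous_interval ppc u)
    obtain P where P: "\<And>i s. s \<in> {0..t} \<Longrightarrow> \<bar>p i s\<bar> \<le> P"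
    proof -
      have "\<bar>p i s\<bar> \<le> nrm ?D * C" if s: "s \<in> {0..t}" for i s
      proof -
        have sT: "s \<in> {0..T}" using s t by auto
        have "\<bar>p i s\<bar> \<le> nrm ?D * nrm (hh s i)"
          unfolding p_def by (rule Cauchy_Schwarz_ip[OF DL hh_L2[OF sT]])
        also have "\<dots> \<le> nrm ?D * C"
          using order_trans[OF hat_nrm[OF sT h_GG[OF sT]] C(2)[OF sT]] by (intro mult_left_mono) (auto simp: hh_def)
        finally show ?thesis .
      qed
      then show thesis using that by blast
    qed
    have \<phi>2i: "(\<lambda>s. (\<phi> i s)\<^sup>2) integrable_on {0..u}" if u: "u \<in> {0..t}" for u i
    proof (rule bounded_borel_integrable_on[where C="(e + P)\<^sup>2"])
      have [measurable]: "(\<lambda>s. indicator {0..u} s * p i s) \<in> borel_measurable borel"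
        using borel_measurable_continuous_on_indicator[OF _ ppc[OF u, of i]] by simp
      note [measurable] = fu[OF u, of i]
      have "(\<lambda>s. indicator {0..u} s * (\<phi> i s)\<^sup>2) = (\<lambda>s. (indicator {0..u} s * f i s + indicator {0..u} s * p i s)\<^sup>2)"
        by (auto simp: \<phi>_def indicator_def)
      then show "(\<lambda>s. indicator {0..u} s * (\<phi> i s)\<^sup>2) \<in> borel_measurable borel" by simp
      fix s assume s: "s \<in> {0..u}"
      then have "\<bar>f i s\<bar> \<le> e" "\<bar>p i s\<bar> \<le> P" using fe P u by auto
      then have "\<bar>\<phi> i s\<bar> \<le> e + P" unfolding \<phi>_def by linarith
      then have "\<bar>\<phi> i s\<bar>\<^sup>2 \<le> (e + P)\<^sup>2" by (rule power_mono) simp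
      then show "\<bar>(\<phi> i s)\<^sup>2\<bar> \<le> (e + P)\<^sup>2" by simp
    qed
    \<comment> \<open>The feedback: since the observation is innovation plus integrated filtered
      signal, the pairings of \<open>D\<close> with the filtered signal reappear in those with
      \<open>Z\<close>.\<close>
    define \<alpha> where "\<alpha> u = (\<Sum>i\<in>UNIV. (p i u)\<^sup>2)" for u
    have \<alpha>c: "continuous_on {0..t} \<alpha>"
      unfolding \<alpha>_def[abs_def] by (intro continuous_intros ppc) (use t in auto)
    have \<phi>le: "(\<Sum>i\<in>UNIV. integral {0..u} (\<lambda>s. (\<phi> i s)\<^sup>2)) \<le> 2 * m * e\<^sup>2 * u + 2 * integral {0..u} \<alpha>" if u: "u \<in> {0..t}" for u
    proof -
      have p2: "(\<lambda>s. (p i s)\<^sup>2) integrable_on {0..u}" for i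
        by (intro integrable_continuous_interval continuous_intros ppc u)
      have "integral {0..u} (\<lambda>s. (\<phi> i s)\<^sup>2) \<le> integral {0..u} (\<lambda>s. 2 * e\<^sup>2 + 2 * (p i s)\<^sup>2)" for i
      proof (rule integral_le[OF \<phi>2i[OF u]])
        show "(\<lambda>s. 2 * e\<^sup>2 + 2 * (p i s)\<^sup>2) integrable_on {0..u}"
          by (intro integrable_continuous_interval continuous_intros ppc u)
        fix s assume "s \<in> {0..u}"
        then have "\<bar>f i s\<bar>\<^sup>2 \<le> e\<^sup>2" using fe[of s i] u by (intro power_mono) auto
        moreover have "0 \<le> (f i s - p i s)\<^sup>2" by simp
        ultimately show "(\<phi> i s)\<^sup>2 \<le> 2 * e\<^sup>2 + 2 * (p i s)\<^sup>2"
          by (simp add: \<phi>_def power2_sum power2_diff)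
      qed
      also have "integral {0..u} (\<lambda>s. 2 * e\<^sup>2 + 2 * (p i s)\<^sup>2) = 2 * e\<^sup>2 * u + 2 * integral {0..u} (\<lambda>s. (p i s)\<^sup>2)" for i
      proof -
        have "integral {0..u} (\<lambda>s. 2 * e\<^sup>2 + 2 * (p i s)\<^sup>2) = integral {0..u} (\<lambda>s. 2 * e\<^sup>2) + integral {0..u} (\<lambda>s. 2 * (p i s)\<^sup>2)"
          by (intro Henstock_Kurzweil_Integration.integral_add integrable_on_mult_right p2 integrable_continuous_interval continuous_on_const)
        then show ?thesis using u by simp
      qed
      finally have "integral {0..u} (\<lambda>s. (\<phi> i s)\<^sup>2) \<le> 2 * e\<^sup>2 * u + 2 * integral {0..u} (\<lambda>s. (p i s)\<^sup>2)" for i .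
      then have "(\<Sum>i\<in>UNIV. integral {0..u} (\<lambda>s. (\<phi> i s)\<^sup>2)) \<le> (\<Sum>i\<in>(UNIV::'i set). 2 * e\<^sup>2 * u + 2 * integral {0..u} (\<lambda>s. (p i s)\<^sup>2))"
        by (intro sum_mono)
      also have "\<dots> = 2 * m * e\<^sup>2 * u + 2 * (\<Sum>i\<in>UNIV. integral {0..u} (\<lambda>s. (p i s)\<^sup>2))"
        by (simp add: sum.distrib sum_distrib_left m_def)
      also have "(\<Sum>i\<in>UNIV. integral {0..u} (\<lambda>s. (p i s)\<^sup>2)) = integral {0..u} \<alpha>"
        unfolding \<alpha>_def[abs_def] by (rule integral_sum[symmetric]) (auto intro: p2)
      finally show ?thesis .
    qed
    have DZ: "ip ?D (Z r i) = integral {0..r} (\<phi> i)" if r: "r \<in> {0..t}" for r i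
    proof -
      have rT: "r \<in> {0..T}" "0 \<le> r" "r \<le> t" using r t by auto
      have "ip ?D (Z r i) = ip ?D (nu r i) + ip ?D (I r i)"
      proof -
        have "ip ?D (nu r i) = ip ?D (Z r i) - ip ?D (I r i)"
          unfolding nu_def[abs_def] by (rule ip_diff_right[OF Z_decomp(2)[OF rT(1)] wint_L2[OF I[OF rT(1)]] DL])
        then show ?thesis by simp
      qed
      also have "ip ?D (I r i) = integral {0..r} (p i)"
        using wint_ip2[OF I[OF rT(1)] DL] by (simp add: p_def[abs_def] hh_def)
      also have "ip ?D (nu r i) = integral {0..r} (gain v i) - integral {0..r} (step_fun n \<tau> g i)"
        using MT(2) ST(2) nu_L2[OF rT(1)] mart_nu[OF sig J rT(2,3) tT] step_sum_nu[where n=n and \<tau>=\<tau>, OF \<tau> t r]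
        by (simp add: ip_diff_left)
      also have "\<dots> = integral {0..r} (\<lambda>s. gain v i s - step_fun n \<tau> g i s)"
      proof (rule Henstock_Kurzweil_Integration.integral_diff[symmetric])
        show "gain v i integrable_on {0..r}"
          by (intro integrable_continuous_interval continuous_on_subset[OF gain_cont[OF sig]]) (use rT in auto)
        show "step_fun n \<tau> g i integrable_on {0..r}"
          using step_fun_integral[where n=n and \<tau>=\<tau>, OF \<tau> t r] unfolding integrable_on_def by blast
      qed
      also have "\<dots> = integral {0..r} (f i)"
        by (rule integral_spike[of "{0}"]) (auto simp: f_def)
      also have "integral {0..r} (f i) + integral {0..r} (p i) = integral {0..r} (\<phi> i)"
        unfolding \<phi>_def[abs_def]
        by (intro Henstock_Kurzweil_Integration.integral_add[symmetric] fi r integrable_continuous_interval ppc)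
      finally show ?thesis .
    qed
    \<comment> \<open>The bound is applied to the projection of \<open>D\<close> on the observation
      up to \<open>u\<close>. It has the same pairings up to \<open>u\<close> as \<open>D\<close>,
      so only the integral of \<open>\<alpha>\<close> up to \<open>u\<close> appears, as Gronwall
      requires.\<close>
    have proj: "ip (hat u ?D) (hat u ?D) \<le> 2 * m * e\<^sup>2 * u + 2 * integral {0..u} \<alpha>" if u: "u \<in> {0..t}" for u
    proof -
      have uT: "u \<in> {0..T}" "u \<le> T" using u t by auto
      have "ip (hat u ?D) (hat u ?D) \<le> (\<Sum>i\<in>UNIV. integral {0..u} (\<lambda>s. (\<phi> i s)\<^sup>2))"
      proof (rule observed_norm_bound[OF uT(1) hat_cZ(1)[OF uT(1) DG] _ _ \<phi>i[OF u] \<phi>2i[OF u]])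
        show "ip (hat u ?D) (\<lambda>x. 1) = 0"
          using hat_cZ(2)[OF uT(1) DG one_cZ[OF uT(2)]] D1 by simp
        show "ip (hat u ?D) (Z r i) = integral {0..r} (\<phi> i)" if r: "r \<in> {0..u}" for r i
          using hat_cZ(2)[OF uT(1) DG Z_cZ[OF uT(2) r]] DZ[of r i] r u by simp
      qed
      also have "\<dots> \<le> 2 * m * e\<^sup>2 * u + 2 * integral {0..u} \<alpha>" by (rule \<phi>le[OF u])
      finally show ?thesis .
    qed
    have \<alpha>le: "\<alpha> u \<le> (A * m * T * e\<^sup>2) * exp (A * u)" if u: "u \<in> {0..t}" for u
    proof (rule gronwall[OF \<alpha>c A0(1) _ u])
      fix u assume u: "u \<in> {0..t}"
      then have uT: "u \<in> {0..T}" "u \<le> T" using t by auto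
      \<comment> \<open>The filtered signal at \<open>u\<close> is an observable of time
        \<open>u\<close>, so \<open>D\<close> may be replaced by its projection before
        Cauchy-Schwarz.\<close>
      have "(p i u)\<^sup>2 \<le> C\<^sup>2 * ip (hat u ?D) (hat u ?D)" for i
      proof -
        have "p i u = ip (hat u ?D) (hh u i)"
          unfolding p_def by (rule hat_cZ(2)[OF uT(1) DG hh_cZ[OF uT(1)], symmetric])
        then have "(p i u)\<^sup>2 \<le> ip (hat u ?D) (hat u ?D) * ip (hh u i) (hh u i)"
          using Cauchy_Schwarz_ip_sq[OF hat_L2[OF uT(1) DG] hh_L2[OF uT(1)]] by simp
        also have "\<dots> \<le> ip (hat u ?D) (hat u ?D) * C\<^sup>2"
        proof (rule mult_left_mono)
          have "nrm (hh u i) \<le> C"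
            using order_trans[OF hat_nrm[OF uT(1) h_GG[OF uT(1)]] C(2)[OF uT(1)]] by (simp add: hh_def)
          then show "ip (hh u i) (hh u i) \<le> C\<^sup>2"
            unfolding nrm_square[symmetric] by (rule power_mono) simp
        qed simp
        finally show ?thesis by (simp add: mult.commute)
      qed
      then have "\<alpha> u \<le> (\<Sum>i\<in>(UNIV::'i set). C\<^sup>2 * ip (hat u ?D) (hat u ?D))"
        unfolding \<alpha>_def by (intro sum_mono)
      also have "\<dots> = m * C\<^sup>2 * ip (hat u ?D) (hat u ?D)" by (simp add: m_def)
      also have "\<dots> \<le> m * C\<^sup>2 * (2 * m * e\<^sup>2 * T + 2 * integral {0..u} \<alpha>)"
      proof (rule mult_left_mono)
        have "2 * m * e\<^sup>2 * u \<le> 2 * m * e\<^sup>2 * T" using uT m0 by (intro mult_left_mono) auto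
        then show "ip (hat u ?D) (hat u ?D) \<le> 2 * m * e\<^sup>2 * T + 2 * integral {0..u} \<alpha>"
          using proj[OF u] by linarith
      qed (use m0 in simp)
      also have "\<dots> = A * m * T * e\<^sup>2 + A * integral {0..u} \<alpha>" by (simp add: A_def algebra_simps)
      finally show "\<alpha> u \<le> A * m * T * e\<^sup>2 + A * integral {0..u} \<alpha>" .
    qed
    have tt: "t \<in> {0..t}" using t by auto
    have "ip ?D ?D \<le> (\<Sum>i\<in>UNIV. integral {0..t} (\<lambda>s. (\<phi> i s)\<^sup>2))"
      by (rule observed_norm_bound[OF t D D1 DZ \<phi>i[OF tt] \<phi>2i[OF tt]])
    also have "\<dots> \<le> 2 * m * e\<^sup>2 * t + 2 * integral {0..t} \<alpha>" by (rule \<phi>le[OF tt])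
    also have "integral {0..t} \<alpha> \<le> integral {0..t} (\<lambda>_. B * e\<^sup>2)"
    proof (intro integral_le integrable_continuous_interval \<alpha>c continuous_on_const)
      fix u assume u: "u \<in> {0..t}"
      have "\<alpha> u \<le> (A * m * T * e\<^sup>2) * exp (A * u)" by (rule \<alpha>le[OF u])
      also have "\<dots> \<le> (A * m * T * e\<^sup>2) * exp (A * T)"
        using u t A0 m0 T by (intro mult_left_mono) (auto intro!: mult_left_mono)
      finally show "\<alpha> u \<le> B * e\<^sup>2" by (simp add: B_def mult_ac)
    qed
    also have "integral {0..t} (\<lambda>_. B * e\<^sup>2) = t * (B * e\<^sup>2)" using t by simp
    also have "2 * m * e\<^sup>2 * t + 2 * (t * (B * e\<^sup>2)) = (2 * m + 2 * B) * e\<^sup>2 * t" by (simp add: algebra_simps)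
    also have "\<dots> \<le> (2 * m + 2 * B) * e\<^sup>2 * T" using t m0 A0 by (intro mult_left_mono) auto
    also have "\<dots> = K * e\<^sup>2" by (simp add: K_def algebra_simps)
    finally show "(nrm ?D)\<^sup>2 \<le> K * e\<^sup>2" unfolding nrm_square by simp
  qed
qed

end

text \<open>The Ito isometry for two remainders. Only the second one is replaced by step sums of
  innovations; the pairing of the first with each innovation increment is known exactly from
  \<open>mart_nu\<close>.\<close>

lemma mart_mart:
  assumes sig1: "signal v1 b1 w1" and sig2: "signal v2 b2 w2"
    and J1: "\<And>t. t \<in> {0..T} \<Longrightarrow> wint (\<lambda>s. real_cond_exp M (F s) (b1 s)) t (J1 t)"
    and J2: "\<And>t. t \<in> {0..T} \<Longrightarrow> wint (\<lambda>s. real_cond_exp M (F s) (b2 s)) t (J2 t)"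
    and t: "t \<in> {0..T}"
  shows "ip (mart v1 J1 t) (mart v2 J2 t) = integral {0..t} (\<lambda>s. \<Sum>i\<in>UNIV. gain v1 i s * gain v2 i s)"
proof -
  obtain K where K: "K \<ge> 0" and approx:
    "\<And>t n \<tau> g e. t \<in> {0..T} \<Longrightarrow> (\<And>k. k < n \<Longrightarrow> 0 \<le> \<tau> k) \<Longrightarrow> (\<And>k. k < n \<Longrightarrow> \<tau> k \<le> \<tau> (Suc k)) \<Longrightarrow>
      (\<And>k. k < n \<Longrightarrow> \<tau> (Suc k) \<le> t) \<Longrightarrow> 0 \<le> e \<Longrightarrow>
      (\<And>i s. s \<in> {0<..t} \<Longrightarrow> \<bar>gain v2 i s - step_fun n \<tau> g i s\<bar> \<le> e) \<Longrightarrow>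
      (nrm (\<lambda>x. mart v2 J2 t x - step_sum n \<tau> g x))\<^sup>2 \<le> K * e\<^sup>2"
    using mart_step_approx[OF sig2 J2] by blast
  have tT: "0 \<le> t" "t \<le> T" using t by auto
  note M1 = mart_L2[OF sig1 J1 t] and M2 = mart_L2[OF sig2 J2 t]
  have gc: "continuous_on {0..t} (gain v1 i)" "continuous_on {0..t} (gain v2 i)" for i
    using tT by (auto intro: continuous_on_subset[OF gain_cont[OF sig1]] continuous_on_subset[OF gain_cont[OF sig2]])
  have gi: "gain v1 i integrable_on {0..t}" "(\<lambda>s. \<bar>gain v1 i s\<bar>) integrable_on {0..t}"
    "(\<lambda>s. gain v1 i s * gain v2 i s) integrable_on {0..t}" for i
    by (intro integrable_continuous_interval continuous_intros gc)+
  \<comment> \<open>The two errors per unit of \<open>e\<close>: the first comes from replacing the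
    second remainder by its step sum, the second from replacing its gain by the step
    function.\<close>
  define B where "B = nrm (mart v1 J1 t) * sqrt K + (\<Sum>i\<in>UNIV. integral {0..t} (\<lambda>s. \<bar>gain v1 i s\<bar>))"
  define X Y where "X = ip (mart v1 J1 t) (mart v2 J2 t)"
    and "Y = integral {0..t} (\<lambda>s. \<Sum>i\<in>UNIV. gain v1 i s * gain v2 i s)"
  have "\<bar>X - Y\<bar> \<le> e * B" if e: "e > 0" for e
  proof -
    obtain n0 where n0: "\<And>n s i. n \<ge> n0 \<Longrightarrow> 0 < n \<Longrightarrow> s \<in> {0<..t} \<Longrightarrow>
        \<bar>gain v2 i s - (\<Sum>k<n. gain v2 i (t * real k / real n) * indicator {t * real k / real n<..t * real (Suc k) / real n} s)\<bar> \<le> e"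
      by (rule uniform_step_approx[where G="gain v2" and T=T, OF gain_cont[OF sig2] tT e]) blast
    define n where "n = max n0 1"
    define \<tau> where "\<tau> k = t * real k / real n" for k
    define g where "g k i = gain v2 i (\<tau> k)" for k i
    have n: "n \<ge> n0" "n > 0" by (auto simp: n_def)
    have app: "\<bar>gain v2 i s - step_fun n \<tau> g i s\<bar> \<le> e" if "s \<in> {0<..t}" for i s
      using n0[OF n that, of i] by (simp only: step_fun_def g_def \<tau>_def)
    have \<tau>: "0 \<le> \<tau> k" "\<tau> k \<le> \<tau> (Suc k)" "\<tau> (Suc k) \<le> t" if "k < n" for k
    proof -
      show "0 \<le> \<tau> k" "\<tau> k \<le> \<tau> (Suc k)" using tT by (auto simp: \<tau>_def intro!: divide_right_mono mult_left_mono)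
      have "t * real (Suc k) \<le> t * real n" using that tT by (intro mult_left_mono) auto
      then show "\<tau> (Suc k) \<le> t" using n(2) by (simp add: \<tau>_def pos_divide_le_eq)
    qed
    let ?S = "step_sum n \<tau> g"
    have SL: "?S \<in> L2" by (rule cZ_L2[OF step_sum_cZ[where n=n and \<tau>=\<tau>, OF \<tau> t]])
    have "(nrm (\<lambda>x. mart v2 J2 t x - ?S x))\<^sup>2 \<le> K * e\<^sup>2"
      by (rule approx[OF t \<tau> _ app]) (use e in auto)
    then have "nrm (\<lambda>x. mart v2 J2 t x - ?S x) \<le> sqrt (K * e\<^sup>2)" by (rule real_le_rsqrt)
    then have N: "nrm (\<lambda>x. mart v2 J2 t x - ?S x) \<le> sqrt K * e" using e by (simp add: real_sqrt_mult)
    have "X - ip (mart v1 J1 t) ?S = ip (mart v1 J1 t) (\<lambda>x. mart v2 J2 t x - ?S x)"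
      unfolding X_def by (rule ip_diff_right[OF M2 SL M1, symmetric])
    then have "\<bar>X - ip (mart v1 J1 t) ?S\<bar> \<le> nrm (mart v1 J1 t) * nrm (\<lambda>x. mart v2 J2 t x - ?S x)"
      using Cauchy_Schwarz_ip[OF M1 L2_diff[OF M2 SL]] by simp
    also have "\<dots> \<le> nrm (mart v1 J1 t) * (sqrt K * e)" by (intro mult_left_mono N) simp
    finally have b1: "\<bar>X - ip (mart v1 J1 t) ?S\<bar> \<le> e * (nrm (mart v1 J1 t) * sqrt K)" by (simp add: mult_ac)
    have sp: "((\<lambda>s. step_fun n \<tau> g i s * gain v1 i s) has_integral
        (\<Sum>k<n. g k i * (integral {0..\<tau> (Suc k)} (gain v1 i) - integral {0..\<tau> k} (gain v1 i)))) {0..t}" for i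
      by (rule step_fun_prod_integral[where n=n and \<tau>=\<tau>, OF \<tau> t gi(1)])
    have "ip (mart v1 J1 t) ?S = (\<Sum>k<n. \<Sum>i\<in>UNIV. g k i * (ip (nu (\<tau> (Suc k)) i) (mart v1 J1 t) - ip (nu (\<tau> k) i) (mart v1 J1 t)))"
      unfolding ip_commute[of "mart v1 J1 t" ?S] by (rule step_sum_ip[where n=n and \<tau>=\<tau>, OF \<tau> t M1])
    also have "\<dots> = (\<Sum>k<n. \<Sum>i\<in>UNIV. g k i * (integral {0..\<tau> (Suc k)} (gain v1 i) - integral {0..\<tau> k} (gain v1 i)))"
    proof (intro sum.cong refl)
      fix k i assume "k \<in> {..<n}"
      then have k: "0 \<le> \<tau> k" "\<tau> k \<le> t" "0 \<le> \<tau> (Suc k)" "\<tau> (Suc k) \<le> t"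
        using \<tau>[of k] by auto
      show "g k i * (ip (nu (\<tau> (Suc k)) i) (mart v1 J1 t) - ip (nu (\<tau> k) i) (mart v1 J1 t))
          = g k i * (integral {0..\<tau> (Suc k)} (gain v1 i) - integral {0..\<tau> k} (gain v1 i))"
        using mart_nu[OF sig1 J1 k(1,2) tT(2), of i] mart_nu[OF sig1 J1 k(3,4) tT(2), of i]
        by (simp add: ip_commute[of "mart v1 J1 t" "nu _ i"])
    qed
    also have "\<dots> = (\<Sum>i\<in>UNIV. integral {0..t} (\<lambda>s. step_fun n \<tau> g i s * gain v1 i s))"
      unfolding integral_unique[OF sp] by (rule sum.swap)
    finally have S: "ip (mart v1 J1 t) ?S = (\<Sum>i\<in>UNIV. integral {0..t} (\<lambda>s. step_fun n \<tau> g i s * gain v1 i s))" .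
    have Y: "Y = (\<Sum>i\<in>UNIV. integral {0..t} (\<lambda>s. gain v1 i s * gain v2 i s))"
      unfolding Y_def by (intro integral_sum gi) simp
    have "\<bar>ip (mart v1 J1 t) ?S - Y\<bar> \<le> (\<Sum>i\<in>UNIV. \<bar>integral {0..t} (\<lambda>s. step_fun n \<tau> g i s * gain v1 i s) - integral {0..t} (\<lambda>s. gain v1 i s * gain v2 i s)\<bar>)"
      unfolding S Y sum_subtractf[symmetric] by (rule sum_abs)
    also have "\<dots> \<le> (\<Sum>i\<in>UNIV. e * integral {0..t} (\<lambda>s. \<bar>gain v1 i s\<bar>))"
    proof (rule sum_mono)
      fix i
      let ?f = "\<lambda>s. step_fun n \<tau> g i s * gain v1 i s - gain v1 i s * gain v2 i s"
      have fi: "?f integrable_on {0..t}"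
        using sp[of i] gi(3)[of i] by (intro Henstock_Kurzweil_Integration.integrable_diff) (auto simp: integrable_on_def)
      have "integral {0..t} (\<lambda>s. step_fun n \<tau> g i s * gain v1 i s) - integral {0..t} (\<lambda>s. gain v1 i s * gain v2 i s) = integral {0..t} ?f"
        using sp[of i] gi(3)[of i] by (intro Henstock_Kurzweil_Integration.integral_diff[symmetric]) (auto simp: integrable_on_def)
      also have "\<dots> = integral {0..t} (\<lambda>s. if s = 0 then 0 else ?f s)"
        by (rule integral_spike[of "{0}"]) auto
      finally have eq: "integral {0..t} (\<lambda>s. step_fun n \<tau> g i s * gain v1 i s) - integral {0..t} (\<lambda>s. gain v1 i s * gain v2 i s)
          = integral {0..t} (\<lambda>s. if s = 0 then 0 else ?f s)" .
      have "norm (integral {0..t} (\<lambda>s. if s = 0 then 0 else ?f s)) \<le> integral {0..t} (\<lambda>s. e * \<bar>gain v1 i s\<bar>)"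
      proof (rule integral_norm_bound_integral)
        show "(\<lambda>s. if s = 0 then 0 else ?f s) integrable_on {0..t}"
          by (rule integrable_spike[OF fi, of "{0}"]) auto
        show "(\<lambda>s. e * \<bar>gain v1 i s\<bar>) integrable_on {0..t}" by (intro integrable_on_mult_right gi)
        fix s assume s: "s \<in> {0..t}"
        show "norm (if s = 0 then 0 else ?f s) \<le> e * \<bar>gain v1 i s\<bar>"
        proof (cases "s = 0")
          case False
          have "?f s = - (gain v2 i s - step_fun n \<tau> g i s) * gain v1 i s" by (simp add: algebra_simps)
          then have "\<bar>?f s\<bar> = \<bar>gain v2 i s - step_fun n \<tau> g i s\<bar> * \<bar>gain v1 i s\<bar>" by (simp add: abs_mult abs_minus_commute)
          also have "\<dots> \<le> e * \<bar>gain v1 i s\<bar>" using app[of s i] s False by (intro mult_right_mono) auto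
          finally show ?thesis using False by simp
        qed (use e in simp)
      qed
      then show "\<bar>integral {0..t} (\<lambda>s. step_fun n \<tau> g i s * gain v1 i s) - integral {0..t} (\<lambda>s. gain v1 i s * gain v2 i s)\<bar>
          \<le> e * integral {0..t} (\<lambda>s. \<bar>gain v1 i s\<bar>)"
        unfolding eq by simp
    qed
    also have "\<dots> = e * (\<Sum>i\<in>UNIV. integral {0..t} (\<lambda>s. \<bar>gain v1 i s\<bar>))" by (simp add: sum_distrib_left)
    finally have b2: "\<bar>ip (mart v1 J1 t) ?S - Y\<bar> \<le> e * (\<Sum>i\<in>UNIV. integral {0..t} (\<lambda>s. \<bar>gain v1 i s\<bar>))" .
    show ?thesis using b1 b2 unfolding B_def distrib_left by linarith
  qed
  note bound = this
  have B0: "0 \<le> B" unfolding B_def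
    by (intro add_nonneg_nonneg mult_nonneg_nonneg sum_nonneg integral_nonneg gi) (use K in auto)
  have "\<bar>X - Y\<bar> \<le> e" if "e > 0" for e
  proof -
    have "\<bar>X - Y\<bar> \<le> (e / (B + 1)) * B" using that B0 by (intro bound) simp
    also have "\<dots> \<le> e" using that B0 by (simp add: pos_divide_le_eq mult_left_mono)
    finally show ?thesis .
  qed
  then have "\<bar>X - Y\<bar> \<le> 0" using field_le_epsilon[of "\<bar>X - Y\<bar>" 0] by simp
  then show ?thesis by (simp add: X_def Y_def)
qed

section \<open>Error covariances, the Riccati equation and the bracket of the innovations\<close>

definition err :: "real \<Rightarrow> ('w \<Rightarrow> real) \<Rightarrow> 'w \<Rightarrow> real" where
  "err t Y x = Y x - hat t Y x"

lemma err_ip: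
  assumes t: "t \<in> {0..T}" and Y: "Y \<in> cspan GG" and Y': "Y' \<in> cspan GG"
  shows "ip (err t Y) (err t Y') = ip Y Y' - ip (hat t Y) (hat t Y')"
proof -
  note L = cspan_L2[OF Y] cspan_L2[OF Y'] hat_L2[OF t Y] hat_L2[OF t Y']
  have "ip (err t Y) (err t Y') = ip (err t Y) Y' - ip (err t Y) (hat t Y')"
    unfolding err_def[abs_def] using L by (intro ip_diff_right) auto
  also have "ip (err t Y) (hat t Y') = 0"
    unfolding err_def[abs_def] by (rule hat_orth[OF t Y hat_cZ(1)[OF t Y']])
  also have "ip (err t Y) Y' = ip Y Y' - ip (hat t Y) Y'"
    unfolding err_def[abs_def] using L by (intro ip_diff_left) auto
  also have "ip (hat t Y) Y' = ip (hat t Y) (hat t Y')"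
    using hat_cZ(2)[OF t Y' hat_cZ(1)[OF t Y]] by (simp add: ip_commute[of "hat t Y" "Y'"] ip_commute[of "hat t Y" "hat t Y'"])
  finally show ?thesis by simp
qed

text \<open>The bracket in the rule for the signals is \<open>c\<close>, the one for their filters
  is the sum of gain products by \<open>mart_mart\<close>. Pythagoras in the form
  \<open>err_ip\<close> turns each difference, including those that pair a signal with a drift, into
  a covariance of errors.\<close>

lemma riccati_equation:
  assumes sig1: "signal v1 b1 w1" and sig2: "signal v2 b2 w2"
    and o1: "\<And>s t. 0 \<le> s \<Longrightarrow> s \<le> t \<Longrightarrow> t \<le> T \<Longrightarrow> ip (w1 t) (b2 s) = ip (w1 s) (b2 s)"
    and o2: "\<And>s t. 0 \<le> s \<Longrightarrow> s \<le> t \<Longrightarrow> t \<le> T \<Longrightarrow> ip (w2 t) (b1 s) = ip (w2 s) (b1 s)"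
    and z: "\<And>t. t \<in> {0..T} \<Longrightarrow> ip (w1 t) (v2 0) = 0" "\<And>t. t \<in> {0..T} \<Longrightarrow> ip (w2 t) (v1 0) = 0"
    and c: "ip (w1 t) (w2 t) = c * t"
    and t: "t \<in> {0..T}"
  shows "((\<lambda>s. ip (err s (v1 s)) (err s (b2 s)) + ip (err s (b1 s)) (err s (v2 s)) + c
        - (\<Sum>i\<in>UNIV. gain v1 i s * gain v2 i s)) has_integral
      ip (err t (v1 t)) (err t (v2 t)) - ip (err 0 (v1 0)) (err 0 (v2 0))) {0..t}"
proof -
  \<comment> \<open>Some version of the integral of the filtered drift is needed to speak of
    \<open>mart\<close>. The equation itself does not mention it.\<close>
  have wex: "\<exists>J. \<forall>t\<in>{0..T}. wint (\<lambda>s. hat s (b s)) t (J t)" if "signal v b w" for v b w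
  proof -
    note cont = sig_hatb_cont[OF that]
    obtain y' where y': "(\<lambda>(s, x). y' s x) \<in> borel_measurable (borel \<Otimes>\<^sub>M M)"
      "\<And>s. s \<in> {0..T} \<Longrightarrow> AE x in M. y' s x = hat s (b s) x"
      using measurable_modification_exists[OF cont] by blast
    show ?thesis
      using path_integral(2)[OF T cont y'] by (intro exI[of _ "\<lambda>t x. LINT s:{0..t}|lborel. y' s x"]) blast
  qed
  obtain J1 where J1: "\<And>t. t \<in> {0..T} \<Longrightarrow> wint (\<lambda>s. hat s (b1 s)) t (J1 t)" using wex[OF sig1] by blast
  obtain J2 where J2: "\<And>t. t \<in> {0..T} \<Longrightarrow> wint (\<lambda>s. hat s (b2 s)) t (J2 t)" using wex[OF sig2] by blast
  have tT: "0 \<le> t" "t \<le> T" using t by auto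
  have ci: "(\<lambda>_. c) integrable_on {0..t}" by (rule integrable_continuous_interval) simp
  have c': "ip (w1 t) (w2 t) = integral {0..t} (\<lambda>_. c)" using c tT by simp
  note P1 = product_rule[OF sig_cont(2)[OF sig1] sig_cont(2)[OF sig2] sig_L2(1)[OF sig1] sig_L2(1)[OF sig2]
      sig_L2(3)[OF sig1] sig_L2(3)[OF sig2] sig_ip[OF sig1] sig_ip[OF sig2] o1 o2 z c' ci t]
  have gi: "(\<lambda>s. \<Sum>i\<in>UNIV. gain v1 i s * gain v2 i s) integrable_on {0..t}"
    by (intro integrable_continuous_interval continuous_intros
        continuous_on_subset[OF gain_cont[OF sig1]] continuous_on_subset[OF gain_cont[OF sig2]]) (use tT in auto)
  have hat_ip: "ip (hat t (v t)) Y = ip (hat 0 (v 0)) Y + integral {0..t} (\<lambda>s. ip (hat s (b s)) Y) + ip (mart v J t) Y"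
    if "signal v b w" "\<And>t. t \<in> {0..T} \<Longrightarrow> wint (\<lambda>s. hat s (b s)) t (J t)" "t \<in> {0..T}" "Y \<in> L2" for v b w J t Y
    using mart_ip[OF that] by simp
  have z0: "ip (mart v J t) (hat 0 (v' 0)) = 0"
    if sg: "signal v b w" "\<And>t. t \<in> {0..T} \<Longrightarrow> wint (\<lambda>s. hat s (b s)) t (J t)" "signal v' b' w'" "t \<in> {0..T}" for v b w J v' b' w' t
    using mart_orth[OF sg(1,2) order_refl _ _ sig_hat_cZ(1)[OF sg(3) zero_T[OF sig1 J1]], of t]
      mart_zero[OF sg(1,2) sig_hat_L2(1)[OF sg(3) zero_T[OF sig1 J1]]] sg(4) by simp
  have mo: "ip (mart v J t) (hat s (b' s)) = ip (mart v J s) (hat s (b' s))"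
    if sg: "signal v b w" "\<And>t. t \<in> {0..T} \<Longrightarrow> wint (\<lambda>s. hat s (b s)) t (J t)" "signal v' b' w'" "0 \<le> s" "s \<le> t" "t \<le> T" for v b w J v' b' w' s t
    by (rule mart_orth[OF sg(1,2,4-6) sig_hat_cZ(2)[OF sg(3)]]) (use sg in auto)
  have P2: "((\<lambda>s. ip (hat s (v1 s)) (hat s (b2 s)) + ip (hat s (b1 s)) (hat s (v2 s)) + (\<Sum>i\<in>UNIV. gain v1 i s * gain v2 i s))
      has_integral ip (hat t (v1 t)) (hat t (v2 t)) - ip (hat 0 (v1 0)) (hat 0 (v2 0))) {0..t}"
    by (rule product_rule[OF sig_hatb_cont[OF sig1] sig_hatb_cont[OF sig2] sig_hat_L2(1)[OF sig1] sig_hat_L2(1)[OF sig2]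
      mart_L2[OF sig1 J1] mart_L2[OF sig2 J2] hat_ip[OF sig1 J1] hat_ip[OF sig2 J2] mo[OF sig1 J1 sig2] mo[OF sig2 J2 sig1]
      z0[OF sig1 J1 sig2] z0[OF sig2 J2 sig1] mart_mart[OF sig1 sig2 J1 J2 t] gi t])
  have e: "ip (err s Y) (err s Y') = ip Y Y' - ip (hat s Y) (hat s Y')"
    if "s \<in> {0..T}" "Y \<in> cspan GX" "Y' \<in> cspan GX" for s Y Y'
    using err_ip[OF that(1)] that GX_GG by blast
  have "((\<lambda>s. ip (v1 s) (b2 s) + ip (b1 s) (v2 s) + c - (ip (hat s (v1 s)) (hat s (b2 s)) + ip (hat s (b1 s)) (hat s (v2 s)) + (\<Sum>i\<in>UNIV. gain v1 i s * gain v2 i s)))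
      has_integral (ip (v1 t) (v2 t) - ip (v1 0) (v2 0)) - (ip (hat t (v1 t)) (hat t (v2 t)) - ip (hat 0 (v1 0)) (hat 0 (v2 0)))) {0..t}"
    by (rule has_integral_diff[OF P1 P2])
  also have "(ip (v1 t) (v2 t) - ip (v1 0) (v2 0)) - (ip (hat t (v1 t)) (hat t (v2 t)) - ip (hat 0 (v1 0)) (hat 0 (v2 0)))
      = ip (err t (v1 t)) (err t (v2 t)) - ip (err 0 (v1 0)) (err 0 (v2 0))"
    using e[OF t sig_GX(1)[OF sig1 t] sig_GX(1)[OF sig2 t]]
      e[OF zero_T[OF sig1 J1] sig_GX(1)[OF sig1 zero_T[OF sig1 J1]] sig_GX(1)[OF sig2 zero_T[OF sig1 J1]]] by simp
  finally show ?thesis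
  proof (rule has_integral_eq[rotated])
    fix s assume "s \<in> {0..t}"
    then have s: "s \<in> {0..T}" using tT by auto
    show "ip (v1 s) (b2 s) + ip (b1 s) (v2 s) + c - (ip (hat s (v1 s)) (hat s (b2 s)) + ip (hat s (b1 s)) (hat s (v2 s)) + (\<Sum>i\<in>UNIV. gain v1 i s * gain v2 i s))
      = ip (err s (v1 s)) (err s (b2 s)) + ip (err s (b1 s)) (err s (v2 s)) + c - (\<Sum>i\<in>UNIV. gain v1 i s * gain v2 i s)"
      using e[OF s sig_GX(1)[OF sig1 s] sig_GX(2)[OF sig2 s]] e[OF s sig_GX(2)[OF sig1 s] sig_GX(1)[OF sig2 s]] by simp
  qed
qed

lemma gain_err:
  assumes s: "s \<in> {0..T}" and v: "v s \<in> cspan GG" and sig: "signal v b w"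
  shows "gain v i s = ip (err s (v s)) (err s (h s i))"
proof -
  have "err s (h s i) = ht s i" by (simp add: fun_eq_iff err_def ht_def hh_def)
  moreover have "ip (err s (v s)) (ht s i) = ip (v s) (ht s i) - ip (hat s (v s)) (ht s i)"
    unfolding err_def[abs_def] by (rule ip_diff_left[OF cspan_L2[OF v] hat_L2[OF s v] ht_L2[OF s]])
  moreover have "ip (hat s (v s)) (ht s i) = 0"
    using ht_orth[OF s hat_cZ(1)[OF s v]] by (simp add: ip_commute[of "hat s (v s)"])
  ultimately show ?thesis by (simp add: gain_def[OF sig])
qed

lemma S_GG: "t \<in> {0..T} \<Longrightarrow> {Z s i | s i. s \<in> {0..t}} \<subseteq> cspan GG"
  using SZ_GG[of t] by (auto simp: SZ_def)

lemma err_cond_cov: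
  assumes t: "t \<in> {0..T}" and Y: "Y \<in> cspan GG" and Y': "Y' \<in> cspan GG"
  shows "AE x in M. real_cond_exp M (F t) (\<lambda>x. err t Y x * err t Y' x) x = ip (err t Y) (err t Y')"
proof -
  have tT: "t \<le> T" using t by simp
  have E: "err t Y \<in> cspan GG" "ip (err t Y) (\<lambda>x. 1) = 0" "\<And>V. V \<in> {Z s i | s i. s \<in> {0..t}} \<Longrightarrow> ip (err t Y) V = 0"
    if Y: "Y \<in> cspan GG" for Y
  proof -
    show "err t Y \<in> cspan GG"
      unfolding err_def[abs_def] using hat_cZ(1)[OF t Y] cZ_GG[OF tT] Y by (intro cspan_diff[OF GG_L2]) auto
    show "ip (err t Y) (\<lambda>x. 1) = 0"
      unfolding err_def[abs_def] by (rule hat_orth[OF t Y one_cZ[OF tT]])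
    show "ip (err t Y) V = 0" if "V \<in> {Z s i | s i. s \<in> {0..t}}" for V
      unfolding err_def[abs_def] using that Z_cZ[OF tT] by (intro hat_orth[OF t Y]) auto
  qed
  show ?thesis
    using E(2)[OF Y] E(2)[OF Y']
    by (intro gaussian_cond_exp_prod[OF GG_L2 chf F_gen[OF t] S_GG[OF t] E(1)[OF Y] _ E(3)[OF Y] E(1)[OF Y'] _ E(3)[OF Y']])
      (simp_all add: ip_const)
qed

lemma nu_GG: "t \<in> {0..T} \<Longrightarrow> nu t i \<in> cspan GG"
  using nu_cZ[of t i] cZ_GG[of t] by auto

text \<open>Both sides belong to \<open>cZ s\<close> and have the same inner products with it, so
  their difference is orthogonal to itself.\<close>

lemma nu_martingale:
  assumes s: "0 \<le> s" "s \<le> u" "u \<le> T"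
  shows "AE x in M. real_cond_exp M (F s) (nu u i) x = nu s i x"
proof -
  have sT: "s \<in> {0..T}" "u \<in> {0..T}" "s \<le> T" using s by auto
  note nuG = nu_GG[OF sT(2)]
  let ?E = "\<lambda>x. hat s (nu u i) x - nu s i x"
  note L = hat_L2[OF sT(1) nuG, of i] nu_L2[OF sT(1), of i]
  have E: "?E \<in> cZ s"
    using hat_cZ(1)[OF sT(1) nuG, of i] nu_cZ[OF sT(1), of i] unfolding cZ_def by (intro cspan_diff[OF SZ_L2[OF sT(3)]])
  have "ip ?E ?E = ip (hat s (nu u i)) ?E - ip (nu s i) ?E"
    by (rule ip_diff_left[OF L cZ_L2[OF E]])
  also have "ip (hat s (nu u i)) ?E = ip (nu s i) ?E"
    using hat_cZ(2)[OF sT(1) nuG E] nu_incr_orth[OF s E] by simp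
  finally have "AE x in M. ?E x = 0" using ip_self_eq_0_iff[OF cZ_L2[OF E]] by simp
  then show ?thesis by simp
qed

text \<open>The increments are centred, lie in the Gaussian span and are orthogonal to the past, so
  their conditional covariances equal the constants given by \<open>nu_cov\<close>.\<close>

lemma nu_bracket:
  assumes s: "0 \<le> s" "s \<le> u" "u \<le> T"
  shows "AE x in M. real_cond_exp M (F s) (\<lambda>x. (nu u i x - nu s i x) * (nu u j x - nu s j x)) x = (if i = j then u - s else 0)"
proof -
  have sT: "s \<in> {0..T}" "u \<in> {0..T}" "s \<le> T" using s by auto
  note L = nu_L2[OF sT(1)] nu_L2[OF sT(2)]
  have D: "(\<lambda>x. nu u i x - nu s i x) \<in> cspan GG" for i
    by (rule cspan_diff[OF GG_L2 nu_GG[OF sT(2)] nu_GG[OF sT(1)]])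
  have o: "ip (\<lambda>x. nu u i x - nu s i x) V = 0" if "V \<in> cZ s" for i V
    using nu_incr_orth[OF s that, of i] L cZ_L2[OF that] by (simp add: ip_diff_left)
  have e: "expectation (\<lambda>x. nu u i x - nu s i x) = 0" for i
    using o[OF one_cZ[OF sT(3)], of i] by (simp add: ip_const)
  have oZ: "ip (\<lambda>x. nu u i x - nu s i x) V = 0" if "V \<in> {Z r i | r i. r \<in> {0..s}}" for i V
    using that Z_cZ[OF sT(3)] by (intro o) auto
  have "AE x in M. real_cond_exp M (F s) (\<lambda>x. (nu u i x - nu s i x) * (nu u j x - nu s j x)) x
      = ip (\<lambda>x. nu u i x - nu s i x) (\<lambda>x. nu u j x - nu s j x)"
    by (intro gaussian_cond_exp_prod[OF GG_L2 chf F_gen[OF sT(1)] S_GG[OF sT(1)] D e oZ D e oZ])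
  also have "ip (\<lambda>x. nu u i x - nu s i x) (\<lambda>x. nu u j x - nu s j x) = (if i = j then u - s else 0)"
    using L nu_cov[OF sT(2) sT(2), of i j] nu_cov[OF sT(2) sT(1), of i j] nu_cov[OF sT(1) sT(2), of i j] nu_cov[OF sT(1) sT(1), of i j] s
    by (simp add: ip_diff_left ip_diff_right)
  finally show ?thesis .
qed

end

section \<open>The observation kernel\<close>

text \<open>The substitution \<open>u = t x\<close> moves the varying upper limit into the
  integrand, so continuity in a parameter over the fixed interval \<open>[0, 1]\<close>
  applies.\<close>

lemma continuous_on_integral_upto:
  fixes f :: "real \<Rightarrow> real \<Rightarrow> real"
  assumes f: "continuous_on ({0..T} \<times> {0..T}) (\<lambda>(t, s). f t s)"
  shows "continuous_on ({0..T} \<times> {0..T}) (\<lambda>(t, s). integral {0..t} (\<lambda>u. f u s))"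
proof -
  have c: "continuous_on (({0..T} \<times> {0..T}) \<times> cbox 0 1) (\<lambda>(p, x). fst p * f (fst p * x) (snd p))"
  proof -
    have "continuous_on (({0..T} \<times> {0..T}) \<times> cbox 0 1) (\<lambda>z. (\<lambda>(t, s). f t s) (fst (fst z) * snd z, snd (fst z)))"
    proof (rule continuous_on_compose2[OF f])
      show "(\<lambda>z. (fst (fst z) * snd z, snd (fst z))) ` (({0..T} \<times> {0..T}) \<times> cbox 0 1) \<subseteq> {0..T} \<times> {0..T}"
        by (auto intro: mult_left_le order_trans[OF mult_left_le])
    qed (intro continuous_intros)
    then show ?thesis by (auto simp: case_prod_unfold intro!: continuous_intros)
  qed
  have "continuous_on ({0..T} \<times> {0..T}) (\<lambda>p. integral (cbox 0 1) (\<lambda>x. fst p * f (fst p * x) (snd p)))"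
    using integral_continuous_on_param[of "{0..T} \<times> {0..T}" 0 1 "\<lambda>p x. fst p * f (fst p * x) (snd p)"] c by simp
  then show ?thesis
  proof (rule continuous_on_eq)
    fix p assume "p \<in> {0..T} \<times> {0..T}"
    then obtain t s where p: "p = (t, s)" "t \<in> {0..T}" "s \<in> {0..T}" by auto
    have fc: "continuous_on {0..t} (\<lambda>u. f u s)"
    proof -
      have "continuous_on {0..t} (\<lambda>u. (\<lambda>(t, s). f t s) (u, s))"
        by (rule continuous_on_compose2[OF f]) (use p in \<open>auto intro!: continuous_intros\<close>)
      then show ?thesis by simp
    qed
    have "((\<lambda>x. t *\<^sub>R f (t * x) s) has_integral integral {t * 0..t * 1} (\<lambda>u. f u s)) {0..1}"
    proof (rule has_integral_substitution[where c=0 and d=t])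
      show "((\<lambda>x. t * x) has_real_derivative t) (at x within {0..1})" for x
        by (auto intro!: derivative_eq_intros)
      show "(\<lambda>x. t * x) ` {0..1} \<subseteq> {0..t}" using p by (auto intro: mult_left_le)
    qed (use p fc in auto)
    from integral_unique[OF this]
    show "integral (cbox 0 1) (\<lambda>x. fst p * f (fst p * x) (snd p)) = (\<lambda>(t, s). integral {0..t} (\<lambda>u. f u s)) p"
      using p by simp
  qed
qed

lemma square_integral:
  fixes f :: "real \<Rightarrow> real \<Rightarrow> real"
  assumes f: "continuous_on ({0..T} \<times> {0..T}) (\<lambda>(t, s). f t s)"
  shows "(LINT (t, s):{0..T} \<times> {0..T}|lborel. f t s) = integral {0..T} (\<lambda>s. integral {0..T} (\<lambda>t. f t s))"
    and "(\<lambda>s. integral {0..T} (\<lambda>t. f t s)) integrable_on {0..T}"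
    and "s \<in> {0..T} \<Longrightarrow> (\<lambda>t. f t s) integrable_on {0..T}"
proof -
  have sq: "{0..T} \<times> {0..T} = cbox (0, 0) (T, T)" by (auto simp: cbox_Pair_eq cbox_interval)
  have c: "continuous_on (cbox (0, 0) (T, T)) (\<lambda>(t, s). f t s)" using f by (simp add: sq)
  have "integrable lborel (\<lambda>x. indicator (cbox (0, 0) (T, T)) x *\<^sub>R (\<lambda>(t, s). f t s) x)"
    by (rule borel_integrable_compact[OF compact_cbox c])
  then have "(LINT (t, s):{0..T} \<times> {0..T}|lborel. f t s) = integral UNIV (\<lambda>x. if x \<in> cbox (0, 0) (T, T) then (\<lambda>(t, s). f t s) x else 0)"
  proof -
    have "(\<lambda>x. indicator (cbox (0, 0) (T, T)) x *\<^sub>R (\<lambda>(t, s). f t s) x) = (\<lambda>x. if x \<in> cbox (0, 0) (T, T) then (\<lambda>(t, s). f t s) x else 0)"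
      by (auto simp: indicator_def)
    with integral_lborel[OF \<open>integrable lborel _\<close>] show ?thesis
      unfolding set_lebesgue_integral_def sq by simp
  qed
  also have "\<dots> = integral (cbox (0, 0) (T, T)) (\<lambda>(t, s). f t s)" by (rule integral_restrict_UNIV)
  also have "\<dots> = integral (cbox 0 T) (\<lambda>t. integral (cbox 0 T) (\<lambda>s. f t s))"
    using integral_prod_continuous[of 0 0 T T "\<lambda>(t, s). f t s"] c by simp
  also have "\<dots> = integral (cbox 0 T) (\<lambda>s. integral (cbox 0 T) (\<lambda>t. f t s))"
    by (rule integral_swap_continuous[OF c])
  finally show "(LINT (t, s):{0..T} \<times> {0..T}|lborel. f t s) = integral {0..T} (\<lambda>s. integral {0..T} (\<lambda>t. f t s))"
    by (simp add: cbox_interval)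
  have swap: "continuous_on ({0..T} \<times> cbox 0 T) (\<lambda>(s, t). f t s)"
  proof -
    have "continuous_on ({0..T} \<times> {0..T}) (\<lambda>x. case prod.swap x of (t, s) \<Rightarrow> f t s)"
      by (rule continuous_on_compose2[OF f]) (auto intro!: continuous_on_swap)
    then show ?thesis by (simp add: case_prod_unfold cbox_interval)
  qed
  show "(\<lambda>s. integral {0..T} (\<lambda>t. f t s)) integrable_on {0..T}"
    using integral_continuous_on_param[OF swap] by (intro integrable_continuous_interval) (simp add: cbox_interval)
  assume s: "s \<in> {0..T}"
  have "continuous_on {0..T} (\<lambda>t. (\<lambda>(t, s). f t s) (t, s))"
    by (rule continuous_on_compose2[OF f]) (use s in \<open>auto intro!: continuous_intros\<close>)
  then show "(\<lambda>t. f t s) integrable_on {0..T}" by (intro integrable_continuous_interval) simp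
qed

lemma continuous_on_square_section:
  assumes "continuous_on ({0..T} \<times> {0..T}) (\<lambda>(t, s). f t s)" "s \<in> {0..T}"
  shows "continuous_on {0..T} (\<lambda>t. f t s)"
proof -
  have "continuous_on {0..T} (\<lambda>t. (\<lambda>(t, s). f t s) (t, s))"
    by (rule continuous_on_compose2[OF assms(1)]) (use assms(2) in \<open>auto intro!: continuous_intros\<close>)
  then show ?thesis by simp
qed

text \<open>\<open>A(t,s) = H(t,s) - \<integral>\<^sub>0\<^sup>t L(u,s) du\<close> is an \<open>L\<^sub>1\<close>-limit of functions not depending on \<open>t\<close>; its
  oscillation around the mean over \<open>t\<close> is bounded by twice the distance to any such function.\<close>

lemma kernel_derivative:
  fixes p p' q :: "nat \<Rightarrow> real \<Rightarrow> real" and H L :: "real \<Rightarrow> real \<Rightarrow> real"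
  assumes T: "0 < T"
    and H_cont: "continuous_on ({0..T} \<times> {0..T}) (\<lambda>(t, s). H t s)"
    and p_C1: "\<And>i t. i \<ge> 1 \<Longrightarrow> t \<in> {0..T} \<Longrightarrow> (p i has_real_derivative p' i t) (at t within {0..T})"
      "\<And>i. i \<ge> 1 \<Longrightarrow> continuous_on {0..T} (p' i)"
    and q_cont: "\<And>i. i \<ge> 1 \<Longrightarrow> continuous_on {0..T} (q i)"
    and H_series: "(\<lambda>n. LINT (t, s):{0..T} \<times> {0..T}|lborel. \<bar>(\<Sum>i=1..n. p i t * q i s) - H t s\<bar>) \<longlonglongrightarrow> 0"
    and L_cont: "continuous_on ({0..T} \<times> {0..T}) (\<lambda>(t, s). L t s)"
    and L_series: "(\<lambda>n. LINT (t, s):{0..T} \<times> {0..T}|lborel. \<bar>(\<Sum>i=1..n. p' i t * q i s) - L t s\<bar>) \<longlonglongrightarrow> 0"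
    and s: "s \<in> {0..T}" and t: "t \<in> {0..T}"
  shows "H t s = H 0 s + integral {0..t} (\<lambda>u. L u s)"
proof -
  let ?Q = "{0..T} \<times> {0..T}"
  have fst_c: "continuous_on ?Q (\<lambda>(t, s). f t)" if "continuous_on {0..T} f" for f :: "real \<Rightarrow> real"
    unfolding case_prod_unfold by (rule continuous_on_compose2[OF that]) (auto intro!: continuous_intros)
  have snd_c: "continuous_on ?Q (\<lambda>(t, s). f s)" if "continuous_on {0..T} f" for f :: "real \<Rightarrow> real"
    unfolding case_prod_unfold by (rule continuous_on_compose2[OF that]) (auto intro!: continuous_intros)
  have p_cont: "continuous_on {0..T} (p i)" if "i \<ge> 1" for i
    using p_C1(1)[OF that] by (rule DERIV_continuous_on)
  define Hn Ln where "Hn n t s = (\<Sum>i=1..n. p i t * q i s)" and "Ln n t s = (\<Sum>i=1..n. p' i t * q i s)" for n t s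
  have Hn_c: "continuous_on ?Q (\<lambda>(t, s). Hn n t s)" and Ln_c: "continuous_on ?Q (\<lambda>(t, s). Ln n t s)" for n
    unfolding Hn_def Ln_def case_prod_unfold
    using fst_c[OF p_cont] fst_c[OF p_C1(2)] snd_c[OF q_cont] unfolding case_prod_unfold
    by (intro continuous_intros; simp)+
  define K where "K t s = integral {0..t} (\<lambda>u. L u s)" for t s
  have K_c: "continuous_on ?Q (\<lambda>(t, s). K t s)"
    unfolding K_def by (rule continuous_on_integral_upto[OF L_cont])
  define A where "A t s = H t s - K t s" for t s
  have A_c: "continuous_on ?Q (\<lambda>(t, s). A t s)"
    using H_cont K_c unfolding A_def case_prod_unfold by (intro continuous_intros)
  define avg where "avg s = integral {0..T} (\<lambda>t. A t s)" for s
  have avg_c: "continuous_on {0..T} avg"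
  proof -
    have "continuous_on ?Q (\<lambda>x. case prod.swap x of (t, s) \<Rightarrow> A t s)"
      by (rule continuous_on_compose2[OF A_c]) (auto intro!: continuous_on_swap)
    then have "continuous_on ({0..T} \<times> cbox 0 T) (\<lambda>(s, t). A t s)" by (simp add: case_prod_unfold cbox_interval)
    from integral_continuous_on_param[OF this] show ?thesis unfolding avg_def by (simp add: cbox_interval)
  qed
  \<comment> \<open>\<open>avg\<close> is an integral, not a mean; multiplying \<open>A\<close> by
    \<open>T\<close> avoids the division.\<close>
  define B where "B t s = \<bar>T * A t s - avg s\<bar>" for t s
  have B_c: "continuous_on ?Q (\<lambda>(t, s). B t s)"
    using A_c snd_c[OF avg_c] unfolding B_def case_prod_unfold by (intro continuous_intros)
  define E where "E n t s = \<bar>Hn n t s - H t s\<bar>" for n t s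
  define G where "G n t s = \<bar>Ln n t s - L t s\<bar>" for n t s
  have E_c: "continuous_on ?Q (\<lambda>(t, s). E n t s)" for n
    using Hn_c H_cont unfolding E_def case_prod_unfold by (intro continuous_intros)
  have G_c: "continuous_on ?Q (\<lambda>(t, s). G n t s)" for n
    using Ln_c L_cont unfolding G_def case_prod_unfold by (intro continuous_intros)
  note IE = square_integral[OF E_c] and IG = square_integral[OF G_c] and IB = square_integral[OF B_c] and IA = square_integral[OF A_c]
  \<comment> \<open>By the fundamental theorem \<open>Hn n t s\<close> minus the integral of
    \<open>Ln n\<close> is \<open>Hn n 0 s\<close>, which does not depend on \<open>t\<close>. The
    two error terms replace \<open>Hn n\<close> by \<open>H\<close> and \<open>Ln n\<close> by
    \<open>L\<close>.\<close>
  have A_near: "\<bar>A t s - Hn n 0 s\<bar> \<le> E n t s + integral {0..T} (\<lambda>u. G n u s)" if st: "t \<in> {0..T}" "s \<in> {0..T}" for n t s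
  proof -
    have "((\<lambda>u. Ln n u s) has_integral Hn n t s - Hn n 0 s) {0..t}"
    proof (rule fundamental_theorem_of_calculus)
      fix u assume u: "u \<in> {0..t}"
      have "((\<lambda>u. Hn n u s) has_real_derivative Ln n u s) (at u within {0..T})"
        unfolding Hn_def Ln_def using st u
        by (intro derivative_intros DERIV_sum DERIV_cmult_right p_C1(1)) auto
      then have "((\<lambda>u. Hn n u s) has_real_derivative Ln n u s) (at u within {0..t})"
        by (rule DERIV_subset) (use st in auto)
      then show "((\<lambda>u. Hn n u s) has_vector_derivative Ln n u s) (at u within {0..t})"
        by (simp add: has_real_derivative_iff_has_vector_derivative)
    qed (use st in auto)
    then have "Hn n t s - Hn n 0 s = integral {0..t} (\<lambda>u. Ln n u s)" by (simp add: integral_unique)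
    moreover have sub: "{0..t} \<subseteq> {0..T}" using st by auto
    have li: "(\<lambda>u. Ln n u s) integrable_on {0..t}" "(\<lambda>u. L u s) integrable_on {0..t}" "(\<lambda>u. G n u s) integrable_on {0..t}"
      by (rule integrable_continuous_interval, rule continuous_on_subset[OF _ sub],
          rule continuous_on_square_section[OF Ln_c st(2)] continuous_on_square_section[OF L_cont st(2)]
            continuous_on_square_section[OF G_c st(2)])+
    have "integral {0..t} (\<lambda>u. Ln n u s) - K t s = integral {0..t} (\<lambda>u. Ln n u s - L u s)"
      unfolding K_def by (rule Henstock_Kurzweil_Integration.integral_diff[symmetric, OF li(1,2)])
    moreover have "\<bar>integral {0..t} (\<lambda>u. Ln n u s - L u s)\<bar> \<le> integral {0..t} (\<lambda>u. G n u s)"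
      unfolding real_norm_def[symmetric]
      by (rule integral_norm_bound_integral[OF Henstock_Kurzweil_Integration.integrable_diff[OF li(1,2)] li(3)]) (simp add: G_def)
    moreover have "integral {0..t} (\<lambda>u. G n u s) \<le> integral {0..T} (\<lambda>u. G n u s)"
      by (rule integral_subset_le[OF sub li(3) IG(3)[OF st(2)]]) (simp add: G_def)
    ultimately show ?thesis unfolding A_def E_def by linarith
  qed
  have B_le: "integral {0..T} (\<lambda>t. B t s) \<le> 2 * T * (integral {0..T} (\<lambda>t. E n t s) + T * integral {0..T} (\<lambda>u. G n u s))"
    if s: "s \<in> {0..T}" for n s
  proof -
    define c where "c = Hn n 0 s"
    define R where "R = integral {0..T} (\<lambda>t. E n t s) + T * integral {0..T} (\<lambda>u. G n u s)"
    have a_c: "continuous_on {0..T} (\<lambda>t. A t s)" by (rule continuous_on_square_section[OF A_c s])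
    have ai: "(\<lambda>t. A t s) integrable_on {0..T}" "(\<lambda>t. \<bar>A t s - c\<bar>) integrable_on {0..T}"
      by (intro integrable_continuous_interval continuous_intros a_c)+
    have "integral {0..T} (\<lambda>t. \<bar>A t s - c\<bar>) \<le> integral {0..T} (\<lambda>t. E n t s + integral {0..T} (\<lambda>u. G n u s))"
    proof (rule integral_le[OF ai(2)])
      show "(\<lambda>t. E n t s + integral {0..T} (\<lambda>u. G n u s)) integrable_on {0..T}"
        by (intro integrable_continuous_interval continuous_intros continuous_on_square_section[OF E_c s])
    qed (use A_near s c_def in auto)
    also have "\<dots> = R"
      unfolding R_def using T
      by (subst Henstock_Kurzweil_Integration.integral_add[OF IE(3)[OF s]])
        (auto intro!: integrable_continuous_interval)
    finally have osc: "integral {0..T} (\<lambda>t. \<bar>A t s - c\<bar>) \<le> R" .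
    have "avg s - T * c = integral {0..T} (\<lambda>t. A t s - c)"
      unfolding avg_def using T ai(1)
      by (subst Henstock_Kurzweil_Integration.integral_diff) (auto intro!: integrable_continuous_interval)
    also have "\<bar>\<dots>\<bar> \<le> integral {0..T} (\<lambda>t. \<bar>A t s - c\<bar>)"
      unfolding real_norm_def[symmetric]
      by (rule integral_norm_bound_integral) (auto intro!: integrable_continuous_interval continuous_intros a_c)
    finally have av: "\<bar>avg s - T * c\<bar> \<le> R" using osc by linarith
    have "integral {0..T} (\<lambda>t. B t s) \<le> integral {0..T} (\<lambda>t. T * \<bar>A t s - c\<bar> + R)"
    proof (rule integral_le[OF IB(3)[OF s]])
      show "(\<lambda>t. T * \<bar>A t s - c\<bar> + R) integrable_on {0..T}"
        by (intro integrable_continuous_interval continuous_intros a_c)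
      fix t
      have "T * A t s - avg s = T * (A t s - c) - (avg s - T * c)" by (simp add: algebra_simps)
      then have "B t s \<le> \<bar>T * (A t s - c)\<bar> + \<bar>avg s - T * c\<bar>" unfolding B_def by linarith
      then show "B t s \<le> T * \<bar>A t s - c\<bar> + R" using av T by (simp add: abs_mult)
    qed
    also have "\<dots> = T * integral {0..T} (\<lambda>t. \<bar>A t s - c\<bar>) + T * R"
      using T by (subst Henstock_Kurzweil_Integration.integral_add[OF integrable_on_mult_right[OF ai(2)]])
        (auto intro!: integrable_continuous_interval)
    also have "\<dots> \<le> 2 * T * R"
    proof -
      have "T * integral {0..T} (\<lambda>t. \<bar>A t s - c\<bar>) \<le> T * R" using osc T by (intro mult_left_mono) auto
      then show ?thesis by (simp add: mult.commute)
    qed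
    finally show ?thesis unfolding R_def .
  qed
  have "integral {0..T} (\<lambda>s. integral {0..T} (\<lambda>t. B t s)) \<le>
      2 * T * ((LINT (t, s):?Q|lborel. E n t s) + T * (LINT (t, s):?Q|lborel. G n t s))" for n
  proof -
    have "integral {0..T} (\<lambda>s. integral {0..T} (\<lambda>t. B t s)) \<le>
        integral {0..T} (\<lambda>s. 2 * T * (integral {0..T} (\<lambda>t. E n t s) + T * integral {0..T} (\<lambda>u. G n u s)))"
      by (intro integral_le IB(2) integrable_on_mult_right Henstock_Kurzweil_Integration.integrable_add IE(2) IG(2) B_le)
    also have "\<dots> = 2 * T * (integral {0..T} (\<lambda>s. integral {0..T} (\<lambda>t. E n t s)) + T * integral {0..T} (\<lambda>s. integral {0..T} (\<lambda>u. G n u s)))"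
      by (simp only: integral_mult_right Henstock_Kurzweil_Integration.integral_add[OF IE(2) integrable_on_mult_right[OF IG(2)]])
    finally show ?thesis unfolding IE(1) IG(1) .
  qed
  moreover have "(\<lambda>n. 2 * T * ((LINT (t, s):?Q|lborel. E n t s) + T * (LINT (t, s):?Q|lborel. G n t s))) \<longlonglongrightarrow> 2 * T * (0 + T * 0)"
    using H_series L_series unfolding E_def G_def Hn_def Ln_def by (intro tendsto_intros)
  ultimately have "integral {0..T} (\<lambda>s. integral {0..T} (\<lambda>t. B t s)) \<le> 2 * T * (0 + T * 0)"
    by (intro LIMSEQ_le_const) auto
  moreover have "0 \<le> integral {0..T} (\<lambda>s. integral {0..T} (\<lambda>t. B t s))"
    by (intro integral_nonneg IB) (auto simp: B_def)
  ultimately have int0: "integral {0..T} (\<lambda>s. integral {0..T} (\<lambda>t. B t s)) = 0" by simp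
  have bc: "continuous_on {0..T} (\<lambda>s. integral {0..T} (\<lambda>t. B t s))"
  proof -
    have "continuous_on ?Q (\<lambda>x. case prod.swap x of (t, s) \<Rightarrow> B t s)"
      by (rule continuous_on_compose2[OF B_c]) (auto intro!: continuous_on_swap)
    then have "continuous_on ({0..T} \<times> cbox 0 T) (\<lambda>(s, t). B t s)" by (simp add: case_prod_unfold cbox_interval)
    from integral_continuous_on_param[OF this] show ?thesis by (simp add: cbox_interval)
  qed
  \<comment> \<open>Used twice, in \<open>s\<close> and then in \<open>t\<close>: continuity turns
    the vanishing of the double integral into an identity at every point, although the hypotheses
    give convergence in L_1 only.\<close>
  have zero: "f x = 0" if f: "continuous_on {0..T} f" "\<And>x. x \<in> {0..T} \<Longrightarrow> 0 \<le> f x" "integral {0..T} f = 0" "x \<in> {0..T}"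
    for f :: "real \<Rightarrow> real" and x
  proof -
    have "(f has_integral 0) (cbox 0 T)"
      using integrable_integral[OF integrable_continuous_interval[OF f(1)]] f(3) by (simp add: cbox_interval)
    then show ?thesis
      using f T by (intro has_integral_0_cbox_imp_0[of 0 T f]) (auto simp: cbox_interval box_real)
  qed
  have s0: "integral {0..T} (\<lambda>t. B t s) = 0"
  proof (rule zero[OF bc _ int0 s])
    show "0 \<le> integral {0..T} (\<lambda>t. B t s)" if "s \<in> {0..T}" for s
      by (rule integral_nonneg[OF IB(3)[OF that]]) (simp add: B_def)
  qed
  have "B u s = 0" if "u \<in> {0..T}" for u
    by (rule zero[OF continuous_on_square_section[OF B_c s] _ s0 that]) (simp add: B_def)
  from this[OF t] this[of 0] have "T * A t s = T * A 0 s" using T by (simp add: B_def)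
  then have "A t s = A 0 s" using T by simp
  then show ?thesis by (simp add: A_def K_def)
qed

text \<open>\<open>H t u\<close> is expanded from the diagonal, as \<open>H u u\<close> plus the
  integral of \<open>L s u\<close> over \<open>s\<close> from \<open>u\<close> to \<open>t\<close>,
  and the triangle is swapped. The function \<open>x\<close> is a number at each time because it
  will be the pairing of the state with a test variable.\<close>

lemma kernel_diagonal_integral:
  fixes H L :: "real \<Rightarrow> real \<Rightarrow> real" and x :: "real \<Rightarrow> real"
  assumes H_cont: "continuous_on ({0..T} \<times> {0..T}) (\<lambda>(t, s). H t s)"
    and L_cont: "continuous_on ({0..T} \<times> {0..T}) (\<lambda>(t, s). L t s)"
    and HL: "\<And>s t. s \<in> {0..T} \<Longrightarrow> t \<in> {0..T} \<Longrightarrow> H t s = H 0 s + integral {0..t} (\<lambda>u. L u s)"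
    and x: "continuous_on {0..T} x" and t: "t \<in> {0..T}"
  shows "integral {0..t} (\<lambda>s. H t s * x s) = integral {0..t} (\<lambda>s. H s s * x s + integral {0..s} (\<lambda>u. L s u * x u))"
proof -
  have sub: "{0..t} \<subseteq> {0..T}" using t by auto
  have k: "continuous_on {(s, u). 0 \<le> u \<and> u \<le> s \<and> s \<le> t} (\<lambda>(s, u). L s u * x u)"
  proof -
    have "continuous_on ({0..T} \<times> {0..T}) (\<lambda>z. x (snd z))"
      by (rule continuous_on_compose2[OF x]) (auto intro!: continuous_intros)
    then have "continuous_on ({0..T} \<times> {0..T}) (\<lambda>z. L (fst z) (snd z) * x (snd z))"
      using L_cont unfolding case_prod_unfold by (intro continuous_intros)
    then show ?thesis unfolding case_prod_unfold by (rule continuous_on_subset) (use t in auto)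
  qed
  note tri = triangle_integral[OF k]
  have xt: "continuous_on {0..t} x" by (rule continuous_on_subset[OF x sub])
  have Hd: "continuous_on {0..t} (\<lambda>s. H s s)"
  proof -
    have "continuous_on {0..t} (\<lambda>s. (\<lambda>(t, s). H t s) (s, s))"
      by (rule continuous_on_compose2[OF H_cont]) (use t in \<open>auto intro!: continuous_intros\<close>)
    then show ?thesis by simp
  qed
  have Hi: "(\<lambda>s. H s s * x s) integrable_on {0..t}"
    by (intro integrable_continuous_interval continuous_intros Hd xt)
  have "integral {0..t} (\<lambda>s. H t s * x s) = integral {0..t} (\<lambda>u. H u u * x u + integral {u..t} (\<lambda>s. L s u * x u))"
  proof (rule integral_cong)
    fix u assume u: "u \<in> {0..t}"
    then have uT: "u \<in> {0..T}" using t by auto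
    have Li: "(\<lambda>s. L s u) integrable_on {0..t}"
      by (intro integrable_continuous_interval continuous_on_subset[OF continuous_on_square_section[OF L_cont uT] sub])
    have "H t u = H u u + integral {u..t} (\<lambda>s. L s u)"
      using HL[OF uT t] HL[OF uT uT] Henstock_Kurzweil_Integration.integral_combine[OF _ _ Li, of u] u by simp
    then show "H t u * x u = H u u * x u + integral {u..t} (\<lambda>s. L s u * x u)"
      by (simp add: distrib_right)
  qed
  also have "\<dots> = integral {0..t} (\<lambda>s. H s s * x s) + integral {0..t} (\<lambda>s. integral {0..s} (\<lambda>u. L s u * x u))"
    unfolding tri(3) by (rule Henstock_Kurzweil_Integration.integral_add[OF Hi tri(2)])
  also have "\<dots> = integral {0..t} (\<lambda>s. H s s * x s + integral {0..s} (\<lambda>u. L s u * x u))"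
    by (rule Henstock_Kurzweil_Integration.integral_add[OF Hi tri(1), symmetric])
  finally show ?thesis .
qed

section \<open>The state process\<close>

lemma measurable_component:
  fixes Y :: "'w \<Rightarrow> real ^ 'm::finite"
  assumes "Y \<in> borel_measurable N" shows "(\<lambda>w. Y w $ i) \<in> borel_measurable N"
  using measurable_compose[OF assms borel_measurable_continuous_onI[of "\<lambda>x. x $ i"]]
  by (simp add: continuous_on_component)

text \<open>Fubini in coordinates. Lebesgue measure on vectors is the image of a product measure
  indexed by basis vectors; \<open>k\<close> sends a basis vector back to its coordinate.\<close>

lemma lborel_vec_prod:
  fixes f :: "'m::finite \<Rightarrow> real \<Rightarrow> real"
  assumes f: "\<And>i. integrable lborel (f i)"
  shows "integrable lborel (\<lambda>x :: real ^ 'm. \<Prod>i\<in>UNIV. f i (x $ i))"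
    and "integral\<^sup>L lborel (\<lambda>x :: real ^ 'm. \<Prod>i\<in>UNIV. f i (x $ i)) = (\<Prod>i\<in>UNIV. integral\<^sup>L lborel (f i))"
proof -
  interpret P: product_sigma_finite "\<lambda>_ :: real ^ 'm. lborel :: real measure" ..
  define k :: "real ^ 'm \<Rightarrow> 'm" where "k b = (THE i. b = axis i 1)" for b
  have k: "k (axis i 1) = i" for i by (auto simp: k_def axis_eq_axis)
  have B: "(Basis :: (real ^ 'm) set) = range (\<lambda>i. axis i 1)" by (auto simp: Basis_vec_def)
  have inj: "inj (\<lambda>i :: 'm. axis i (1::real))" by (auto intro!: injI simp: axis_eq_axis)
  have pr: "(\<Prod>b\<in>Basis. g (k b) b) = (\<Prod>i\<in>UNIV. g i (axis i 1))" for g :: "'m \<Rightarrow> real ^ 'm \<Rightarrow> real"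
    unfolding B by (subst prod.reindex[OF inj]) (simp add: k)
  note [measurable] = borel_measurable_integrable[OF f]
  have comp: "(\<Prod>i\<in>UNIV. f i ((\<Sum>b\<in>Basis. x b *\<^sub>R b) $ i)) = (\<Prod>b\<in>Basis. f (k b) (x b))" for x :: "real ^ 'm \<Rightarrow> real"
  proof -
    have "(\<Sum>b\<in>Basis. x b *\<^sub>R b) $ i = x (axis i 1)" for i
      using inner_sum_left_Basis[of "axis i 1" x] by (simp add: inner_axis axis_in_Basis_iff)
    then show ?thesis using pr[of "\<lambda>i b. f i (x b)"] by simp
  qed
  have m: "(\<lambda>x :: real ^ 'm. \<Prod>i\<in>UNIV. f i (x $ i)) \<in> borel_measurable borel" by measurable
  have g: "(\<lambda>x. \<Sum>b\<in>Basis. x b *\<^sub>R b) \<in> (\<Pi>\<^sub>M b\<in>Basis. lborel) \<rightarrow>\<^sub>M (borel :: (real ^ 'm) measure)" by measurable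
  have eq: "(lborel :: (real ^ 'm) measure) = distr (\<Pi>\<^sub>M b\<in>Basis. lborel) borel (\<lambda>x. \<Sum>b\<in>Basis. x b *\<^sub>R b)"
    by (rule lborel_eq)
  show "integrable lborel (\<lambda>x :: real ^ 'm. \<Prod>i\<in>UNIV. f i (x $ i))"
    unfolding eq integrable_distr_eq[OF g m] comp by (rule P.product_integrable_prod) (simp_all add: f)
  have "integral\<^sup>L lborel (\<lambda>x :: real ^ 'm. \<Prod>i\<in>UNIV. f i (x $ i)) = (\<Prod>b\<in>(Basis :: (real ^ 'm) set). integral\<^sup>L lborel (f (k b)))"
    unfolding eq integral_distr[OF g m] comp by (rule P.product_integral_prod) (simp_all add: f)
  then show "integral\<^sup>L lborel (\<lambda>x :: real ^ 'm. \<Prod>i\<in>UNIV. f i (x $ i)) = (\<Prod>i\<in>UNIV. integral\<^sup>L lborel (f i))"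
    using pr[of "\<lambda>i b. integral\<^sup>L lborel (f i)"] by simp
qed

context prob_space
begin

lemma gaussian_vec_moments:
  fixes Y :: "'a \<Rightarrow> real ^ 'm::finite"
  assumes \<sigma>: "0 < \<sigma>"
    and D: "distributed M lborel Y (\<lambda>x. ennreal (\<Prod>i\<in>UNIV. normal_density 0 \<sigma> (x $ i)))"
  shows "(\<lambda>w. Y w $ i) \<in> L2" "expectation (\<lambda>w. Y w $ i) = 0"
    "ip (\<lambda>w. Y w $ i) (\<lambda>w. Y w $ j) = (if i = j then \<sigma>\<^sup>2 else 0)"
proof -
  let ?n = "normal_density 0 \<sigma>"
  have Ym [measurable]: "Y \<in> borel_measurable M" using distributed_measurable[OF D] by simp
  have nn: "0 \<le> (\<Prod>i\<in>UNIV. ?n (x $ i))" for x :: "real ^ 'm" by (intro prod_nonneg) simp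
  have n0: "integrable lborel ?n" "(LINT x|lborel. ?n x) = 1"
    using integrable_normal_density[OF \<sigma>, of 0] integral_normal_density[OF \<sigma>, of 0] by auto
  have n1: "integrable lborel (\<lambda>x. ?n x * x)" "(LINT x|lborel. ?n x * x) = 0"
    using integrable_normal_moment_nz_1[OF \<sigma>, of 0] integral_normal_moment_nz_1[OF \<sigma>, of 0] by auto
  have n2: "integrable lborel (\<lambda>x. ?n x * (x * x))" "(LINT x|lborel. ?n x * (x * x)) = \<sigma>\<^sup>2"
    using integrable_normal_moment[OF \<sigma>, of 0 2] integral_normal_moment_even[OF \<sigma>, of 0 1]
    by (auto simp: power2_eq_square)
  \<comment> \<open>One extra factor \<open>x\<close> at coordinate \<open>i\<close> and one at
    \<open>j\<close>, so that the product over all coordinates is the density times the monomial.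
    For \<open>i = j\<close> both factors fall on the same coordinate and give the second
    moment.\<close>
  define f where "f i j l x = ?n x * ((if l = i then x else 1) * (if l = j then x else 1))" for i j l :: 'm and x
  have fi: "integrable lborel (f i j l)" for i j l
    unfolding f_def[abs_def] using n0(1) n1(1) n2(1) by (cases "l = i"; cases "l = j") auto
  have fI: "integral\<^sup>L lborel (f i j l) = (if l = i then (if l = j then \<sigma>\<^sup>2 else 0) else (if l = j then 0 else 1))" for i j l
    unfolding f_def[abs_def] using n0(2) n1(2) n2(2) by (cases "l = i"; cases "l = j") auto
  have fprod: "(\<Prod>l\<in>UNIV. f i j l (x $ l)) = (\<Prod>l\<in>UNIV. ?n (x $ l)) * (x $ i * x $ j)" for i j and x :: "real ^ 'm"
    unfolding f_def prod.distrib by simp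
  define g where "g i l x = ?n x * (if l = i then x else 1)" for i l :: 'm and x
  have gi: "integrable lborel (g i l)" for i l
    unfolding g_def[abs_def] using n0(1) n1(1) by (cases "l = i") auto
  have gI: "integral\<^sup>L lborel (g i l) = (if l = i then 0 else 1)" for i l
    unfolding g_def[abs_def] using n0(2) n1(2) by (cases "l = i") auto
  have gprod: "(\<Prod>l\<in>UNIV. g i l (x $ l)) = (\<Prod>l\<in>UNIV. ?n (x $ l)) * (x $ i)" for i and x :: "real ^ 'm"
    unfolding g_def prod.distrib by simp
  have E1: "expectation (\<lambda>w. Y w $ i) = (\<Prod>l\<in>UNIV. if l = i then 0 else 1)" for i
    using distributed_integral[OF D, of "\<lambda>x. x $ i"] lborel_vec_prod(2)[of "g i", OF gi] nn unfolding gprod gI by simp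
  then show "expectation (\<lambda>w. Y w $ i) = 0" by (simp add: prod_zero_iff)
  have E2: "expectation (\<lambda>w. Y w $ i * Y w $ j) = (\<Prod>l\<in>UNIV. if l = i then (if l = j then \<sigma>\<^sup>2 else 0) else (if l = j then 0 else 1))" for i j
    using distributed_integral[OF D, of "\<lambda>x. x $ i * x $ j"] lborel_vec_prod(2)[of "f i j", OF fi] nn unfolding fprod fI by simp
  show "ip (\<lambda>w. Y w $ i) (\<lambda>w. Y w $ j) = (if i = j then \<sigma>\<^sup>2 else 0)"
  proof (cases "i = j")
    case True
    have "(\<Prod>l\<in>UNIV. if l = i then (if l = j then \<sigma>\<^sup>2 else 0) else (if l = j then 0 else 1)) = (\<Prod>l\<in>UNIV. if l = i then \<sigma>\<^sup>2 else 1)"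
      using True by (intro prod.cong) auto
    then show ?thesis using True E2[of i j] by (simp add: ip_def)
  next
    case False
    have "(\<Prod>l\<in>UNIV. if l = i then (if l = j then \<sigma>\<^sup>2 else 0) else (if l = j then 0 else 1)) = 0"
      by (rule prod_zero[OF _ bexI[of _ i]]) (use False in auto)
    then show ?thesis using False E2[of i j] by (simp add: ip_def)
  qed
  have "integrable lborel (\<lambda>x :: real ^ 'm. (\<Prod>l\<in>UNIV. ?n (x $ l)) * (x $ i * x $ i))"
    using lborel_vec_prod(1)[of "f i i", OF fi] unfolding fprod .
  then have "integrable M (\<lambda>w. Y w $ i * Y w $ i)"
    using distributed_integrable[OF D, of "\<lambda>x. x $ i * x $ i"] nn by simp
  then show "(\<lambda>w. Y w $ i) \<in> L2" using measurable_component[OF Ym] by (simp add: L2_def power2_eq_square)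
qed

lemma indep_ip:
  assumes indep: "indep_set (sets A) (sets B)" and sp: "space A = space M" "space B = space M"
    and f: "f \<in> borel_measurable A" "f \<in> L2" and g: "g \<in> borel_measurable B" "g \<in> L2"
  shows "ip f g = expectation f * expectation g"
proof -
  have sub: "sigma_sets (space M) {f -` X \<inter> space M |X. X \<in> sets borel} \<subseteq> sets A"
    "sigma_sets (space M) {g -` X \<inter> space M |X. X \<in> sets borel} \<subseteq> sets B"
    using sets.sigma_sets_subset[of "{f -` X \<inter> space M |X. X \<in> sets borel}" A] measurable_sets[OF f(1)]
      sets.sigma_sets_subset[of "{g -` X \<inter> space M |X. X \<in> sets borel}" B] measurable_sets[OF g(1)] sp
    by auto
  have "indep_set (sigma_sets (space M) {f -` X \<inter> space M |X. X \<in> sets borel}) (sigma_sets (space M) {g -` X \<inter> space M |X. X \<in> sets borel})"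
    using indep sub unfolding indep_set_def
    by (elim indep_sets_mono_sets) (auto split: bool.splits)
  then have "indep_var borel f borel g"
    unfolding indep_var_eq using L2_measurable[OF f(2)] L2_measurable[OF g(2)] by auto
  then show ?thesis
    unfolding ip_def by (intro indep_var_lebesgue_integral L2_integrable f g)
qed

lemma generated_algebra_measurable:
  assumes "s \<in> I" shows "Y s \<in> borel_measurable (generated_algebra M I Y)"
  unfolding generated_algebra_def
  using assms by (intro measurableI) (auto simp: space_measure_of_conv intro!: in_measure_of)

lemma space_generated_algebra [simp]: "space (generated_algebra M I Y) = space M"
  by (simp add: generated_algebra_def space_measure_of_conv)

text \<open>Time 0 needs its own treatment: increments are described for strictly increasing times,
  and the value at 0 vanishes almost everywhere only. For \<open>s < t\<close> independence of the
  increment from the past reduces the covariance to the one at \<open>s\<close>.\<close>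

lemma brownian_L2_moments:
  fixes B :: "real \<Rightarrow> 'a \<Rightarrow> real ^ 'm::finite"
  assumes B: "standard_brownian_motion M T B" and T: "0 \<le> T"
  shows "t \<in> {0..T} \<Longrightarrow> (\<lambda>w. B t w $ i) \<in> L2"
    and "t \<in> {0..T} \<Longrightarrow> expectation (\<lambda>w. B t w $ i) = 0"
    and "s \<in> {0..T} \<Longrightarrow> t \<in> {0..T} \<Longrightarrow> ip (\<lambda>w. B s w $ i) (\<lambda>w. B t w $ j) = (if i = j then min s t else 0)"
proof -
  have Bm [measurable]: "B t \<in> borel_measurable M" if "t \<in> {0..T}" for t
    using B that by (simp add: standard_brownian_motion_def)
  have B0: "AE w in M. B 0 w = 0" using B by (simp add: standard_brownian_motion_def)
  have z: "0 \<in> {0..T}" using T by simp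
  have incr: "(\<lambda>w. B t w $ i - B s w $ i) \<in> L2" "expectation (\<lambda>w. B t w $ i - B s w $ i) = 0"
    "ip (\<lambda>w. B t w $ i - B s w $ i) (\<lambda>w. B t w $ j - B s w $ j) = (if i = j then t - s else 0)"
    if "0 \<le> s" "s < t" "t \<le> T" for s t i j
  proof -
    have "distributed M lborel (\<lambda>w. B t w - B s w) (\<lambda>x. ennreal (\<Prod>i\<in>UNIV. normal_density 0 (sqrt (t - s)) (x $ i)))"
      using B that unfolding standard_brownian_motion_def by blast
    from gaussian_vec_moments[OF _ this] that
    show "(\<lambda>w. B t w $ i - B s w $ i) \<in> L2" "expectation (\<lambda>w. B t w $ i - B s w $ i) = 0"
      "ip (\<lambda>w. B t w $ i - B s w $ i) (\<lambda>w. B t w $ j - B s w $ j) = (if i = j then t - s else 0)"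
      by simp_all
  qed
  have zero: "AE w in M. B 0 w $ i = 0" for i using B0 by eventually_elim simp
  have B0L: "(\<lambda>w. B 0 w $ i) \<in> L2" for i
    by (rule L2_AE_cong[OF L2_const[of 0] zero]) (rule measurable_component[OF Bm[OF z]])
  have ip0: "ip (\<lambda>w. B 0 w $ i) U = 0" if "U \<in> L2" for U i
  proof -
    have "ip (\<lambda>w. B 0 w $ i) U = ip (\<lambda>w. 0) U"
      by (rule ip_cong_AE) (use zero L2_measurable[OF B0L] L2_measurable[OF that] in auto)
    then show ?thesis by simp
  qed
  have BL: "(\<lambda>w. B t w $ i) \<in> L2" if "t \<in> {0..T}" for t i
  proof (cases "t = 0")
    case False
    then have "(\<lambda>w. (B t w $ i - B 0 w $ i) + B 0 w $ i) \<in> L2" using that by (intro L2_add incr B0L) auto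
    then show ?thesis by simp
  qed (simp add: B0L)
  have BE: "expectation (\<lambda>w. B t w $ i) = 0" if "t \<in> {0..T}" for t i
  proof -
    have e0: "expectation (\<lambda>w. B 0 w $ i) = 0" using ip0[OF L2_const[of 1], of i] by (simp add: ip_const)
    show ?thesis
    proof (cases "t = 0")
      case False
      then have "expectation (\<lambda>w. B t w $ i - B 0 w $ i) = 0" using that by (intro incr) auto
      then show ?thesis using e0 L2_integrable[OF BL[OF that]] L2_integrable[OF B0L] by simp
    qed (use e0 in simp)
  qed
  have diag: "ip (\<lambda>w. B t w $ i) (\<lambda>w. B t w $ j) = (if i = j then t else 0)" if "t \<in> {0..T}" for t i j
  proof (cases "t = 0")
    case True
    then show ?thesis using ip0[OF B0L] by simp
  next
    case False
    then have "ip (\<lambda>w. B t w $ i - B 0 w $ i) (\<lambda>w. B t w $ j - B 0 w $ j) = (if i = j then t else 0)"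
      using that incr(3)[of 0 t i j] by simp
    then show ?thesis using BL[OF that] B0L ip0[OF BL[OF that]] ip0[OF B0L] ip_commute[of "\<lambda>w. B t w $ i" "\<lambda>w. B 0 w $ j"]
      by (simp add: ip_diff_left ip_diff_right)
  qed
  have cross: "ip (\<lambda>w. B s w $ i) (\<lambda>w. B t w $ j) = (if i = j then s else 0)" if st: "0 \<le> s" "s \<le> t" "t \<le> T" for s t i j
  proof (cases "s = t")
    case True
    then show ?thesis using diag[of t i j] st by simp
  next
    case False
    then have lt: "s < t" using st by simp
    have sT: "s \<in> {0..T}" "t \<in> {0..T}" using st by auto
    have ind: "indep_set (sets (generated_algebra M {()} (\<lambda>_ w. B t w - B s w))) (sets (natural_filtration M B s))"
      using B st lt unfolding standard_brownian_motion_def by blast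
    have m1: "(\<lambda>w. B t w $ j - B s w $ j) \<in> borel_measurable (generated_algebra M {()} (\<lambda>_ w. B t w - B s w))"
      using measurable_component[OF generated_algebra_measurable[of "()" "{()}" "\<lambda>_ w. B t w - B s w"], of j]
      by simp
    have m2: "(\<lambda>w. B s w $ i) \<in> borel_measurable (natural_filtration M B s)"
      using measurable_component[OF generated_algebra_measurable[of s "{0..s}" B]] st by simp
    have "ip (\<lambda>w. B t w $ j - B s w $ j) (\<lambda>w. B s w $ i) = 0"
      using indep_ip[OF ind _ _ m1 incr(1)[OF st(1) lt st(3)] m2 BL[OF sT(1)]] BE[OF sT(1), of i] by simp
    then show ?thesis using ip_diff_left[OF BL[OF sT(2)] BL[OF sT(1)] BL[OF sT(1)], of j j i] diag[OF sT(1), of i j]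
        ip_commute[of "\<lambda>w. B s w $ i" "\<lambda>w. B t w $ j"] ip_commute[of "\<lambda>w. B s w $ j" "\<lambda>w. B s w $ i"] by simp
  qed
  show "t \<in> {0..T} \<Longrightarrow> (\<lambda>w. B t w $ i) \<in> L2" "t \<in> {0..T} \<Longrightarrow> expectation (\<lambda>w. B t w $ i) = 0"
    using BL BE by auto
  assume s: "s \<in> {0..T}" and t: "t \<in> {0..T}"
  show "ip (\<lambda>w. B s w $ i) (\<lambda>w. B t w $ j) = (if i = j then min s t else 0)"
  proof (cases "s \<le> t")
    case True
    then show ?thesis using cross[of s t i j] s t by simp
  next
    case False
    then show ?thesis using cross[of t s j i] s t ip_commute[of "\<lambda>w. B s w $ i" "\<lambda>w. B t w $ j"] by (auto simp: min_def)
  qed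
qed

lemma gaussian_chf_add_const:
  assumes U: "U \<in> L2" "gaussian_chf U" shows "gaussian_chf (\<lambda>w. c + U w)"
proof -
  have [measurable]: "U \<in> borel_measurable M" using U L2_measurable by blast
  have i: "integrable M (\<lambda>w. cos (U w))" "integrable M (\<lambda>w. sin (U w))"
    by (intro integrable_const_bound[of _ 1]; simp)+
  have E: "expectation (\<lambda>w. c + U w) = c + expectation U"
    using L2_integrable[OF U(1)] by (simp add: prob_space)
  have "ip (\<lambda>w. c + U w) (\<lambda>w. c + U w) = c\<^sup>2 + 2 * c * expectation U + ip U U"
    using U(1) by (simp add: ip_add_left ip_add_right ip_const E prob_space power2_eq_square algebra_simps)
  then have V: "ip (\<lambda>w. c + U w) (\<lambda>w. c + U w) - (expectation (\<lambda>w. c + U w))\<^sup>2 = ip U U - (expectation U)\<^sup>2"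
    unfolding E by (simp add: power2_sum)
  show ?thesis
    unfolding gaussian_chf_def V unfolding E cos_add sin_add
    using i U(2)[unfolded gaussian_chf_def] by (simp add: algebra_simps)
qed

text \<open>\<open>gaussian_family\<close> speaks of inner products with whole vectors, the span of
  single coordinates and a constant. Every element of the span is regrouped into one sum over
  distinct vectors plus a shift.\<close>

lemma gaussian_family_lin_chf:
  fixes \<Y> :: "('a \<Rightarrow> real ^ 'm::finite) set"
  assumes G: "gaussian_family M \<Y>"
    and V: "V \<in> lin (insert (\<lambda>w. 1) {(\<lambda>w. Y w $ i) | Y i. Y \<in> \<Y>})"
  shows "gaussian_chf V"
proof -
  have "\<exists>c0 J c. finite J \<and> J \<subseteq> \<Y> \<and> V = (\<lambda>w. c0 + (\<Sum>Y\<in>J. c Y \<bullet> Y w))"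
    using V
  proof induction
    case zero
    show ?case by (rule exI[of _ 0], rule exI[of _ "{}"]) simp
  next
    case (step f V k)
    then obtain c0 J c where J: "finite J" "J \<subseteq> \<Y>" and V: "V = (\<lambda>w. c0 + (\<Sum>Y\<in>J. c Y \<bullet> Y w))" by blast
    from step.hyps(1) consider "f = (\<lambda>w. 1)" | Y i where "f = (\<lambda>w. Y w $ i)" "Y \<in> \<Y>" by auto
    then show ?case
    proof cases
      case 1
      show ?thesis
        by (rule exI[of _ "k + c0"], rule exI[of _ J], rule exI[of _ c]) (use J V 1 in auto)
    next
      case (2 X i)
      \<comment> \<open>\<open>X\<close> may or may not occur in \<open>J\<close> already; its old
        coefficient vector, or 0, is increased by \<open>k\<close> in coordinate
        \<open>i\<close>.\<close>
      define c' where "c' Y = (if Y \<in> J then c Y else 0) + (if Y = X then axis i k else 0)" for Y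
      have "(\<Sum>Y\<in>insert X J. c' Y \<bullet> Y w) = (\<Sum>Y\<in>J. c Y \<bullet> Y w) + k * X w $ i" for w
      proof -
        have "(\<Sum>Y\<in>insert X J. c' Y \<bullet> Y w) = (\<Sum>Y\<in>insert X J. (if Y \<in> J then c Y else 0) \<bullet> Y w) + (\<Sum>Y\<in>insert X J. if Y = X then axis i k \<bullet> X w else 0)"
          unfolding sum.distrib[symmetric] by (intro sum.cong) (auto simp: c'_def inner_add_left)
        also have "(\<Sum>Y\<in>insert X J. if Y = X then axis i k \<bullet> X w else 0) = k * X w $ i"
          using J(1) by (simp add: inner_axis')
        also have "(\<Sum>Y\<in>insert X J. (if Y \<in> J then c Y else 0) \<bullet> Y w) = (\<Sum>Y\<in>J. c Y \<bullet> Y w)"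
          using J(1) by (intro sum.mono_neutral_cong_right) auto
        finally show ?thesis .
      qed
      then have "(\<lambda>w. k * f w + V w) = (\<lambda>w. c0 + (\<Sum>Y\<in>insert X J. c' Y \<bullet> Y w))"
        unfolding V 2(1) by (simp add: fun_eq_iff)
      moreover have "finite (insert X J)" "insert X J \<subseteq> \<Y>" using J 2(2) by auto
      ultimately show ?thesis by blast
    qed
  qed
  then obtain c0 J c where J: "finite J" "J \<subseteq> \<Y>" and V: "V = (\<lambda>w. c0 + (\<Sum>Y\<in>J. c Y \<bullet> Y w))" by blast
  have "gaussian_rv M (\<lambda>w. \<Sum>Y\<in>J. c Y \<bullet> Y w)"
    using G J unfolding gaussian_family_def by blast
  from gaussian_rv_L2_chf[OF this] show ?thesis unfolding V by (intro gaussian_chf_add_const) auto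
qed

end

lemma norm_matrix_vector_mult_le:
  fixes A :: "real ^ 'n::finite ^ 'm::finite" and x :: "real ^ 'n"
  shows "norm (A *v x) \<le> (\<Sum>i\<in>UNIV. \<Sum>j\<in>UNIV. \<bar>A $ i $ j\<bar>) * norm x"
proof -
  have "norm (A *v x) \<le> (\<Sum>i\<in>UNIV. \<bar>(A *v x) $ i\<bar>)" by (rule norm_le_l1_cart)
  also have "\<dots> \<le> (\<Sum>i\<in>UNIV. \<Sum>j\<in>UNIV. \<bar>A $ i $ j\<bar> * norm x)"
  proof (rule sum_mono)
    fix i
    have "\<bar>(A *v x) $ i\<bar> \<le> (\<Sum>j\<in>UNIV. \<bar>A $ i $ j * x $ j\<bar>)"
      unfolding matrix_vector_mult_def by (simp add: sum_abs)
    also have "\<dots> \<le> (\<Sum>j\<in>UNIV. \<bar>A $ i $ j\<bar> * norm x)"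
      by (intro sum_mono) (auto simp: abs_mult intro!: mult_left_mono component_le_norm_cart)
    finally show "\<bar>(A *v x) $ i\<bar> \<le> (\<Sum>j\<in>UNIV. \<bar>A $ i $ j\<bar> * norm x)" .
  qed
  finally show ?thesis by (simp add: sum_distrib_right)
qed

lemma set_integral_component:
  fixes f :: "real \<Rightarrow> real ^ 'm::finite"
  assumes "set_integrable lborel S f"
  shows "set_integrable lborel S (\<lambda>s. f s $ i)" "(LINT s:S|lborel. f s) $ i = (LINT s:S|lborel. f s $ i)"
proof -
  have I: "integrable lborel (\<lambda>s. indicator S s *\<^sub>R f s)" using assms by (simp add: set_integrable_def)
  have bl: "bounded_linear (\<lambda>x :: real ^ 'm. x $ i)" by (rule bounded_linear_vec_nth)
  show "set_integrable lborel S (\<lambda>s. f s $ i)"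
    using integrable_bounded_linear[OF bl I] by (simp add: set_integrable_def)
  show "(LINT s:S|lborel. f s) $ i = (LINT s:S|lborel. f s $ i)"
    using integral_bounded_linear[OF bl I] by (simp add: set_lebesgue_integral_def)
qed

lemma continuous_on_set_integral:
  fixes f :: "real \<Rightarrow> 'b::euclidean_space"
  assumes "set_integrable lborel {0..T} f"
  shows "continuous_on {0..T} (\<lambda>t. LINT s:{0..t}|lborel. f s)"
proof -
  have "continuous_on {0..T} (\<lambda>t. integral {0..t} f)"
    by (rule indefinite_integral_continuous_1[OF set_borel_integral_eq_integral(1)[OF assms]])
  then show ?thesis
  proof (rule continuous_on_eq)
    fix t assume "t \<in> {0..T}"
    then have "set_integrable lborel {0..t} f" by (intro set_integrable_subset[OF assms]) auto
    then show "integral {0..t} f = (LINT s:{0..t}|lborel. f s)" by (rule set_borel_integral_eq_integral(2)[symmetric])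
  qed
qed

text \<open>Gronwall with constant 0 for the sum of the absolute values.\<close>

lemma linear_volterra_zero:
  fixes f :: "'i::finite \<Rightarrow> real \<Rightarrow> real" and a :: "'i \<Rightarrow> 'i \<Rightarrow> real \<Rightarrow> real"
  assumes f: "\<And>i. continuous_on {0..T} (f i)" and a: "\<And>i j. continuous_on {0..T} (a i j)"
    and eq: "\<And>i t. t \<in> {0..T} \<Longrightarrow> f i t = integral {0..t} (\<lambda>s. \<Sum>j\<in>UNIV. a i j s * f j s)"
    and t: "t \<in> {0..T}"
  shows "f i t = 0"
proof -
  define u where "u s = (\<Sum>j\<in>UNIV. \<bar>f j s\<bar>)" for s
  have uc: "continuous_on {0..T} u" unfolding u_def by (intro continuous_intros f)
  define A where "A s = (\<Sum>i\<in>UNIV. \<Sum>j\<in>UNIV. \<bar>a i j s\<bar>)" for s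
  have Ac: "continuous_on {0..T} A" unfolding A_def by (intro continuous_intros a)
  have "bounded (A ` {0..T})" by (rule compact_imp_bounded[OF compact_continuous_image[OF Ac compact_Icc]])
  then obtain C where "\<forall>s\<in>{0..T}. \<bar>A s\<bar> \<le> C" unfolding bounded_iff by auto
  then have C: "\<bar>A s\<bar> \<le> C" if "s \<in> {0..T}" for s using that by blast
  have C0: "0 \<le> C" using order_trans[OF abs_ge_zero C[OF t]] .
  have "u t \<le> 0 * exp (C * t)"
  proof (rule gronwall[OF uc C0 _ t])
    fix t assume t: "t \<in> {0..T}"
    have sub: "{0..t} \<subseteq> {0..T}" using t by auto
    have "\<bar>f i t\<bar> \<le> integral {0..t} (\<lambda>s. (\<Sum>j\<in>UNIV. \<bar>a i j s\<bar>) * u s)" for i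
      unfolding eq[OF t, of i] real_norm_def[symmetric]
    proof (rule integral_norm_bound_integral)
      show "(\<lambda>s. \<Sum>j\<in>UNIV. a i j s * f j s) integrable_on {0..t}" "(\<lambda>s. (\<Sum>j\<in>UNIV. norm (a i j s)) * u s) integrable_on {0..t}"
        by (intro integrable_continuous_interval continuous_intros continuous_on_subset[OF f sub] continuous_on_subset[OF a sub] continuous_on_subset[OF uc sub])+
      fix s
      have "\<bar>\<Sum>j\<in>UNIV. a i j s * f j s\<bar> \<le> (\<Sum>j\<in>UNIV. \<bar>a i j s\<bar> * \<bar>f j s\<bar>)"
        by (rule order_trans[OF sum_abs]) (simp add: abs_mult)
      also have "\<dots> \<le> (\<Sum>j\<in>UNIV. \<bar>a i j s\<bar> * u s)"
        unfolding u_def by (intro sum_mono mult_left_mono member_le_sum) auto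
      finally show "norm (\<Sum>j\<in>UNIV. a i j s * f j s) \<le> (\<Sum>j\<in>UNIV. norm (a i j s)) * u s"
        by (simp add: sum_distrib_right)
    qed
    then have "u t \<le> (\<Sum>i\<in>UNIV. integral {0..t} (\<lambda>s. (\<Sum>j\<in>UNIV. \<bar>a i j s\<bar>) * u s))"
      unfolding u_def by (rule sum_mono)
    also have "\<dots> = integral {0..t} (\<lambda>s. \<Sum>i\<in>UNIV. (\<Sum>j\<in>UNIV. \<bar>a i j s\<bar>) * u s)"
    proof (rule integral_sum[symmetric])
      show "(\<lambda>s. (\<Sum>j\<in>UNIV. \<bar>a i j s\<bar>) * u s) integrable_on {0..t}" for i
        by (intro integrable_continuous_interval continuous_intros continuous_on_subset[OF a sub] continuous_on_subset[OF uc sub])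
    qed simp
    also have "\<dots> = integral {0..t} (\<lambda>s. A s * u s)"
      by (simp add: A_def sum_distrib_right)
    also have "\<dots> \<le> integral {0..t} (\<lambda>s. C * u s)"
    proof (rule integral_le)
      fix s assume "s \<in> {0..t}"
      then have "A s \<le> C" using C[of s] sub by auto
      then show "A s * u s \<le> C * u s" by (intro mult_right_mono) (auto simp: u_def sum_nonneg)
    qed (intro integrable_continuous_interval continuous_intros continuous_on_subset[OF Ac sub] continuous_on_subset[OF uc sub])+
    finally show "u t \<le> 0 + C * integral {0..t} u" by simp
  qed
  then have "u t \<le> 0" by simp
  moreover have "\<bar>f i t\<bar> \<le> u t" unfolding u_def by (rule member_le_sum) auto
  ultimately show ?thesis by simp
qed

context prob_space
begin

lemma gaussian_family_L2:
  fixes \<Y> :: "('a \<Rightarrow> real ^ 'm::finite) set"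
  assumes "gaussian_family M \<Y>" "Y \<in> \<Y>" shows "(\<lambda>w. Y w $ i) \<in> L2"
proof -
  have "finite {Y} \<and> {Y} \<subseteq> \<Y> \<longrightarrow> gaussian_rv M (\<lambda>w. \<Sum>X\<in>{Y}. axis i 1 \<bullet> X w)"
    using assms(1) unfolding gaussian_family_def by (elim allE)
  then have "gaussian_rv M (\<lambda>w. Y w $ i)" using assms(2) by (simp add: inner_axis')
  then show ?thesis by (rule gaussian_rv_L2_chf[THEN conjunct1])
qed

lemma wint_AE_cong:
  assumes Y: "wint y t Y" and AE: "AE w in M. Y' w = Y w" and m: "Y' \<in> borel_measurable M"
  shows "wint y t Y'"
proof -
  note L = wint_L2[OF Y]
  have L': "Y' \<in> L2" by (rule L2_AE_cong[OF L AE m])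
  have "ip Y' U = ip Y U" if "U \<in> L2" for U
    using AE L2_measurable[OF L] m L2_measurable[OF that] by (intro ip_cong_AE) auto
  then show ?thesis using Y L' by (simp add: wint_def)
qed

lemma wint_nrm:
  assumes y: "L2cont {0..t} y" and t: "0 \<le> t" and Y: "wint y t Y" and C: "\<And>r. r \<in> {0..t} \<Longrightarrow> nrm (y r) \<le> C"
  shows "nrm Y \<le> C * t"
proof -
  have "wint y 0 (\<lambda>_. 0)" by (simp add: wint_def)
  from wint_incr_nrm[OF y order_refl t order_refl this Y C] show ?thesis by simp
qed

end

text \<open>The data of the theorem, with the separable expansion of \<open>H\<close> replaced by
  its consequence \<open>HL\<close>.\<close>

locale linear_model = prob_space M for M :: "'w measure" +
  fixes T :: real and a :: "real \<Rightarrow> real ^ 'm ^ 'm::finite" and H L :: "real \<Rightarrow> real \<Rightarrow> real"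
    and X W N Z :: "real \<Rightarrow> 'w \<Rightarrow> real ^ 'm"
  assumes T: "0 < T"
    and a_cont: "continuous_on {0..T} a"
    and gaussian: "gaussian_family M (insert (X 0) (W ` {0..T} \<union> N ` {0..T}))"
    and indep: "prob_space.indep_sets M
          (\<lambda>i. [sets (generated_algebra M {0} X), sets (generated_algebra M {0..T} W),
                sets (generated_algebra M {0..T} N)] ! i) {..<3}"
    and W: "standard_brownian_motion M T W"
    and N: "standard_brownian_motion M T N"
    and X_meas: "(\<lambda>(t, w). X t w) \<in> borel_measurable (restrict_space borel {0..T} \<Otimes>\<^sub>M M)"
    and X_eq: "AE w in M. \<forall>t\<in>{0..T}.
          set_integrable lborel {0..t} (\<lambda>s. a s *v X s w) \<and>
          X t w = X 0 w + (LINT s:{0..t}|lborel. a s *v X s w) + W t w"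
    and Z_meas: "\<And>t. t \<in> {0..T} \<Longrightarrow> Z t \<in> borel_measurable M"
    and Z_eq: "AE w in M. \<forall>t\<in>{0..T}.
          Z t w = (LINT s:{0..t}|lborel. H t s *\<^sub>R X s w) + N t w"
    and H_cont: "continuous_on ({0..T} \<times> {0..T}) (\<lambda>(t, s). H t s)"
    and L_cont: "continuous_on ({0..T} \<times> {0..T}) (\<lambda>(t, s). L t s)"
    and HL: "\<And>s t. s \<in> {0..T} \<Longrightarrow> t \<in> {0..T} \<Longrightarrow> H t s = H 0 s + integral {0..t} (\<lambda>u. L u s)"
begin

lemma T0: "0 \<le> T" "0 \<in> {0..T}" using T by auto

abbreviation "xc i t w \<equiv> X t w $ i"

text \<open>The state is jointly measurable on \<open>[0, T]\<close> only. Composing with this map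
  extends it to the whole line and keeps joint measurability.\<close>

definition clamp :: "real \<Rightarrow> real" where "clamp t = max 0 (min t T)"

lemma clamp: "clamp t \<in> {0..T}" "t \<in> {0..T} \<Longrightarrow> clamp t = t"
  using T by (auto simp: clamp_def)

definition Xb :: "real \<Rightarrow> 'w \<Rightarrow> real ^ 'm" where "Xb t w = X (clamp t) w"

lemma Xb_eq: "t \<in> {0..T} \<Longrightarrow> Xb t = X t"
  by (simp add: Xb_def clamp fun_eq_iff)

lemma Xb_measurable: "(\<lambda>x. Xb (fst x) (snd x)) \<in> borel_measurable (borel \<Otimes>\<^sub>M M)"
proof -
  have "clamp \<in> borel_measurable borel" unfolding clamp_def[abs_def] by measurable
  then have "clamp \<in> borel \<rightarrow>\<^sub>M restrict_space borel {0..T}"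
    by (rule measurable_restrict_space2[rotated]) (use clamp(1) in auto)
  then have "(\<lambda>x. (clamp (fst x), snd x)) \<in> (borel \<Otimes>\<^sub>M M) \<rightarrow>\<^sub>M (restrict_space borel {0..T} \<Otimes>\<^sub>M M)"
    by (intro measurable_Pair measurable_compose[OF measurable_fst] measurable_snd)
  from measurable_compose[OF this X_meas] show ?thesis by (simp add: Xb_def)
qed

lemma xb_measurable [measurable]: "(\<lambda>x. Xb (fst x) (snd x) $ i) \<in> borel_measurable (borel \<Otimes>\<^sub>M M)"
  by (rule measurable_component[OF Xb_measurable])

lemma X_measurable: "t \<in> {0..T} \<Longrightarrow> X t \<in> borel_measurable M"
proof -
  assume t: "t \<in> {0..T}"
  have "(\<lambda>w. (t, w)) \<in> M \<rightarrow>\<^sub>M (borel \<Otimes>\<^sub>M M)" by (rule measurable_Pair1') simp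
  from measurable_compose[OF this Xb_measurable] show ?thesis using t by (simp add: Xb_def clamp(2))
qed

lemma a_comp_cont: "continuous_on {0..T} (\<lambda>s. a s $ i $ j)"
  by (intro continuous_intros a_cont)

lemma a_bound: "\<exists>C\<ge>0. \<forall>s\<in>{0..T}. \<forall>x. norm (a s *v x) \<le> C * norm x"
proof -
  define A where "A s = (\<Sum>i\<in>UNIV. \<Sum>j\<in>UNIV. \<bar>a s $ i $ j\<bar>)" for s
  have Ac: "continuous_on {0..T} A" unfolding A_def by (intro continuous_intros a_comp_cont)
  have "bounded (A ` {0..T})" by (rule compact_imp_bounded[OF compact_continuous_image[OF Ac compact_Icc]])
  then obtain C where C: "\<forall>s\<in>{0..T}. \<bar>A s\<bar> \<le> C" unfolding bounded_iff by auto
  show ?thesis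
  proof (intro exI[of _ C] conjI ballI allI)
    show "0 \<le> C" using order_trans[OF abs_ge_zero bspec[OF C T0(2)]] .
    fix s and x :: "real ^ 'm" assume "s \<in> {0..T}"
    then have "\<bar>A s\<bar> \<le> C" using C by blast
    then have "A s * norm x \<le> C * norm x" by (intro mult_right_mono) auto
    then show "norm (a s *v x) \<le> C * norm x"
      using norm_matrix_vector_mult_le[of "a s" x] by (simp add: A_def)
  qed
qed

lemma W_L2: "t \<in> {0..T} \<Longrightarrow> (\<lambda>w. W t w $ i) \<in> L2"
  by (rule brownian_L2_moments(1)[OF W T0(1)])

lemma N_L2: "t \<in> {0..T} \<Longrightarrow> (\<lambda>w. N t w $ i) \<in> L2"
  by (rule brownian_L2_moments(1)[OF N T0(1)])

lemma X0_L2: "(\<lambda>w. X 0 w $ i) \<in> L2"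
  by (rule gaussian_family_L2[OF gaussian]) simp

lemma X_path: "AE w in M. continuous_on {0..T} (\<lambda>t. X t w)"
proof -
  have "AE w in M. continuous_on {0..T} (\<lambda>t. W t w)" using W by (simp add: standard_brownian_motion_def)
  with X_eq show ?thesis
  proof eventually_elim
    case (elim w)
    have i: "set_integrable lborel {0..T} (\<lambda>s. a s *v X s w)" using elim(1) T0 by auto
    have "continuous_on {0..T} (\<lambda>t. X 0 w + (LINT s:{0..t}|lborel. a s *v X s w) + W t w)"
      by (intro continuous_intros continuous_on_set_integral[OF i] elim(2))
    then show ?case by (rule continuous_on_eq) (rule sym, use elim(1) in blast)
  qed
qed

text \<open>The integrand \<open>a s *v X s\<close> in coordinates; the indicator is there because
  \<open>a\<close> is known to be continuous, hence measurable, on \<open>[0, T]\<close>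
  only.\<close>

definition drift :: "'m \<Rightarrow> real \<Rightarrow> 'w \<Rightarrow> real" where
  "drift i s w = (\<Sum>j\<in>UNIV. (indicator {0..T} s * a s $ i $ j) * Xb s w $ j)"

lemma drift_eq: "s \<in> {0..T} \<Longrightarrow> drift i s w = (a s *v X s w) $ i"
  by (simp add: drift_def Xb_eq matrix_vector_mult_def)

lemma drift_measurable [measurable]: "(\<lambda>x. drift i (fst x) (snd x)) \<in> borel_measurable (borel \<Otimes>\<^sub>M M)"
proof -
  have [measurable]: "(\<lambda>s. indicator {0..T} s * a s $ i $ j) \<in> borel_measurable borel" for j
    using borel_measurable_continuous_on_indicator[OF _ a_comp_cont[of i j]] by simp
  show ?thesis unfolding drift_def by measurable
qed

lemma X_incr:
  "AE w in M. \<forall>s t i. 0 \<le> s \<longrightarrow> s \<le> t \<longrightarrow> t \<le> T \<longrightarrow> set_integrable lborel {s..t} (\<lambda>u. drift i u w) \<and>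
     X t w $ i = X s w $ i + (LINT u:{s..t}|lborel. drift i u w) + (W t w $ i - W s w $ i)"
  using X_eq
proof eventually_elim
  case (elim w)
  show ?case
  proof (intro allI impI)
    fix s t i assume st: "0 \<le> s" "s \<le> t" "t \<le> T"
    have iv: "set_integrable lborel {0..T} (\<lambda>s. a s *v X s w)" using elim T0 by auto
    have "set_integrable lborel {0..T} (\<lambda>s. (a s *v X s w) $ i)" by (rule set_integral_component(1)[OF iv])
    then have di: "set_integrable lborel {0..T} (\<lambda>s. drift i s w)"
      by (subst set_integrable_cong[OF refl refl, where f'="\<lambda>s. (a s *v X s w) $ i"]) (simp_all add: drift_eq)
    have sub: "set_integrable lborel {u..v} (\<lambda>s. drift i s w)" if "0 \<le> u" "v \<le> T" for u v
      by (rule set_integrable_subset[OF di]) (use that in auto)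
    have X: "X r w $ i = X 0 w $ i + integral {0..r} (\<lambda>u. drift i u w) + W r w $ i" if r: "r \<in> {0..T}" for r
    proof -
      have ivr: "set_integrable lborel {0..r} (\<lambda>s. a s *v X s w)" using elim r by auto
      have "(LINT s:{0..r}|lborel. a s *v X s w) $ i = (LINT s:{0..r}|lborel. (a s *v X s w) $ i)"
        by (rule set_integral_component(2)[OF ivr])
      also have "\<dots> = (LINT s:{0..r}|lborel. drift i s w)"
        by (rule set_lebesgue_integral_cong) (use r in \<open>auto simp: drift_eq\<close>)
      also have "\<dots> = integral {0..r} (\<lambda>u. drift i u w)"
        by (rule set_borel_integral_eq_integral(2)[OF sub]) (use r in auto)
      finally have e: "(LINT s:{0..r}|lborel. a s *v X s w) $ i = integral {0..r} (\<lambda>u. drift i u w)" .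
      have "X r w = X 0 w + (LINT s:{0..r}|lborel. a s *v X s w) + W r w" using elim r by blast
      from arg_cong[OF this, of "\<lambda>x. x $ i"] show ?thesis unfolding vector_add_component e .
    qed
    have "integral {0..s} (\<lambda>u. drift i u w) + integral {s..t} (\<lambda>u. drift i u w) = integral {0..t} (\<lambda>u. drift i u w)"
      using st by (intro Henstock_Kurzweil_Integration.integral_combine set_borel_integral_eq_integral(1) sub) auto
    moreover have "(LINT u:{s..t}|lborel. drift i u w) = integral {s..t} (\<lambda>u. drift i u w)"
      by (rule set_borel_integral_eq_integral(2)[OF sub]) (use st in auto)
    ultimately show "set_integrable lborel {s..t} (\<lambda>u. drift i u w) \<and>
        X t w $ i = X s w $ i + (LINT u:{s..t}|lborel. drift i u w) + (W t w $ i - W s w $ i)"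
      using sub[of s t] X[of s] X[of t] st by auto
  qed
qed

section \<open>Second moments of the state, obtained from pathwise estimates\<close>

definition energy :: "'w \<Rightarrow> real" where "energy w = (LINT s:{0..T}|lborel. (norm (Xb s w))\<^sup>2)"

lemma norm_sq_sum: "(norm (x :: real ^ 'm))\<^sup>2 = (\<Sum>i\<in>UNIV. (x $ i)\<^sup>2)"
  by (simp add: norm_vec_def L2_set_def sum_nonneg)

lemma Xb_sq_measurable [measurable]: "(\<lambda>x. (norm (Xb (fst x) (snd x)))\<^sup>2) \<in> borel_measurable (borel \<Otimes>\<^sub>M M)"
  unfolding norm_sq_sum by measurable

lemma path_facts:
  "AE w in M. set_integrable lborel {0..T} (\<lambda>s. (norm (Xb s w))\<^sup>2) \<and>
    (\<forall>s t i. 0 \<le> s \<longrightarrow> s \<le> t \<longrightarrow> t \<le> T \<longrightarrow> set_integrable lborel {s..t} (\<lambda>u. (drift i u w)\<^sup>2))"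
  using X_path
proof eventually_elim
  case (elim w)
  have c1: "continuous_on {0..T} (\<lambda>s. (norm (Xb s w))\<^sup>2)"
    by (rule continuous_on_eq[of _ "\<lambda>s. (norm (X s w))\<^sup>2"]) (auto intro!: continuous_intros elim simp: Xb_eq)
  have c2: "continuous_on {0..T} (\<lambda>s. (drift i s w)\<^sup>2)" for i
  proof (rule continuous_on_eq)
    show "continuous_on {0..T} (\<lambda>s. (\<Sum>j\<in>UNIV. a s $ i $ j * X s w $ j)\<^sup>2)"
      by (intro continuous_intros a_comp_cont elim)
  qed (simp add: drift_eq matrix_vector_mult_def)
  show ?case
    by (intro conjI allI impI borel_integrable_atLeastAtMost' c1 continuous_on_subset[OF c2]) auto
qed

lemma drift_sq_le:
  assumes C: "\<forall>s\<in>{0..T}. \<forall>x. norm (a s *v x) \<le> C * norm x" and s: "s \<in> {0..T}"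
  shows "(drift i s w)\<^sup>2 \<le> C\<^sup>2 * (norm (Xb s w))\<^sup>2"
proof -
  have "\<bar>drift i s w\<bar> \<le> norm (a s *v X s w)" unfolding drift_eq[OF s] by (rule component_le_norm_cart)
  also have "\<dots> \<le> C * norm (Xb s w)" using C s by (simp add: Xb_eq[OF s])
  finally have "\<bar>drift i s w\<bar>\<^sup>2 \<le> (C * norm (Xb s w))\<^sup>2" by (rule power_mono) simp
  then show ?thesis by (simp add: power_mult_distrib)
qed

lemma drift_integral_sq_le:
  assumes C: "\<forall>s\<in>{0..T}. \<forall>x. norm (a s *v x) \<le> C * norm x"
  shows "AE w in M. \<forall>s t i. 0 \<le> s \<longrightarrow> s \<le> t \<longrightarrow> t \<le> T \<longrightarrow>
    (LINT u:{s..t}|lborel. drift i u w)\<^sup>2 \<le> (t - s) * (C\<^sup>2 * (LINT u:{s..t}|lborel. (norm (Xb u w))\<^sup>2))"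
  using path_facts X_incr
proof eventually_elim
  case (elim w)
  show ?case
  proof (intro allI impI)
    fix s t i assume st: "0 \<le> s" "s \<le> t" "t \<le> T"
    have d: "set_integrable lborel {s..t} (\<lambda>u. drift i u w)" "set_integrable lborel {s..t} (\<lambda>u. (drift i u w)\<^sup>2)"
      using elim st by blast+
    have x: "set_integrable lborel {s..t} (\<lambda>u. (norm (Xb u w))\<^sup>2)"
      by (rule set_integrable_subset[OF conjunct1[OF elim(1)]]) (use st in auto)
    have "(LINT u:{s..t}|lborel. drift i u w)\<^sup>2 \<le> (t - s) * (LINT u:{s..t}|lborel. (drift i u w)\<^sup>2)"
      by (rule set_integral_square_le[OF st(2) d])
    also have "\<dots> \<le> (t - s) * (LINT u:{s..t}|lborel. C\<^sup>2 * (norm (Xb u w))\<^sup>2)"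
      using st x by (intro mult_left_mono set_integral_mono d drift_sq_le[OF C]) auto
    finally show "(LINT u:{s..t}|lborel. drift i u w)\<^sup>2 \<le> (t - s) * (C\<^sup>2 * (LINT u:{s..t}|lborel. (norm (Xb u w))\<^sup>2))"
      by (simp only: set_integral_mult_right)
  qed
qed

lemma energy_mono:
  "AE w in M. \<forall>s t. 0 \<le> s \<longrightarrow> s \<le> t \<longrightarrow> t \<le> T \<longrightarrow> (LINT u:{s..t}|lborel. (norm (Xb u w))\<^sup>2) \<le> energy w"
  using path_facts
proof eventually_elim
  case (elim w)
  show ?case
  proof (intro allI impI)
    fix s t :: real assume st: "0 \<le> s" "s \<le> t" "t \<le> T"
    have x: "set_integrable lborel {s..t} (\<lambda>u. (norm (Xb u w))\<^sup>2)"
      by (rule set_integrable_subset[OF conjunct1[OF elim]]) (use st in auto)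
    show "(LINT u:{s..t}|lborel. (norm (Xb u w))\<^sup>2) \<le> energy w"
      unfolding energy_def set_lebesgue_integral_def
      using x elim st by (intro integral_mono) (auto simp: set_integrable_def indicator_def)
  qed
qed

text \<open>The 3 comes from squaring a sum of three terms, \<open>T\<close> from Cauchy-Schwarz in
  time, \<open>CARD('m)\<close> from summing coordinates. One null set serves all times, as the
  pathwise Gronwall argument requires.\<close>

lemma X_sq_bound:
  assumes C: "\<forall>s\<in>{0..T}. \<forall>x. norm (a s *v x) \<le> C * norm x"
  shows "AE w in M. \<forall>t\<in>{0..T}. (norm (X t w))\<^sup>2 \<le> 3 * (norm (X 0 w))\<^sup>2 + 3 * (\<Sum>i\<in>UNIV. (W t w $ i)\<^sup>2)
      + 3 * CARD('m) * (T * (C\<^sup>2 * (LINT u:{0..t}|lborel. (norm (Xb u w))\<^sup>2)))"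
proof -
  have "AE w in M. W 0 w = 0" using W by (simp add: standard_brownian_motion_def)
  with X_incr drift_integral_sq_le[OF C] show ?thesis
  proof eventually_elim
    case (elim w)
    show ?case
    proof
      fix t assume t: "t \<in> {0..T}"
      let ?Q = "LINT u:{0..t}|lborel. (norm (Xb u w))\<^sup>2"
      have Q0: "0 \<le> ?Q" unfolding set_lebesgue_integral_def by (intro integral_nonneg_AE) auto
      have sq: "(x + y + z)\<^sup>2 \<le> 3 * x\<^sup>2 + 3 * z\<^sup>2 + 3 * y\<^sup>2" for x y z :: real
        using zero_le_power2[of "x - y"] zero_le_power2[of "y - z"] zero_le_power2[of "x - z"]
        by (simp add: power2_eq_square algebra_simps)
      have "(X t w $ i)\<^sup>2 \<le> 3 * (X 0 w $ i)\<^sup>2 + 3 * (W t w $ i)\<^sup>2 + 3 * (T * (C\<^sup>2 * ?Q))" for i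
      proof -
        have "X t w $ i = X 0 w $ i + (LINT u:{0..t}|lborel. drift i u w) + W t w $ i"
          using elim(1)[rule_format, of 0 t i] t elim(3) by simp
        then have "(X t w $ i)\<^sup>2 \<le> 3 * (X 0 w $ i)\<^sup>2 + 3 * (W t w $ i)\<^sup>2 + 3 * (LINT u:{0..t}|lborel. drift i u w)\<^sup>2"
          using sq[of "X 0 w $ i" "LINT u:{0..t}|lborel. drift i u w" "W t w $ i"] by simp
        moreover have "(LINT u:{0..t}|lborel. drift i u w)\<^sup>2 \<le> T * (C\<^sup>2 * ?Q)"
        proof -
          have "(LINT u:{0..t}|lborel. drift i u w)\<^sup>2 \<le> (t - 0) * (C\<^sup>2 * ?Q)"
            using elim(2)[rule_format, of 0 t i] t by simp
          also have "\<dots> \<le> T * (C\<^sup>2 * ?Q)" using t Q0 by (intro mult_right_mono) auto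
          finally show ?thesis .
        qed
        ultimately show ?thesis by linarith
      qed
      then have "(norm (X t w))\<^sup>2 \<le> (\<Sum>i\<in>(UNIV::'m set). 3 * (X 0 w $ i)\<^sup>2 + 3 * (W t w $ i)\<^sup>2 + 3 * (T * (C\<^sup>2 * ?Q)))"
        unfolding norm_sq_sum by (intro sum_mono)
      then show "(norm (X t w))\<^sup>2 \<le> 3 * (norm (X 0 w))\<^sup>2 + 3 * (\<Sum>i\<in>UNIV. (W t w $ i)\<^sup>2) + 3 * CARD('m) * (T * (C\<^sup>2 * ?Q))"
        unfolding norm_sq_sum[of "X 0 w"] by (simp add: sum.distrib sum_distrib_left mult_ac)
    qed
  qed
qed

text \<open>Almost surely equal to the Brownian motion \<open>W\<close>, but jointly measurable.\<close>

definition Wm :: "'m \<Rightarrow> real \<Rightarrow> 'w \<Rightarrow> real" where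
  "Wm i t w = Xb t w $ i - Xb 0 w $ i - (LINT u:{0..t}|lborel. drift i u w)"

lemma sets_lborel_pair [measurable_cong]: "sets (lborel \<Otimes>\<^sub>M M) = sets (borel \<Otimes>\<^sub>M M)"
  by (intro sets_pair_measure_cong) auto

lemma drift_integral_measurable:
  "(\<lambda>x. LINT u:{0..fst x}|lborel. drift i u (snd x)) \<in> borel_measurable (borel \<Otimes>\<^sub>M M)"
proof -
  have 1: "(\<lambda>z. drift i (snd z) (snd (fst z))) \<in> borel_measurable ((borel \<Otimes>\<^sub>M M) \<Otimes>\<^sub>M borel)"
  proof -
    have "(\<lambda>z. (snd z, snd (fst z))) \<in> ((borel \<Otimes>\<^sub>M M) \<Otimes>\<^sub>M borel) \<rightarrow>\<^sub>M (borel \<Otimes>\<^sub>M M)"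
      by measurable
    from measurable_compose[OF this drift_measurable[of i]] show ?thesis by simp
  qed
  have "(\<lambda>z. indicat_real {0..fst (fst z)} (snd z) *\<^sub>R drift i (snd z) (snd (fst z))) \<in> borel_measurable ((borel \<Otimes>\<^sub>M M) \<Otimes>\<^sub>M borel)"
  proof (intro borel_measurable_scaleR 1)
    have "(\<lambda>z. indicat_real {0..fst (fst z)} (snd z)) = (\<lambda>z :: (real \<times> 'w) \<times> real. if 0 \<le> snd z \<and> snd z \<le> fst (fst z) then 1 else 0)"
      by (auto simp: fun_eq_iff indicator_def)
    also have "\<dots> \<in> borel_measurable ((borel \<Otimes>\<^sub>M M) \<Otimes>\<^sub>M borel)" by measurable
    finally show "(\<lambda>z :: (real \<times> 'w) \<times> real. indicat_real {0..fst (fst z)} (snd z)) \<in> borel_measurable ((borel \<Otimes>\<^sub>M M) \<Otimes>\<^sub>M borel)" .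
  qed
  moreover have "sets ((borel \<Otimes>\<^sub>M M) \<Otimes>\<^sub>M lborel) = sets ((borel \<Otimes>\<^sub>M M) \<Otimes>\<^sub>M borel)"
    by (intro sets_pair_measure_cong) auto
  ultimately have "(\<lambda>z. indicat_real {0..fst (fst z)} (snd z) *\<^sub>R drift i (snd z) (snd (fst z))) \<in> borel_measurable ((borel \<Otimes>\<^sub>M M) \<Otimes>\<^sub>M lborel)"
    using measurable_cong_sets by blast
  then show ?thesis
    unfolding set_lebesgue_integral_def
    using lborel.borel_measurable_lebesgue_integral[of "\<lambda>x u. indicat_real {0..fst x} u *\<^sub>R drift i u (snd x)" "borel \<Otimes>\<^sub>M M"]
    by (simp add: case_prod_unfold)
qed

lemma Wm_measurable [measurable]: "(\<lambda>x. Wm i (fst x) (snd x)) \<in> borel_measurable (borel \<Otimes>\<^sub>M M)"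
proof -
  have [measurable]: "(\<lambda>x. Xb 0 (snd x) $ i) \<in> borel_measurable (borel \<Otimes>\<^sub>M M)"
  proof -
    have "(\<lambda>x. (0, snd x)) \<in> (borel \<Otimes>\<^sub>M M) \<rightarrow>\<^sub>M (borel \<Otimes>\<^sub>M M)" by measurable
    from measurable_compose[OF this xb_measurable[of i]] show ?thesis by simp
  qed
  note [measurable] = drift_integral_measurable
  show ?thesis unfolding Wm_def by measurable
qed

lemma Wm_eq: "AE w in M. \<forall>t\<in>{0..T}. \<forall>i. Wm i t w = W t w $ i"
proof -
  have "AE w in M. W 0 w = 0" using W by (simp add: standard_brownian_motion_def)
  with X_incr show ?thesis
  proof eventually_elim
    case (elim w)
    show ?case
    proof (intro ballI allI)
      fix t i assume t: "t \<in> {0..T}"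
      have "X t w $ i = X 0 w $ i + (LINT u:{0..t}|lborel. drift i u w) + (W t w $ i - W 0 w $ i)"
        using elim(1) t by auto
      then show "Wm i t w = W t w $ i" using t T0 elim(2) by (simp add: Wm_def Xb_eq)
    qed
  qed
qed

definition noise_energy :: "'m \<Rightarrow> 'w \<Rightarrow> real" where
  "noise_energy i w = (LINT t:{0..T}|lborel. (Wm i t w)\<^sup>2)"

lemma noise_energy_integrable: "integrable M (noise_energy i)"
proof -
  interpret P: pair_sigma_finite lborel M ..
  have AE: "AE w in M. Wm i t w = W t w $ i" if "t \<in> {0..T}" for t
    using Wm_eq by eventually_elim (use that in blast)
  have [measurable]: "Wm i t \<in> borel_measurable M" for t
    using measurable_compose[OF measurable_Pair1' Wm_measurable[of i], of t] by simp
  have WL: "Wm i t \<in> L2" "ip (Wm i t) (Wm i t) = t" if t: "t \<in> {0..T}" for t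
  proof -
    note L = W_L2[OF t, of i]
    show "Wm i t \<in> L2" by (rule L2_AE_cong[OF L AE[OF t]]) measurable
    have "ip (Wm i t) (Wm i t) = ip (\<lambda>w. W t w $ i) (\<lambda>w. W t w $ i)"
      by (rule ip_cong_AE[OF AE[OF t] AE[OF t]]) (use L2_measurable[OF L] in measurable)
    then show "ip (Wm i t) (Wm i t) = t"
      using brownian_L2_moments(3)[OF W T0(1) t t, of i i] by simp
  qed
  have "integrable (lborel \<Otimes>\<^sub>M M) (case_prod (\<lambda>t w. indicator {0..T} t * (Wm i t w)\<^sup>2))"
  proof (rule P.Fubini_integrable)
    have "set_integrable lborel {0..T} (\<lambda>t. t)"
      by (intro borel_integrable_atLeastAtMost' continuous_intros)
    then have "integrable lborel (\<lambda>t. indicator {0..T} t * t)"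
      by (simp add: set_integrable_def)
    moreover have "(LINT w|M. norm (indicator {0..T} t * (Wm i t w)\<^sup>2)) = indicator {0..T} t * t" for t
      using WL(2)[of t] by (auto simp: indicator_def ip_def power2_eq_square)
    ultimately show "integrable lborel (\<lambda>t. LINT w|M. norm (case (t, w) of (t, w) \<Rightarrow> indicator {0..T} t * (Wm i t w)\<^sup>2))"
      by (simp only: prod.case)
    show "AE t in lborel. integrable M (\<lambda>w. case (t, w) of (t, w) \<Rightarrow> indicator {0..T} t * (Wm i t w)\<^sup>2)"
      using WL(1) by (intro AE_I2) (auto simp: indicator_def L2_def)
    show "case_prod (\<lambda>t w. indicator {0..T} t * (Wm i t w)\<^sup>2) \<in> borel_measurable (lborel \<Otimes>\<^sub>M M)"
      unfolding case_prod_unfold by measurable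
  qed
  from P.integrable_snd[OF this] show ?thesis
    by (simp add: noise_energy_def[abs_def] set_lebesgue_integral_def)
qed

lemma energy_measurable [measurable]: "energy \<in> borel_measurable M"
proof -
  have "(\<lambda>x. indicat_real {0..T} (snd x) *\<^sub>R (norm (Xb (snd x) (fst x)))\<^sup>2) \<in> borel_measurable (M \<Otimes>\<^sub>M borel)"
  proof (intro borel_measurable_scaleR)
    have "(\<lambda>x. (snd x, fst x)) \<in> (M \<Otimes>\<^sub>M borel) \<rightarrow>\<^sub>M (borel \<Otimes>\<^sub>M M)" by measurable
    from measurable_compose[OF this Xb_sq_measurable]
    show "(\<lambda>x. (norm (Xb (snd x) (fst x)))\<^sup>2) \<in> borel_measurable (M \<Otimes>\<^sub>M borel)" by simp
  qed measurable
  moreover have "sets (M \<Otimes>\<^sub>M lborel) = sets (M \<Otimes>\<^sub>M borel)" by (intro sets_pair_measure_cong) auto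
  ultimately have "(\<lambda>x. indicat_real {0..T} (snd x) *\<^sub>R (norm (Xb (snd x) (fst x)))\<^sup>2) \<in> borel_measurable (M \<Otimes>\<^sub>M lborel)"
    using measurable_cong_sets by blast
  then show ?thesis
    unfolding energy_def[abs_def] set_lebesgue_integral_def
    using lborel.borel_measurable_lebesgue_integral[of "\<lambda>w s. indicat_real {0..T} s *\<^sub>R (norm (Xb s w))\<^sup>2" M]
    by (simp add: case_prod_unfold)
qed

lemma energy_nonneg: "0 \<le> energy w"
  unfolding energy_def set_lebesgue_integral_def by (intro integral_nonneg_AE) auto

text \<open>Gronwall along almost every path, applied to the integral of \<open>\<parallel>X\<parallel>\<^sup>2\<close>.\<close>

lemma energy_integrable: "integrable M energy"
proof -
  obtain C where C: "\<forall>s\<in>{0..T}. \<forall>x. norm (a s *v x) \<le> C * norm x" using a_bound by blast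
  define K where "K = 3 * CARD('m) * (T * C\<^sup>2)"
  have K: "0 \<le> K" using T0 by (simp add: K_def)
  \<comment> \<open>The integral over \<open>[0, T]\<close> of the inhomogeneous terms in
    \<open>X_sq_bound\<close>. Gronwall is applied to the running integral of the squared norm, not
    to the squared norm itself.\<close>
  define c where "c w = 3 * T * (norm (X 0 w))\<^sup>2 + 3 * (\<Sum>i\<in>UNIV. noise_energy i w)" for w
  have Wp: "AE w in M. continuous_on {0..T} (\<lambda>t. W t w)" using W by (simp add: standard_brownian_motion_def)
  have le: "AE w in M. energy w \<le> c w * exp (K * T)"
    using X_sq_bound[OF C] Wm_eq Wp X_path
  proof eventually_elim
    case (elim w)
    define Y where "Y s = (norm (Xb s w))\<^sup>2" for s
    define V where "V s = (\<Sum>i\<in>UNIV. (W s w $ i)\<^sup>2)" for s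
    have Yc: "continuous_on {0..T} Y"
    proof (rule continuous_on_eq)
      show "continuous_on {0..T} (\<lambda>s. (norm (X s w))\<^sup>2)" by (intro continuous_intros elim(4))
    qed (simp add: Y_def Xb_eq)
    have Vc: "continuous_on {0..T} V" unfolding V_def by (intro continuous_intros elim(3))
    have Wic: "continuous_on {0..T} (\<lambda>s. (W s w $ i)\<^sup>2)" for i by (intro continuous_intros elim(3))
    have LI: "(LINT u:{0..t}|lborel. f u) = integral {0..t} f" if "continuous_on {0..T} f" "t \<le> T" for f :: "real \<Rightarrow> real" and t
      using that(2) by (intro set_borel_integral_eq_integral(2) borel_integrable_atLeastAtMost' continuous_on_subset[OF that(1)]) auto
    have Ic: "continuous_on {0..T} (\<lambda>t. integral {0..t} Y)"
      by (intro indefinite_integral_continuous_1 integrable_continuous_interval Yc)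
    have bnd: "Y t \<le> 3 * (norm (X 0 w))\<^sup>2 + 3 * V t + K * integral {0..t} Y" if t: "t \<in> {0..T}" for t
    proof -
      have "(LINT u:{0..t}|lborel. (norm (Xb u w))\<^sup>2) = integral {0..t} Y"
        using LI[OF Yc] t by (simp add: Y_def)
      then show ?thesis using bspec[OF elim(1) t] t by (simp add: Y_def Xb_eq V_def K_def mult.assoc)
    qed
    have cI: "3 * T * (norm (X 0 w))\<^sup>2 + 3 * integral {0..T} V = c w"
    proof -
      have "noise_energy i w = (LINT t:{0..T}|lborel. (W t w $ i)\<^sup>2)" for i
        unfolding noise_energy_def by (rule set_lebesgue_integral_cong) (use elim(2) in auto)
      then have "noise_energy i w = integral {0..T} (\<lambda>t. (W t w $ i)\<^sup>2)" for i using LI[OF Wic] by simp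
      moreover have "integral {0..T} V = (\<Sum>i\<in>UNIV. integral {0..T} (\<lambda>t. (W t w $ i)\<^sup>2))"
        unfolding V_def by (intro integral_sum integrable_continuous_interval Wic) simp
      ultimately show ?thesis by (simp add: c_def)
    qed
    have "integral {0..T} Y \<le> c w * exp (K * T)"
    proof (rule gronwall[OF Ic K])
      fix t assume t: "t \<in> {0..T}"
      have sub: "{0..t} \<subseteq> {0..T}" using t by auto
      note ii = integrable_continuous_interval
      have i1: "Y integrable_on {0..t}" "V integrable_on {0..t}" "(\<lambda>s. integral {0..s} Y) integrable_on {0..t}"
        by (rule ii, rule continuous_on_subset[OF Yc sub], rule ii, rule continuous_on_subset[OF Vc sub],
            rule ii, rule continuous_on_subset[OF Ic sub])
      have i2: "(\<lambda>s. 3 * (norm (X 0 w))\<^sup>2 :: real) integrable_on {0..t}" by (rule ii) simp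
      note i3 = integrable_on_mult_right[OF i1(2), of 3] integrable_on_mult_right[OF i1(3), of K]
      note add = Henstock_Kurzweil_Integration.integrable_add Henstock_Kurzweil_Integration.integral_add
      have "integral {0..t} Y \<le> integral {0..t} (\<lambda>s. 3 * (norm (X 0 w))\<^sup>2 + 3 * V s + K * integral {0..s} Y)"
        by (rule integral_le[OF i1(1) add(1)[OF add(1)[OF i2 i3(1)] i3(2)]]) (use bnd sub in auto)
      also have "\<dots> = integral {0..t} (\<lambda>s. 3 * (norm (X 0 w))\<^sup>2) + 3 * integral {0..t} V + K * integral {0..t} (\<lambda>s. integral {0..s} Y)"
        unfolding add(2)[OF add(1)[OF i2 i3(1)] i3(2)] add(2)[OF i2 i3(1)] by simp
      also have "integral {0..t} (\<lambda>s. 3 * (norm (X 0 w))\<^sup>2) \<le> 3 * T * (norm (X 0 w))\<^sup>2"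
        using t by (simp add: mult.assoc[symmetric] mult_right_mono)
      also have "integral {0..t} V \<le> integral {0..T} V"
        by (intro integral_subset_le sub i1(2) ii Vc) (auto simp: V_def sum_nonneg)
      finally show "integral {0..t} Y \<le> c w + K * integral {0..t} (\<lambda>s. integral {0..s} Y)"
        using cI by simp
    qed (use T0 in simp)
    then show ?case using LI[OF Yc order_refl] by (simp add: energy_def Y_def)
  qed
  have "integrable M (\<lambda>w. (X 0 w $ i)\<^sup>2)" for i using X0_L2[of i] by (simp add: L2_def)
  then have "integrable M (\<lambda>w. c w * exp (K * T))"
    unfolding c_def norm_sq_sum
    by (intro Bochner_Integration.integrable_add integrable_mult_right integrable_mult_left Bochner_Integration.integrable_sum noise_energy_integrable)
  then show ?thesis
    by (rule Bochner_Integration.integrable_bound) (use le energy_nonneg in \<open>auto elim: eventually_mono\<close>)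
qed

end

context prob_space
begin

lemma L2_sq_le:
  assumes m: "Y \<in> borel_measurable M" and D: "integrable M D" and le: "AE z in M. (Y z)\<^sup>2 \<le> D z"
  shows "Y \<in> L2" "(nrm Y)\<^sup>2 \<le> expectation D"
proof -
  have i: "integrable M (\<lambda>z. (Y z)\<^sup>2)"
    by (rule Bochner_Integration.integrable_bound[OF D]) (use m le in \<open>auto elim: eventually_mono\<close>)
  then show "Y \<in> L2" using m by (simp add: L2_def)
  have "(nrm Y)\<^sup>2 = expectation (\<lambda>z. (Y z)\<^sup>2)" unfolding nrm_square by (simp add: ip_def power2_eq_square)
  also have "\<dots> \<le> expectation D" by (rule integral_mono_AE[OF i D le])
  finally show "(nrm Y)\<^sup>2 \<le> expectation D" .
qed

lemma indep_sets_pair: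
  assumes "indep_sets F I" "i \<in> I" "j \<in> I" "i \<noteq> j" shows "indep_set (F i) (F j)"
proof (rule indep_setI)
  show "F i \<subseteq> events" "F j \<subseteq> events" using assms unfolding indep_sets_def by auto
  fix A B assume "A \<in> F i" "B \<in> F j"
  then show "prob (A \<inter> B) = prob A * prob B"
    using indep_setsD[OF assms(1), of "{i, j}" "\<lambda>k. if k = i then A else B"] assms(2-4) by (auto simp: Int_commute)
qed

end

context linear_model
begin

lemma X_comp_measurable: "t \<in> {0..T} \<Longrightarrow> xc i t \<in> borel_measurable M"
  by (rule measurable_component[OF X_measurable])

lemma X_L2: assumes t: "t \<in> {0..T}" shows "xc i t \<in> L2"
proof -
  obtain C where C: "\<forall>s\<in>{0..T}. \<forall>x. norm (a s *v x) \<le> C * norm x" using a_bound by blast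
  define K where "K = 3 * CARD('m) * (T * C\<^sup>2)"
  have K: "0 \<le> K" using T0 by (simp add: K_def)
  show ?thesis
  proof (rule L2_sq_le(1)[OF X_comp_measurable[OF t]])
    have "integrable M (\<lambda>z. (X 0 z $ i)\<^sup>2)" "integrable M (\<lambda>z. (W t z $ i)\<^sup>2)" for i
      using X0_L2[of i] W_L2[OF t, of i] by (simp_all add: L2_def)
    then show "integrable M (\<lambda>z. 3 * (norm (X 0 z))\<^sup>2 + 3 * (\<Sum>i\<in>UNIV. (W t z $ i)\<^sup>2) + K * energy z)"
      unfolding norm_sq_sum
      by (intro Bochner_Integration.integrable_add integrable_mult_right Bochner_Integration.integrable_sum energy_integrable)
    show "AE z in M. (X t z $ i)\<^sup>2 \<le> 3 * (norm (X 0 z))\<^sup>2 + 3 * (\<Sum>i\<in>UNIV. (W t z $ i)\<^sup>2) + K * energy z"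
      using X_sq_bound[OF C] energy_mono
    proof eventually_elim
      case (elim z)
      have "(X t z $ i)\<^sup>2 \<le> (norm (X t z))\<^sup>2"
        using component_le_norm_cart[of "X t z" i] power_mono[of "\<bar>X t z $ i\<bar>" "norm (X t z)" 2] by simp
      also have "\<dots> \<le> 3 * (norm (X 0 z))\<^sup>2 + 3 * (\<Sum>i\<in>UNIV. (W t z $ i)\<^sup>2) + K * (LINT u:{0..t}|lborel. (norm (Xb u z))\<^sup>2)"
        using bspec[OF elim(1) t] by (simp add: K_def mult.assoc)
      also have "(LINT u:{0..t}|lborel. (norm (Xb u z))\<^sup>2) \<le> energy z" using elim(2) t by auto
      finally show ?case using K by (simp add: mult_left_mono)
    qed
  qed
qed

text \<open>Cauchy-Schwarz in time bounds the squared drift increment by \<open>t - s\<close> times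
  the energy, and the noise increment has variance \<open>t - s\<close>; squaring a sum of two terms
  gives the factor 2.\<close>

lemma X_incr_nrm:
  "\<exists>K\<ge>0. \<forall>s t. 0 \<le> s \<longrightarrow> s \<le> t \<longrightarrow> t \<le> T \<longrightarrow> (nrm (\<lambda>z. xc i t z - xc i s z))\<^sup>2 \<le> K * (t - s)"
proof -
  obtain C where C: "\<forall>s\<in>{0..T}. \<forall>x. norm (a s *v x) \<le> C * norm x" using a_bound by blast
  define K where "K = 2 * C\<^sup>2 * expectation energy + 2"
  have E0: "0 \<le> expectation energy" using energy_nonneg by (intro integral_nonneg_AE) auto
  show ?thesis
  proof (intro exI[of _ K] conjI allI impI)
    show "0 \<le> K" using E0 by (simp add: K_def)
    fix s t assume st: "0 \<le> s" "s \<le> t" "t \<le> T"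
    then have sT: "s \<in> {0..T}" "t \<in> {0..T}" by auto
    let ?w = "\<lambda>z. W t z $ i - W s z $ i"
    note WL = W_L2[OF sT(1), of i] W_L2[OF sT(2), of i]
    have wL: "?w \<in> L2" using WL by auto
    have wi: "integrable M (\<lambda>z. (?w z)\<^sup>2)" using wL by (simp add: L2_def)
    have we: "expectation (\<lambda>z. (?w z)\<^sup>2) = t - s"
    proof -
      have "expectation (\<lambda>z. (?w z)\<^sup>2) = ip ?w ?w" by (simp add: ip_def power2_eq_square)
      also have "\<dots> = t - s"
        using WL wL brownian_L2_moments(3)[OF W T0(1) sT(1) sT(1), of i i] brownian_L2_moments(3)[OF W T0(1) sT(2) sT(2), of i i]
          brownian_L2_moments(3)[OF W T0(1) sT(1) sT(2), of i i] brownian_L2_moments(3)[OF W T0(1) sT(2) sT(1), of i i] st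
        by (simp add: ip_diff_left ip_diff_right)
      finally show ?thesis .
    qed
    have "(nrm (\<lambda>z. xc i t z - xc i s z))\<^sup>2 \<le> expectation (\<lambda>z. (2 * ((t - s) * C\<^sup>2)) * energy z + 2 * (?w z)\<^sup>2)"
    proof (rule L2_sq_le(2))
      show "(\<lambda>z. xc i t z - xc i s z) \<in> borel_measurable M"
        by (intro borel_measurable_diff X_comp_measurable sT)
      show "integrable M (\<lambda>z. (2 * ((t - s) * C\<^sup>2)) * energy z + 2 * (?w z)\<^sup>2)"
        by (intro Bochner_Integration.integrable_add integrable_mult_right energy_integrable wi)
      show "AE z in M. (xc i t z - xc i s z)\<^sup>2 \<le> (2 * ((t - s) * C\<^sup>2)) * energy z + 2 * (?w z)\<^sup>2"
        using X_incr drift_integral_sq_le[OF C] energy_mono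
      proof eventually_elim
        case (elim z)
        let ?D = "LINT u:{s..t}|lborel. drift i u z"
        have sq: "(x + y)\<^sup>2 \<le> 2 * x\<^sup>2 + 2 * y\<^sup>2" for x y :: real
          using zero_le_power2[of "x - y"] by (simp add: power2_eq_square algebra_simps)
        have "xc i t z - xc i s z = ?D + ?w z" using elim(1)[rule_format, of s t i] st by simp
        then have "(xc i t z - xc i s z)\<^sup>2 \<le> 2 * ?D\<^sup>2 + 2 * (?w z)\<^sup>2" using sq[of ?D "?w z"] by simp
        also have "?D\<^sup>2 \<le> (t - s) * (C\<^sup>2 * (LINT u:{s..t}|lborel. (norm (Xb u z))\<^sup>2))"
          by (rule elim(2)[rule_format, OF st])
        also have "\<dots> \<le> (t - s) * (C\<^sup>2 * energy z)"
          using elim(3) st by (intro mult_left_mono) auto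
        finally show ?case by (simp add: mult_ac)
      qed
    qed
    also have "\<dots> = (2 * ((t - s) * C\<^sup>2)) * expectation energy + 2 * (t - s)"
      using energy_integrable wi we by simp
    also have "\<dots> = K * (t - s)" by (simp add: K_def algebra_simps)
    finally show "(nrm (\<lambda>z. xc i t z - xc i s z))\<^sup>2 \<le> K * (t - s)" .
  qed
qed

lemma X_L2cont: "L2cont {0..T} (xc i)"
proof -
  obtain K where K: "K \<ge> 0" "\<forall>s t. 0 \<le> s \<longrightarrow> s \<le> t \<longrightarrow> t \<le> T \<longrightarrow> (nrm (\<lambda>z. xc i t z - xc i s z))\<^sup>2 \<le> K * (t - s)"
    using X_incr_nrm[of i] by blast
  show ?thesis
  proof (rule L2contI_sq[OF X_L2])
    fix s u assume su: "s \<in> {0..T}" "u \<in> {0..T}"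
    have "(nrm (\<lambda>z. xc i u z - xc i s z))\<^sup>2 \<le> K * \<bar>u - s\<bar>"
    proof (cases "s \<le> u")
      case True
      then show ?thesis using K(2)[rule_format, of s u] su by simp
    next
      case False
      then show ?thesis using K(2)[rule_format, of u s] su nrm_commute[of "xc i u" "xc i s"] by simp
    qed
    then show "nrm (\<lambda>z. xc i u z - xc i s z) \<le> sqrt (K * \<bar>u - s\<bar>)" by (rule real_le_rsqrt)
    show "continuous_on {0..T} (\<lambda>u. sqrt (K * \<bar>u - s\<bar>))" by (intro continuous_intros)
    show "sqrt (K * \<bar>s - s\<bar>) = 0" by simp
  qed
qed

definition bx :: "'m \<Rightarrow> real \<Rightarrow> 'w \<Rightarrow> real" where
  "bx i s z = (\<Sum>j\<in>UNIV. a s $ i $ j * X s z $ j)"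

lemma bx_L2cont: "L2cont {0..T} (bx i)"
  unfolding bx_def[abs_def] by (intro L2cont_sum L2cont_scale X_L2cont a_comp_cont)

lemma X_weak:
  assumes t: "t \<in> {0..T}" and U: "U \<in> L2"
  shows "ip (xc i t) U = ip (xc i 0) U + integral {0..t} (\<lambda>s. ip (bx i s) U) + ip (\<lambda>z. W t z $ i) U"
proof -
  let ?D = "\<lambda>z. LINT s:{0..t}|lborel. drift i s z"
  have D: "wint (bx i) t ?D"
  proof (rule path_integral(2)[OF T0(1) bx_L2cont _ _ t])
    show "(\<lambda>(s, z). drift i s z) \<in> borel_measurable (borel \<Otimes>\<^sub>M M)"
      using drift_measurable[of i] by (simp add: case_prod_unfold)
    show "AE z in M. drift i s z = bx i s z" if "s \<in> {0..T}" for s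
      using that by (simp add: drift_def bx_def Xb_eq)
  qed
  note L = X_L2[OF T0(2), of i] wint_L2[OF D] W_L2[OF t, of i] X_L2[OF t, of i]
  have "AE z in M. W 0 z = 0" using W by (simp add: standard_brownian_motion_def)
  with X_incr have "AE z in M. xc i t z = (xc i 0 z + ?D z) + W t z $ i"
  proof eventually_elim
    case (elim z)
    show ?case using elim(1)[rule_format, of 0 t i] elim(2) t by simp
  qed
  then have "ip (xc i t) U = ip (\<lambda>z. (xc i 0 z + ?D z) + W t z $ i) U"
    using L U by (intro ip_cong_AE L2_measurable) auto
  also have "\<dots> = ip (xc i 0) U + ip ?D U + ip (\<lambda>z. W t z $ i) U"
    using L U by (simp add: ip_add_left)
  finally show ?thesis using wint_ip[OF D U] by simp
qed

lemma bx_ip: "s \<in> {0..T} \<Longrightarrow> U \<in> L2 \<Longrightarrow> ip (bx i s) U = (\<Sum>j\<in>UNIV. a s $ i $ j * ip (xc j s) U)"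
  unfolding bx_def[abs_def] using X_L2 by (simp add: ip_sum_left ip_scale_left)

text \<open>A functional of the state that annihilates the initial value and the noise solves the
  homogeneous equation.\<close>

lemma X_orth:
  assumes t: "t \<in> {0..T}" and U: "U \<in> L2" and X0: "\<And>i. ip (xc i 0) U = 0"
    and W0: "\<And>i s. s \<in> {0..t} \<Longrightarrow> ip (\<lambda>z. W s z $ i) U = 0"
  shows "ip (xc i t) U = 0"
proof (rule linear_volterra_zero[where T=t and f="\<lambda>i t. ip (xc i t) U" and a="\<lambda>i j s. a s $ i $ j"])
  have sub: "{0..t} \<subseteq> {0..T}" using t by auto
  show "continuous_on {0..t} (\<lambda>t. ip (xc i t) U)" for i
    by (rule ip_continuous_on1[OF L2cont_subset[OF X_L2cont sub] U])
  show "continuous_on {0..t} (\<lambda>s. a s $ i $ j)" for i j by (rule continuous_on_subset[OF a_comp_cont sub])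
  fix i s assume s: "s \<in> {0..t}"
  have "integral {0..s} (\<lambda>r. ip (bx i r) U) = integral {0..s} (\<lambda>r. \<Sum>j\<in>UNIV. a r $ i $ j * ip (xc j r) U)"
    by (intro integral_cong bx_ip U) (use s t in auto)
  then show "ip (xc i s) U = integral {0..s} (\<lambda>r. \<Sum>j\<in>UNIV. a r $ i $ j * ip (xc j r) U)"
    using X_weak[OF _ U, of s i] X0 W0[OF s] s t by auto
qed (use t in auto)

section \<open>The state in the span of its initial value and noise, and the integral block\<close>

definition GX :: "('w \<Rightarrow> real) set" where
  "GX = insert (\<lambda>z. 1) (range (\<lambda>i. xc i 0) \<union> {(\<lambda>z. W t z $ i) | t i. t \<in> {0..T}})"

lemma GX_L2: "GX \<subseteq> L2"
  using X0_L2 W_L2 by (auto simp: GX_def)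

lemma X_GX: assumes t: "t \<in> {0..T}" shows "xc i t \<in> cspan GX"
proof (rule cspan_orthI[OF GX_L2 X_L2[OF t]])
  fix U assume U: "U \<in> L2" and o: "\<And>V. V \<in> GX \<Longrightarrow> ip U V = 0"
  show "ip (xc i t) U = 0"
  proof (rule X_orth[OF t U])
    show "ip (xc i 0) U = 0" for i
      by (subst ip_commute, rule o) (simp add: GX_def)
    fix i s assume "s \<in> {0..t}"
    then have "s \<in> {0..T}" using t by auto
    then show "ip (\<lambda>z. W s z $ i) U = 0"
      by (subst ip_commute, intro o) (auto simp: GX_def)
  qed
qed

lemma W_GX: "t \<in> {0..T} \<Longrightarrow> (\<lambda>z. W t z $ i) \<in> cspan GX"
  by (rule cspan_base[OF GX_L2]) (auto simp: GX_def)

lemma one_GX: "(\<lambda>z. 1) \<in> GX"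
  by (simp add: GX_def)

lemma independence:
  "ip (\<lambda>z. W t z $ i) (xc j 0) = 0" "ip (\<lambda>z. N t z $ i) (xc j 0) = 0" "s \<in> {0..T} \<Longrightarrow> ip (\<lambda>z. N t z $ i) (\<lambda>z. W s z $ j) = 0"
  if t: "t \<in> {0..T}"
proof -
  let ?F = "\<lambda>i. [sets (generated_algebra M {0} X), sets (generated_algebra M {0..T} W),
                sets (generated_algebra M {0..T} N)] ! i"
  have i1: "indep_set (sets (generated_algebra M {0..T} W)) (sets (generated_algebra M {0} X))"
    using indep_sets_pair[OF indep, of 1 0] by simp
  have i2: "indep_set (sets (generated_algebra M {0..T} N)) (sets (generated_algebra M {0} X))"
    using indep_sets_pair[OF indep, of 2 0] by simp
  have i3: "indep_set (sets (generated_algebra M {0..T} N)) (sets (generated_algebra M {0..T} W))"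
    using indep_sets_pair[OF indep, of 2 1] by simp
  have mX: "xc j 0 \<in> borel_measurable (generated_algebra M {0} X)"
    by (rule measurable_component[OF generated_algebra_measurable]) simp
  have mW: "(\<lambda>z. W s z $ i) \<in> borel_measurable (generated_algebra M {0..T} W)" if "s \<in> {0..T}" for s i
    by (rule measurable_component[OF generated_algebra_measurable[OF that]])
  have mN: "(\<lambda>z. N s z $ i) \<in> borel_measurable (generated_algebra M {0..T} N)" if "s \<in> {0..T}" for s i
    by (rule measurable_component[OF generated_algebra_measurable[OF that]])
  note e = brownian_L2_moments(2)[OF W T0(1)] brownian_L2_moments(2)[OF N T0(1)]
  show "ip (\<lambda>z. W t z $ i) (xc j 0) = 0"
    using indep_ip[OF i1 _ _ mW[OF t] W_L2[OF t] mX X0_L2] e(1)[OF t] by simp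
  show "ip (\<lambda>z. N t z $ i) (xc j 0) = 0"
    using indep_ip[OF i2 _ _ mN[OF t] N_L2[OF t] mX X0_L2] e(2)[OF t] by simp
  show "ip (\<lambda>z. N t z $ i) (\<lambda>z. W s z $ j) = 0" if "s \<in> {0..T}"
    using indep_ip[OF i3 _ _ mN[OF t] N_L2[OF t] mW[OF that] W_L2[OF that]] e(2)[OF t] by simp
qed

lemma N_GX_orth: "t \<in> {0..T} \<Longrightarrow> V \<in> GX \<Longrightarrow> ip (\<lambda>z. N t z $ i) V = 0"
  using independence brownian_L2_moments(2)[OF N T0(1)] by (auto simp: GX_def ip_const)

text \<open>\<open>X_orth\<close> with the later increment of \<open>W\<close> as test variable: it
  annihilates the initial value and the noise up to \<open>s\<close>, hence the state at
  \<open>s\<close>.\<close>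

lemma W_X:
  assumes s: "0 \<le> s" "s \<le> t" "t \<le> T"
  shows "ip (\<lambda>z. W t z $ j) (xc i s) = ip (\<lambda>z. W s z $ j) (xc i s)"
proof -
  have sT: "s \<in> {0..T}" "t \<in> {0..T}" using s by auto
  note L = W_L2[OF sT(1)] W_L2[OF sT(2)]
  have "ip (xc i s) (\<lambda>z. W t z $ j - W s z $ j) = 0"
  proof (rule X_orth[OF sT(1)])
    show "(\<lambda>z. W t z $ j - W s z $ j) \<in> L2" using L by auto
    show "ip (xc i 0) (\<lambda>z. W t z $ j - W s z $ j) = 0" for i
      using independence(1)[OF sT(1), of j i] independence(1)[OF sT(2), of j i] L X0_L2[of i]
      by (simp add: ip_diff_left ip_commute[of "xc i 0"])
    fix i r assume r: "r \<in> {0..s}"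
    then have rT: "r \<in> {0..T}" using s by auto
    show "ip (\<lambda>z. W r z $ i) (\<lambda>z. W t z $ j - W s z $ j) = 0"
      using brownian_L2_moments(3)[OF W T0(1) rT sT(1), of i j] brownian_L2_moments(3)[OF W T0(1) rT sT(2), of i j]
        L W_L2[OF rT] r s by (simp add: ip_diff_right min_def)
  qed
  then show ?thesis
    using L X_L2[OF sT(1), of i] by (simp add: ip_diff_left ip_commute[of "xc i s"])
qed

lemma kernel_section: "s \<in> {0..T} \<Longrightarrow> continuous_on {0..T} (L s)" "s \<in> {0..T} \<Longrightarrow> continuous_on {0..T} (H s)"
proof -
  assume s: "s \<in> {0..T}"
  have "continuous_on {0..T} (\<lambda>u. (\<lambda>(t, s). L t s) (s, u))" "continuous_on {0..T} (\<lambda>u. (\<lambda>(t, s). H t s) (s, u))"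
    by (rule continuous_on_compose2[OF L_cont] continuous_on_compose2[OF H_cont]; use s in \<open>auto intro!: continuous_intros\<close>)+
  then show "continuous_on {0..T} (L s)" "continuous_on {0..T} (H s)" by simp_all
qed

lemma H_diag: "continuous_on {0..T} (\<lambda>s. H s s)"
proof -
  have "continuous_on {0..T} (\<lambda>s. (\<lambda>(t, s). H t s) (s, s))"
    by (rule continuous_on_compose2[OF H_cont]) (auto intro!: continuous_intros)
  then show ?thesis by simp
qed

text \<open>The coordinate of the vector integral equals the integral of the coordinate only where
  the path is integrable, hence almost everywhere. Measurability of the vector integral is shown
  separately, and \<open>wint_AE_cong\<close> joins the two.\<close>

lemma kernel_wint:
  assumes k: "continuous_on {0..T} k" and t: "t \<in> {0..T}"
  shows "wint (\<lambda>s z. k s * xc i s z) t (\<lambda>z. (LINT s:{0..t}|lborel. k s *\<^sub>R X s z) $ i)"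
proof -
  define k' where "k' s = indicator {0..T} s * k s" for s
  have k'm: "k' \<in> borel_measurable borel"
    unfolding k'_def[abs_def] using borel_measurable_continuous_on_indicator[OF _ k] by simp
  have kX: "(\<lambda>x. k' (fst x) *\<^sub>R Xb (fst x) (snd x)) \<in> borel_measurable (borel \<Otimes>\<^sub>M M)"
    by (intro borel_measurable_scaleR Xb_measurable measurable_compose[OF measurable_fst k'm])
  define y' where "y' s z = k' s * Xb s z $ i" for s z
  have w: "wint (\<lambda>s z. k s * xc i s z) t (\<lambda>z. LINT s:{0..t}|lborel. y' s z)"
  proof (rule path_integral(2)[OF T0(1) L2cont_scale[OF X_L2cont k] _ _ t])
    show "(\<lambda>(s, z). y' s z) \<in> borel_measurable (borel \<Otimes>\<^sub>M M)"
      using measurable_component[OF kX, of i] by (simp add: case_prod_unfold y'_def)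
    show "AE z in M. y' s z = k s * xc i s z" if "s \<in> {0..T}" for s
      using that by (simp add: y'_def k'_def Xb_eq)
  qed
  have eq: "(LINT s:{0..t}|lborel. k s *\<^sub>R X s z) = (LINT s:{0..t}|lborel. k' s *\<^sub>R Xb s z)" for z
    by (rule set_lebesgue_integral_cong) (use t in \<open>auto simp: k'_def Xb_eq\<close>)
  have m: "(\<lambda>z. LINT s:{0..t}|lborel. k s *\<^sub>R X s z) \<in> borel_measurable M"
  proof -
    have "(\<lambda>x. indicat_real {0..t} (snd x) *\<^sub>R (k' (snd x) *\<^sub>R Xb (snd x) (fst x))) \<in> borel_measurable (M \<Otimes>\<^sub>M borel)"
    proof (intro borel_measurable_scaleR[where f="\<lambda>x. indicat_real {0..t} (snd x)"])
      have "(\<lambda>x. (snd x, fst x)) \<in> (M \<Otimes>\<^sub>M borel) \<rightarrow>\<^sub>M (borel \<Otimes>\<^sub>M M)" by measurable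
      from measurable_compose[OF this kX]
      show "(\<lambda>x. k' (snd x) *\<^sub>R Xb (snd x) (fst x)) \<in> borel_measurable (M \<Otimes>\<^sub>M borel)" by simp
    qed measurable
    moreover have "sets (M \<Otimes>\<^sub>M lborel) = sets (M \<Otimes>\<^sub>M borel)" by (intro sets_pair_measure_cong) auto
    ultimately have "(\<lambda>x. indicat_real {0..t} (snd x) *\<^sub>R (k' (snd x) *\<^sub>R Xb (snd x) (fst x))) \<in> borel_measurable (M \<Otimes>\<^sub>M lborel)"
      using measurable_cong_sets by blast
    then show ?thesis
      unfolding eq unfolding set_lebesgue_integral_def
      using lborel.borel_measurable_lebesgue_integral[of "\<lambda>z s. indicat_real {0..t} s *\<^sub>R (k' s *\<^sub>R Xb s z)" M]
      by (simp add: case_prod_unfold)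
  qed
  have "AE z in M. (LINT s:{0..t}|lborel. k s *\<^sub>R X s z) $ i = (LINT s:{0..t}|lborel. y' s z)"
    using X_path
  proof eventually_elim
    case (elim z)
    have "continuous_on {0..t} (\<lambda>s. k s *\<^sub>R X s z)"
      by (rule continuous_on_subset[of "{0..T}"]) (use t in \<open>auto intro!: continuous_intros k elim\<close>)
    then have "set_integrable lborel {0..t} (\<lambda>s. k s *\<^sub>R X s z)" by (rule borel_integrable_atLeastAtMost')
    then have "(LINT s:{0..t}|lborel. k s *\<^sub>R X s z) $ i = (LINT s:{0..t}|lborel. (k s *\<^sub>R X s z) $ i)"
      by (rule set_integral_component(2))
    also have "\<dots> = (LINT s:{0..t}|lborel. y' s z)"
      by (rule set_lebesgue_integral_cong) (use t in \<open>auto simp: y'_def k'_def Xb_eq\<close>)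
    finally show ?case .
  qed
  from wint_AE_cong[OF w this measurable_component[OF m]] show ?thesis .
qed

definition V2 :: "real \<Rightarrow> 'm \<Rightarrow> real \<Rightarrow> 'w \<Rightarrow> real" where
  "V2 r i t z = (LINT s:{0..t}|lborel. L r s *\<^sub>R X s z) $ i"

lemma V2_wint: "r \<in> {0..T} \<Longrightarrow> t \<in> {0..T} \<Longrightarrow> wint (\<lambda>s z. L r s * xc i s z) t (V2 r i t)"
  unfolding V2_def[abs_def] by (rule kernel_wint[OF kernel_section(1)])

lemma LX_L2cont: "r \<in> {0..T} \<Longrightarrow> L2cont {0..T} (\<lambda>s z. L r s * xc i s z)"
  by (rule L2cont_scale[OF X_L2cont kernel_section(1)])

lemma V2_L2cont: "r \<in> {0..T} \<Longrightarrow> L2cont {0..T} (V2 r i)"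
  by (rule wint_L2cont[OF LX_L2cont V2_wint])

lemma V2_L2: "r \<in> {0..T} \<Longrightarrow> t \<in> {0..T} \<Longrightarrow> V2 r i t \<in> L2"
  by (rule wint_L2[OF V2_wint])

lemma V2_GX: assumes r: "r \<in> {0..T}" and t: "t \<in> {0..T}" shows "V2 r i t \<in> cspan GX"
  by (rule wint_cspan[OF GX_L2 _ V2_wint[OF r t]]) (use t in \<open>auto intro!: cspan_scale[OF GX_L2] X_GX\<close>)

text \<open>Both indices move. With the kernel index fixed, the increment in the time index is
  Lipschitz because \<open>L\<close> and the state are bounded; with the time fixed, the change of
  the kernel index is governed by the uniform continuity of \<open>L\<close>.\<close>

lemma V2_diag_L2cont: "L2cont {0..T} (\<lambda>s. V2 s i s)"
proof -
  obtain CX where CX: "CX \<ge> 0" "\<And>s. s \<in> {0..T} \<Longrightarrow> nrm (xc i s) \<le> CX"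
    by (rule L2cont_bounded[OF X_L2cont[of i]]) blast
  have Q: "compact ({0..T} \<times> {0..T})" by (intro compact_Times compact_Icc)
  have "bounded ((\<lambda>(t, s). L t s) ` ({0..T} \<times> {0..T}))"
    by (rule compact_imp_bounded[OF compact_continuous_image[OF L_cont Q]])
  then obtain CL where "\<forall>x\<in>(\<lambda>(t, s). L t s) ` ({0..T} \<times> {0..T}). \<bar>x\<bar> \<le> CL"
    unfolding bounded_iff by auto
  then have CL: "\<bar>L t s\<bar> \<le> CL" if "t \<in> {0..T}" "s \<in> {0..T}" for t s using that by fastforce
  have CL0: "0 \<le> CL" using order_trans[OF abs_ge_zero CL[OF T0(2) T0(2)]] .
  have LX: "nrm (\<lambda>z. L r s * xc i s z) \<le> CL * CX" if "r \<in> {0..T}" "s \<in> {0..T}" for r s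
    unfolding nrm_scale by (intro mult_mono CL CX that CL0) simp
  have incr1: "nrm (\<lambda>z. V2 r i u z - V2 r i s z) \<le> CL * CX * \<bar>u - s\<bar>"
    if "r \<in> {0..T}" "s \<in> {0..T}" "u \<in> {0..T}" for r s u
  proof (cases "s \<le> u")
    case True
    then show ?thesis
      using wint_incr_nrm[OF LX_L2cont[OF that(1)] _ True _ V2_wint[OF that(1,2)] V2_wint[OF that(1,3)] LX[OF that(1)]] that by simp
  next
    case False
    then show ?thesis
      using wint_incr_nrm[OF LX_L2cont[OF that(1)] _ _ _ V2_wint[OF that(1,3)] V2_wint[OF that(1,2)] LX[OF that(1)]] that
        nrm_commute[of "V2 r i u" "V2 r i s"] by simp
  qed
  have incr2: "nrm (\<lambda>z. V2 u i s z - V2 r i s z) \<le> e * CX * T"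
    if ru: "r \<in> {0..T}" "u \<in> {0..T}" "s \<in> {0..T}" and e: "0 \<le> e" "\<And>q. q \<in> {0..T} \<Longrightarrow> \<bar>L u q - L r q\<bar> \<le> e" for r s u e
  proof -
    have c: "continuous_on {0..T} (\<lambda>q. L u q - L r q)" by (intro continuous_intros kernel_section ru)
    have sub: "{0..s} \<subseteq> {0..T}" using ru by auto
    note VL = V2_L2[OF ru(1,3), of i] V2_L2[OF ru(2,3), of i]
    have w: "wint (\<lambda>q z. (L u q - L r q) * xc i q z) s (\<lambda>z. V2 u i s z - V2 r i s z)"
      unfolding wint_def
    proof (intro conjI ballI)
      show "(\<lambda>z. V2 u i s z - V2 r i s z) \<in> L2" using VL by auto
      fix U assume U: "U \<in> L2"
      have i: "(\<lambda>q. ip (\<lambda>z. L u q * xc i q z) U) integrable_on {0..s}" "(\<lambda>q. ip (\<lambda>z. L r q * xc i q z) U) integrable_on {0..s}"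
        by (intro integrable_continuous_interval ip_continuous_on1 L2cont_subset[OF LX_L2cont sub] ru U)+
      have "ip (\<lambda>z. V2 u i s z - V2 r i s z) U
          = integral {0..s} (\<lambda>q. ip (\<lambda>z. L u q * xc i q z) U) - integral {0..s} (\<lambda>q. ip (\<lambda>z. L r q * xc i q z) U)"
        using ip_diff_left[OF VL(2,1) U] wint_ip[OF V2_wint[OF ru(2,3)] U] wint_ip[OF V2_wint[OF ru(1,3)] U] by simp
      also have "\<dots> = integral {0..s} (\<lambda>q. ip (\<lambda>z. L u q * xc i q z) U - ip (\<lambda>z. L r q * xc i q z) U)"
        by (rule Henstock_Kurzweil_Integration.integral_diff[symmetric, OF i])
      also have "\<dots> = integral {0..s} (\<lambda>q. ip (\<lambda>z. (L u q - L r q) * xc i q z) U)"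
        by (simp only: ip_scale_left left_diff_distrib[symmetric])
      finally show "ip (\<lambda>z. V2 u i s z - V2 r i s z) U = integral {0..s} (\<lambda>q. ip (\<lambda>z. (L u q - L r q) * xc i q z) U)" .
    qed
    have b: "nrm (\<lambda>z. (L u q - L r q) * xc i q z) \<le> e * CX" if "q \<in> {0..s}" for q
    proof -
      have "q \<in> {0..T}" using that sub by blast
      then show ?thesis unfolding nrm_scale by (intro mult_mono e CX) simp_all
    qed
    have "L2cont {0..s} (\<lambda>q z. (L u q - L r q) * xc i q z)"
      by (rule L2cont_subset[OF L2cont_scale[OF X_L2cont c] sub])
    from wint_nrm[OF this _ w b] have "nrm (\<lambda>z. V2 u i s z - V2 r i s z) \<le> e * CX * s" using ru by simp
    also have "\<dots> \<le> e * CX * T" using ru e CX by (intro mult_left_mono) auto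
    finally show ?thesis .
  qed
  show ?thesis
    unfolding L2cont_def
  proof (intro conjI ballI allI impI V2_L2)
    fix s \<epsilon> :: real assume s: "s \<in> {0..T}" and \<epsilon>: "0 < \<epsilon>"
    \<comment> \<open>Chosen so that the change of the kernel contributes at most half of
      \<open>\<epsilon>\<close>; the added 1 keeps the quotient defined when \<open>CX * T\<close>
      vanishes.\<close>
    define e where "e = \<epsilon> / (2 * (CX * T + 1))"
    have CT: "0 \<le> CX * T" using CX T0 by simp
    have e: "0 < e" using \<epsilon> CT by (simp add: e_def)
    have eb: "e * CX * T \<le> \<epsilon> / 2"
    proof -
      have "e * (CX * T) \<le> e * (CX * T + 1)" using e by (intro mult_left_mono) auto
      also have "\<dots> = \<epsilon> / 2" using CT by (simp add: e_def field_simps)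
      finally show ?thesis by (simp add: mult.assoc)
    qed
    obtain d where d: "d > 0" "\<forall>x\<in>{0..T} \<times> {0..T}. \<forall>x'\<in>{0..T} \<times> {0..T}. dist x' x < d \<longrightarrow> dist ((\<lambda>(t, s). L t s) x') ((\<lambda>(t, s). L t s) x) < e"
      using compact_uniformly_continuous[OF L_cont Q] e unfolding uniformly_continuous_on_def by blast
    define d' where "d' = min d (\<epsilon> / (2 * (CL * CX + 1)))"
    have CC: "0 \<le> CL * CX" using CL0 CX by simp
    have "d' > 0" using d \<epsilon> CC by (simp add: d'_def)
    moreover have "nrm (\<lambda>z. V2 u i u z - V2 s i s z) < \<epsilon>" if u: "u \<in> {0..T}" "\<bar>u - s\<bar> < d'" for u
    proof -
      have "\<bar>L u q - L s q\<bar> \<le> e" if "q \<in> {0..T}" for q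
        using d(2)[rule_format, of "(s, q)" "(u, q)"] u s that by (simp add: dist_Pair_Pair dist_real_def d'_def)
      then have a1: "nrm (\<lambda>z. V2 u i s z - V2 s i s z) \<le> \<epsilon> / 2"
        using incr2[OF s u(1) s, of e] e eb by simp
      have "CL * CX * \<bar>u - s\<bar> \<le> (CL * CX + 1) * \<bar>u - s\<bar>" by (simp add: algebra_simps)
      also have "\<dots> < (CL * CX + 1) * (\<epsilon> / (2 * (CL * CX + 1)))"
        using u(2) CC by (intro mult_strict_left_mono) (auto simp: d'_def)
      also have "\<dots> = \<epsilon> / 2" using CC by (simp add: field_simps)
      finally have a2: "nrm (\<lambda>z. V2 u i u z - V2 u i s z) < \<epsilon> / 2"
        using incr1[OF u(1) s u(1)] by linarith
      show ?thesis
        using nrm_triangle3[OF V2_L2[OF u(1) u(1)] V2_L2[OF u(1) s] V2_L2[OF s s], of i i i] a1 a2 by linarith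
    qed
    ultimately show "\<exists>d>0. \<forall>u\<in>{0..T}. \<bar>u - s\<bar> < d \<longrightarrow> nrm (\<lambda>z. V2 u i u z - V2 s i s z) < \<epsilon>" by blast
  qed
qed

definition h :: "real \<Rightarrow> 'm \<Rightarrow> 'w \<Rightarrow> real" where
  "h s i z = H s s * X s z $ i + V2 s i s z"

lemma h_L2cont: "L2cont {0..T} (\<lambda>s. h s i)"
  unfolding h_def[abs_def] by (intro L2cont_add L2cont_scale X_L2cont V2_diag_L2cont H_diag)

lemma h_GX: "s \<in> {0..T} \<Longrightarrow> h s i \<in> cspan GX"
  unfolding h_def[abs_def] by (intro cspan_add[OF GX_L2] cspan_scale[OF GX_L2] X_GX V2_GX)

lemma h_ip: "s \<in> {0..T} \<Longrightarrow> U \<in> L2 \<Longrightarrow> ip (h s i) U = H s s * ip (xc i s) U + ip (V2 s i s) U"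
  unfolding h_def[abs_def] using X_L2 V2_L2 by (simp add: ip_add_left ip_scale_left)

text \<open>The observed integral is paired with an arbitrary test variable, which turns
  \<open>kernel_diagonal_integral\<close> into the weak statement that the drift of \<open>Z\<close>
  is \<open>h\<close>.\<close>

lemma observation:
  assumes t: "t \<in> {0..T}"
  shows "\<exists>Y. wint (\<lambda>s. h s i) t Y \<and> (AE z in M. Z t z $ i = Y z + N t z $ i)"
proof (intro exI conjI)
  let ?Y = "\<lambda>z. (LINT s:{0..t}|lborel. H t s *\<^sub>R X s z) $ i"
  have w: "wint (\<lambda>s z. H t s * xc i s z) t ?Y" by (rule kernel_wint[OF kernel_section(2)[OF t] t])
  show "wint (\<lambda>s. h s i) t ?Y"
    unfolding wint_def
  proof (intro conjI ballI wint_L2[OF w])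
    fix U assume U: "U \<in> L2"
    have "ip ?Y U = integral {0..t} (\<lambda>s. H t s * ip (xc i s) U)"
      using wint_ip[OF w U] by (simp add: ip_scale_left)
    also have "\<dots> = integral {0..t} (\<lambda>s. H s s * ip (xc i s) U + integral {0..s} (\<lambda>u. L s u * ip (xc i u) U))"
      by (rule kernel_diagonal_integral[OF H_cont L_cont HL ip_continuous_on1[OF X_L2cont U] t])
    also have "\<dots> = integral {0..t} (\<lambda>s. ip (h s i) U)"
    proof (rule integral_cong)
      fix s assume "s \<in> {0..t}"
      then have s: "s \<in> {0..T}" using t by auto
      show "H s s * ip (xc i s) U + integral {0..s} (\<lambda>u. L s u * ip (xc i u) U) = ip (h s i) U"
        using h_ip[OF s U] wint_ip[OF V2_wint[OF s s] U] by (simp add: ip_scale_left)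
    qed
    finally show "ip ?Y U = integral {0..t} (\<lambda>s. ip (h s i) U)" .
  qed
  show "AE z in M. Z t z $ i = ?Y z + N t z $ i"
    using Z_eq by eventually_elim (use t in auto)
qed

text \<open>The filtration is defined by vectors, the abstract problem by scalars; a vector is
  measurable exactly when its coordinates are.\<close>

lemma natural_filtration_generated:
  assumes t: "t \<in> {0..T}"
  shows "generated_by (natural_filtration M Z t) {(\<lambda>z. Z s z $ i) | s i. s \<in> {0..t}}"
proof -
  let ?S = "{(\<lambda>z. Z s z $ i) | s i. s \<in> {0..t}}"
  let ?A = "{Z s -` B \<inter> space M | s B. s \<in> {0..t} \<and> B \<in> sets borel}"
  let ?B = "{\<zeta> -` B \<inter> space M | \<zeta> B. \<zeta> \<in> ?S \<and> B \<in> sets borel}"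
  have A: "sets (natural_filtration M Z t) = sigma_sets (space M) ?A"
    unfolding generated_algebra_def by (rule sets_measure_of) auto
  have "?B \<subseteq> sigma_sets (space M) ?A"
  proof
    fix E assume "E \<in> ?B"
    then obtain s i B where s: "s \<in> {0..t}" and B: "B \<in> sets borel" and E: "E = (\<lambda>z. Z s z $ i) -` B \<inter> space M" by auto
    have "(\<lambda>z. Z s z $ i) \<in> borel_measurable (natural_filtration M Z t)"
      by (rule measurable_component[OF generated_algebra_measurable[OF s]])
    from measurable_sets[OF this B] show "E \<in> sigma_sets (space M) ?A" unfolding A E by simp
  qed
  moreover have "?A \<subseteq> sigma_sets (space M) ?B"
  proof
    let ?G = "sigma (space M) ?B"
    have G: "sets ?G = sigma_sets (space M) ?B" "space ?G = space M" by (auto simp: space_measure_of_conv intro!: sets_measure_of)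
    fix E assume "E \<in> ?A"
    then obtain s B where s: "s \<in> {0..t}" and B: "B \<in> sets borel" and E: "E = Z s -` B \<inter> space M" by auto
    have "Z s \<in> borel_measurable ?G"
    proof (rule borel_measurable_euclidean_space[THEN iffD2, rule_format])
      fix b :: "real ^ 'm" assume "b \<in> Basis"
      then obtain i where b: "b = axis i 1" by (auto simp: Basis_vec_def)
      have "(\<lambda>z. Z s z $ i) \<in> borel_measurable ?G"
      proof (rule measurableI)
        fix D :: "real set" assume "D \<in> sets borel"
        then have "(\<lambda>z. Z s z $ i) -` D \<inter> space M \<in> ?B" using s by blast
        then show "(\<lambda>z. Z s z $ i) -` D \<inter> space ?G \<in> sets ?G" unfolding G by (rule sigma_sets.Basic)
      qed simp
      then show "(\<lambda>z. Z s z \<bullet> b) \<in> borel_measurable ?G" by (simp add: b inner_axis)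
    qed
    from measurable_sets[OF this B] show "E \<in> sigma_sets (space M) ?B" unfolding G E .
  qed
  ultimately have "sigma_sets (space M) ?A = sigma_sets (space M) ?B"
    by (intro equalityI sigma_sets_subseteq sigma_sets_mono)
  then show ?thesis unfolding generated_by_def A by simp
qed

sublocale F: filtering M T GX h "\<lambda>t i z. N t z $ i" "\<lambda>t i z. Z t z $ i" "natural_filtration M Z"
proof
  show "0 \<le> T" by (rule T0)
  show "GX \<subseteq> L2" by (rule GX_L2)
  show "(\<lambda>z. 1) \<in> GX" by (rule one_GX)
  show "h s i \<in> cspan GX" if "s \<in> {0..T}" for s i by (rule h_GX[OF that])
  show "L2cont {0..T} (\<lambda>s. h s i)" for i by (rule h_L2cont)
  show "(\<lambda>z. N s z $ i) \<in> L2" if "s \<in> {0..T}" for s i by (rule N_L2[OF that])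
  show "ip (\<lambda>z. N s z $ i) V = 0" if "s \<in> {0..T}" "V \<in> GX" for s i V by (rule N_GX_orth[OF that])
  show "ip (\<lambda>z. N s z $ i) (\<lambda>z. N t z $ j) = (if i = j then min s t else 0)" if "s \<in> {0..T}" "t \<in> {0..T}" for s t i j
    by (rule brownian_L2_moments(3)[OF N T0(1) that])
  show "(\<lambda>z. Z t z $ i) \<in> borel_measurable M" if "t \<in> {0..T}" for t i
    by (rule measurable_component[OF Z_meas[OF that]])
  show "\<exists>Y. wint (\<lambda>s. h s i) t Y \<and> (AE z in M. Z t z $ i = Y z + N t z $ i)" if "t \<in> {0..T}" for t i
    by (rule observation[OF that])
  show "gaussian_chf V" if "V \<in> lin (GX \<union> {(\<lambda>z. N s z $ i) | s i. s \<in> {0..T}})" for V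
  proof (rule gaussian_family_lin_chf[OF gaussian])
    have "GX \<union> {(\<lambda>z. N s z $ i) | s i. s \<in> {0..T}} \<subseteq> insert (\<lambda>z. 1) {(\<lambda>z. Y z $ i) | Y i. Y \<in> insert (X 0) (W ` {0..T} \<union> N ` {0..T})}"
      by (auto simp: GX_def)
    from lin_mono[OF this] that
    show "V \<in> lin (insert (\<lambda>z. 1) {(\<lambda>z. Y z $ i) | Y i. Y \<in> insert (X 0) (W ` {0..T} \<union> N ` {0..T})})" by blast
  qed
  show "generated_by (natural_filtration M Z t) {(\<lambda>z. Z s z $ i) | s i. s \<in> {0..t}}" if "t \<in> {0..T}" for t
    by (rule natural_filtration_generated[OF that])
qed

end

section \<open>The augmented filter\<close>

lemma sum_UNIV_sum:
  fixes f :: "'a::finite + 'b::finite \<Rightarrow> 'c::comm_monoid_add"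
  shows "sum f UNIV = (\<Sum>i\<in>UNIV. f (Inl i)) + (\<Sum>i\<in>UNIV. f (Inr i))"
  using sum.Plus[of UNIV UNIV f] by (simp add: o_def)

lemma power2_norm_vec: "(norm (x :: 'b::real_normed_vector ^ 'n::finite))\<^sup>2 = (\<Sum>i\<in>UNIV. (norm (x $ i))\<^sup>2)"
  by (simp add: norm_vec_def L2_set_def sum_nonneg)

lemma borel_measurable_vecI:
  fixes f :: "'w \<Rightarrow> 'b::euclidean_space ^ 'n::finite"
  assumes "\<And>i. (\<lambda>z. f z $ i) \<in> borel_measurable N" shows "f \<in> borel_measurable N"
proof (rule borel_measurable_euclidean_space[THEN iffD2, rule_format])
  fix b :: "'b ^ 'n" assume "b \<in> Basis"
  then obtain i u where b: "b = axis i u" by (auto simp: Basis_vec_def)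
  have "(\<lambda>z. f z $ i \<bullet> u) \<in> borel_measurable N"
    by (intro borel_measurable_inner assms borel_measurable_const)
  then show "(\<lambda>z. f z \<bullet> b) \<in> borel_measurable N" by (simp add: b inner_axis)
qed

lemma set_integral_vecI:
  fixes f :: "real \<Rightarrow> 'b::euclidean_space ^ 'n::finite"
  assumes "\<And>i. set_integrable lborel S (\<lambda>s. f s $ i)"
  shows "set_integrable lborel S f" "(LINT s:S|lborel. f s) = (\<chi> i. LINT s:S|lborel. f s $ i)"
proof -
  have bl: "bounded_linear (axis i :: 'b \<Rightarrow> 'b ^ 'n)" for i
    by (rule linear_conv_bounded_linear[THEN iffD1], rule linearI) (auto simp: axis_def vec_eq_iff)
  have eq: "f s = (\<Sum>i\<in>UNIV. axis i (f s $ i))" for s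
    by (simp add: vec_eq_iff axis_def if_distrib cong: if_cong)
  have "integrable lborel (\<lambda>s. \<Sum>i\<in>UNIV. axis i (indicator S s *\<^sub>R f s $ i))"
    by (intro Bochner_Integration.integrable_sum integrable_bounded_linear[OF bl]) (use assms in \<open>simp add: set_integrable_def\<close>)
  moreover have "indicator S s *\<^sub>R f s = (\<Sum>i\<in>UNIV. axis i (indicator S s *\<^sub>R f s $ i))" for s
    by (simp add: vec_eq_iff axis_def if_distrib cong: if_cong)
  ultimately show i: "set_integrable lborel S f" by (simp add: set_integrable_def)
  show "(LINT s:S|lborel. f s) = (\<chi> i. LINT s:S|lborel. f s $ i)"
  proof (rule vec_eq_iff[THEN iffD2, rule_format])
    fix i
    have "integrable lborel (\<lambda>s. indicator S s *\<^sub>R f s)" using i by (simp add: set_integrable_def)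
    from integral_bounded_linear[OF bounded_linear_vec_nth this, of i]
    show "(LINT s:S|lborel. f s) $ i = (\<chi> i. LINT s:S|lborel. f s $ i) $ i"
      by (simp add: set_lebesgue_integral_def)
  qed
qed

lemma vstack_nth [simp]: "vstack A B $ Inl i = A $ i" "vstack A B $ Inr j = B $ j"
  by (simp_all add: vstack_def)

lemma hstack_nth [simp]: "hstack A B $ k = vstack (A $ k) (B $ k)"
  by (simp add: hstack_def)

context prob_space
begin

lemma AE_vec_eqI:
  fixes f g :: "'a \<Rightarrow> 'b ^ 'n::finite"
  assumes "\<And>i. AE z in M. f z $ i = g z $ i" shows "AE z in M. f z = g z"
proof -
  have "AE z in M. \<forall>i\<in>UNIV. f z $ i = g z $ i" by (rule AE_finite_allI) (simp_all add: assms)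
  then show ?thesis by eventually_elim (simp add: vec_eq_iff)
qed

text \<open>One measurable modification per coordinate yields one family \<open>J\<close> that is at
  once the pathwise integral of the statement and the weak integral of the proof. It supplies both
  the integral subtracted in the innovation and the drift term of the filter.\<close>

lemma vec_time_integral:
  fixes Y :: "real \<Rightarrow> 'a \<Rightarrow> real ^ 'n::finite"
  assumes T: "0 \<le> T" and y: "\<And>k. L2cont {0..T} (y k)" and Y: "\<And>s k. s \<in> {0..T} \<Longrightarrow> AE z in M. Y s z $ k = y k s z"
  shows "\<exists>J. \<forall>t\<in>{0..T}. has_time_integral M Y t (J t) \<and> (\<forall>k. wint (y k) t (\<lambda>z. J t z $ k))"
proof -
  have "\<exists>y'. (\<lambda>(s, z). y' s z) \<in> borel_measurable (borel \<Otimes>\<^sub>M M) \<and> (\<forall>s\<in>{0..T}. AE z in M. y' s z = y k s z)" for k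
    using measurable_modification_exists[OF y[of k]] by metis
  then obtain y' where y': "\<And>k. (\<lambda>(s, z). y' k s z) \<in> borel_measurable (borel \<Otimes>\<^sub>M M)"
    "\<And>k s. s \<in> {0..T} \<Longrightarrow> AE z in M. y' k s z = y k s z" by metis
  define J where "J t z = (\<chi> k. LINT s:{0..t}|lborel. y' k s z)" for t z
  have "has_time_integral M Y t (J t) \<and> (\<forall>k. wint (y k) t (\<lambda>z. J t z $ k))" if t: "t \<in> {0..T}" for t
  proof
    have w: "wint (y k) t (\<lambda>z. J t z $ k)" for k
      using path_integral(2)[OF T y[of k] y'(1)[of k] y'(2)[of _ k] t] by (simp add: J_def)
    then show "\<forall>k. wint (y k) t (\<lambda>z. J t z $ k)" by blast
    define Y' where "Y' s z = (\<chi> k. y' k s z)" for s z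
    show "has_time_integral M Y t (J t)"
      unfolding has_time_integral_def
    proof (intro conjI exI[of _ Y'])
      show "J t \<in> borel_measurable M"
        by (rule borel_measurable_vecI) (rule L2_measurable[OF wint_L2[OF w]])
      show "measurable_modification M t Y Y'"
        unfolding measurable_modification_def
      proof (intro conjI ballI)
        show "(\<lambda>(s, z). Y' s z) \<in> borel_measurable (borel \<Otimes>\<^sub>M M)"
          by (rule borel_measurable_vecI) (use y'(1) in \<open>simp add: Y'_def case_prod_unfold\<close>)
        fix s assume "s \<in> {0..t}"
        then have s: "s \<in> {0..T}" using t by auto
        show "AE z in M. Y' s z = Y s z"
        proof (rule AE_vec_eqI)
          show "AE z in M. Y' s z $ k = Y s z $ k" for k
            using Y[OF s, of k] y'(2)[OF s, of k] by eventually_elim (simp add: Y'_def)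
        qed
      qed
      have "AE z in M. \<forall>k\<in>UNIV. set_integrable lborel {0..T} (\<lambda>s. y' k s z)"
        by (intro AE_finite_allI path_integral(1)[OF T y y']) simp_all
      then show "AE z in M. set_integrable lborel {0..t} (\<lambda>s. Y' s z) \<and> J t z = (LINT s:{0..t}|lborel. Y' s z)"
      proof eventually_elim
        case (elim z)
        have "set_integrable lborel {0..t} (\<lambda>s. Y' s z $ k)" for k
          unfolding Y'_def vec_lambda_beta by (rule set_integrable_subset[OF bspec[OF elim]]) (use t in auto)
        from set_integral_vecI[OF this] show ?case by (simp add: J_def Y'_def)
      qed
    qed
  qed
  then show ?thesis by blast
qed

text \<open>Conditional covariances are constant up to a null set at each time, so a modification
  independent of the sample point exists and the time integral is an ordinary one.\<close>

lemma deterministic_time_integral: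
  fixes Y :: "real \<Rightarrow> 'a \<Rightarrow> real ^ 'n ^ 'm::finite"
  assumes t: "0 \<le> t" and y: "\<And>k l. continuous_on {0..t} (y k l)"
    and Y: "\<And>s k l. s \<in> {0..t} \<Longrightarrow> AE z in M. Y s z $ k $ l = y k l s"
    and Jm: "\<And>k l. (\<lambda>z. J z $ k $ l) \<in> borel_measurable M"
    and J: "\<And>k l. AE z in M. J z $ k $ l = integral {0..t} (y k l)"
  shows "has_time_integral M Y t J"
  unfolding has_time_integral_def
proof (intro conjI)
  define y' where "y' k l s = indicator {0..t} s * y k l s" for k l s
  have y'm: "y' k l \<in> borel_measurable borel" for k l
    unfolding y'_def[abs_def] using borel_measurable_continuous_on_indicator[OF _ y[of k l]] by simp
  define Y' where "Y' s z = (\<chi> k l. y' k l s)" for s and z :: 'a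
  show "J \<in> borel_measurable M" by (intro borel_measurable_vecI Jm)
  show "\<exists>Y'. measurable_modification M t Y Y' \<and>
      (AE z in M. set_integrable lborel {0..t} (\<lambda>s. Y' s z) \<and> J z = (LINT s:{0..t}|lborel. Y' s z))"
  proof (intro exI[of _ Y'] conjI)
    show "measurable_modification M t Y Y'"
      unfolding measurable_modification_def
    proof (intro conjI ballI)
      show "(\<lambda>(s, z). Y' s z) \<in> borel_measurable (borel \<Otimes>\<^sub>M M)"
        unfolding case_prod_unfold Y'_def
        by (intro borel_measurable_vecI) (simp add: measurable_compose[OF measurable_fst y'm])
      fix s assume s: "s \<in> {0..t}"
      show "AE z in M. Y' s z = Y s z"
      proof (intro AE_vec_eqI)
        show "AE z in M. Y' s z $ k $ l = Y s z $ k $ l" for k l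
          using Y[OF s, of k l] by eventually_elim (use s in \<open>simp add: Y'_def y'_def\<close>)
      qed
    qed
    have i: "set_integrable lborel {0..t} (y' k l)" "(LINT s:{0..t}|lborel. y' k l s) = integral {0..t} (y k l)" for k l
    proof -
      have i: "set_integrable lborel {0..t} (y k l)" by (rule borel_integrable_atLeastAtMost'[OF y])
      then show "set_integrable lborel {0..t} (y' k l)"
        by (subst set_integrable_cong[OF refl refl, where f'="y k l"]) (simp_all add: y'_def)
      have "(LINT s:{0..t}|lborel. y' k l s) = (LINT s:{0..t}|lborel. y k l s)"
        by (rule set_lebesgue_integral_cong) (auto simp: y'_def)
      then show "(LINT s:{0..t}|lborel. y' k l s) = integral {0..t} (y k l)"
        using set_borel_integral_eq_integral(2)[OF i] by simp
    qed
    have iv: "set_integrable lborel {0..t} (\<lambda>s. Y' s z)" "(LINT s:{0..t}|lborel. Y' s z) = (\<chi> k l. integral {0..t} (y k l))" for z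
    proof -
      have c: "set_integrable lborel {0..t} (\<lambda>s. Y' s z $ k $ l)" for k l using i(1) by (simp add: Y'_def)
      show "set_integrable lborel {0..t} (\<lambda>s. Y' s z)" by (intro set_integral_vecI(1) c)
      show "(LINT s:{0..t}|lborel. Y' s z) = (\<chi> k l. integral {0..t} (y k l))"
        unfolding set_integral_vecI(2)[OF set_integral_vecI(1)[OF c]] set_integral_vecI(2)[OF c]
        by (simp add: Y'_def i(2))
    qed
    have "AE z in M. J z = (\<chi> k l. integral {0..t} (y k l))"
      by (intro AE_vec_eqI) (simp add: J)
    then show "AE z in M. set_integrable lborel {0..t} (\<lambda>s. Y' s z) \<and> J z = (LINT s:{0..t}|lborel. Y' s z)"
      by eventually_elim (use iv in simp)
  qed
qed

end

context linear_model
begin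

section \<open>Components of the augmented state and their estimates\<close>

definition vs :: "real \<Rightarrow> 'm + 'm \<Rightarrow> real \<Rightarrow> 'w \<Rightarrow> real" where
  "vs r k t x = aug_state L X r t x $ k"

lemma vs_simps: "vs r (Inl i) t = xc i t" "vs r (Inr i) t = V2 r i t"
  by (simp_all add: fun_eq_iff vs_def aug_state_def V2_def)

lemma h_eq: "h s i x = H s s * vs s (Inl i) s x + vs s (Inr i) s x"
  by (simp add: h_def vs_simps)

lemma F_subalgebra: "s \<in> {0..T} \<Longrightarrow> subalgebra M (natural_filtration M Z s)"
  using generated_by_subalgebra[OF F.F_gen] measurable_component[OF Z_meas] by fastforce

lemma hat_add:
  assumes s: "s \<in> {0..T}" and U: "U \<in> L2" and V: "V \<in> L2"
  shows "AE x in M. F.hat s (\<lambda>x. c * U x + V x) x = c * F.hat s U x + F.hat s V x"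
proof -
  interpret S: finite_measure_subalgebra M "natural_filtration M Z s"
    by unfold_locales (rule F_subalgebra[OF s])
  have "AE x in M. F.hat s (\<lambda>x. c * U x + V x) x = F.hat s (\<lambda>x. c * U x) x + F.hat s V x"
    by (rule S.real_cond_exp_add) (use U V in \<open>auto intro: L2_integrable\<close>)
  moreover have "AE x in M. F.hat s (\<lambda>x. c * U x) x = c * F.hat s U x"
    by (rule S.real_cond_exp_cmult[OF L2_integrable[OF U]])
  ultimately show ?thesis by eventually_elim simp
qed

lemma hat_sum:
  assumes s: "s \<in> {0..T}" and U: "\<And>j. U j \<in> L2"
  shows "AE x in M. F.hat s (\<lambda>x. \<Sum>j\<in>(UNIV :: 'm set). c j * U j x) x = (\<Sum>j\<in>UNIV. c j * F.hat s (U j) x)"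
proof -
  interpret S: finite_measure_subalgebra M "natural_filtration M Z s"
    by unfold_locales (rule F_subalgebra[OF s])
  have "AE x in M. F.hat s (\<lambda>x. \<Sum>j\<in>(UNIV :: 'm set). c j * U j x) x = (\<Sum>j\<in>UNIV. F.hat s (\<lambda>x. c j * U j x) x)"
    by (rule S.real_cond_exp_sum) (use U in \<open>auto intro: L2_integrable\<close>)
  moreover have "AE x in M. \<forall>j\<in>UNIV. F.hat s (\<lambda>x. c j * U j x) x = c j * F.hat s (U j) x"
    by (intro AE_finite_allI S.real_cond_exp_cmult[OF L2_integrable[OF U]]) simp
  ultimately show ?thesis by eventually_elim simp
qed

lemma estimates:
  "state_estimate M Z X t x $ i = F.hat t (xc i t) x"
  "aug_estimate M Z L X r t x $ k = F.hat t (vs r k t) x"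
  by (simp_all add: state_estimate_def aug_estimate_def vec_cond_exp_def vs_def[abs_def])

lemma observed_estimate:
  assumes s: "s \<in> {0..T}"
  shows "AE x in M. (obs_mat H s *v aug_estimate M Z L X s s x) $ i = F.hat s (h s i) x"
proof -
  have L: "vs s k s \<in> L2" for k using X_L2[OF s] V2_L2[OF s s] by (cases k) (simp_all add: vs_simps)
  have "h s i = (\<lambda>x. H s s * vs s (Inl i) s x + vs s (Inr i) s x)" by (simp add: fun_eq_iff h_eq)
  then have "AE x in M. F.hat s (h s i) x = H s s * F.hat s (vs s (Inl i) s) x + F.hat s (vs s (Inr i) s) x"
    using hat_add[OF s L L] by simp
  then show ?thesis
    by eventually_elim
      (simp add: obs_mat_def matrix_vector_mult_def sum_UNIV_sum estimates mat_def if_distrib if_distribR cong: if_cong)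
qed

end

text \<open>Since \<open>I\<close> is almost surely the integral of \<open>[H I]\<close> applied to
  the augmented estimate, \<open>Z - I\<close> is the innovation of the theorem.\<close>

locale linear_filter = linear_model M T a H L X W N Z
  for M :: "'w measure" and T :: real and a :: "real \<Rightarrow> real ^ 'm ^ 'm::finite" and H L :: "real \<Rightarrow> real \<Rightarrow> real"
    and X W N Z :: "real \<Rightarrow> 'w \<Rightarrow> real ^ 'm" +
  fixes I :: "real \<Rightarrow> 'w \<Rightarrow> real ^ 'm"
  assumes I: "\<And>t i. t \<in> {0..T} \<Longrightarrow> wint (\<lambda>s. F.hat s (h s i)) t (\<lambda>x. I t x $ i)"
begin

sublocale F: innovation M T GX h "\<lambda>t i x. N t x $ i" "\<lambda>t i x. Z t x $ i" "natural_filtration M Z" "\<lambda>t i x. I t x $ i"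
  by unfold_locales (rule I)

definition bs :: "real \<Rightarrow> 'm + 'm \<Rightarrow> real \<Rightarrow> 'w \<Rightarrow> real" where
  "bs r k s x = (\<Sum>j\<in>UNIV. drift_col a L r s $ k $ j * xc j s x)"

definition ws :: "'m + 'm \<Rightarrow> real \<Rightarrow> 'w \<Rightarrow> real" where
  "ws k t x = (case k of Inl i \<Rightarrow> W t x $ i | Inr i \<Rightarrow> 0)"

lemma ws_simps: "ws (Inl i) t = (\<lambda>x. W t x $ i)" "ws (Inr i) t = (\<lambda>x. 0)"
  by (simp_all add: fun_eq_iff ws_def)

lemma bs_simps: "bs r (Inl i) s = bx i s" "bs r (Inr i) s = (\<lambda>x. L r s * xc i s x)"
  by (simp_all add: fun_eq_iff bs_def bx_def drift_col_def mat_def if_distrib if_distribR cong: if_cong)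

lemma bx_GX: "s \<in> {0..T} \<Longrightarrow> bx i s \<in> cspan GX"
  unfolding bx_def[abs_def] by (intro cspan_sum[OF GX_L2] cspan_scale[OF GX_L2] X_GX)

text \<open>With \<open>r\<close> frozen every coordinate is a signal in \<open>t\<close>. The state
  block carries the noise \<open>W\<close>, whose increments do not see the earlier \<open>h\<close>
  because \<open>W_X\<close> can be used under the integral defining \<open>V2\<close>; the integral
  block has no noise at all.\<close>

lemma sig: assumes r: "r \<in> {0..T}" shows "F.signal (vs r k) (bs r k) (ws k)"
proof (cases k)
  case (Inl i)
  have W_h: "ip (\<lambda>x. W t x $ i) (h s j) = ip (\<lambda>x. W s x $ i) (h s j)" if st: "0 \<le> s" "s \<le> t" "t \<le> T" for s t j
  proof -
    have sT: "s \<in> {0..T}" "t \<in> {0..T}" using st by auto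
    have V: "ip (\<lambda>x. W u x $ i) (V2 s j s) = integral {0..s} (\<lambda>q. L s q * ip (\<lambda>x. W u x $ i) (xc j q))" if "u \<in> {0..T}" for u
      using wint_ip2[OF V2_wint[OF sT(1) sT(1)] W_L2[OF that]] by (simp add: ip_scale_right)
    have "integral {0..s} (\<lambda>q. L s q * ip (\<lambda>x. W t x $ i) (xc j q)) = integral {0..s} (\<lambda>q. L s q * ip (\<lambda>x. W s x $ i) (xc j q))"
    proof (rule integral_cong)
      fix q assume q: "q \<in> {0..s}"
      then show "L s q * ip (\<lambda>x. W t x $ i) (xc j q) = L s q * ip (\<lambda>x. W s x $ i) (xc j q)"
        using W_X[of q t i j] W_X[of q s i j] st by simp
    qed
    then show ?thesis
      using h_ip[OF sT(1) W_L2[OF sT(1), of i], of j] h_ip[OF sT(1) W_L2[OF sT(2), of i], of j] V[OF sT(1)] V[OF sT(2)] W_X[OF st, of i j]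
      by (simp add: ip_commute[of "h s j"] ip_commute[of "xc j s"] ip_commute[of "V2 s j s"])
  qed
  show ?thesis
    unfolding F.signal_def Inl vs_simps bs_simps ws_simps
  proof (intro conjI ballI allI impI X_GX bx_GX W_GX X_L2cont bx_L2cont X_weak)
    show "ip (\<lambda>x. W t x $ i) (h s j) = ip (\<lambda>x. W s x $ i) (h s j)" if "0 \<le> s \<and> s \<le> t \<and> t \<le> T" for s t j
      using W_h that by blast
    show "ip (\<lambda>x. W t x $ i) (\<lambda>x. 1) = 0" if "t \<in> {0..T}" for t
      using brownian_L2_moments(2)[OF W T0(1) that] by (simp add: ip_const)
  qed
next
  case (Inr i)
  show ?thesis
    unfolding F.signal_def Inr vs_simps bs_simps ws_simps
  proof (intro conjI ballI allI impI V2_GX[OF r] cspan_scale[OF GX_L2] X_GX cspan_zero[OF GX_L2] V2_L2cont[OF r] LX_L2cont[OF r])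
    fix t U assume t: "t \<in> {0..T}" and U: "U \<in> L2"
    show "ip (V2 r i t) U = ip (V2 r i 0) U + integral {0..t} (\<lambda>s. ip (\<lambda>x. L r s * xc i s x) U) + ip (\<lambda>x. 0) U"
      using wint_ip[OF V2_wint[OF r T0(2)] U] wint_ip[OF V2_wint[OF r t] U] by simp
  qed simp_all
qed

lemma vs_GG: "r \<in> {0..T} \<Longrightarrow> t \<in> {0..T} \<Longrightarrow> vs r k t \<in> cspan F.GG"
  by (rule F.sig_GG(1)[OF sig])

lemma drift_estimate:
  assumes s: "s \<in> {0..T}"
  shows "AE x in M. (drift_col a L r s *v state_estimate M Z X s x) $ k = F.hat s (bs r k s) x"
  using hat_sum[where U="\<lambda>j. xc j s" and c="\<lambda>j. drift_col a L r s $ k $ j", OF s X_L2[OF s]] unfolding bs_def[abs_def]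
  by eventually_elim (simp add: matrix_vector_mult_def estimates)

text \<open>The constant value of the conditional covariance. The second factor carries the index
  \<open>t\<close> twice, as in the definition of the covariance of the augmented state.\<close>

definition PP :: "real \<Rightarrow> real \<Rightarrow> 'm + 'm \<Rightarrow> 'm + 'm \<Rightarrow> real" where
  "PP r t k l = ip (F.err t (vs r k t)) (F.err t (vs t l t))"

lemma cond_cov_component:
  "aug_cond_cov M Z L X r t x $ k $ l
    = real_cond_exp M (natural_filtration M Z t) (\<lambda>x. F.err t (vs r k t) x * F.err t (vs t l t) x) x"
  by (simp add: aug_cond_cov_def mat_cond_exp_def outer_prod_def estimates F.err_def vs_def)

lemma cond_cov_AE:
  assumes r: "r \<in> {0..T}" and t: "t \<in> {0..T}"
  shows "AE x in M. aug_cond_cov M Z L X r t x = (\<chi> k l. PP r t k l)"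
proof (intro AE_vec_eqI)
  show "AE x in M. aug_cond_cov M Z L X r t x $ k $ l = (\<chi> k l. PP r t k l) $ k $ l" for k l
    using F.err_cond_cov[OF t vs_GG[OF r t] vs_GG[OF t t]] by (simp add: cond_cov_component PP_def)
qed

lemma err_L2: "r \<in> {0..T} \<Longrightarrow> s \<in> {0..T} \<Longrightarrow> F.err s (vs r k s) \<in> L2"
  unfolding F.err_def[abs_def] by (intro L2_diff cspan_L2[OF vs_GG] F.hat_L2 vs_GG)

lemma gain_PP:
  assumes r: "r \<in> {0..T}" and s: "s \<in> {0..T}"
  shows "F.gain (vs r k) i s = ((\<chi> k l. PP r s k l) ** transpose (obs_mat H s)) $ k $ i"
proof -
  have L: "vs s k s \<in> L2" for k using cspan_L2[OF vs_GG[OF s s]] .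
  note e = err_L2[OF s s]
  have "h s i = (\<lambda>x. H s s * vs s (Inl i) s x + vs s (Inr i) s x)" by (simp add: fun_eq_iff h_eq)
  then have "AE x in M. F.hat s (h s i) x = H s s * F.hat s (vs s (Inl i) s) x + F.hat s (vs s (Inr i) s) x"
    using hat_add[OF s L L] by simp
  then have "AE x in M. F.err s (h s i) x = H s s * F.err s (vs s (Inl i) s) x + F.err s (vs s (Inr i) s) x"
    by eventually_elim (simp add: F.err_def h_eq algebra_simps)
  moreover have "F.err s (h s i) \<in> L2"
    unfolding F.err_def[abs_def] by (intro L2_diff F.h_L2 F.hat_L2 F.h_GG s)
  ultimately have "ip (F.err s (vs r k s)) (F.err s (h s i))
      = ip (F.err s (vs r k s)) (\<lambda>x. H s s * F.err s (vs s (Inl i) s) x + F.err s (vs s (Inr i) s) x)"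
    using err_L2[OF r s] e by (intro ip_cong_AE L2_measurable) auto
  also have "\<dots> = H s s * PP r s k (Inl i) + PP r s k (Inr i)"
    using err_L2[OF r s] e by (simp add: ip_add_right ip_scale_right PP_def)
  finally show ?thesis
    using F.gain_err[OF s vs_GG[OF r s] sig[OF r]]
    by (simp add: matrix_matrix_mult_def transpose_def obs_mat_def sum_UNIV_sum mat_def if_distrib if_distribR mult.commute cong: if_cong)
qed

text \<open>The observation at time 0 is null, so the observed span at time 0 consists of constants
  up to null sets, and the projection on it is the mean.\<close>

lemma hat_zero: assumes Y: "Y \<in> cspan F.GG" shows "AE x in M. F.hat 0 Y x = expectation Y"
proof -
  note z = T0(2)
  have S: "F.SZ 0 \<subseteq> L2" by (rule F.SZ_L2[OF T0(1)])
  define U where "U = (\<lambda>x. F.hat 0 Y x - expectation Y * 1)"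
  have one: "(\<lambda>x. expectation Y * 1) \<in> F.cZ 0"
    unfolding F.cZ_def by (rule cspan_scale[OF S]) (rule F.one_cZ[OF T0(1), unfolded F.cZ_def])
  have U: "U \<in> F.cZ 0"
    using cspan_diff[OF S F.hat_cZ(1)[OF z Y, unfolded F.cZ_def] one[unfolded F.cZ_def]] unfolding F.cZ_def U_def .
  note L = F.cZ_L2[OF U] F.hat_L2[OF z Y]
  have Z0: "ip (\<lambda>x. Z 0 x $ i) V = 0" if V: "V \<in> L2" for i V
  proof -
    have "ip (\<lambda>x. N 0 x $ i) V = 0"
      using brownian_L2_moments(3)[OF N T0(1) z z, of i i] by (simp add: ip_null[OF N_L2[OF z] V])
    then show ?thesis using F.Z_decomp(3)[OF z V, of i] by simp
  qed
  have "ip U U = 0"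
  proof (rule F.cZ_orthI[OF T0(1) L(1) _ _ U])
    have "ip (F.hat 0 Y) (\<lambda>x. 1) = expectation Y"
      using F.hat_cZ(2)[OF z Y F.one_cZ[OF T0(1)]] by (simp add: ip_const)
    moreover have "ip (\<lambda>x. expectation Y * 1) (\<lambda>x. 1) = expectation Y"
      unfolding ip_const by (simp add: prob_space)
    ultimately show "ip U (\<lambda>x. 1) = 0"
      unfolding U_def using ip_diff_left[OF L(2) F.cZ_L2[OF one] L2_const[of 1]] by linarith
    show "ip U (\<lambda>x. Z s x $ i) = 0" if "s \<in> {0..0}" for s i
      using Z0[OF L(1), of i] that ip_commute[of U "\<lambda>x. Z 0 x $ i"] by simp
  qed
  then have "AE x in M. U x = 0" using ip_self_eq_0_iff[OF L(1)] by blast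
  then show ?thesis by eventually_elim (simp add: U_def)
qed

text \<open>The integral block is null at time 0, which empties three of the four blocks; in the
  remaining one \<open>hat_zero\<close> turns errors into deviations from the mean.\<close>

lemma initial_covariance:
  assumes r: "r \<in> {0..T}" and t: "t \<in> {0..T}"
  shows "ip (F.err 0 (vs r k 0)) (F.err 0 (vs t l 0)) = initial_cov M (X 0) $ k $ l"
proof -
  note z = T0(2)
  have null: "ip (F.err 0 (V2 r i 0)) (F.err 0 V) = 0" if r: "r \<in> {0..T}" and V: "V \<in> cspan F.GG" for r i V
  proof -
    have VG: "V2 r i 0 \<in> cspan F.GG" using vs_GG[OF r z, of "Inr i"] by (simp add: vs_simps)
    have v0: "ip (V2 r i 0) U = 0" if "U \<in> L2" for U
      using wint_ip[OF V2_wint[OF r z] that] by simp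
    have "nrm (F.hat 0 (V2 r i 0)) \<le> 0"
      using F.hat_nrm[OF z VG] v0[OF V2_L2[OF r z]] by (simp add: nrm_def)
    then have "nrm (F.hat 0 (V2 r i 0)) = 0" using nrm_nonneg[of "F.hat 0 (V2 r i 0)"] by linarith
    then have "(nrm (F.hat 0 (V2 r i 0)))\<^sup>2 = 0" by simp
    then have "ip (F.hat 0 (V2 r i 0)) (F.hat 0 (V2 r i 0)) = 0" unfolding nrm_square .
    from ip_null[OF F.hat_L2[OF z VG] F.hat_L2[OF z V] this]
    have "ip (F.hat 0 (V2 r i 0)) (F.hat 0 V) = 0" .
    then show ?thesis using F.err_ip[OF z VG V] v0[OF cspan_L2[OF V]] by simp
  qed
  show ?thesis
  proof (cases k)
    case (Inr i)
    then show ?thesis using null[OF r vs_GG[OF t z, of l]] by (cases l) (simp_all add: vs_simps initial_cov_def)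
  next
    case kl: (Inl i)
    show ?thesis
    proof (cases l)
      case (Inr j)
      then show ?thesis
        using null[OF t vs_GG[OF r z, of k]] kl by (subst ip_commute) (simp add: vs_simps initial_cov_def)
    next
      case (Inl j)
      have E: "AE x in M. F.err 0 (xc i 0) x = xc i 0 x - expectation (xc i 0)" for i
        using hat_zero[OF vs_GG[OF r z, of "Inl i"]] unfolding vs_simps
        by eventually_elim (simp add: F.err_def)
      have "ip (F.err 0 (xc i 0)) (F.err 0 (xc j 0))
          = ip (\<lambda>x. xc i 0 x - expectation (xc i 0)) (\<lambda>x. xc j 0 x - expectation (xc j 0))"
        using err_L2[OF r z, of "Inl i"] err_L2[OF r z, of "Inl j"] X0_L2[of i] X0_L2[of j] unfolding vs_simps
        by (intro ip_cong_AE E L2_measurable) auto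
      then show ?thesis
        using kl Inl by (simp add: vs_simps initial_cov_def covariance_matrix_def ip_def)
    qed
  qed
qed

lemma drift_mat_nth: "drift_mat a L r s $ k $ Inl j = drift_col a L r s $ k $ j" "drift_mat a L r s $ k $ Inr j = 0"
  by (simp_all add: drift_mat_def matrix_matrix_mult_def mat_def if_distrib cong: if_cong)

lemma err_bs_ip:
  assumes r: "r \<in> {0..T}" and t: "t \<in> {0..T}" and s: "s \<in> {0..T}"
  shows "ip (F.err s (vs r k s)) (F.err s (bs t l s)) = ((\<chi> k l. PP r s k l) ** transpose (drift_mat a L t s)) $ k $ l"
proof -
  let ?c = "\<lambda>j. drift_col a L t s $ l $ j"
  have "AE x in M. F.err s (bs t l s) x = (\<Sum>j\<in>UNIV. ?c j * F.err s (vs s (Inl j) s) x)"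
    using hat_sum[where U="\<lambda>j. xc j s" and c="?c", OF s X_L2[OF s]] unfolding bs_def[abs_def] vs_simps
    by eventually_elim (simp add: F.err_def sum_subtractf right_diff_distrib)
  moreover have "F.err s (bs t l s) \<in> L2"
    unfolding F.err_def[abs_def] by (intro L2_diff F.sig_L2(2)[OF sig] F.hat_L2 F.sig_GG(2)[OF sig] s t)
  moreover have "(\<lambda>x. \<Sum>j\<in>UNIV. ?c j * F.err s (vs s (Inl j) s) x) \<in> L2" by (intro L2_sum L2_scale err_L2 s)
  ultimately have "ip (F.err s (vs r k s)) (F.err s (bs t l s))
      = ip (F.err s (vs r k s)) (\<lambda>x. \<Sum>j\<in>UNIV. ?c j * F.err s (vs s (Inl j) s) x)"
    using err_L2[OF r s] by (intro ip_cong_AE L2_measurable) auto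
  also have "\<dots> = (\<Sum>j\<in>UNIV. ?c j * PP r s k (Inl j))"
    using err_L2[OF s s] err_L2[OF r s] by (simp add: ip_sum_right ip_scale_right PP_def)
  finally show ?thesis
    by (simp add: matrix_matrix_mult_def transpose_def sum_UNIV_sum drift_mat_nth mult.commute)
qed

lemma err_L2cont: "r \<in> {0..T} \<Longrightarrow> L2cont {0..T} (\<lambda>s. F.err s (vs r k s))" "r \<in> {0..T} \<Longrightarrow> L2cont {0..T} (\<lambda>s. F.err s (bs r k s))"
  unfolding F.err_def[abs_def]
  by (intro L2cont_diff F.hat_L2cont F.sig_cont[OF sig] F.sig_GX[OF sig]; assumption)+

lemma ws_bs:
  assumes s: "0 \<le> s" "s \<le> t" "t \<le> T"
  shows "ip (ws k t) (bs r l s) = ip (ws k s) (bs r l s)"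
proof (cases k)
  case (Inl i)
  have sT: "s \<in> {0..T}" "t \<in> {0..T}" using s by auto
  show ?thesis
    unfolding Inl ws_simps bs_def[abs_def] using W_L2[OF sT(1), of i] W_L2[OF sT(2), of i] X_L2[OF sT(1)] W_X[OF s, of i]
    by (simp add: ip_sum_right ip_scale_right)
qed (simp add: ws_simps)

lemma ws_vs_zero:
  assumes r: "r \<in> {0..T}" and t: "t \<in> {0..T}" shows "ip (ws k t) (vs r l 0) = 0"
proof (cases k)
  case (Inl i)
  have "ip (\<lambda>x. W t x $ i) (V2 r j 0) = 0" for j
    using wint_ip2[OF V2_wint[OF r T0(2)] W_L2[OF t]] by simp
  then show ?thesis
    using independence(1)[OF t] by (cases l) (simp_all add: Inl ws_simps vs_simps)
qed (simp add: ws_simps)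

lemma transpose_nth: "transpose A $ k $ l = A $ l $ k"
  by (simp add: transpose_def)

lemma mult_transpose_nth: "(A ** transpose B) $ k $ l = (\<Sum>i\<in>UNIV. A $ k $ i * B $ l $ i)"
  by (simp add: matrix_matrix_mult_def transpose_def)

lemma noise_nth: "((noise_mat :: real ^ 'm ^ ('m + 'm)) ** transpose noise_mat) $ k $ l = (if k = l \<and> isl k then 1 else 0)"
  by (cases k; cases l) (simp_all add: noise_mat_def matrix_matrix_mult_def transpose_def mat_def if_distrib if_distribR cong: if_cong)

lemma ws_ip: "t \<in> {0..T} \<Longrightarrow> ip (ws k t) (ws l t) = (if k = l \<and> isl k then 1 else 0) * t"
  using brownian_L2_moments(3)[OF W T0(1)] by (cases k; cases l) (simp_all add: ws_simps)

lemma riccati: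
  assumes r: "r \<in> {0..T}" and t: "t \<in> {0..T}"
  shows "has_time_integral M
    (\<lambda>s x. aug_cond_cov M Z L X r s x ** transpose (drift_mat a L t s)
         + drift_mat a L r s ** transpose (aug_cond_cov M Z L X t s x)
         + noise_mat ** transpose noise_mat
         - aug_cond_cov M Z L X r s x ** transpose (obs_mat H s) ** obs_mat H s ** transpose (aug_cond_cov M Z L X t s x))
    t (\<lambda>x. aug_cond_cov M Z L X r t x - initial_cov M (X 0))"
proof (rule deterministic_time_integral)
  define y where "y k l s = ip (F.err s (vs r k s)) (F.err s (bs t l s)) + ip (F.err s (bs r k s)) (F.err s (vs t l s))
      + (if k = l \<and> isl k then 1 else 0) - (\<Sum>i\<in>UNIV. F.gain (vs r k) i s * F.gain (vs t l) i s)" for k l s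
  have sub: "{0..t} \<subseteq> {0..T}" using t by auto
  show "0 \<le> t" using t by simp
  have "continuous_on {0..T} (y k l)" for k l
    unfolding y_def[abs_def]
    by (intro continuous_intros ip_continuous_on_diag err_L2cont r t F.gain_cont[OF sig])
  then show "continuous_on {0..t} (y k l)" for k l using sub by (rule continuous_on_subset)
  have ric: "(y k l has_integral PP r t k l - initial_cov M (X 0) $ k $ l) {0..t}" for k l
    using F.riccati_equation[OF sig[OF r] sig[OF t] ws_bs ws_bs ws_vs_zero[OF t] ws_vs_zero[OF r] ws_ip[OF t] t, of k l]
      initial_covariance[OF r t, of k l]
    by (simp add: y_def[abs_def] PP_def)
  show "AE x in M. (aug_cond_cov M Z L X r t x - initial_cov M (X 0)) $ k $ l = integral {0..t} (y k l)" for k l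
    using cond_cov_AE[OF r t] by eventually_elim (simp add: integral_unique[OF ric])
  show "(\<lambda>x. (aug_cond_cov M Z L X r t x - initial_cov M (X 0)) $ k $ l) \<in> borel_measurable M" for k l
    by (simp add: cond_cov_component)
  fix s k l assume "s \<in> {0..t}"
  then have s: "s \<in> {0..T}" using t by auto
  let ?P = "\<lambda>r. \<chi> k l. PP r s k l"
  \<comment> \<open>The terms that involve the covariance with first index \<open>t\<close> are
    written as transposes, so that \<open>err_bs_ip\<close> and \<open>gain_PP\<close> apply with
    \<open>r\<close> and \<open>t\<close> exchanged.\<close>
  have "?P r ** transpose (drift_mat a L t s) + drift_mat a L r s ** transpose (?P t)
         + noise_mat ** transpose noise_mat
         - ?P r ** transpose (obs_mat H s) ** obs_mat H s ** transpose (?P t)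
      = ?P r ** transpose (drift_mat a L t s) + transpose (?P t ** transpose (drift_mat a L r s))
         + noise_mat ** transpose noise_mat
         - (?P r ** transpose (obs_mat H s)) ** transpose (?P t ** transpose (obs_mat H s))"
    by (simp add: matrix_transpose_mul matrix_mul_assoc)
  moreover have "(\<dots>) $ k $ l = y k l s"
    unfolding y_def vector_add_component vector_minus_component noise_nth transpose_nth
      mult_transpose_nth[of "?P r ** transpose (obs_mat H s)"]
      err_bs_ip[OF r t s, symmetric] err_bs_ip[OF t r s, symmetric] gain_PP[OF r s] gain_PP[OF t s]
    by (simp add: ip_commute[of "F.err s (bs r k s)" "F.err s (vs t l s)"])
  ultimately have e: "(?P r ** transpose (drift_mat a L t s) + drift_mat a L r s ** transpose (?P t)
         + noise_mat ** transpose noise_mat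
         - ?P r ** transpose (obs_mat H s) ** obs_mat H s ** transpose (?P t)) $ k $ l = y k l s" by (simp only:)
  show "AE x in M. (aug_cond_cov M Z L X r s x ** transpose (drift_mat a L t s)
         + drift_mat a L r s ** transpose (aug_cond_cov M Z L X t s x)
         + noise_mat ** transpose noise_mat
         - aug_cond_cov M Z L X r s x ** transpose (obs_mat H s) ** obs_mat H s ** transpose (aug_cond_cov M Z L X t s x)) $ k $ l = y k l s"
    using cond_cov_AE[OF r s] cond_cov_AE[OF t s] by eventually_elim (simp only: e)
qed

definition nuv :: "real \<Rightarrow> 'w \<Rightarrow> real ^ 'm" where "nuv t z = Z t z - I t z"

lemma nuv_nth: "nuv t z $ i = F.nu t i z"
  by (simp add: nuv_def F.nu_def)

lemma brownian_integrator_nuv: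
  assumes t: "t \<in> {0..T}" shows "brownian_integrator M (natural_filtration M Z) t nuv"
  unfolding brownian_integrator_def
proof (intro conjI ballI allI impI)
  fix s assume "s \<in> {0..t}"
  then have s: "s \<in> {0..T}" using t by auto
  show "nuv s \<in> borel_measurable M"
    by (rule borel_measurable_vecI) (simp add: nuv_nth L2_measurable[OF F.nu_L2[OF s]])
  have "integrable M (\<lambda>z. (F.nu s i z)\<^sup>2)" for i using F.nu_L2[OF s, of i] by (simp add: L2_def)
  then show "integrable M (\<lambda>z. (norm (nuv s z))\<^sup>2)"
    by (simp add: power2_norm_vec nuv_nth)
next
  fix s u assume "0 \<le> s \<and> s \<le> u \<and> u \<le> t"
  then have su: "0 \<le> s" "s \<le> u" "u \<le> T" using t by auto
  show "AE z in M. vec_cond_exp M (natural_filtration M Z s) (nuv u) z = nuv s z"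
    by (rule AE_vec_eqI) (use F.nu_martingale[OF su] in \<open>simp add: vec_cond_exp_def nuv_nth\<close>)
  show "AE z in M. mat_cond_exp M (natural_filtration M Z s) (\<lambda>z. outer_prod (nuv u z - nuv s z) (nuv u z - nuv s z)) z = mat (u - s)"
    by (intro AE_vec_eqI) (use F.nu_bracket[OF su] in \<open>simp add: mat_cond_exp_def outer_prod_def nuv_nth mat_def\<close>)
qed

section \<open>The Ito integral of the gain\<close>

context
  fixes r t :: real and J :: "real \<Rightarrow> 'w \<Rightarrow> real ^ ('m + 'm)"
  assumes r: "r \<in> {0..T}" and t: "t \<in> {0..T}"
    and J: "\<And>k t. t \<in> {0..T} \<Longrightarrow> wint (\<lambda>s. F.hat s (bs r k s)) t (\<lambda>z. J t z $ k)"
begin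

text \<open>The partition with index \<open>j\<close> has \<open>Suc j\<close> cells, so there is
  always at least one.\<close>

definition \<tau> :: "nat \<Rightarrow> nat \<Rightarrow> real" where "\<tau> j l = t * real l / real (Suc j)"

definition G :: "real \<Rightarrow> real ^ 'm ^ ('m + 'm)" where "G s = (\<chi> k i. F.gain (vs r k) i s)"

text \<open>Defined as the remainder, so the decomposition of the estimate holds at every point by
  definition; what has to be shown is that it is an Ito integral.\<close>

definition ito :: "'w \<Rightarrow> real ^ ('m + 'm)" where
  "ito z = (\<chi> k. F.mart (vs r k) (\<lambda>t z. J t z $ k) t z)"

lemma \<tau>_props: "0 \<le> \<tau> j l" "\<tau> j l \<le> \<tau> j (Suc l)" "l < Suc j \<Longrightarrow> \<tau> j (Suc l) \<le> t" "\<tau> j 0 = 0" "\<tau> j (Suc j) = t"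
proof -
  show "0 \<le> \<tau> j l" "\<tau> j l \<le> \<tau> j (Suc l)" using t by (auto simp: \<tau>_def intro!: divide_right_mono mult_left_mono)
  show "\<tau> j 0 = 0" "\<tau> j (Suc j) = t" by (simp_all add: \<tau>_def)
  assume "l < Suc j"
  then have "t * real (Suc l) \<le> t * real (Suc j)" using t by (intro mult_left_mono) auto
  then show "\<tau> j (Suc l) \<le> t" by (simp add: \<tau>_def divide_le_eq)
qed

lemma G_cont: "continuous_on {0..T} (\<lambda>s. G s $ k $ i)"
  unfolding G_def by (simp add: F.gain_cont[OF sig[OF r]])

lemma G_approx:
  assumes e: "0 < e"
  shows "\<exists>n. \<forall>j\<ge>n. \<forall>s\<in>{0<..t}. \<forall>k i. \<bar>G s $ k $ i - (\<Sum>l<Suc j. G (\<tau> j l) $ k $ i * indicator {\<tau> j l<..\<tau> j (Suc l)} s)\<bar> \<le> e"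
proof -
  obtain n where n: "\<And>m s x. m \<ge> n \<Longrightarrow> 0 < m \<Longrightarrow> s \<in> {0<..t} \<Longrightarrow>
    \<bar>G s $ fst x $ snd x - (\<Sum>k<m. G (t * real k / real m) $ fst x $ snd x * indicator {t * real k / real m<..t * real (Suc k) / real m} s)\<bar> \<le> e"
    by (rule uniform_step_approx[of T "\<lambda>x s. G s $ fst x $ snd x" t e]) (use G_cont t e in auto)
  show ?thesis
  proof (intro exI[of _ n] allI impI ballI)
    fix j s k i assume "n \<le> j" "s \<in> {0<..t}"
    then show "\<bar>G s $ k $ i - (\<Sum>l<Suc j. G (\<tau> j l) $ k $ i * indicator {\<tau> j l<..\<tau> j (Suc l)} s)\<bar> \<le> e"
      using n[of "Suc j" s "(k, i)"] by (simp only: \<tau>_def fst_conv snd_conv)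
  qed
qed

lemma simple_nth:
  "simple_value n \<tau>' (\<lambda>l _. G (\<tau>' l)) s z $ k $ i = (\<Sum>l<n. G (\<tau>' l) $ k $ i * indicator {\<tau>' l<..\<tau>' (Suc l)} s)"
  "simple_ito n \<tau>' (\<lambda>l _. G (\<tau>' l)) nuv z $ k = F.step_sum n \<tau>' (\<lambda>l i. G (\<tau>' l) $ k $ i) z"
  by (simp_all add: simple_value_def simple_ito_def F.step_sum_def matrix_vector_mult_def nuv_nth mult.commute)

lemma ito_approx:
  "(\<lambda>j. (nrm (\<lambda>z. ito z $ k - simple_ito (Suc j) (\<tau> j) (\<lambda>l _. G (\<tau> j l)) nuv z $ k))\<^sup>2) \<longlonglongrightarrow> 0"
proof (rule LIMSEQ_I)
  fix e :: real assume e: "0 < e"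
  show "\<exists>n. \<forall>j\<ge>n. norm ((nrm (\<lambda>z. ito z $ k - simple_ito (Suc j) (\<tau> j) (\<lambda>l _. G (\<tau> j l)) nuv z $ k))\<^sup>2 - 0) < e"
  proof (rule F.mart_step_approx[OF sig[OF r, of k]])
    show "wint (\<lambda>s. F.hat s (bs r k s)) t (\<lambda>z. J t z $ k)" if "t \<in> {0..T}" for t by (rule J[OF that])
    fix K :: real
    assume K: "K \<ge> 0" and approx:
      "\<And>t n \<tau> g e. t \<in> {0..T} \<Longrightarrow> (\<And>k. k < n \<Longrightarrow> 0 \<le> \<tau> k) \<Longrightarrow> (\<And>k. k < n \<Longrightarrow> \<tau> k \<le> \<tau> (Suc k)) \<Longrightarrow>
        (\<And>k. k < n \<Longrightarrow> \<tau> (Suc k) \<le> t) \<Longrightarrow> 0 \<le> e \<Longrightarrow>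
        (\<And>i s. s \<in> {0<..t} \<Longrightarrow> \<bar>F.gain (vs r k) i s - F.step_fun n \<tau> g i s\<bar> \<le> e) \<Longrightarrow>
        (nrm (\<lambda>z. F.mart (vs r k) (\<lambda>t z. J t z $ k) t z - F.step_sum n \<tau> g z))\<^sup>2 \<le> K * e\<^sup>2"
    \<comment> \<open>The tolerance for the integrand that makes \<open>K \<epsilon>^2\<close>
      smaller than \<open>e\<close>, also when \<open>K\<close> vanishes.\<close>
    define \<epsilon> where "\<epsilon> = sqrt (e / (K + 1))"
    have \<epsilon>: "0 < \<epsilon>" "\<epsilon>\<^sup>2 = e / (K + 1)" using e K by (simp_all add: \<epsilon>_def)
    have "K * \<epsilon>\<^sup>2 < (K + 1) * \<epsilon>\<^sup>2" using \<epsilon>(1) by (intro mult_strict_right_mono) auto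
    also have "\<dots> = e" using K by (simp add: \<epsilon>(2))
    finally have Ke: "K * \<epsilon>\<^sup>2 < e" .
    obtain n where n: "\<And>j s i. j \<ge> n \<Longrightarrow> s \<in> {0<..t} \<Longrightarrow>
        \<bar>G s $ k $ i - (\<Sum>l<Suc j. G (\<tau> j l) $ k $ i * indicator {\<tau> j l<..\<tau> j (Suc l)} s)\<bar> \<le> \<epsilon>"
      using G_approx[OF \<epsilon>(1)] by blast
    show "\<exists>n. \<forall>j\<ge>n. norm ((nrm (\<lambda>z. ito z $ k - simple_ito (Suc j) (\<tau> j) (\<lambda>l _. G (\<tau> j l)) nuv z $ k))\<^sup>2 - 0) < e"
    proof (intro exI[of _ n] allI impI)
      fix j assume j: "n \<le> j"
      have "(nrm (\<lambda>z. F.mart (vs r k) (\<lambda>t z. J t z $ k) t z - F.step_sum (Suc j) (\<tau> j) (\<lambda>l i. G (\<tau> j l) $ k $ i) z))\<^sup>2 \<le> K * \<epsilon>\<^sup>2"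
      proof (rule approx[OF t])
        show "\<bar>F.gain (vs r k) i s - F.step_fun (Suc j) (\<tau> j) (\<lambda>l i. G (\<tau> j l) $ k $ i) i s\<bar> \<le> \<epsilon>" if "s \<in> {0<..t}" for i s
          using n[OF j that, of i] by (simp add: F.step_fun_def G_def)
      qed (use \<tau>_props \<epsilon>(1) in auto)
      then show "norm ((nrm (\<lambda>z. ito z $ k - simple_ito (Suc j) (\<tau> j) (\<lambda>l _. G (\<tau> j l)) nuv z $ k))\<^sup>2 - 0) < e"
        using Ke by (simp add: simple_nth(2) ito_def)
    qed
  qed
qed

lemma ito_L2: "(\<lambda>z. ito z $ k) \<in> L2"
  using F.mart_L2[OF sig[OF r] J t, of k] by (simp add: ito_def)

text \<open>The integrand is almost surely deterministic and continuous. Its values at the left ends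
  of the cells form simple processes that converge uniformly on \<open>]0, t]\<close>, and their
  integrals converge by \<open>ito_approx\<close>.\<close>

lemma ito_integral:
  "has_ito_integral M (natural_filtration M Z) nuv (\<lambda>s z. aug_cond_cov M Z L X r s z ** transpose (obs_mat H s)) t ito"
  unfolding has_ito_integral_def
proof (intro conjI exI)
  let ?G' = "\<lambda>s (z :: 'w). \<chi> k i. indicator {0..T} s * G s $ k $ i"
  let ?\<xi> = "\<lambda>j l (z :: 'w). G (\<tau> j l)"
  show "brownian_integrator M (natural_filtration M Z) t nuv" by (rule brownian_integrator_nuv[OF t])
  show "ito \<in> borel_measurable M" by (rule borel_measurable_vecI) (rule L2_measurable[OF ito_L2])
  show "measurable_modification M t (\<lambda>s z. aug_cond_cov M Z L X r s z ** transpose (obs_mat H s)) ?G'"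
    unfolding measurable_modification_def
  proof (intro conjI ballI)
    have "(\<lambda>s. indicator {0..T} s * G s $ k $ i) \<in> borel_measurable borel" for k i
      using borel_measurable_continuous_on_indicator[OF _ G_cont[of k i]] by simp
    then show "(\<lambda>(s, z). ?G' s z) \<in> borel_measurable (borel \<Otimes>\<^sub>M M)"
      unfolding case_prod_unfold
      by (intro borel_measurable_vecI) (simp add: measurable_compose[OF measurable_fst])
    fix s assume "s \<in> {0..t}"
    then have s: "s \<in> {0..T}" using t by auto
    have eq: "?G' s z = (\<chi> k l. PP r s k l) ** transpose (obs_mat H s)" for z
      using s by (simp add: vec_eq_iff G_def gain_PP[OF r s])
    show "AE z in M. ?G' s z = aug_cond_cov M Z L X r s z ** transpose (obs_mat H s)"
      using cond_cov_AE[OF r s] by eventually_elim (simp only: eq)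
  qed
  show "\<forall>j. simple_process M (natural_filtration M Z) t (Suc j) (\<tau> j) (?\<xi> j)"
    unfolding simple_process_def using \<tau>_props by auto
  show "(\<lambda>j. \<integral>\<^sup>+ s\<in>{0..t}. (\<integral>\<^sup>+ z. ennreal ((norm (?G' s z - simple_value (Suc j) (\<tau> j) (?\<xi> j) s z))\<^sup>2) \<partial>M) \<partial>lborel) \<longlonglongrightarrow> 0"
  proof (rule tendsto_zero_ennreal)
    fix e :: real assume e: "0 < e"
    \<comment> \<open>Number of matrix entries times the length of the interval: each entry is
      within \<open>\<epsilon>\<close> of its step approximation.\<close>
    define c where "c = real CARD('m + 'm) * real CARD('m) * t"
    have c: "0 \<le> c" using t by (simp add: c_def)
    define \<epsilon> where "\<epsilon> = sqrt (e / (c + 1))"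
    have \<epsilon>: "0 < \<epsilon>" "\<epsilon>\<^sup>2 = e / (c + 1)" using e c by (simp_all add: \<epsilon>_def)
    have "c * \<epsilon>\<^sup>2 < (c + 1) * \<epsilon>\<^sup>2" using \<epsilon>(1) by (intro mult_strict_right_mono) auto
    also have "\<dots> = e" using c by (simp add: \<epsilon>(2))
    finally have ce: "c * \<epsilon>\<^sup>2 < e" .
    obtain n where n: "\<And>j s k i. j \<ge> n \<Longrightarrow> s \<in> {0<..t} \<Longrightarrow>
        \<bar>G s $ k $ i - (\<Sum>l<Suc j. G (\<tau> j l) $ k $ i * indicator {\<tau> j l<..\<tau> j (Suc l)} s)\<bar> \<le> \<epsilon>"
      using G_approx[OF \<epsilon>(1)] by blast
    have "(\<integral>\<^sup>+ s\<in>{0..t}. (\<integral>\<^sup>+ z. ennreal ((norm (?G' s z - simple_value (Suc j) (\<tau> j) (?\<xi> j) s z))\<^sup>2) \<partial>M) \<partial>lborel) < ennreal e"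
      if j: "n \<le> j" for j
    proof -
      let ?D = "\<lambda>s z. (norm (?G' s z - simple_value (Suc j) (\<tau> j) (?\<xi> j) s z))\<^sup>2"
      let ?b = "real CARD('m + 'm) * real CARD('m) * \<epsilon>\<^sup>2"
      \<comment> \<open>No cell contains time 0, where the simple process is 0 whatever the
        integrand is; this point is discarded below as a null set.\<close>
      have D: "?D s z \<le> ?b" if s: "s \<in> {0<..t}" for s z
      proof -
        have "?D s z = (\<Sum>k\<in>UNIV. \<Sum>i\<in>UNIV. (G s $ k $ i - (\<Sum>l<Suc j. G (\<tau> j l) $ k $ i * indicator {\<tau> j l<..\<tau> j (Suc l)} s))\<^sup>2)"
          unfolding power2_norm_vec vector_minus_component simple_nth(1) using s t by simp
        also have "\<dots> \<le> (\<Sum>k\<in>(UNIV :: ('m + 'm) set). \<Sum>i\<in>(UNIV :: 'm set). \<epsilon>\<^sup>2)"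
          by (intro sum_mono power2_le_iff_abs_le[THEN iffD2] n[OF j s]) (use \<epsilon>(1) in simp)
        finally show ?thesis by (simp add: mult.assoc)
      qed
      have "(\<integral>\<^sup>+ s\<in>{0..t}. (\<integral>\<^sup>+ z. ennreal (?D s z) \<partial>M) \<partial>lborel) \<le> (\<integral>\<^sup>+ s\<in>{0..t}. ennreal ?b \<partial>lborel)"
      proof (rule nn_integral_mono_AE)
        show "AE s in lborel. (\<integral>\<^sup>+ z. ennreal (?D s z) \<partial>M) * indicator {0..t} s \<le> ennreal ?b * indicator {0..t} s"
          using AE_lborel_singleton[of 0]
        proof eventually_elim
          case (elim s)
          show ?case
          proof (cases "s \<in> {0..t}")
            case True
            then have s: "s \<in> {0<..t}" using elim by auto
            have "(\<integral>\<^sup>+ z. ennreal (?D s z) \<partial>M) \<le> (\<integral>\<^sup>+ z. ennreal ?b \<partial>M)"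
              by (intro nn_integral_mono ennreal_leI D s)
            then show ?thesis using True by (simp add: emeasure_space_1)
          qed simp
        qed
      qed
      also have "\<dots> = ennreal ?b * ennreal t" using t by (simp add: nn_integral_cmult_indicator)
      also have "\<dots> = ennreal (c * \<epsilon>\<^sup>2)" using t by (simp add: ennreal_mult'[symmetric] c_def mult_ac)
      also have "\<dots> < ennreal e" using ce e by (simp add: ennreal_lessI)
      finally show ?thesis .
    qed
    then show "\<forall>\<^sub>F j in sequentially. (\<integral>\<^sup>+ s\<in>{0..t}. (\<integral>\<^sup>+ z. ennreal ((norm (?G' s z - simple_value (Suc j) (\<tau> j) (?\<xi> j) s z))\<^sup>2) \<partial>M) \<partial>lborel) < ennreal e"
      unfolding eventually_sequentially by blast
  qed
  have DL: "(\<lambda>z. ito z $ k - simple_ito (Suc j) (\<tau> j) (?\<xi> j) nuv z $ k) \<in> L2" for j k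
  proof -
    have "F.step_sum (Suc j) (\<tau> j) (\<lambda>l i. G (\<tau> j l) $ k $ i) \<in> F.cZ t"
      by (rule F.step_sum_cZ[where n="Suc j" and \<tau>="\<tau> j", OF _ _ _ t]) (use \<tau>_props in auto)
    then show ?thesis unfolding simple_nth(2) by (intro L2_diff ito_L2) (rule F.cZ_L2)
  qed
  have "(\<integral>\<^sup>+ z. ennreal ((norm (ito z - simple_ito (Suc j) (\<tau> j) (?\<xi> j) nuv z))\<^sup>2) \<partial>M)
      = ennreal (\<Sum>k\<in>UNIV. (nrm (\<lambda>z. ito z $ k - simple_ito (Suc j) (\<tau> j) (?\<xi> j) nuv z $ k))\<^sup>2)" for j
  proof -
    let ?d = "\<lambda>k z. ito z $ k - simple_ito (Suc j) (\<tau> j) (?\<xi> j) nuv z $ k"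
    have "(\<integral>\<^sup>+ z. ennreal ((norm (ito z - simple_ito (Suc j) (\<tau> j) (?\<xi> j) nuv z))\<^sup>2) \<partial>M)
        = (\<integral>\<^sup>+ z. (\<Sum>k\<in>UNIV. ennreal ((?d k z)\<^sup>2)) \<partial>M)"
      by (intro nn_integral_cong) (simp add: power2_norm_vec sum_ennreal)
    also have "\<dots> = (\<Sum>k\<in>UNIV. \<integral>\<^sup>+ z. ennreal ((?d k z)\<^sup>2) \<partial>M)"
      using L2_measurable[OF DL] by (intro nn_integral_sum) simp
    also have "\<dots> = (\<Sum>k\<in>UNIV. ennreal ((nrm (?d k))\<^sup>2))"
      by (intro sum.cong refl nn_integral_square DL)
    finally show ?thesis by (simp add: sum_ennreal)
  qed
  moreover have "(\<lambda>j. ennreal (\<Sum>k\<in>UNIV. (nrm (\<lambda>z. ito z $ k - simple_ito (Suc j) (\<tau> j) (?\<xi> j) nuv z $ k))\<^sup>2))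
      \<longlonglongrightarrow> ennreal (\<Sum>k\<in>(UNIV :: ('m + 'm) set). 0)"
    by (intro tendsto_ennrealI tendsto_sum ito_approx)
  ultimately show "(\<lambda>j. \<integral>\<^sup>+ z. ennreal ((norm (ito z - simple_ito (Suc j) (\<tau> j) (?\<xi> j) nuv z))\<^sup>2) \<partial>M) \<longlonglongrightarrow> 0"
    by simp
qed

lemma ito_decomposition:
  "aug_estimate M Z L X r t z = aug_estimate M Z L X r 0 z + J t z + ito z"
proof (rule vec_eq_iff[THEN iffD2, rule_format])
  fix k
  have "F.mart (vs r k) (\<lambda>t z. J t z $ k) t z = F.hat t (vs r k t) z - F.hat 0 (vs r k 0) z - J t z $ k"
    by (rule F.mart_def[OF sig[OF r] J])
  then show "aug_estimate M Z L X r t z $ k = (aug_estimate M Z L X r 0 z + J t z + ito z) $ k"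
    by (simp add: estimates ito_def)
qed

end

lemma conditional_mean:
  assumes r: "r \<in> {0..T}" and t: "t \<in> {0..T}"
  shows "\<exists>I J. has_time_integral M (\<lambda>s z. drift_col a L r s *v state_estimate M Z X s z) t I \<and>
      has_ito_integral M (natural_filtration M Z) nuv (\<lambda>s z. aug_cond_cov M Z L X r s z ** transpose (obs_mat H s)) t J \<and>
      (AE z in M. aug_estimate M Z L X r t z = aug_estimate M Z L X r 0 z + I z + J z)"
proof -
  obtain J where J: "\<And>t. t \<in> {0..T} \<Longrightarrow> has_time_integral M (\<lambda>s z. drift_col a L r s *v state_estimate M Z X s z) t (J t)"
    "\<And>t k. t \<in> {0..T} \<Longrightarrow> wint (\<lambda>s. F.hat s (bs r k s)) t (\<lambda>z. J t z $ k)"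
    using vec_time_integral[OF T0(1) F.sig_hatb_cont[OF sig[OF r]] drift_estimate] by blast
  show ?thesis
    using J(1)[OF t] ito_integral[OF r t J(2)] ito_decomposition[OF r t J(2)] by blast
qed

end

text \<open>The innovation is quantified existentially because its integral term is unique only up
  to a null set at each time; the witness is \<open>nuv\<close>, and the same process drives the
  equations for all \<open>r\<close> and \<open>t\<close>.\<close>

theorem theorem5p2:
  fixes M :: "'w measure"
    and T :: real
    and a :: "real \<Rightarrow> real ^ 'm ^ 'm::finite"
    and H L :: "real \<Rightarrow> real \<Rightarrow> real"
    and p p' q :: "nat \<Rightarrow> real \<Rightarrow> real"
    and X W N Z :: "real \<Rightarrow> 'w \<Rightarrow> real ^ 'm"
  assumes "prob_space M"
    and "0 < T"
    and a_cont: "continuous_on {0..T} a"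
    \<comment> \<open>the noises and the initial condition\<close>
    and gaussian: "gaussian_family M (insert (X 0) (W ` {0..T} \<union> N ` {0..T}))"
    and indep: "prob_space.indep_sets M
          (\<lambda>i. [sets (generated_algebra M {0} X), sets (generated_algebra M {0..T} W),
                sets (generated_algebra M {0..T} N)] ! i) {..<3}"
    and W: "standard_brownian_motion M T W"
    and N: "standard_brownian_motion M T N"
    \<comment> \<open>state and observation\<close>
    and X_meas: "(\<lambda>(t, \<omega>). X t \<omega>) \<in> borel_measurable (restrict_space borel {0..T} \<Otimes>\<^sub>M M)"
    and X_eq: "AE \<omega> in M. \<forall>t\<in>{0..T}.
          set_integrable lborel {0..t} (\<lambda>s. a s *v X s \<omega>) \<and>
          X t \<omega> = X 0 \<omega> + (LINT s:{0..t}|lborel. a s *v X s \<omega>) + W t \<omega>"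
    and Z_meas: "\<And>t. t \<in> {0..T} \<Longrightarrow> Z t \<in> borel_measurable M"
    and Z_eq: "AE \<omega> in M. \<forall>t\<in>{0..T}.
          Z t \<omega> = (LINT s:{0..t}|lborel. H t s *\<^sub>R X s \<omega>) + N t \<omega>"
    \<comment> \<open>(i)\<close>
    and H_cont: "continuous_on ({0..T} \<times> {0..T}) (\<lambda>(t, s). H t s)"
    \<comment> \<open>(ii)\<close>
    and p_C1: "\<And>i t. i \<ge> 1 \<Longrightarrow> t \<in> {0..T} \<Longrightarrow>
          (p i has_real_derivative p' i t) (at t within {0..T})"
        "\<And>i. i \<ge> 1 \<Longrightarrow> continuous_on {0..T} (p' i)"
    and q_cont: "\<And>i. i \<ge> 1 \<Longrightarrow> continuous_on {0..T} (q i)"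
    and H_series: "(\<lambda>n. LINT (t, s):{0..T} \<times> {0..T}|lborel.
          \<bar>(\<Sum>i=1..n. p i t * q i s) - H t s\<bar>) \<longlonglongrightarrow> 0"
    \<comment> \<open>(iii)\<close>
    and L_cont: "continuous_on ({0..T} \<times> {0..T}) (\<lambda>(t, s). L t s)"
    and L_series: "(\<lambda>n. LINT (t, s):{0..T} \<times> {0..T}|lborel.
          \<bar>(\<Sum>i=1..n. p' i t * q i s) - L t s\<bar>) \<longlonglongrightarrow> 0"
  shows
    \<comment> \<open>the conditional mean, driven by \<open>\<nu>\<close>\<close>
    "(\<exists>\<nu>. (\<forall>t\<in>{0..T}. has_time_integral M
              (\<lambda>s \<omega>. obs_mat H s *v aug_estimate M Z L X s s \<omega>) t
              (\<lambda>\<omega>. Z t \<omega> - \<nu> t \<omega>)) \<and>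
          (\<forall>r t. 0 \<le> t \<and> t \<le> r \<and> r \<le> T \<longrightarrow>
             (\<exists>I J. has_time_integral M
                      (\<lambda>s \<omega>. drift_col a L r s *v state_estimate M Z X s \<omega>) t I \<and>
                    has_ito_integral M (natural_filtration M Z) \<nu>
                      (\<lambda>s \<omega>. aug_cond_cov M Z L X r s \<omega> ** transpose (obs_mat H s)) t J \<and>
                    (AE \<omega> in M. aug_estimate M Z L X r t \<omega> =
                       aug_estimate M Z L X r 0 \<omega> + I \<omega> + J \<omega>)))) \<and>
     \<comment> \<open>the Riccati type equation for the conditional covariance\<close>
     (\<forall>r t. 0 \<le> t \<and> t \<le> r \<and> r \<le> T \<longrightarrow>
        has_time_integral M
          (\<lambda>s \<omega>. aug_cond_cov M Z L X r s \<omega> ** transpose (drift_mat a L t s)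
               + drift_mat a L r s ** transpose (aug_cond_cov M Z L X t s \<omega>)
               + noise_mat ** transpose noise_mat
               - aug_cond_cov M Z L X r s \<omega> ** transpose (obs_mat H s)
                   ** obs_mat H s ** transpose (aug_cond_cov M Z L X t s \<omega>))
          t (\<lambda>\<omega>. aug_cond_cov M Z L X r t \<omega> - initial_cov M (X 0)))"
proof -
  interpret prob_space M by fact
  \<comment> \<open>The separable expansion serves here and is then left behind.\<close>
  have HL: "H t s = H 0 s + integral {0..t} (\<lambda>u. L u s)" if "s \<in> {0..T}" "t \<in> {0..T}" for s t
    by (rule kernel_derivative[OF \<open>0 < T\<close> H_cont p_C1 q_cont H_series L_cont L_series that])
  interpret linear_model M T a H L X W N Z
    by unfold_locales (fact \<open>0 < T\<close> a_cont gaussian indep W N X_meas X_eq Z_meas Z_eq H_cont L_cont HL)+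
  \<comment> \<open>The pathwise integral is fixed before the innovations can be formed; its weak
    form is what the next locale assumes.\<close>
  obtain I where Ih: "\<And>t. t \<in> {0..T} \<Longrightarrow> has_time_integral M (\<lambda>s \<omega>. obs_mat H s *v aug_estimate M Z L X s s \<omega>) t (I t)"
    "\<And>t i. t \<in> {0..T} \<Longrightarrow> wint (\<lambda>s. F.hat s (h s i)) t (\<lambda>\<omega>. I t \<omega> $ i)"
    using vec_time_integral[OF T0(1) F.hat_L2cont[OF h_L2cont h_GX] observed_estimate] by blast
  interpret linear_filter M T a H L X W N Z I
    by unfold_locales (rule Ih(2))
  show ?thesis
  proof (intro conjI exI[of _ nuv] ballI allI impI)
    show "has_time_integral M (\<lambda>s \<omega>. obs_mat H s *v aug_estimate M Z L X s s \<omega>) t (\<lambda>\<omega>. Z t \<omega> - nuv t \<omega>)"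
      if "t \<in> {0..T}" for t
      using Ih(1)[OF that] by (simp add: nuv_def)
  qed (rule conditional_mean riccati; auto)+
qed

end
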